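(* Let $d\ge2$ and $D=\binom{d+1}{2}$. The no-overlap zeta function $\zeta^{\mathrm{n.o.}}_{\mathfrak{f}_{2,d}}(q,t)\in\mathbb{Q}(q,t)$ satisfies the functional equation $$\zeta^{\mathrm{n.o.}}_{\mathfrak{f}_{2,d}}(q^{-1},t^{-1})=(-1)^{D}\,q^{\binom D2}\,t^{D}\,\zeta^{\mathrm{n.o.}}_{\mathfrak{f}_{2,d}}(q,t).$$
   Context: For an integer $d\ge 2$ put $d'=\binom d2$. Let $\mathfrak{f}_{2,d}=\langle x_1,\dots,x_d\mid [[x_i,x_j],x_k]=0\ \forall i,j,k\rangle$ be the free class-2-nilpotent Lie ring on $d$ generators (free of $\mathbb{Z}$-rank $D=d+d'$), and $\mathfrak{f}_{2,d}(R)=\mathfrak{f}_{2,d}\otimes_{\mathbb Z}R$ for a commutative ring $R$. A cDVR $\mathfrak{o}$ is a compact discrete valuation ring (the ring of integers of a finite extension of $\mathbb{Q}_p$, or $\mathbb{F}_q[[T]]$), with maximal ideal $\mathfrak p$ and $q_{\mathfrak o}=|\mathfrak{o}/\mathfrak{p}|$. The elementary divisor type of a finite-index submodule $\Lambda\le\mathfrak{o}^n$ is the tuple $\lambda_1\ge\dots\ge\lambda_n\geq 0$ with $\mathfrak{o}^n/\Lambda\cong\prod_i\mathfrak{o}/\mathfrak{p}^{\lambda_i}$. Let $L=\mathfrak{f}_{2,d}(\mathfrak{o})$ and let $\mathfrak{h}\le L$ be an $\mathfrak{o}$-subalgebra of finite index. Let $\lambda=(\lambda_1\ge\dots\ge\lambda_d)$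 be the elementary divisor type of $(\mathfrak{h}+[L,L])/[L,L]$ in $L/[L,L]\cong\mathfrak{o}^d$ and $\nu=(\nu_1\ge\dots\ge\nu_{d'})$ that of $\mathfrak{h}\cap[L,L]$ in $[L,L]\cong\mathfrak{o}^{d'}$. Let $\mu_1\ge\dots\ge\mu_{d'}$ be the elements of the multiset $\{\lambda_i+\lambda_{i'}:i<i'\in[d]\}$ in weakly decreasing order. One says $\mathfrak{h}$ has no overlap if $\mu_1\ge\dots\ge\mu_{d'}\ge\nu_1\ge\dots\ge\nu_{d'}$. The no-overlap zeta function is $\zeta^{\mathrm{n.o.}}_{\mathfrak{f}_{2,d}(\mathfrak{o})}(s)=\sum_{\mathfrak{h}}|L:\mathfrak{h}|^{-s}$, summed over the finite-index subalgebras $\mathfrak{h}$ with no overlap. $\zeta^{\mathrm{n.o.}}_{\mathfrak{f}_{2,d}}(q,t)\in\mathbb{Q}(q,t)$ is the (unique) rational function with $\zeta^{\mathrm{n.o.}}_{\mathfrak{f}_{2,d}}(q_{\mathfrak o},q_{\mathfrak o}^{-s})=\zeta^{\mathrm{n.o.}}_{\mathfrak{f}_{2,d}(\mathfrak{o})}(s)$ for all cDVRs $\mathfrak{o}$. *)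

theory Defs
  imports
    "HOL-Analysis.Analysis"
    "HOL-Computational_Algebra.Fraction_Field"
    "HOL-Computational_Algebra.Polynomial"
    "HOL-Algebra.Ring_Divisibility"
    "HOL-Algebra.Ideal_Product"
    "HOL-Algebra.Module"
begin

section \<open>Compact discrete valuation rings\<close>

definition is_dvr :: "('a, 'm) ring_scheme \<Rightarrow> bool" where
  "is_dvr R \<longleftrightarrow> principal_domain R \<and> \<not> field R \<and> (\<exists>!P. maximalideal P R)"

definition max_ideal :: "('a, 'm) ring_scheme \<Rightarrow> 'a set" where
  "max_ideal R = (THE P. maximalideal P R)"

definition max_ideal_pow :: "('a, 'm) ring_scheme \<Rightarrow> nat \<Rightarrow> 'a set" where
  "max_ideal_pow R n = max_ideal R [^]\<^bsub>ideals_set R\<^esub> n"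

definition adic_topology :: "('a, 'm) ring_scheme \<Rightarrow> 'a topology" where
  "adic_topology R = topology (\<lambda>U. U \<subseteq> carrier R \<and>
     (\<forall>x\<in>U. \<exists>n. max_ideal_pow R n +>\<^bsub>R\<^esub> x \<subseteq> U))"

definition is_cDVR :: "('a, 'm) ring_scheme \<Rightarrow> bool" where
  "is_cDVR R \<longleftrightarrow> is_dvr R \<and> compact_space (adic_topology R)"

definition residue_card :: "('a, 'm) ring_scheme \<Rightarrow> nat" where
  "residue_card R = card (carrier (R Quot max_ideal R))"


section \<open>Modules and elementary divisor types\<close>

definition lin_hom ::
  "('r, 'q) ring_scheme \<Rightarrow> ('r, 'a, 'm) module_scheme \<Rightarrow> ('r, 'b, 'n) module_scheme \<Rightarrow> ('a \<Rightarrow> 'b) set" where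
  "lin_hom R M N = {f \<in> carrier M \<rightarrow> carrier N.
     (\<forall>x\<in>carrier M. \<forall>y\<in>carrier M. f (x \<oplus>\<^bsub>M\<^esub> y) = f x \<oplus>\<^bsub>N\<^esub> f y) \<and>
     (\<forall>r\<in>carrier R. \<forall>x\<in>carrier M. f (r \<odot>\<^bsub>M\<^esub> x) = r \<odot>\<^bsub>N\<^esub> f x)}"

definition lin_iso ::
  "('r, 'q) ring_scheme \<Rightarrow> ('r, 'a, 'm) module_scheme \<Rightarrow> ('r, 'b, 'n) module_scheme \<Rightarrow> bool" where
  "lin_iso R M N \<longleftrightarrow> (\<exists>f \<in> lin_hom R M N. bij_betw f (carrier M) (carrier N))"

text \<open>The record type of modules extends that of rings. For the modules constructed in this
  section the fields \<^const>\<open>mult\<close> and \<^const>\<open>one\<close> play no role, except that they are inherited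
  from the ring in \<open>regular_module\<close>.\<close>

definition regular_module :: "('a, 'm) ring_scheme \<Rightarrow> ('a, 'a) module" where
  "regular_module R = \<lparr>carrier = carrier R, mult = mult R, one = one R,
     zero = zero R, add = add R, smult = mult R\<rparr>"

definition quot_module :: "('r, 'a, 'm) module_scheme \<Rightarrow> 'a set \<Rightarrow> ('r, 'a set) module" where
  "quot_module M N = \<lparr>carrier = a_rcosets\<^bsub>M\<^esub> N, mult = (\<lambda>_ _. N), one = N,
     zero = N, add = set_add M, smult = (\<lambda>r X. \<Union>x\<in>X. N +>\<^bsub>M\<^esub> (r \<odot>\<^bsub>M\<^esub> x))\<rparr>"

definition prod_module :: "'i set \<Rightarrow> ('i \<Rightarrow> ('r, 'a, 'm) module_scheme) \<Rightarrow> ('r, 'i \<Rightarrow> 'a) module" where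
  "prod_module I M = \<lparr>carrier = (\<Pi>\<^sub>E i\<in>I. carrier (M i)),
     mult = (\<lambda>_ _. \<lambda>i\<in>I. \<zero>\<^bsub>M i\<^esub>), one = (\<lambda>i\<in>I. \<zero>\<^bsub>M i\<^esub>),
     zero = (\<lambda>i\<in>I. \<zero>\<^bsub>M i\<^esub>), add = (\<lambda>x y. \<lambda>i\<in>I. x i \<oplus>\<^bsub>M i\<^esub> y i),
     smult = (\<lambda>r x. \<lambda>i\<in>I. r \<odot>\<^bsub>M i\<^esub> x i)\<rparr>"

text \<open>\<open>lam\<close> is the elementary divisor type of the submodule \<open>N\<close> of \<open>M\<close>, where \<open>M\<close> is
  a free module of rank \<open>n\<close> over the discrete valuation ring \<open>R\<close>. Entries of types are indexed
  from 0.\<close>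

definition has_elem_div_type ::
  "('r, 'q) ring_scheme \<Rightarrow> nat \<Rightarrow> ('r, 'a, 'm) module_scheme \<Rightarrow> 'a set \<Rightarrow> nat list \<Rightarrow> bool" where
  "has_elem_div_type R n M N lam \<longleftrightarrow> length lam = n \<and> sorted_wrt (\<ge>) lam \<and>
     lin_iso R (quot_module M N)
       (prod_module {..<n} (\<lambda>i. quot_module (regular_module R) (max_ideal_pow R (lam ! i))))"


section \<open>Lie algebras\<close>

text \<open>A Lie algebra over \<open>R\<close> is a record of type \<^typ>\<open>('r, 'a) module\<close> whose multiplication is the
  Lie bracket; its field \<^const>\<open>one\<close> is unused.\<close>

locale lie_algebra = module R L
  for R :: "('r, 'q) ring_scheme" (structure) and L :: "('r, 'a, 'm) module_scheme" (structure) +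
  assumes bracket_closed: "\<lbrakk>x \<in> carrier L; y \<in> carrier L\<rbrakk> \<Longrightarrow> x \<otimes>\<^bsub>L\<^esub> y \<in> carrier L"
    and bracket_add_left: "\<lbrakk>x \<in> carrier L; y \<in> carrier L; z \<in> carrier L\<rbrakk>
      \<Longrightarrow> (x \<oplus>\<^bsub>L\<^esub> y) \<otimes>\<^bsub>L\<^esub> z = (x \<otimes>\<^bsub>L\<^esub> z) \<oplus>\<^bsub>L\<^esub> (y \<otimes>\<^bsub>L\<^esub> z)"
    and bracket_add_right: "\<lbrakk>x \<in> carrier L; y \<in> carrier L; z \<in> carrier L\<rbrakk>
      \<Longrightarrow> x \<otimes>\<^bsub>L\<^esub> (y \<oplus>\<^bsub>L\<^esub> z) = (x \<otimes>\<^bsub>L\<^esub> y) \<oplus>\<^bsub>L\<^esub> (x \<otimes>\<^bsub>L\<^esub> z)"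
    and bracket_smult_left: "\<lbrakk>r \<in> carrier R; x \<in> carrier L; y \<in> carrier L\<rbrakk>
      \<Longrightarrow> (r \<odot>\<^bsub>L\<^esub> x) \<otimes>\<^bsub>L\<^esub> y = r \<odot>\<^bsub>L\<^esub> (x \<otimes>\<^bsub>L\<^esub> y)"
    and bracket_smult_right: "\<lbrakk>r \<in> carrier R; x \<in> carrier L; y \<in> carrier L\<rbrakk>
      \<Longrightarrow> x \<otimes>\<^bsub>L\<^esub> (r \<odot>\<^bsub>L\<^esub> y) = r \<odot>\<^bsub>L\<^esub> (x \<otimes>\<^bsub>L\<^esub> y)"
    and bracket_alt: "x \<in> carrier L \<Longrightarrow> x \<otimes>\<^bsub>L\<^esub> x = \<zero>\<^bsub>L\<^esub>"
    and jacobi: "\<lbrakk>x \<in> carrier L; y \<in> carrier L; z \<in> carrier L\<rbrakk>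
      \<Longrightarrow> (x \<otimes>\<^bsub>L\<^esub> y) \<otimes>\<^bsub>L\<^esub> z \<oplus>\<^bsub>L\<^esub> (y \<otimes>\<^bsub>L\<^esub> z) \<otimes>\<^bsub>L\<^esub> x \<oplus>\<^bsub>L\<^esub> (z \<otimes>\<^bsub>L\<^esub> x) \<otimes>\<^bsub>L\<^esub> y = \<zero>\<^bsub>L\<^esub>"

definition lie_hom ::
  "('r, 'q) ring_scheme \<Rightarrow> ('r, 'a, 'm) module_scheme \<Rightarrow> ('r, 'b, 'n) module_scheme \<Rightarrow> ('a \<Rightarrow> 'b) set" where
  "lie_hom R L K = {f \<in> lin_hom R L K.
     \<forall>x\<in>carrier L. \<forall>y\<in>carrier L. f (x \<otimes>\<^bsub>L\<^esub> y) = f x \<otimes>\<^bsub>K\<^esub> f y}"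

definition lie_subalgebra :: "('r, 'q) ring_scheme \<Rightarrow> ('r, 'a, 'm) module_scheme \<Rightarrow> 'a set \<Rightarrow> bool" where
  "lie_subalgebra R L H \<longleftrightarrow> submodule H R L \<and> (\<forall>x\<in>H. \<forall>y\<in>H. x \<otimes>\<^bsub>L\<^esub> y \<in> H)"

definition derived_alg :: "('r, 'q) ring_scheme \<Rightarrow> ('r, 'a, 'm) module_scheme \<Rightarrow> 'a set" where
  "derived_alg R L = \<Inter> {N. submodule N R L \<and> (\<forall>x\<in>carrier L. \<forall>y\<in>carrier L. x \<otimes>\<^bsub>L\<^esub> y \<in> N)}"


section \<open>Free class-2-nilpotent Lie rings\<close>

definition index_pairs :: "nat \<Rightarrow> (nat \<times> nat) set" where
  "index_pairs d = {(i, j). i < j \<and> j < d}"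

text \<open>\<open>\<ff>\<^bsub>2,d\<^esub>(R)\<close>, in coordinates with respect to the basis consisting of the generators
  \<open>x\<^sub>i\<close> (\<open>i < d\<close>) and the brackets \<open>[x\<^sub>i, x\<^sub>j]\<close> (\<open>i < j < d\<close>) of \<open>\<ff>\<^bsub>2,d\<^esub>\<close>. That this is the Lie algebra
  presented by generators \<open>x\<^sub>i\<close> and relations \<open>[[x\<^sub>i, x\<^sub>j], x\<^sub>k] = 0\<close>, over an arbitrary
  commutative ring \<open>R\<close>, is the content of \<open>free_nil2_lie_algebra\<close>, \<open>free_nil2_relation\<close> and
  \<open>free_nil2_universal\<close> below.\<close>

definition free_nil2 ::
  "nat \<Rightarrow> ('r, 'q) ring_scheme \<Rightarrow> ('r, (nat \<Rightarrow> 'r) \<times> (nat \<times> nat \<Rightarrow> 'r)) module" where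
  "free_nil2 d R = \<lparr>
     carrier = ({..<d} \<rightarrow>\<^sub>E carrier R) \<times> (index_pairs d \<rightarrow>\<^sub>E carrier R),
     mult = (\<lambda>(a, b) (a', b'). (\<lambda>i\<in>{..<d}. \<zero>\<^bsub>R\<^esub>,
               \<lambda>(i, j)\<in>index_pairs d. (a i \<otimes>\<^bsub>R\<^esub> a' j) \<ominus>\<^bsub>R\<^esub> (a j \<otimes>\<^bsub>R\<^esub> a' i))),
     one = (\<lambda>i\<in>{..<d}. \<zero>\<^bsub>R\<^esub>, \<lambda>p\<in>index_pairs d. \<zero>\<^bsub>R\<^esub>),
     zero = (\<lambda>i\<in>{..<d}. \<zero>\<^bsub>R\<^esub>, \<lambda>p\<in>index_pairs d. \<zero>\<^bsub>R\<^esub>),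
     add = (\<lambda>(a, b) (a', b'). (\<lambda>i\<in>{..<d}. a i \<oplus>\<^bsub>R\<^esub> a' i, \<lambda>p\<in>index_pairs d. b p \<oplus>\<^bsub>R\<^esub> b' p)),
     smult = (\<lambda>r (a, b). (\<lambda>i\<in>{..<d}. r \<otimes>\<^bsub>R\<^esub> a i, \<lambda>p\<in>index_pairs d. r \<otimes>\<^bsub>R\<^esub> b p))\<rparr>"

definition free_nil2_gen :: "nat \<Rightarrow> ('r, 'q) ring_scheme \<Rightarrow> nat \<Rightarrow> (nat \<Rightarrow> 'r) \<times> (nat \<times> nat \<Rightarrow> 'r)" where
  "free_nil2_gen d R i = (\<lambda>k\<in>{..<d}. if k = i then \<one>\<^bsub>R\<^esub> else \<zero>\<^bsub>R\<^esub>, \<lambda>p\<in>index_pairs d. \<zero>\<^bsub>R\<^esub>)"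

lemma finite_index_pairs: "finite (index_pairs d)"
  by (rule finite_subset[of _ "{..<d} \<times> {..<d}"]) (auto simp: index_pairs_def)

lemma free_nil2_carrier:
  "x \<in> carrier (free_nil2 d R) \<longleftrightarrow>
    fst x \<in> {..<d} \<rightarrow>\<^sub>E carrier R \<and> snd x \<in> index_pairs d \<rightarrow>\<^sub>E carrier R"
  by (cases x) (simp add: free_nil2_def)

lemma free_nil2_eqI:
  assumes "x \<in> carrier (free_nil2 d R)" "y \<in> carrier (free_nil2 d R)"
    and "\<And>i. i < d \<Longrightarrow> fst x i = fst y i"
    and "\<And>i j. \<lbrakk>(i, j) \<in> index_pairs d; i < d; j < d\<rbrakk> \<Longrightarrow> snd x (i, j) = snd y (i, j)"
  shows "x = y"
proof (rule prod_eqI)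
  show "fst x = fst y"
    by (rule PiE_ext[of _ "{..<d}" "\<lambda>_. carrier R"]) (use assms in \<open>auto simp: free_nil2_carrier\<close>)
  show "snd x = snd y"
    by (rule PiE_ext[of _ "index_pairs d" "\<lambda>_. carrier R"])
      (use assms in \<open>auto simp: free_nil2_carrier index_pairs_def\<close>)
qed

lemma free_nil2_nth:
  assumes "x \<in> carrier (free_nil2 d R)"
  shows "i < d \<Longrightarrow> fst x i \<in> carrier R"
    and "(i, j) \<in> index_pairs d \<Longrightarrow> snd x (i, j) \<in> carrier R"
    and "(i, j) \<in> index_pairs d \<Longrightarrow> fst x i \<in> carrier R"
    and "(i, j) \<in> index_pairs d \<Longrightarrow> fst x j \<in> carrier R"
  using assms by (auto simp: free_nil2_carrier PiE_iff index_pairs_def)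

lemma free_nil2_sel:
  "i < d \<Longrightarrow> fst \<zero>\<^bsub>free_nil2 d R\<^esub> i = \<zero>\<^bsub>R\<^esub>"
  "p \<in> index_pairs d \<Longrightarrow> snd \<zero>\<^bsub>free_nil2 d R\<^esub> p = \<zero>\<^bsub>R\<^esub>"
  "i < d \<Longrightarrow> fst (x \<oplus>\<^bsub>free_nil2 d R\<^esub> y) i = fst x i \<oplus>\<^bsub>R\<^esub> fst y i"
  "p \<in> index_pairs d \<Longrightarrow> snd (x \<oplus>\<^bsub>free_nil2 d R\<^esub> y) p = snd x p \<oplus>\<^bsub>R\<^esub> snd y p"
  "i < d \<Longrightarrow> fst (r \<odot>\<^bsub>free_nil2 d R\<^esub> x) i = r \<otimes>\<^bsub>R\<^esub> fst x i"
  "p \<in> index_pairs d \<Longrightarrow> snd (r \<odot>\<^bsub>free_nil2 d R\<^esub> x) p = r \<otimes>\<^bsub>R\<^esub> snd x p"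
  "i < d \<Longrightarrow> fst (x \<otimes>\<^bsub>free_nil2 d R\<^esub> y) i = \<zero>\<^bsub>R\<^esub>"
  "(i, j) \<in> index_pairs d \<Longrightarrow> snd (x \<otimes>\<^bsub>free_nil2 d R\<^esub> y) (i, j) =
     (fst x i \<otimes>\<^bsub>R\<^esub> fst y j) \<ominus>\<^bsub>R\<^esub> (fst x j \<otimes>\<^bsub>R\<^esub> fst y i)"
  "i < d \<Longrightarrow> fst (free_nil2_gen d R k) i = (if i = k then \<one>\<^bsub>R\<^esub> else \<zero>\<^bsub>R\<^esub>)"
  "p \<in> index_pairs d \<Longrightarrow> snd (free_nil2_gen d R k) p = \<zero>\<^bsub>R\<^esub>"
  by (auto simp: free_nil2_def free_nil2_gen_def split: prod.splits)

lemma free_nil2_closed: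
  assumes "cring R"
  shows "\<zero>\<^bsub>free_nil2 d R\<^esub> \<in> carrier (free_nil2 d R)"
    and "\<lbrakk>x \<in> carrier (free_nil2 d R); y \<in> carrier (free_nil2 d R)\<rbrakk>
      \<Longrightarrow> x \<oplus>\<^bsub>free_nil2 d R\<^esub> y \<in> carrier (free_nil2 d R)"
    and "\<lbrakk>r \<in> carrier R; x \<in> carrier (free_nil2 d R)\<rbrakk>
      \<Longrightarrow> r \<odot>\<^bsub>free_nil2 d R\<^esub> x \<in> carrier (free_nil2 d R)"
    and "\<lbrakk>x \<in> carrier (free_nil2 d R); y \<in> carrier (free_nil2 d R)\<rbrakk>
      \<Longrightarrow> x \<otimes>\<^bsub>free_nil2 d R\<^esub> y \<in> carrier (free_nil2 d R)"
    and "free_nil2_gen d R i \<in> carrier (free_nil2 d R)"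
proof -
  interpret cring R by fact
  show "\<zero>\<^bsub>free_nil2 d R\<^esub> \<in> carrier (free_nil2 d R)"
    "\<lbrakk>x \<in> carrier (free_nil2 d R); y \<in> carrier (free_nil2 d R)\<rbrakk>
      \<Longrightarrow> x \<oplus>\<^bsub>free_nil2 d R\<^esub> y \<in> carrier (free_nil2 d R)"
    "\<lbrakk>r \<in> carrier R; x \<in> carrier (free_nil2 d R)\<rbrakk>
      \<Longrightarrow> r \<odot>\<^bsub>free_nil2 d R\<^esub> x \<in> carrier (free_nil2 d R)"
    "\<lbrakk>x \<in> carrier (free_nil2 d R); y \<in> carrier (free_nil2 d R)\<rbrakk>
      \<Longrightarrow> x \<otimes>\<^bsub>free_nil2 d R\<^esub> y \<in> carrier (free_nil2 d R)"
    "free_nil2_gen d R i \<in> carrier (free_nil2 d R)"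
    by (auto simp: free_nil2_def free_nil2_gen_def index_pairs_def PiE_iff split: prod.splits)
qed

lemma free_nil2_lie_algebra:
  assumes "cring R"
  shows "lie_algebra R (free_nil2 d R)"
proof -
  interpret cring R by fact
  let ?L = "free_nil2 d R"
  note cl = free_nil2_closed[OF assms] and sel = free_nil2_sel[where R = R] free_nil2_nth
  have ab: "abelian_group ?L"
  proof (rule abelian_groupI)
    fix x assume x: "x \<in> carrier ?L"
    have "(\<ominus>\<^bsub>R\<^esub> \<one>\<^bsub>R\<^esub>) \<odot>\<^bsub>?L\<^esub> x \<oplus>\<^bsub>?L\<^esub> x = \<zero>\<^bsub>?L\<^esub>"
      by (rule free_nil2_eqI[of _ d R])
        (use x in \<open>auto simp: cl sel l_minus l_neg\<close>)
    then show "\<exists>y\<in>carrier ?L. y \<oplus>\<^bsub>?L\<^esub> x = \<zero>\<^bsub>?L\<^esub>"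
      using x by (intro bexI[of _ "(\<ominus>\<^bsub>R\<^esub> \<one>\<^bsub>R\<^esub>) \<odot>\<^bsub>?L\<^esub> x"]) (auto simp: cl)
  qed ((auto simp: cl; fail) | (rule free_nil2_eqI[of _ d R]; (auto simp: cl sel a_ac; fail)))+
  have mod: "module R ?L"
    by (rule moduleI[OF assms ab])
      ((auto simp: cl; fail) |
        (rule free_nil2_eqI[of _ d R]; (auto simp: cl sel l_distr r_distr m_assoc; fail)))+
  show ?thesis
    by (intro lie_algebra.intro mod lie_algebra_axioms.intro)
      ((auto simp: cl; fail) |
        (rule free_nil2_eqI[of _ d R];
         (auto simp: cl sel a_minus_def minus_add l_minus r_minus l_distr r_distr a_ac m_ac r_neg; fail)))+
qed

lemma free_nil2_relation:
  assumes "cring R"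
  shows "(free_nil2_gen d R i \<otimes>\<^bsub>free_nil2 d R\<^esub> free_nil2_gen d R j) \<otimes>\<^bsub>free_nil2 d R\<^esub> free_nil2_gen d R k
    = \<zero>\<^bsub>free_nil2 d R\<^esub>"
proof -
  interpret cring R by fact
  note cl = free_nil2_closed[OF assms] and sel = free_nil2_sel[where R = R] free_nil2_nth
  show ?thesis
    by (rule free_nil2_eqI[of _ d R]) (auto simp: cl sel index_pairs_def a_minus_def)
qed

lemma (in lie_algebra) bracket_zero:
  assumes "x \<in> carrier L"
  shows "\<zero>\<^bsub>L\<^esub> \<otimes>\<^bsub>L\<^esub> x = \<zero>\<^bsub>L\<^esub>" "x \<otimes>\<^bsub>L\<^esub> \<zero>\<^bsub>L\<^esub> = \<zero>\<^bsub>L\<^esub>"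
proof -
  show "\<zero>\<^bsub>L\<^esub> \<otimes>\<^bsub>L\<^esub> x = \<zero>\<^bsub>L\<^esub>"
    using bracket_smult_left[of "\<zero>\<^bsub>R\<^esub>" x x] bracket_closed assms by simp
  show "x \<otimes>\<^bsub>L\<^esub> \<zero>\<^bsub>L\<^esub> = \<zero>\<^bsub>L\<^esub>"
    using bracket_smult_right[of "\<zero>\<^bsub>R\<^esub>" x x] bracket_closed assms by simp
qed

lemma (in lie_algebra) bracket_anti:
  assumes "x \<in> carrier L" "y \<in> carrier L"
  shows "y \<otimes>\<^bsub>L\<^esub> x = \<ominus>\<^bsub>L\<^esub> (x \<otimes>\<^bsub>L\<^esub> y)"
proof -
  have "\<zero>\<^bsub>L\<^esub> = (x \<oplus>\<^bsub>L\<^esub> y) \<otimes>\<^bsub>L\<^esub> (x \<oplus>\<^bsub>L\<^esub> y)"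
    using assms by (simp add: bracket_alt)
  also have "\<dots> = (x \<otimes>\<^bsub>L\<^esub> y) \<oplus>\<^bsub>L\<^esub> (y \<otimes>\<^bsub>L\<^esub> x)"
    using assms bracket_alt[of x] bracket_alt[of y]
    by (simp add: bracket_add_left bracket_add_right bracket_closed M.a_comm)
  finally have "(y \<otimes>\<^bsub>L\<^esub> x) \<oplus>\<^bsub>L\<^esub> (x \<otimes>\<^bsub>L\<^esub> y) = \<zero>\<^bsub>L\<^esub>"
    using assms by (simp add: M.a_comm bracket_closed)
  then show ?thesis
    using assms by (metis M.minus_equality bracket_closed)
qed

lemma (in lie_algebra) bracket_finsum:
  assumes "finite A" "u \<in> A \<rightarrow> carrier L" "v \<in> carrier L"
  shows "finsum L u A \<otimes>\<^bsub>L\<^esub> v = finsum L (\<lambda>i. u i \<otimes>\<^bsub>L\<^esub> v) A"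
    and "v \<otimes>\<^bsub>L\<^esub> finsum L u A = finsum L (\<lambda>i. v \<otimes>\<^bsub>L\<^esub> u i) A"
  using assms
  by (induction A rule: finite_induct)
    (auto simp: bracket_zero bracket_add_left bracket_add_right bracket_closed Pi_def)

lemma index_pairs_Suc: "index_pairs (Suc n) = index_pairs n \<union> (\<lambda>i. (i, n)) ` {..<n}"
  by (auto simp: index_pairs_def less_Suc_eq)

lemma (in lie_algebra) bracket_linear_combinations:
  assumes "a \<in> {..<n} \<rightarrow> carrier R" "b \<in> {..<n} \<rightarrow> carrier R" "y \<in> {..<n} \<rightarrow> carrier L"
  shows "(\<Oplus>\<^bsub>L\<^esub>i\<in>{..<n}. a i \<odot>\<^bsub>L\<^esub> y i) \<otimes>\<^bsub>L\<^esub> (\<Oplus>\<^bsub>L\<^esub>i\<in>{..<n}. b i \<odot>\<^bsub>L\<^esub> y i) =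
    (\<Oplus>\<^bsub>L\<^esub>p\<in>index_pairs n. ((a (fst p) \<otimes> b (snd p)) \<ominus> (a (snd p) \<otimes> b (fst p))) \<odot>\<^bsub>L\<^esub>
       (y (fst p) \<otimes>\<^bsub>L\<^esub> y (snd p)))"
  using assms
proof (induction n)
  case 0
  show ?case by (simp add: index_pairs_def bracket_zero)
next
  case (Suc n)
  let ?A = "\<Oplus>\<^bsub>L\<^esub>i\<in>{..<n}. a i \<odot>\<^bsub>L\<^esub> y i" and ?B = "\<Oplus>\<^bsub>L\<^esub>i\<in>{..<n}. b i \<odot>\<^bsub>L\<^esub> y i"
  let ?c = "\<lambda>p. ((a (fst p) \<otimes> b (snd p)) \<ominus> (a (snd p) \<otimes> b (fst p))) \<odot>\<^bsub>L\<^esub>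
       (y (fst p) \<otimes>\<^bsub>L\<^esub> y (snd p))"
  have car: "a i \<in> carrier R" "b i \<in> carrier R" "y i \<in> carrier L" if "i \<le> n" for i
    using Suc.prems that by (auto simp: Pi_def)
  have IH: "?A \<otimes>\<^bsub>L\<^esub> ?B = finsum L ?c (index_pairs n)"
    by (rule Suc.IH) (auto simp: car)
  have AB: "?A \<in> carrier L" "?B \<in> carrier L"
    by (auto intro!: M.finsum_closed simp: car)
  have c: "?c \<in> index_pairs n \<rightarrow> carrier L" "?c \<in> (\<lambda>i. (i, n)) ` {..<n} \<rightarrow> carrier L"
    by (auto simp: index_pairs_def car bracket_closed)
  have "finsum L ?c (index_pairs (Suc n)) =
      finsum L ?c (index_pairs n) \<oplus>\<^bsub>L\<^esub> finsum L ?c ((\<lambda>i. (i, n)) ` {..<n})"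
    unfolding index_pairs_Suc
    by (rule M.finsum_Un_disjoint) (use c finite_index_pairs in \<open>auto simp: index_pairs_def\<close>)
  also have "finsum L ?c ((\<lambda>i. (i, n)) ` {..<n}) = finsum L (\<lambda>i. ?c (i, n)) {..<n}"
    by (rule M.finsum_reindex) (use c in \<open>auto simp: inj_on_def\<close>)
  also have "\<dots> = finsum L (\<lambda>i. (a i \<odot>\<^bsub>L\<^esub> y i) \<otimes>\<^bsub>L\<^esub> (b n \<odot>\<^bsub>L\<^esub> y n)
      \<oplus>\<^bsub>L\<^esub> (a n \<odot>\<^bsub>L\<^esub> y n) \<otimes>\<^bsub>L\<^esub> (b i \<odot>\<^bsub>L\<^esub> y i)) {..<n}"
  proof (rule M.finsum_cong')
    fix i assume "i \<in> {..<n}"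
    then have i: "a i \<in> carrier R" "b i \<in> carrier R" "y i \<in> carrier L"
      using car[of i] by auto
    have n: "a n \<in> carrier R" "b n \<in> carrier R" "y n \<in> carrier L"
      using car[of n] by auto
    show "?c (i, n) = (a i \<odot>\<^bsub>L\<^esub> y i) \<otimes>\<^bsub>L\<^esub> (b n \<odot>\<^bsub>L\<^esub> y n)
      \<oplus>\<^bsub>L\<^esub> (a n \<odot>\<^bsub>L\<^esub> y n) \<otimes>\<^bsub>L\<^esub> (b i \<odot>\<^bsub>L\<^esub> y i)"
      using i n bracket_anti[of "y i" "y n"]
      by (simp add: bracket_smult_left bracket_smult_right bracket_closed smult_l_distr
          R.minus_eq smult_l_minus smult_r_minus R.m_comm flip: smult_assoc1)
  qed (auto simp: car bracket_closed)
  also have "\<dots> = ?A \<otimes>\<^bsub>L\<^esub> (b n \<odot>\<^bsub>L\<^esub> y n) \<oplus>\<^bsub>L\<^esub> (a n \<odot>\<^bsub>L\<^esub> y n) \<otimes>\<^bsub>L\<^esub> ?B"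
    by (subst M.finsum_addf) (auto simp: bracket_finsum car bracket_closed)
  finally have R: "finsum L ?c (index_pairs (Suc n)) = ?A \<otimes>\<^bsub>L\<^esub> ?B \<oplus>\<^bsub>L\<^esub>
      (?A \<otimes>\<^bsub>L\<^esub> (b n \<odot>\<^bsub>L\<^esub> y n) \<oplus>\<^bsub>L\<^esub> (a n \<odot>\<^bsub>L\<^esub> y n) \<otimes>\<^bsub>L\<^esub> ?B)"
    using IH by simp
  have "(\<Oplus>\<^bsub>L\<^esub>i\<in>{..<Suc n}. a i \<odot>\<^bsub>L\<^esub> y i) = a n \<odot>\<^bsub>L\<^esub> y n \<oplus>\<^bsub>L\<^esub> ?A"
    "(\<Oplus>\<^bsub>L\<^esub>i\<in>{..<Suc n}. b i \<odot>\<^bsub>L\<^esub> y i) = b n \<odot>\<^bsub>L\<^esub> y n \<oplus>\<^bsub>L\<^esub> ?B"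
    unfolding lessThan_Suc by (subst M.finsum_insert; auto simp: car)+
  moreover have "(a n \<odot>\<^bsub>L\<^esub> y n) \<otimes>\<^bsub>L\<^esub> (b n \<odot>\<^bsub>L\<^esub> y n) = \<zero>\<^bsub>L\<^esub>"
    using car[of n] by (simp add: bracket_smult_left bracket_smult_right bracket_alt)
  ultimately show ?case
    using AB car[of n] R
    by (simp add: bracket_add_left bracket_add_right bracket_closed M.a_ac)
qed

lemma free_nil2_finsum:
  assumes "cring R" "finite A" "F \<in> A \<rightarrow> carrier (free_nil2 d R)"
  shows "i < d \<Longrightarrow> fst (finsum (free_nil2 d R) F A) i = finsum R (\<lambda>k. fst (F k) i) A"
    and "p \<in> index_pairs d \<Longrightarrow> snd (finsum (free_nil2 d R) F A) p = finsum R (\<lambda>k. snd (F k) p) A"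
proof -
  interpret cring R by fact
  interpret L: lie_algebra R "free_nil2 d R" by (rule free_nil2_lie_algebra[OF assms(1)])
  have "(i < d \<longrightarrow> fst (finsum (free_nil2 d R) F A) i = finsum R (\<lambda>k. fst (F k) i) A) \<and>
    (p \<in> index_pairs d \<longrightarrow> snd (finsum (free_nil2 d R) F A) p = finsum R (\<lambda>k. snd (F k) p) A)"
    using assms(2,3)
  proof (induction A rule: finite_induct)
    case empty
    then show ?case by (simp add: free_nil2_sel)
  next
    case (insert k A)
    have "(\<lambda>k. fst (F k) i) \<in> insert k A \<rightarrow> carrier R" if "i < d"
      using insert.prems that by (intro Pi_I free_nil2_nth(1)[where d = d]) auto
    moreover have "(\<lambda>k. snd (F k) p) \<in> insert k A \<rightarrow> carrier R" if "p \<in> index_pairs d"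
      using insert.prems that
      by (cases p, simp only:) (intro Pi_I free_nil2_nth(2)[where d = d]; auto)
    ultimately show ?case
      using insert by (auto simp: free_nil2_sel Pi_def)
  qed
  then show "i < d \<Longrightarrow> fst (finsum (free_nil2 d R) F A) i = finsum R (\<lambda>k. fst (F k) i) A"
    "p \<in> index_pairs d \<Longrightarrow> snd (finsum (free_nil2 d R) F A) p = finsum R (\<lambda>k. snd (F k) p) A"
    by auto
qed

lemma free_nil2_expansion:
  assumes "cring R" "x \<in> carrier (free_nil2 d R)"
  shows "x = (\<Oplus>\<^bsub>free_nil2 d R\<^esub>i\<in>{..<d}. fst x i \<odot>\<^bsub>free_nil2 d R\<^esub> free_nil2_gen d R i)
    \<oplus>\<^bsub>free_nil2 d R\<^esub> (\<Oplus>\<^bsub>free_nil2 d R\<^esub>p\<in>index_pairs d. snd x p \<odot>\<^bsub>free_nil2 d R\<^esub>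
      (free_nil2_gen d R (fst p) \<otimes>\<^bsub>free_nil2 d R\<^esub> free_nil2_gen d R (snd p)))"
    (is "x = ?A \<oplus>\<^bsub>?L\<^esub> ?B")
proof -
  interpret cring R by fact
  interpret L: lie_algebra R ?L by (rule free_nil2_lie_algebra[OF assms(1)])
  note cl = free_nil2_closed[OF assms(1)] and nth = free_nil2_nth[OF assms(2)]
  have FA: "(\<lambda>i. fst x i \<odot>\<^bsub>?L\<^esub> free_nil2_gen d R i) \<in> {..<d} \<rightarrow> carrier ?L"
    by (auto simp: cl nth)
  have FB: "(\<lambda>p. snd x p \<odot>\<^bsub>?L\<^esub> (free_nil2_gen d R (fst p) \<otimes>\<^bsub>?L\<^esub> free_nil2_gen d R (snd p)))
      \<in> index_pairs d \<rightarrow> carrier ?L"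
    by (auto simp: cl nth)
  note fs = free_nil2_finsum[OF assms(1) finite_lessThan FA]
    free_nil2_finsum[OF assms(1) finite_index_pairs FB]
  have AB: "?A \<in> carrier ?L" "?B \<in> carrier ?L"
    using FA FB by (auto intro!: L.M.finsum_closed)
  show ?thesis
  proof (rule free_nil2_eqI[of _ d R])
    fix i assume i: "i < d"
    have "fst ?A i = finsum R (\<lambda>k. if i = k then fst x k else \<zero>\<^bsub>R\<^esub>) {..<d}"
      unfolding fs(1)[OF i] by (rule finsum_cong') (use i in \<open>auto simp: free_nil2_sel nth\<close>)
    also have "\<dots> = fst x i"
      by (rule finsum_singleton) (use i in \<open>auto simp: nth\<close>)
    moreover have "fst ?B i = finsum R (\<lambda>k. \<zero>\<^bsub>R\<^esub>) (index_pairs d)"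
      unfolding fs(3)[OF i] by (rule finsum_cong') (use i in \<open>auto simp: free_nil2_sel nth\<close>)
    ultimately show "fst x i = fst (?A \<oplus>\<^bsub>?L\<^esub> ?B) i"
      using i by (simp add: free_nil2_sel(3) nth)
  next
    fix i j assume ij: "(i, j) \<in> index_pairs d"
    have "snd ?B (i, j) = finsum R (\<lambda>p. if (i, j) = p then snd x p else \<zero>\<^bsub>R\<^esub>) (index_pairs d)"
      unfolding fs(4)[OF ij]
    proof (rule finsum_cong')
      fix p assume "p \<in> index_pairs d"
      with ij show "snd (snd x p \<odot>\<^bsub>?L\<^esub> (free_nil2_gen d R (fst p) \<otimes>\<^bsub>?L\<^esub> free_nil2_gen d R (snd p))) (i, j)
          = (if (i, j) = p then snd x p else \<zero>\<^bsub>R\<^esub>)"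
        by (cases p) (auto simp: free_nil2_sel(6,8,9) nth index_pairs_def a_minus_def)
    qed (auto simp: nth)
    also have "\<dots> = snd x (i, j)"
      by (rule finsum_singleton) (use ij in \<open>auto simp: nth finite_index_pairs\<close>)
    moreover have "snd ?A (i, j) = finsum R (\<lambda>k. \<zero>\<^bsub>R\<^esub>) {..<d}"
      unfolding fs(2)[OF ij] by (rule finsum_cong') (use ij in \<open>auto simp: free_nil2_sel nth\<close>)
    ultimately show "snd x (i, j) = snd (?A \<oplus>\<^bsub>?L\<^esub> ?B) (i, j)"
      using ij by (simp add: free_nil2_sel(4) nth)
  qed (use AB assms in auto)
qed

lemma lin_hom_finsum:
  assumes "module R M" "module R N" "f \<in> lin_hom R M N" "finite A" "u \<in> A \<rightarrow> carrier M"
  shows "f (finsum M u A) = finsum N (\<lambda>i. f (u i)) A"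
proof -
  interpret M: module R M by fact
  interpret N: module R N by fact
  have cl: "f x \<in> carrier N" if "x \<in> carrier M" for x
    using assms(3) that by (auto simp: lin_hom_def)
  have "f (\<zero>\<^bsub>R\<^esub> \<odot>\<^bsub>M\<^esub> \<zero>\<^bsub>M\<^esub>) = \<zero>\<^bsub>R\<^esub> \<odot>\<^bsub>N\<^esub> f \<zero>\<^bsub>M\<^esub>"
    using assms(3) M.R.zero_closed M.M.zero_closed unfolding lin_hom_def by blast
  then have zero: "f \<zero>\<^bsub>M\<^esub> = \<zero>\<^bsub>N\<^esub>"
    by (simp add: cl)
  show ?thesis
    using assms(4,5)
  proof (induction A rule: finite_induct)
    case (insert k A)
    have "f (u k \<oplus>\<^bsub>M\<^esub> finsum M u A) = f (u k) \<oplus>\<^bsub>N\<^esub> f (finsum M u A)"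
      using insert.prems assms(3) by (auto simp: lin_hom_def)
    then show ?case
      using insert by (simp add: cl Pi_def)
  qed (simp add: zero)
qed

theorem free_nil2_universal:
  assumes "lie_algebra R K" "y \<in> {..<d} \<rightarrow> carrier K"
    and "\<And>i j k. \<lbrakk>i < d; j < d; k < d\<rbrakk> \<Longrightarrow> (y i \<otimes>\<^bsub>K\<^esub> y j) \<otimes>\<^bsub>K\<^esub> y k = \<zero>\<^bsub>K\<^esub>"
  shows "\<exists>!f. f \<in> lie_hom R (free_nil2 d R) K \<inter> extensional (carrier (free_nil2 d R)) \<and>
    (\<forall>i<d. f (free_nil2_gen d R i) = y i)"
proof -
  interpret K: lie_algebra R K by fact
  have R: "cring R" by (rule K.is_cring)
  let ?L = "free_nil2 d R"
  interpret L: lie_algebra R ?L by (rule free_nil2_lie_algebra[OF R])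
  note cl = free_nil2_closed[OF R] and sel = free_nil2_sel[where R = R] free_nil2_nth
  have y: "y i \<in> carrier K" if "i < d" for i using assms(2) that by auto
  define br where "br p = y (fst p) \<otimes>\<^bsub>K\<^esub> y (snd p)" for p
  have br: "br p \<in> carrier K" if "p \<in> index_pairs d" for p
    using that by (auto simp: br_def index_pairs_def intro!: K.bracket_closed y)
  define A where "A x = (\<Oplus>\<^bsub>K\<^esub>i\<in>{..<d}. fst x i \<odot>\<^bsub>K\<^esub> y i)" for x :: "(nat \<Rightarrow> 'a) \<times> (nat \<times> nat \<Rightarrow> 'a)"
  define B where "B x = (\<Oplus>\<^bsub>K\<^esub>p\<in>index_pairs d. snd x p \<odot>\<^bsub>K\<^esub> br p)"
    for x :: "(nat \<Rightarrow> 'a) \<times> (nat \<times> nat \<Rightarrow> 'a)"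
  have Af: "(\<lambda>i. fst x i \<odot>\<^bsub>K\<^esub> y i) \<in> {..<d} \<rightarrow> carrier K"
    and Bf: "(\<lambda>p. snd x p \<odot>\<^bsub>K\<^esub> br p) \<in> index_pairs d \<rightarrow> carrier K" if "x \<in> carrier ?L" for x
    using that by (auto simp: sel y br)
  have Acl: "A x \<in> carrier K" and Bcl: "B x \<in> carrier K" if "x \<in> carrier ?L" for x
    unfolding A_def B_def using Af[OF that] Bf[OF that] by (auto intro!: K.M.finsum_closed)
  have Aadd: "A (x \<oplus>\<^bsub>?L\<^esub> z) = A x \<oplus>\<^bsub>K\<^esub> A z" if "x \<in> carrier ?L" "z \<in> carrier ?L" for x z
  proof -
    have "A (x \<oplus>\<^bsub>?L\<^esub> z) = (\<Oplus>\<^bsub>K\<^esub>i\<in>{..<d}. (fst x i \<odot>\<^bsub>K\<^esub> y i) \<oplus>\<^bsub>K\<^esub> (fst z i \<odot>\<^bsub>K\<^esub> y i))"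
      unfolding A_def
      by (rule K.M.finsum_cong') (use that in \<open>auto simp: sel y K.smult_l_distr\<close>)
    then show ?thesis
      unfolding A_def using K.M.finsum_addf[OF Af[OF that(1)] Af[OF that(2)]] by simp
  qed
  have Badd: "B (x \<oplus>\<^bsub>?L\<^esub> z) = B x \<oplus>\<^bsub>K\<^esub> B z" if "x \<in> carrier ?L" "z \<in> carrier ?L" for x z
  proof -
    have "B (x \<oplus>\<^bsub>?L\<^esub> z) = (\<Oplus>\<^bsub>K\<^esub>p\<in>index_pairs d. (snd x p \<odot>\<^bsub>K\<^esub> br p) \<oplus>\<^bsub>K\<^esub> (snd z p \<odot>\<^bsub>K\<^esub> br p))"
      unfolding B_def
      by (rule K.M.finsum_cong') (use that in \<open>auto simp: sel br K.smult_l_distr\<close>)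
    then show ?thesis
      unfolding B_def using K.M.finsum_addf[OF Bf[OF that(1)] Bf[OF that(2)]] by simp
  qed
  have Asm: "A (r \<odot>\<^bsub>?L\<^esub> x) = r \<odot>\<^bsub>K\<^esub> A x" if "r \<in> carrier R" "x \<in> carrier ?L" for r x
    unfolding A_def K.finsum_smult_ldistr[OF finite_lessThan that(1) Af[OF that(2)]]
    by (rule K.M.finsum_cong') (use that in \<open>auto simp: sel y K.smult_assoc1\<close>)
  have Bsm: "B (r \<odot>\<^bsub>?L\<^esub> x) = r \<odot>\<^bsub>K\<^esub> B x" if "r \<in> carrier R" "x \<in> carrier ?L" for r x
    unfolding B_def K.finsum_smult_ldistr[OF finite_index_pairs that(1) Bf[OF that(2)]]
    by (rule K.M.finsum_cong') (use that in \<open>auto simp: sel br K.smult_assoc1\<close>)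

  have bry: "br p \<otimes>\<^bsub>K\<^esub> y k = \<zero>\<^bsub>K\<^esub>" "y k \<otimes>\<^bsub>K\<^esub> br p = \<zero>\<^bsub>K\<^esub>"
    if "p \<in> index_pairs d" "k < d" for p k
  proof -
    show 1: "br p \<otimes>\<^bsub>K\<^esub> y k = \<zero>\<^bsub>K\<^esub>"
      unfolding br_def by (rule assms(3)) (use that in \<open>auto simp: index_pairs_def\<close>)
    show "y k \<otimes>\<^bsub>K\<^esub> br p = \<zero>\<^bsub>K\<^esub>"
      using K.bracket_anti[OF br[OF that(1)] y[OF that(2)]] 1 by simp
  qed
  have brbr: "br p \<otimes>\<^bsub>K\<^esub> br q = \<zero>\<^bsub>K\<^esub>" if "p \<in> index_pairs d" "q \<in> index_pairs d" for p q
  proof -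
    have q: "fst q < d" "snd q < d" using that by (auto simp: index_pairs_def)
    have "br q \<otimes>\<^bsub>K\<^esub> br p \<oplus>\<^bsub>K\<^esub> (y (snd q) \<otimes>\<^bsub>K\<^esub> br p) \<otimes>\<^bsub>K\<^esub> y (fst q)
        \<oplus>\<^bsub>K\<^esub> (br p \<otimes>\<^bsub>K\<^esub> y (fst q)) \<otimes>\<^bsub>K\<^esub> y (snd q) = \<zero>\<^bsub>K\<^esub>"
      using K.jacobi[OF y[OF q(1)] y[OF q(2)] br[OF that(1)]] by (simp add: br_def)
    then have "br q \<otimes>\<^bsub>K\<^esub> br p = \<zero>\<^bsub>K\<^esub>"
      using that q by (simp add: bry y br K.bracket_zero K.bracket_closed)
    then show ?thesis
      using K.bracket_anti[OF br[OF that(2)] br[OF that(1)]] by simp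
  qed
  have AB: "A x \<otimes>\<^bsub>K\<^esub> B z = \<zero>\<^bsub>K\<^esub>" "B x \<otimes>\<^bsub>K\<^esub> A z = \<zero>\<^bsub>K\<^esub>" "B x \<otimes>\<^bsub>K\<^esub> B z = \<zero>\<^bsub>K\<^esub>"
    if x: "x \<in> carrier ?L" and z: "z \<in> carrier ?L" for x z
  proof -
    have yB: "y i \<otimes>\<^bsub>K\<^esub> B z = \<zero>\<^bsub>K\<^esub>" if "z \<in> carrier ?L" "i < d" for i z
    proof -
      have "y i \<otimes>\<^bsub>K\<^esub> B z = (\<Oplus>\<^bsub>K\<^esub>p\<in>index_pairs d. \<zero>\<^bsub>K\<^esub>)"
        unfolding B_def K.bracket_finsum(2)[OF finite_index_pairs Bf[OF that(1)] y[OF that(2)]]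
        by (rule K.M.finsum_cong') (use that in \<open>auto simp: sel br y bry K.bracket_smult_right\<close>)
      then show ?thesis by simp
    qed
    have Ay: "A x \<otimes>\<^bsub>K\<^esub> B z = \<zero>\<^bsub>K\<^esub>" if x: "x \<in> carrier ?L" and z: "z \<in> carrier ?L" for x z
    proof -
      have "A x \<otimes>\<^bsub>K\<^esub> B z = (\<Oplus>\<^bsub>K\<^esub>p\<in>{..<d}. \<zero>\<^bsub>K\<^esub>)"
        unfolding A_def K.bracket_finsum(1)[OF finite_lessThan Af[OF x] Bcl[OF z]]
        by (rule K.M.finsum_cong') (use x z in \<open>auto simp: sel y yB Bcl K.bracket_smult_left\<close>)
      then show ?thesis by simp
    qed
    show "A x \<otimes>\<^bsub>K\<^esub> B z = \<zero>\<^bsub>K\<^esub>" by (rule Ay[OF x z])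
    show "B x \<otimes>\<^bsub>K\<^esub> A z = \<zero>\<^bsub>K\<^esub>"
      using K.bracket_anti[OF Acl[OF z] Bcl[OF x]] Ay[OF z x] by simp
    have brB: "br q \<otimes>\<^bsub>K\<^esub> B z = \<zero>\<^bsub>K\<^esub>" if "q \<in> index_pairs d" for q
    proof -
      have "br q \<otimes>\<^bsub>K\<^esub> B z = (\<Oplus>\<^bsub>K\<^esub>p\<in>index_pairs d. \<zero>\<^bsub>K\<^esub>)"
        unfolding B_def K.bracket_finsum(2)[OF finite_index_pairs Bf[OF z] br[OF that]]
        by (rule K.M.finsum_cong') (use that z in \<open>auto simp: sel br brbr K.bracket_smult_right\<close>)
      then show ?thesis by simp
    qed
    have "B x \<otimes>\<^bsub>K\<^esub> B z = (\<Oplus>\<^bsub>K\<^esub>p\<in>index_pairs d. \<zero>\<^bsub>K\<^esub>)"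
      unfolding B_def[of x] K.bracket_finsum(1)[OF finite_index_pairs Bf[OF x] Bcl[OF z]]
      by (rule K.M.finsum_cong') (use x z in \<open>auto simp: sel br brB Bcl K.bracket_smult_left\<close>)
    then show "B x \<otimes>\<^bsub>K\<^esub> B z = \<zero>\<^bsub>K\<^esub>" by simp
  qed
  have AA: "A x \<otimes>\<^bsub>K\<^esub> A z = B (x \<otimes>\<^bsub>?L\<^esub> z)" if x: "x \<in> carrier ?L" and z: "z \<in> carrier ?L" for x z
  proof -
    have "A x \<otimes>\<^bsub>K\<^esub> A z = (\<Oplus>\<^bsub>K\<^esub>p\<in>index_pairs d. ((fst x (fst p) \<otimes>\<^bsub>R\<^esub> fst z (snd p)) \<ominus>\<^bsub>R\<^esub>
        (fst x (snd p) \<otimes>\<^bsub>R\<^esub> fst z (fst p))) \<odot>\<^bsub>K\<^esub> br p)"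
      unfolding A_def br_def
      by (rule K.bracket_linear_combinations) (use x z in \<open>auto simp: sel y\<close>)
    also have "\<dots> = B (x \<otimes>\<^bsub>?L\<^esub> z)"
      unfolding B_def
      by (rule K.M.finsum_cong') (use x z in \<open>auto simp: sel cl br\<close>)
    finally show ?thesis .
  qed
  have A0: "A (x \<otimes>\<^bsub>?L\<^esub> z) = \<zero>\<^bsub>K\<^esub>" for x z
  proof -
    have "A (x \<otimes>\<^bsub>?L\<^esub> z) = (\<Oplus>\<^bsub>K\<^esub>i\<in>{..<d}. \<zero>\<^bsub>K\<^esub>)"
      unfolding A_def by (rule K.M.finsum_cong') (auto simp: sel y)
    then show ?thesis by simp
  qed
  define f where "f = restrict (\<lambda>x. A x \<oplus>\<^bsub>K\<^esub> B x) (carrier ?L)"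
  have lie: "f \<in> lie_hom R ?L K"
    unfolding lie_hom_def lin_hom_def
  proof (safe)
    fix x z assume xz: "x \<in> carrier ?L" "z \<in> carrier ?L"
    show "f (x \<oplus>\<^bsub>?L\<^esub> z) = f x \<oplus>\<^bsub>K\<^esub> f z"
      using xz by (simp add: f_def cl Aadd Badd Acl Bcl K.M.a_ac)
    show "f (x \<otimes>\<^bsub>?L\<^esub> z) = f x \<otimes>\<^bsub>K\<^esub> f z"
      using xz by (simp add: f_def cl A0 AB AA[symmetric] Acl Bcl K.bracket_add_left
          K.bracket_add_right K.bracket_closed)
  next
    fix r x assume "r \<in> carrier R" "x \<in> carrier ?L"
    then show "f (r \<odot>\<^bsub>?L\<^esub> x) = r \<odot>\<^bsub>K\<^esub> f x"
      by (simp add: f_def cl Asm Bsm Acl Bcl K.smult_r_distr)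
  qed (simp add: f_def Acl Bcl)
  have gen: "f (free_nil2_gen d R i) = y i" if i: "i < d" for i
  proof -
    have "A (free_nil2_gen d R i) = (\<Oplus>\<^bsub>K\<^esub>k\<in>{..<d}. if i = k then y k else \<zero>\<^bsub>K\<^esub>)"
      unfolding A_def by (rule K.M.finsum_cong') (auto simp: sel y)
    also have "\<dots> = y i"
      by (rule K.M.finsum_singleton) (use i in \<open>auto simp: y\<close>)
    finally have "A (free_nil2_gen d R i) = y i" .
    moreover have "B (free_nil2_gen d R i) = (\<Oplus>\<^bsub>K\<^esub>p\<in>index_pairs d. \<zero>\<^bsub>K\<^esub>)"
      unfolding B_def by (rule K.M.finsum_cong') (auto simp: sel br)
    ultimately show ?thesis
      using i by (simp add: f_def cl y)
  qed
  have unique: "g x = A x \<oplus>\<^bsub>K\<^esub> B x"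
    if g: "g \<in> lie_hom R ?L K" "\<forall>i<d. g (free_nil2_gen d R i) = y i" and x: "x \<in> carrier ?L" for g x
  proof -
    let ?gen = "free_nil2_gen d R"
    have lin: "g \<in> lin_hom R ?L K" using g by (simp add: lie_hom_def)
    have FA: "(\<lambda>i. fst x i \<odot>\<^bsub>?L\<^esub> ?gen i) \<in> {..<d} \<rightarrow> carrier ?L"
      using x by (auto simp: cl sel)
    have FB: "(\<lambda>p. snd x p \<odot>\<^bsub>?L\<^esub> (?gen (fst p) \<otimes>\<^bsub>?L\<^esub> ?gen (snd p))) \<in> index_pairs d \<rightarrow> carrier ?L"
      using x by (auto simp: cl sel)
    have "g x = g (finsum ?L (\<lambda>i. fst x i \<odot>\<^bsub>?L\<^esub> ?gen i) {..<d} \<oplus>\<^bsub>?L\<^esub>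
        finsum ?L (\<lambda>p. snd x p \<odot>\<^bsub>?L\<^esub> (?gen (fst p) \<otimes>\<^bsub>?L\<^esub> ?gen (snd p))) (index_pairs d))"
      using free_nil2_expansion[OF R x] by simp
    also have "\<dots> = g (finsum ?L (\<lambda>i. fst x i \<odot>\<^bsub>?L\<^esub> ?gen i) {..<d}) \<oplus>\<^bsub>K\<^esub>
        g (finsum ?L (\<lambda>p. snd x p \<odot>\<^bsub>?L\<^esub> (?gen (fst p) \<otimes>\<^bsub>?L\<^esub> ?gen (snd p))) (index_pairs d))"
      using lin L.M.finsum_closed[OF FA] L.M.finsum_closed[OF FB] by (simp add: lin_hom_def)
    also have "g (finsum ?L (\<lambda>i. fst x i \<odot>\<^bsub>?L\<^esub> ?gen i) {..<d}) = A x"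
      unfolding A_def lin_hom_finsum[OF L.module_axioms K.module_axioms lin finite_lessThan FA]
      by (rule K.M.finsum_cong') (use x g in \<open>auto simp: lin_hom_def lie_hom_def sel cl y\<close>)
    also have "g (finsum ?L (\<lambda>p. snd x p \<odot>\<^bsub>?L\<^esub> (?gen (fst p) \<otimes>\<^bsub>?L\<^esub> ?gen (snd p))) (index_pairs d)) = B x"
      unfolding B_def lin_hom_finsum[OF L.module_axioms K.module_axioms lin finite_index_pairs FB]
    proof (rule K.M.finsum_cong')
      fix p assume p: "p \<in> index_pairs d"
      then have "fst p < d" "snd p < d" "snd x p \<in> carrier R"
        using x by (cases p; auto simp: sel index_pairs_def)+
      then show "g (snd x p \<odot>\<^bsub>?L\<^esub> (?gen (fst p) \<otimes>\<^bsub>?L\<^esub> ?gen (snd p))) = snd x p \<odot>\<^bsub>K\<^esub> br p"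
        using g by (simp add: lin_hom_def lie_hom_def cl br_def)
    qed (use Bf[OF x] in auto)
    finally show ?thesis .
  qed
  show ?thesis
  proof (rule ex1I[of _ f])
    show "f \<in> lie_hom R ?L K \<inter> extensional (carrier ?L) \<and> (\<forall>i<d. f (free_nil2_gen d R i) = y i)"
      using lie gen by (auto simp: f_def)
    fix g assume g: "g \<in> lie_hom R ?L K \<inter> extensional (carrier ?L) \<and> (\<forall>i<d. g (free_nil2_gen d R i) = y i)"
    show "g = f"
    proof (rule extensionalityI[of _ "carrier ?L"])
      show "g x = f x" if "x \<in> carrier ?L" for x
        using unique[of g x] g that by (simp add: f_def)
    qed (use g in \<open>auto simp: f_def\<close>)
  qed
qed

section \<open>The no-overlap zeta function\<close>

text \<open>The multiset \<open>{lam\<^sub>i + lam\<^sub>j : i < j}\<close> in weakly decreasing order.\<close>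

definition pair_sums :: "nat list \<Rightarrow> nat list" where
  "pair_sums lam = rev (sort [lam ! i + lam ! j. j \<leftarrow> [0..<length lam], i \<leftarrow> [0..<j]])"

definition no_overlap :: "nat \<Rightarrow> ('r, 'q) ring_scheme \<Rightarrow> ((nat \<Rightarrow> 'r) \<times> (nat \<times> nat \<Rightarrow> 'r)) set \<Rightarrow> bool" where
  "no_overlap d R H \<longleftrightarrow> (let L = free_nil2 d R; L' = derived_alg R L in
     \<exists>lam nu. has_elem_div_type R d (quot_module L L') ((\<lambda>x. L' +>\<^bsub>L\<^esub> x) ` (H <+>\<^bsub>L\<^esub> L')) lam \<and>
       has_elem_div_type R (d choose 2) (L\<lparr>carrier := L'\<rparr>) (H \<inter> L') nu \<and>
       sorted_wrt (\<ge>) (pair_sums lam @ nu))"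

definition no_overlap_subalgebras ::
  "nat \<Rightarrow> ('r, 'q) ring_scheme \<Rightarrow> ((nat \<Rightarrow> 'r) \<times> (nat \<times> nat \<Rightarrow> 'r)) set set" where
  "no_overlap_subalgebras d R = {H. lie_subalgebra R (free_nil2 d R) H \<and>
     finite (a_rcosets\<^bsub>free_nil2 d R\<^esub> H) \<and> no_overlap d R H}"

text \<open>The terms \<open>|L : H|\<^bsup>-s\<^esup>\<close> of the Dirichlet series over \<open>R\<close>.\<close>

definition no_overlap_term ::
  "nat \<Rightarrow> ('r, 'q) ring_scheme \<Rightarrow> complex \<Rightarrow> ((nat \<Rightarrow> 'r) \<times> (nat \<times> nat \<Rightarrow> 'r)) set \<Rightarrow> complex" where
  "no_overlap_term d R s H = of_nat (card (a_rcosets\<^bsub>free_nil2 d R\<^esub> H)) powr (- s)"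


section \<open>Rational functions in two variables\<close>

text \<open>\<open>\<rat>(q, t)\<close> is the field of fractions of \<open>\<rat>[q][t]\<close>: the variable \<open>q\<close> is that of the inner,
  \<open>t\<close> that of the outer polynomial ring.\<close>

type_synonym ratfun2 = "rat poly poly fract"

definition q_var :: ratfun2 where "q_var = Fraction_Field.Fract [:[:0, 1:]:] 1"

definition t_var :: ratfun2 where "t_var = Fraction_Field.Fract [:0, 1:] 1"

instance fract :: ("{idom, ring_char_0}") ring_char_0
  by standard (auto simp: inj_def of_nat_fract eq_fract)

instance fract :: ("{idom, ring_char_0}") field_char_0 ..

definition poly2_eval :: "'k::field_char_0 \<Rightarrow> 'k \<Rightarrow> rat poly poly \<Rightarrow> 'k" where
  "poly2_eval x y P = poly (map_poly (\<lambda>c. poly (map_poly of_rat c) x) P) y"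

definition ratfun2_defined :: "'k::field_char_0 \<Rightarrow> 'k \<Rightarrow> ratfun2 \<Rightarrow> bool" where
  "ratfun2_defined x y W \<longleftrightarrow> (\<exists>P Q. W = Fraction_Field.Fract P Q \<and> poly2_eval x y Q \<noteq> 0)"

text \<open>\<open>W(x, y)\<close>, meaningful if \<open>W\<close> is defined at \<open>(x, y)\<close>; the field \<open>'k\<close> may be \<open>\<rat>(q, t)\<close> itself.\<close>

definition ratfun2_eval :: "'k::field_char_0 \<Rightarrow> 'k \<Rightarrow> ratfun2 \<Rightarrow> 'k" where
  "ratfun2_eval x y W = (THE z. \<exists>P Q. W = Fraction_Field.Fract P Q \<and> poly2_eval x y Q \<noteq> 0 \<and>
     z = poly2_eval x y P / poly2_eval x y Q)"

text \<open>\<open>W(q, q\<^bsup>-s\<^esup>)\<close> equals the no-overlap zeta function over \<open>R\<close> (with residue cardinality \<open>q\<close>) on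
  some right half-plane on which the latter converges.\<close>

definition interpolates_no_overlap :: "nat \<Rightarrow> ('r, 'q) ring_scheme \<Rightarrow> ratfun2 \<Rightarrow> bool" where
  "interpolates_no_overlap d R W \<longleftrightarrow> (\<exists>\<sigma>::real. \<forall>s::complex. Re s > \<sigma> \<longrightarrow>
     (let q = of_nat (residue_card R); t = q powr (- s) in
       ratfun2_defined q t W \<and>
       (no_overlap_term d R s has_sum ratfun2_eval q t W) (no_overlap_subalgebras d R)))"

text \<open>A compact discrete valuation ring has the cardinality of the continuum, so up to isomorphism
  all of them have a carrier in the type \<^typ>\<open>nat \<Rightarrow> nat\<close>.\<close>

definition is_no_overlap_zeta :: "nat \<Rightarrow> ratfun2 \<Rightarrow> bool" where
  "is_no_overlap_zeta d W \<longleftrightarrow>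
     (\<forall>R :: (nat \<Rightarrow> nat) ring. is_cDVR R \<longrightarrow> interpolates_no_overlap d R W)"

definition no_overlap_zeta :: "nat \<Rightarrow> ratfun2" where
  "no_overlap_zeta d = (THE W. is_no_overlap_zeta d W)"

end

theory Submission
  imports Defs
begin

text \<open>
  A finite-index submodule \<open>\<hh>\<close> of \<open>L = \<ff>\<^bsub>2,d\<^esub>(\<oo>)\<close> is given by its image \<open>\<Lambda>\<close> in \<open>L/[L,L]\<close>, by
  \<open>N = \<hh> \<inter> [L,L]\<close> and by one of \<open>|[L,L] : N|\<^sup>d\<close> sections. If \<open>\<lambda>\<close> is the type of \<open>\<Lambda>\<close>, there is no
  overlap iff \<open>\<pp>\<^sup>M [L,L] \<subseteq> N\<close> for \<open>M = \<lambda>\<^bsub>d-1\<^esub> + \<lambda>\<^sub>d\<close>, and then \<open>\<hh>\<close> is automatically closed under the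
  bracket. Removing one layer \<open>N \<mapsto> N + \<pp>L\<close> at a time turns a sum over lattices \<open>N \<supseteq> \<pp>\<^sup>M L\<close> into a
  triangular recursion in \<open>M\<close> with Gaussian binomial coefficients. Its diagonalisation expresses
  the sum over \<open>N\<close> as a combination of \<open>y\<^sub>k\<^sup>M\<close> with \<open>y\<^sub>k = q\<^bsup>k(d'-k)\<^esup> (q\<^sup>d t)\<^sup>k\<close>, \<open>0 \<le> k \<le> d'\<close>; summing
  \<open>t\<^bsup>|\<lambda>|\<^esup> y\<^sub>k\<^sup>M\<close> over \<open>\<Lambda>\<close> is the limit of a recursion of the same kind. Each summand of the
  resulting rational function has the required behaviour under \<open>(q, t) \<mapsto> (q\<^bsup>-1\<^esup>, t\<^bsup>-1\<^esup>)\<close>. Uniqueness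
  of the rational function follows by evaluation over the rings \<open>\<bbbF>\<^sub>p[[T]]\<close>.
\<close>

section \<open>Indices and complements of submodules\<close>

text \<open>Closure under the bracket holds because, with e \<le> r the two smallest parts of
  \<lambda>, every element of \<Lambda> is a multiple of one fixed vector by an element of p^e, up
  to p^r L. The multiples of that vector commute, so all brackets fall into p^(r+e)[L,L] with r + e
  = M. What remains is a count of pairs (\<Lambda>, N) that are coupled only through M. The coupling
  is what obstructs a product formula, and the diagonalisation removes it: M is the number of layers
  of \<Lambda> of index at least q^(d-1) plus the number of those of index q^d, so each power y_k^M
  is a product over layers and can be summed by a recursion in which y_k is a mere parameter. The
  natural variable is X = q^(d'+d) t: the weighted number of choices for a layer, q^(s(d'-r)) (q^d
  t)^s times a Gaussian binomial, equals q^(-rs) X^s times that binomial. The rank d' then enters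
  the matrix through X alone, and inversion of q and t inverts X and every y_k. All identities are
  exact as long as \<Lambda> contains p^m L; only m tends to infinity.\<close>

lemma card_image_eq_kernel:
  assumes "\<And>a b. a \<in> A \<Longrightarrow> b \<in> A \<Longrightarrow> g a = g b \<longleftrightarrow> h a = h b"
  shows "card (g ` A) = card (h ` A)"
proof (rule bij_betw_same_card)
  show "bij_betw (\<lambda>y. h (inv_into A g y)) (g ` A) (h ` A)"
    unfolding bij_betw_def
  proof
    show "inj_on (\<lambda>y. h (inv_into A g y)) (g ` A)"
      by (rule inj_onI) (metis assms f_inv_into_f inv_into_into)
    show "(\<lambda>y. h (inv_into A g y)) ` g ` A = h ` A"
    proof safe
      fix a assume a: "a \<in> A"
      then have "h (inv_into A g (g a)) = h a"
        by (metis assms f_inv_into_f imageI inv_into_into)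
      then show "h a \<in> (\<lambda>y. h (inv_into A g y)) ` g ` A" using a by force
    qed (metis imageI inv_into_into)
  qed
qed

text \<open>The index is 0 if it is infinite.\<close>

definition mindex :: "('r, 'a, 'm) module_scheme \<Rightarrow> 'a set \<Rightarrow> 'a set \<Rightarrow> nat" where
  "mindex M A B = card ((\<lambda>a. B +>\<^bsub>M\<^esub> a) ` A)"

definition mscale :: "('r, 'a, 'm) module_scheme \<Rightarrow> 'r \<Rightarrow> 'a set \<Rightarrow> 'a set" where
  "mscale M p A = (\<lambda>x. p \<odot>\<^bsub>M\<^esub> x) ` A"

text \<open>For \<open>Z\<close> inside \<open>Y\<close> these are the complements of
  \<open>Y/Z\<close> in \<open>X/Z\<close>, described without quotient modules. The notion serves
  twice: for submodules of \<open>L\<close> with prescribed image in \<open>L/[L,L]\<close> and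
  prescribed intersection with \<open>[L,L]\<close>, and for the single layers in the lattice
  count.\<close>

definition complements ::
  "('r, 'q) ring_scheme \<Rightarrow> ('r, 'a, 'm) module_scheme \<Rightarrow> 'a set \<Rightarrow> 'a set \<Rightarrow> 'a set \<Rightarrow> 'a set set" where
  "complements R M X Y Z = {W. submodule W R M \<and> W \<subseteq> X \<and> W <+>\<^bsub>M\<^esub> Y = X \<and> W \<inter> Y = Z}"

context module
begin

abbreviation sm where "sm A \<equiv> submodule A R M"
abbreviation mplus (infixl "\<oplus>\<^sub>M" 65) where "x \<oplus>\<^sub>M y \<equiv> x \<oplus>\<^bsub>M\<^esub> y"
abbreviation msum (infixl "<+>\<^sub>M" 60) where "A <+>\<^sub>M B \<equiv> A <+>\<^bsub>M\<^esub> B"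
abbreviation mminus (infixl "\<ominus>\<^sub>M" 65) where "x \<ominus>\<^sub>M y \<equiv> x \<ominus>\<^bsub>M\<^esub> y"
abbreviation idx where "idx \<equiv> mindex M"
abbreviation scl :: "'a \<Rightarrow> 'c set \<Rightarrow> 'c set" where "scl \<equiv> mscale M"
abbreviation comps where "comps \<equiv> complements R M"

lemma smD:
  assumes "sm A"
  shows "A \<subseteq> carrier M" "\<zero>\<^bsub>M\<^esub> \<in> A" "x \<in> A \<Longrightarrow> x \<in> carrier M"
    "x \<in> A \<Longrightarrow> y \<in> A \<Longrightarrow> x \<oplus>\<^sub>M y \<in> A"
    "x \<in> A \<Longrightarrow> \<ominus>\<^bsub>M\<^esub> x \<in> A"
    "x \<in> A \<Longrightarrow> y \<in> A \<Longrightarrow> x \<ominus>\<^sub>M y \<in> A"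
    "r \<in> carrier R \<Longrightarrow> x \<in> A \<Longrightarrow> r \<odot>\<^bsub>M\<^esub> x \<in> A"
proof -
  note E = submoduleE[OF assms]
  show "A \<subseteq> carrier M" by (rule E)
  show "x \<in> A \<Longrightarrow> x \<in> carrier M" for x using E(1) by auto
  show add: "x \<in> A \<Longrightarrow> y \<in> A \<Longrightarrow> x \<oplus>\<^sub>M y \<in> A" for x y by (rule E)
  show inv: "x \<in> A \<Longrightarrow> \<ominus>\<^bsub>M\<^esub> x \<in> A" for x by (rule E)
  show "x \<in> A \<Longrightarrow> y \<in> A \<Longrightarrow> x \<ominus>\<^sub>M y \<in> A" using add inv by (simp add: a_minus_def)
  show "r \<in> carrier R \<Longrightarrow> x \<in> A \<Longrightarrow> r \<odot>\<^bsub>M\<^esub> x \<in> A" by (rule E)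
  show "\<zero>\<^bsub>M\<^esub> \<in> A"
    using E(1,2) add inv by (metis M.r_neg ex_in_conv subsetD)
qed

lemma smI:
  assumes "A \<subseteq> carrier M" "\<zero>\<^bsub>M\<^esub> \<in> A"
    and "\<And>x y. x \<in> A \<Longrightarrow> y \<in> A \<Longrightarrow> x \<oplus>\<^sub>M y \<in> A"
    and "\<And>r x. r \<in> carrier R \<Longrightarrow> x \<in> A \<Longrightarrow> r \<odot>\<^bsub>M\<^esub> x \<in> A"
  shows "sm A"
proof (rule submoduleI)
  fix a assume a: "a \<in> A"
  have "(\<ominus> \<one>) \<odot>\<^bsub>M\<^esub> a \<in> A" using a assms(4) by simp
  then show "\<ominus>\<^bsub>M\<^esub> a \<in> A" using a assms(1) by (simp add: smult_l_minus subset_iff)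
qed (use assms in auto)

lemma sm_carrier: "sm (carrier M)"
  by (rule smI) auto

lemma sm_Int: "sm A \<Longrightarrow> sm B \<Longrightarrow> sm (A \<inter> B)"
  by (rule smI) (auto simp: smD)

lemma msum_iff: "x \<in> A <+>\<^sub>M B \<longleftrightarrow> (\<exists>a\<in>A. \<exists>b\<in>B. x = a \<oplus>\<^sub>M b)"
  by (auto simp: set_add_def set_mult_def)

lemma msumI: "a \<in> A \<Longrightarrow> b \<in> B \<Longrightarrow> a \<oplus>\<^sub>M b \<in> A <+>\<^sub>M B"
  by (auto simp: msum_iff)

lemma sm_sum:
  assumes "sm A" "sm B" shows "sm (A <+>\<^sub>M B)"
proof (rule smI)
  note A = smD[OF assms(1)] and B = smD[OF assms(2)]
  show "A <+>\<^sub>M B \<subseteq> carrier M" by (auto simp: msum_iff A B)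
  show "\<zero>\<^bsub>M\<^esub> \<in> A <+>\<^sub>M B" using msumI[OF A(2) B(2)] by simp
  fix x y assume "x \<in> A <+>\<^sub>M B" "y \<in> A <+>\<^sub>M B"
  then obtain a b a' b' where *: "x = a \<oplus>\<^sub>M b" "y = a' \<oplus>\<^sub>M b'" "a \<in> A" "a' \<in> A" "b \<in> B" "b' \<in> B"
    by (auto simp: msum_iff)
  then have "x \<oplus>\<^sub>M y = (a \<oplus>\<^sub>M a') \<oplus>\<^sub>M (b \<oplus>\<^sub>M b')" using A(3) B(3) by (simp add: M.a_ac)
  then show "x \<oplus>\<^sub>M y \<in> A <+>\<^sub>M B" using * A B by (auto intro!: msumI)
next
  note A = smD[OF assms(1)] and B = smD[OF assms(2)]
  fix r x assume r: "r \<in> carrier R" "x \<in> A <+>\<^sub>M B"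
  then show "r \<odot>\<^bsub>M\<^esub> x \<in> A <+>\<^sub>M B"
    by (auto simp: msum_iff smult_r_distr A B) (intro bexI, rule refl, auto simp: A B)
qed

lemma sum_upper: assumes "sm A" "sm B" shows "A \<subseteq> A <+>\<^sub>M B" "B \<subseteq> A <+>\<^sub>M B"
proof -
  note A = smD[OF assms(1)] and B = smD[OF assms(2)]
  show "A \<subseteq> A <+>\<^sub>M B"
  proof
    fix x assume "x \<in> A" then show "x \<in> A <+>\<^sub>M B" using msumI[of x A "\<zero>\<^bsub>M\<^esub>" B] A B by simp
  qed
  show "B \<subseteq> A <+>\<^sub>M B"
  proof
    fix x assume "x \<in> B" then show "x \<in> A <+>\<^sub>M B" using msumI[of "\<zero>\<^bsub>M\<^esub>" A x B] A B by simp
  qed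
qed

lemma sum_least: "sm C \<Longrightarrow> A \<subseteq> C \<Longrightarrow> B \<subseteq> C \<Longrightarrow> A <+>\<^sub>M B \<subseteq> C"
  by (auto simp: msum_iff intro!: smD(4))

lemma sum_comm: "A \<subseteq> carrier M \<Longrightarrow> B \<subseteq> carrier M \<Longrightarrow> A <+>\<^sub>M B = B <+>\<^sub>M A"
  by (auto simp: msum_iff) (metis M.a_comm subsetD)+

lemma sum_absorb: "sm A \<Longrightarrow> sm B \<Longrightarrow> B \<subseteq> A \<Longrightarrow> A <+>\<^sub>M B = A"
  using sum_upper(1)[of A B] sum_least[of A A B] by auto

lemma sum_mono: "A \<subseteq> A' \<Longrightarrow> B \<subseteq> B' \<Longrightarrow> A <+>\<^sub>M B \<subseteq> A' <+>\<^sub>M B'"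
  by (auto simp: msum_iff) blast

lemma add_minus_cancel:
  "a \<in> carrier M \<Longrightarrow> b \<in> carrier M \<Longrightarrow> a \<oplus>\<^sub>M (b \<oplus>\<^sub>M \<ominus>\<^bsub>M\<^esub> a) = b"
  "a \<in> carrier M \<Longrightarrow> b \<in> carrier M \<Longrightarrow> \<ominus>\<^bsub>M\<^esub> a \<oplus>\<^sub>M (b \<oplus>\<^sub>M a) = b"
  "a \<in> carrier M \<Longrightarrow> b \<in> carrier M \<Longrightarrow> c \<in> carrier M \<Longrightarrow>
    a \<oplus>\<^sub>M (b \<oplus>\<^sub>M (\<ominus>\<^bsub>M\<^esub> a \<oplus>\<^sub>M c)) = b \<oplus>\<^sub>M c"
  by (metis M.a_comm M.a_inv_closed M.r_neg1 M.r_neg2,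
      metis M.a_comm M.a_inv_closed M.r_neg1 M.r_neg2,
      metis M.a_lcomm M.a_inv_closed M.r_neg2 M.add.m_closed)

lemma modular_law:
  assumes "sm A" "sm B" "sm C" "A \<subseteq> C"
  shows "(A <+>\<^sub>M B) \<inter> C = A <+>\<^sub>M (B \<inter> C)"
proof
  note A = smD[OF assms(1)] and B = smD[OF assms(2)] and C = smD[OF assms(3)]
  show "(A <+>\<^sub>M B) \<inter> C \<subseteq> A <+>\<^sub>M (B \<inter> C)"
  proof
    fix x assume "x \<in> (A <+>\<^sub>M B) \<inter> C"
    then obtain a b where *: "x = a \<oplus>\<^sub>M b" "a \<in> A" "b \<in> B" "x \<in> C" by (auto simp: msum_iff)
    then have "b = x \<ominus>\<^sub>M a"
      using A(3) B(3) by (simp add: a_minus_def M.a_assoc add_minus_cancel)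
    then have "b \<in> C" using C(6)[OF *(4), of a] *(2) assms(4) by (metis subsetD)
    then show "x \<in> A <+>\<^sub>M (B \<inter> C)" using * by (auto intro: msumI)
  qed
  show "A <+>\<^sub>M (B \<inter> C) \<subseteq> (A <+>\<^sub>M B) \<inter> C"
    by (intro Int_greatest sum_mono sum_least[OF assms(3,4)]) auto
qed

lemma minus_telescope:
  "a \<in> carrier M \<Longrightarrow> b \<in> carrier M \<Longrightarrow> (a \<ominus>\<^sub>M b) \<oplus>\<^sub>M b = a"
  "a \<in> carrier M \<Longrightarrow> b \<in> carrier M \<Longrightarrow> b \<oplus>\<^sub>M (a \<ominus>\<^sub>M b) = a"
  "a \<in> carrier M \<Longrightarrow> b \<in> carrier M \<Longrightarrow> (a \<oplus>\<^sub>M b) \<ominus>\<^sub>M b = a"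
  "a \<in> carrier M \<Longrightarrow> b \<in> carrier M \<Longrightarrow> (a \<oplus>\<^sub>M b) \<ominus>\<^sub>M a = b"
  "a \<in> carrier M \<Longrightarrow> b \<in> carrier M \<Longrightarrow> \<ominus>\<^bsub>M\<^esub> (a \<ominus>\<^sub>M b) = b \<ominus>\<^sub>M a"
  "a \<in> carrier M \<Longrightarrow> b \<in> carrier M \<Longrightarrow> c \<in> carrier M \<Longrightarrow> (a \<ominus>\<^sub>M b) \<oplus>\<^sub>M (b \<ominus>\<^sub>M c) = a \<ominus>\<^sub>M c"
  "a \<in> carrier M \<Longrightarrow> b \<in> carrier M \<Longrightarrow> c \<in> carrier M \<Longrightarrow> (a \<ominus>\<^sub>M c) \<ominus>\<^sub>M (b \<ominus>\<^sub>M c) = a \<ominus>\<^sub>M b"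
  "a \<in> carrier M \<Longrightarrow> b \<in> carrier M \<Longrightarrow> c \<in> carrier M \<Longrightarrow> (c \<oplus>\<^sub>M a) \<ominus>\<^sub>M (c \<oplus>\<^sub>M b) = a \<ominus>\<^sub>M b"
  "a \<in> carrier M \<Longrightarrow> b \<in> carrier M \<Longrightarrow> c \<in> carrier M \<Longrightarrow> (c \<oplus>\<^sub>M a) \<ominus>\<^sub>M b = c \<oplus>\<^sub>M (a \<ominus>\<^sub>M b)"
proof -
  note [simp] = a_minus_def M.a_assoc M.l_neg M.r_neg M.r_neg1 M.r_neg2 M.minus_add add_minus_cancel
  show "a \<in> carrier M \<Longrightarrow> b \<in> carrier M \<Longrightarrow> \<ominus>\<^bsub>M\<^esub> (a \<ominus>\<^sub>M b) = b \<ominus>\<^sub>M a"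
    by (simp add: M.a_comm[of "\<ominus>\<^bsub>M\<^esub> a" b])
qed (simp_all add: a_minus_def M.a_assoc M.l_neg M.r_neg M.r_neg1 M.r_neg2 M.minus_add add_minus_cancel)

lemma smult_minus:
  "r \<in> carrier R \<Longrightarrow> a \<in> carrier M \<Longrightarrow> b \<in> carrier M \<Longrightarrow> r \<odot>\<^bsub>M\<^esub> (a \<ominus>\<^sub>M b) = r \<odot>\<^bsub>M\<^esub> a \<ominus>\<^sub>M r \<odot>\<^bsub>M\<^esub> b"
  by (simp add: a_minus_def smult_r_distr smult_r_minus)

lemma sm_minus_cases:
  assumes "sm A" "a \<in> carrier M" "b \<in> carrier M" "a \<ominus>\<^sub>M b \<in> A"
  shows "a \<in> A \<longleftrightarrow> b \<in> A"
  using smD(4)[OF assms(1), of "a \<ominus>\<^sub>M b" b] smD(6)[OF assms(1), of a "a \<ominus>\<^sub>M b"] assms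
  by (metis minus_telescope(1,4) M.minus_closed)

lemma rcos_eq_iff:
  assumes "sm B" "a \<in> carrier M" "b \<in> carrier M"
  shows "B +>\<^bsub>M\<^esub> a = B +>\<^bsub>M\<^esub> b \<longleftrightarrow> a \<ominus>\<^sub>M b \<in> B"
proof
  note B = smD[OF assms(1)]
  have el: "x \<in> B +>\<^bsub>M\<^esub> c \<longleftrightarrow> x \<in> carrier M \<and> x \<ominus>\<^sub>M c \<in> B" if "c \<in> carrier M" for x c
    using that B(3)
    by (auto simp: a_r_coset_def r_coset_def minus_telescope intro!: bexI[of _ "x \<ominus>\<^sub>M c"])
  {
    assume "B +>\<^bsub>M\<^esub> a = B +>\<^bsub>M\<^esub> b"
    moreover have "a \<in> B +>\<^bsub>M\<^esub> a" using assms B by (simp add: el a_minus_def M.r_neg)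
    ultimately show "a \<ominus>\<^sub>M b \<in> B" using assms by (simp add: el)
  next
    assume ab: "a \<ominus>\<^sub>M b \<in> B"
    have "x \<ominus>\<^sub>M a \<in> B \<longleftrightarrow> x \<ominus>\<^sub>M b \<in> B" if "x \<in> carrier M" for x
    proof (rule sm_minus_cases[OF assms(1)])
      have "(x \<ominus>\<^sub>M a) \<ominus>\<^sub>M (x \<ominus>\<^sub>M b) = \<ominus>\<^bsub>M\<^esub> (a \<ominus>\<^sub>M b)"
        using that assms minus_telescope(5)[of a x] minus_telescope(5)[of a b]
            minus_telescope(6)[of b x a] minus_telescope(5)[of x b] M.a_comm[of "x \<ominus>\<^sub>M a" "b \<ominus>\<^sub>M x"]
          by (simp add: a_minus_def[of M "x \<ominus>\<^sub>M a"])
      then show "(x \<ominus>\<^sub>M a) \<ominus>\<^sub>M (x \<ominus>\<^sub>M b) \<in> B" using ab B by simp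
    qed (use that assms in auto)
    then show "B +>\<^bsub>M\<^esub> a = B +>\<^bsub>M\<^esub> b" using assms by (auto simp: el)
  }
qed

text \<open>Reduces an index to any map on \<open>A\<close> whose fibres are the cosets of
  \<open>B\<close>. The target carries no structure, so tuples of coordinates or cosets in another
  module may serve; if the index is infinite, both sides are 0.\<close>

lemma idx_eq:
  assumes "sm B" "A \<subseteq> carrier M"
    and "\<And>a b. a \<in> A \<Longrightarrow> b \<in> A \<Longrightarrow> g a = g b \<longleftrightarrow> a \<ominus>\<^sub>M b \<in> B"
  shows "idx A B = card (g ` A)"
  unfolding mindex_def
  by (rule card_image_eq_kernel) (use assms in \<open>auto simp: rcos_eq_iff subset_iff\<close>)

lemma idx_mult:
  assumes "sm A" "sm B" "sm C" "C \<subseteq> B" "B \<subseteq> A"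
  shows "idx A C = idx A B * idx B C"
proof -
  note A = smD[OF assms(1)] and B = smD[OF assms(2)] and C = smD[OF assms(3)]
  define rep where "rep X = (SOME a. a \<in> A \<and> B +>\<^bsub>M\<^esub> a = X)" for X
  have rep: "rep (B +>\<^bsub>M\<^esub> a) \<in> A" "a \<ominus>\<^sub>M rep (B +>\<^bsub>M\<^esub> a) \<in> B"
    "B +>\<^bsub>M\<^esub> rep (B +>\<^bsub>M\<^esub> a) = B +>\<^bsub>M\<^esub> a" if "a \<in> A" for a
  proof -
    have *: "rep (B +>\<^bsub>M\<^esub> a) \<in> A \<and> B +>\<^bsub>M\<^esub> rep (B +>\<^bsub>M\<^esub> a) = B +>\<^bsub>M\<^esub> a"
      unfolding rep_def by (rule someI[of _ a]) (use that in auto)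
    then show "rep (B +>\<^bsub>M\<^esub> a) \<in> A" "B +>\<^bsub>M\<^esub> rep (B +>\<^bsub>M\<^esub> a) = B +>\<^bsub>M\<^esub> a" by auto
    then show "a \<ominus>\<^sub>M rep (B +>\<^bsub>M\<^esub> a) \<in> B"
      using rcos_eq_iff[OF assms(2), of a "rep (B +>\<^bsub>M\<^esub> a)"] that A by auto
  qed
  define g where "g a = (B +>\<^bsub>M\<^esub> a, C +>\<^bsub>M\<^esub> (a \<ominus>\<^sub>M rep (B +>\<^bsub>M\<^esub> a)))" for a
  have "idx A C = card (g ` A)"
  proof (rule idx_eq)
    fix a b assume ab: "a \<in> A" "b \<in> A"
    let ?r = "rep (B +>\<^bsub>M\<^esub> a)"
    have *: "a \<in> carrier M" "b \<in> carrier M" "?r \<in> carrier M" using ab rep A by auto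
    show "g a = g b \<longleftrightarrow> a \<ominus>\<^sub>M b \<in> C"
    proof
      assume "g a = g b"
      then have e: "B +>\<^bsub>M\<^esub> a = B +>\<^bsub>M\<^esub> b" "C +>\<^bsub>M\<^esub> (a \<ominus>\<^sub>M ?r) = C +>\<^bsub>M\<^esub> (b \<ominus>\<^sub>M ?r)" by (auto simp: g_def)
      then show "a \<ominus>\<^sub>M b \<in> C"
        using * rcos_eq_iff[OF assms(3), of "a \<ominus>\<^sub>M ?r" "b \<ominus>\<^sub>M ?r"] by (simp add: minus_telescope)
    next
      assume C: "a \<ominus>\<^sub>M b \<in> C"
      then have e: "B +>\<^bsub>M\<^esub> a = B +>\<^bsub>M\<^esub> b" using assms * by (auto simp: rcos_eq_iff)
      then show "g a = g b"
        using * C rcos_eq_iff[OF assms(3), of "a \<ominus>\<^sub>M ?r" "b \<ominus>\<^sub>M ?r"]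
        by (simp add: g_def minus_telescope)
    qed
  qed (use assms A in auto)
  also have "g ` A = (\<lambda>a. B +>\<^bsub>M\<^esub> a) ` A \<times> (\<lambda>b. C +>\<^bsub>M\<^esub> b) ` B"
  proof
    show "g ` A \<subseteq> (\<lambda>a. B +>\<^bsub>M\<^esub> a) ` A \<times> (\<lambda>b. C +>\<^bsub>M\<^esub> b) ` B"
      using rep by (auto simp: g_def)
    show "(\<lambda>a. B +>\<^bsub>M\<^esub> a) ` A \<times> (\<lambda>b. C +>\<^bsub>M\<^esub> b) ` B \<subseteq> g ` A"
    proof safe
      fix a b assume ab: "a \<in> A" "b \<in> B"
      let ?r = "rep (B +>\<^bsub>M\<^esub> a)"
      have car: "b \<in> carrier M" "?r \<in> carrier M" using ab rep A B by auto
      have e: "B +>\<^bsub>M\<^esub> (b \<oplus>\<^sub>M ?r) = B +>\<^bsub>M\<^esub> a"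
        using rep(3)[OF ab(1)] rcos_eq_iff[OF assms(2), of "b \<oplus>\<^sub>M ?r" ?r] car ab
        by (simp add: minus_telescope)
      have "g (b \<oplus>\<^sub>M ?r) = (B +>\<^bsub>M\<^esub> a, C +>\<^bsub>M\<^esub> b)"
        unfolding g_def e using car by (simp add: minus_telescope)
      moreover have "b \<oplus>\<^sub>M ?r \<in> A" using ab rep A(4) assms(5) by auto
      ultimately show "(B +>\<^bsub>M\<^esub> a, C +>\<^bsub>M\<^esub> b) \<in> g ` A" by (metis imageI)
    qed
  qed
  finally show ?thesis by (simp add: card_cartesian_product mindex_def)
qed

lemma idx_sum:
  assumes "sm A" "sm B"
  shows "idx (A <+>\<^sub>M B) B = idx A (A \<inter> B)"
proof -
  note A = smD[OF assms(1)] and B = smD[OF assms(2)]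
  have "idx A (A \<inter> B) = card ((\<lambda>a. B +>\<^bsub>M\<^esub> a) ` A)"
    by (rule idx_eq) (use assms A in \<open>auto simp: sm_Int rcos_eq_iff\<close>)
  also have "(\<lambda>a. B +>\<^bsub>M\<^esub> a) ` A = (\<lambda>a. B +>\<^bsub>M\<^esub> a) ` (A <+>\<^sub>M B)"
  proof safe
    fix a assume "a \<in> A"
    then show "B +>\<^bsub>M\<^esub> a \<in> (\<lambda>a. B +>\<^bsub>M\<^esub> a) ` (A <+>\<^sub>M B)" using sum_upper(1)[OF assms] by auto
  next
    fix x assume "x \<in> A <+>\<^sub>M B"
    then obtain a b where ab: "a \<in> A" "b \<in> B" "x = a \<oplus>\<^sub>M b" by (auto simp: msum_iff)
    then have "B +>\<^bsub>M\<^esub> x = B +>\<^bsub>M\<^esub> a"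
      using rcos_eq_iff[OF assms(2), of x a] A(3) B(3) by (simp add: minus_telescope)
    then show "B +>\<^bsub>M\<^esub> x \<in> (\<lambda>a. B +>\<^bsub>M\<^esub> a) ` A" using ab by auto
  qed
  finally show ?thesis by (simp add: mindex_def)
qed

lemma sm_scale:
  assumes "sm A" "p \<in> carrier R" shows "sm (scl p A)"
proof (rule smI)
  note A = smD[OF assms(1)]
  show "scl p A \<subseteq> carrier M" using A assms by (auto simp: mscale_def)
  show "\<zero>\<^bsub>M\<^esub> \<in> scl p A" using A assms by (auto simp: mscale_def intro!: image_eqI[of _ _ "\<zero>\<^bsub>M\<^esub>"])
  fix x y assume "x \<in> scl p A" "y \<in> scl p A"
  then show "x \<oplus>\<^sub>M y \<in> scl p A"
    using A assms by (auto simp: mscale_def smult_r_distr[symmetric])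
next
  note A = smD[OF assms(1)]
  fix r x assume r: "r \<in> carrier R" "x \<in> scl p A"
  then obtain a where "a \<in> A" "x = p \<odot>\<^bsub>M\<^esub> a" by (auto simp: mscale_def)
  then have "r \<odot>\<^bsub>M\<^esub> x = p \<odot>\<^bsub>M\<^esub> (r \<odot>\<^bsub>M\<^esub> a)" "r \<odot>\<^bsub>M\<^esub> a \<in> A"
    using r A assms by (auto simp: m_comm simp flip: smult_assoc1)
  then show "r \<odot>\<^bsub>M\<^esub> x \<in> scl p A" by (auto simp: mscale_def)
qed

lemma scale_le: "sm A \<Longrightarrow> p \<in> carrier R \<Longrightarrow> scl p A \<subseteq> A"
  by (auto simp: mscale_def smD)

lemma scale_mono: "A \<subseteq> B \<Longrightarrow> scl p A \<subseteq> scl p B"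
  by (auto simp: mscale_def)

lemma scale_sum:
  "sm A \<Longrightarrow> sm B \<Longrightarrow> p \<in> carrier R \<Longrightarrow> scl p (A <+>\<^sub>M B) = scl p A <+>\<^sub>M scl p B"
proof -
  assume *: "sm A" "sm B" "p \<in> carrier R"
  note A = smD[OF *(1)] and B = smD[OF *(2)]
  show "scl p (A <+>\<^sub>M B) = scl p A <+>\<^sub>M scl p B"
  proof safe
    fix x assume "x \<in> scl p (A <+>\<^sub>M B)"
    then obtain a b where ab: "a \<in> A" "b \<in> B" "x = p \<odot>\<^bsub>M\<^esub> (a \<oplus>\<^sub>M b)"
      by (auto simp: mscale_def msum_iff)
    then show "x \<in> scl p A <+>\<^sub>M scl p B"
      using *(3) A(3) B(3) msumI[of "p \<odot>\<^bsub>M\<^esub> a" "scl p A" "p \<odot>\<^bsub>M\<^esub> b" "scl p B"]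
      by (simp add: mscale_def smult_r_distr)
  next
    fix x assume "x \<in> scl p A <+>\<^sub>M scl p B"
    then obtain a b where "a \<in> A" "b \<in> B" "x = p \<odot>\<^bsub>M\<^esub> a \<oplus>\<^sub>M p \<odot>\<^bsub>M\<^esub> b"
      by (auto simp: mscale_def msum_iff)
    then have "x = p \<odot>\<^bsub>M\<^esub> (a \<oplus>\<^sub>M b)" "a \<oplus>\<^sub>M b \<in> A <+>\<^sub>M B"
      using *(3) A(3) B(3) by (simp_all add: smult_r_distr msumI)
    then show "x \<in> scl p (A <+>\<^sub>M B)" by (auto simp: mscale_def)
  qed
qed

lemma scale_scale:
  "A \<subseteq> carrier M \<Longrightarrow> p \<in> carrier R \<Longrightarrow> r \<in> carrier R \<Longrightarrow> scl p (scl r A) = scl (p \<otimes> r) A"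
  by (force simp: mscale_def image_image smult_assoc1 subset_iff)

lemma idx_scale:
  assumes "sm A" "sm B" "B \<subseteq> A" "p \<in> carrier R"
    and tf: "\<And>x. x \<in> carrier M \<Longrightarrow> p \<odot>\<^bsub>M\<^esub> x = \<zero>\<^bsub>M\<^esub> \<Longrightarrow> x = \<zero>\<^bsub>M\<^esub>"
  shows "idx (scl p A) (scl p B) = idx A B"
proof -
  note A = smD[OF assms(1)] and B = smD[OF assms(2)]
  have inj: "x = y" if "x \<in> carrier M" "y \<in> carrier M" "p \<odot>\<^bsub>M\<^esub> x = p \<odot>\<^bsub>M\<^esub> y" for x y
  proof -
    have "p \<odot>\<^bsub>M\<^esub> (x \<ominus>\<^sub>M y) = \<zero>\<^bsub>M\<^esub>" using that assms(4) by (simp add: smult_minus) (simp add: a_minus_def M.r_neg)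
    then have "x \<ominus>\<^sub>M y = \<zero>\<^bsub>M\<^esub>" using that tf by simp
    then show ?thesis using that minus_telescope(2)[of x y] by simp
  qed
  have "idx A B = card ((\<lambda>a. scl p B +>\<^bsub>M\<^esub> (p \<odot>\<^bsub>M\<^esub> a)) ` A)"
  proof (rule idx_eq)
    fix a b assume ab: "a \<in> A" "b \<in> A"
    have "p \<odot>\<^bsub>M\<^esub> (a \<ominus>\<^sub>M b) \<in> scl p B \<longleftrightarrow> a \<ominus>\<^sub>M b \<in> B"
      using inj[of "a \<ominus>\<^sub>M b"] ab A(3) B(3) by (auto simp: mscale_def)
    then show "(scl p B +>\<^bsub>M\<^esub> (p \<odot>\<^bsub>M\<^esub> a) = scl p B +>\<^bsub>M\<^esub> (p \<odot>\<^bsub>M\<^esub> b)) = (a \<ominus>\<^sub>M b \<in> B)"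
      using ab A assms(2,4) by (simp add: rcos_eq_iff sm_scale smult_minus)
  qed (use assms A in auto)
  also have "\<dots> = idx (scl p A) (scl p B)"
    by (simp add: mindex_def mscale_def image_image)
  finally show ?thesis ..
qed

lemma idx_eq_1:
  assumes "sm A" "sm B" "B \<subseteq> A" "idx A B = 1" shows "A = B"
proof -
  note A = smD[OF assms(1)] and B = smD[OF assms(2)]
  obtain X where X: "(\<lambda>a. B +>\<^bsub>M\<^esub> a) ` A = {X}"
    using assms(4) by (auto simp: mindex_def card_1_singleton_iff)
  have "a \<in> B" if "a \<in> A" for a
  proof -
    have "B +>\<^bsub>M\<^esub> a = B +>\<^bsub>M\<^esub> \<zero>\<^bsub>M\<^esub>" using X that A(2) by (metis imageI singletonD)
    then show ?thesis using rcos_eq_iff[OF assms(2), of a "\<zero>\<^bsub>M\<^esub>"] that A(3)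
        sm_minus_cases[OF assms(2), of a "\<zero>\<^bsub>M\<^esub>"] B(2) by simp
  qed
  then show ?thesis using assms by auto
qed

lemma idx_self:
  assumes "sm A" shows "idx A A = 1"
proof -
  have "idx A A = card ((\<lambda>_. 0::nat) ` A)"
    by (rule idx_eq) (use assms smD[OF assms] in auto)
  moreover have "A \<noteq> {}" using smD(2)[OF assms] by auto
  ultimately show ?thesis by (simp add: image_constant_conv)
qed

lemma idx_mono_pos:
  assumes "sm A" "sm B" "sm C" "C \<subseteq> B" "B \<subseteq> A" "idx A C > 0"
  shows "idx A B > 0" "idx B C > 0"
  using idx_mult[OF assms(1-5)] assms(6) by auto

end

section \<open>Relative complements, one generator at a time\<close>

context module
begin

definition cyc :: "'c \<Rightarrow> 'c set" where "cyc x = (\<lambda>a. a \<odot>\<^bsub>M\<^esub> x) ` carrier R"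

lemma sm_cyc: assumes "x \<in> carrier M" shows "sm (cyc x)"
proof (rule smI)
  show "cyc x \<subseteq> carrier M" using assms by (auto simp: cyc_def)
  show "\<zero>\<^bsub>M\<^esub> \<in> cyc x" using assms by (auto simp: cyc_def intro!: image_eqI[of _ _ \<zero>])
  fix u v assume "u \<in> cyc x" "v \<in> cyc x"
  then show "u \<oplus>\<^sub>M v \<in> cyc x" using assms by (auto simp: cyc_def smult_l_distr[symmetric])
next
  fix r u assume "r \<in> carrier R" "u \<in> cyc x"
  then show "r \<odot>\<^bsub>M\<^esub> u \<in> cyc x" using assms by (auto simp: cyc_def smult_assoc1[symmetric])
qed

lemma cyc_self: "x \<in> carrier M \<Longrightarrow> x \<in> cyc x"
  unfolding cyc_def by (rule image_eqI[of _ _ \<one>]) auto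

lemma cyc_least: "sm A \<Longrightarrow> x \<in> A \<Longrightarrow> cyc x \<subseteq> A"
  by (auto simp: cyc_def smD)

lemma compsD:
  assumes "W \<in> comps X Y Z"
  shows "sm W" "W \<subseteq> X" "W <+>\<^sub>M Y = X" "W \<inter> Y = Z" "Z \<subseteq> W"
  using assms by (auto simp: complements_def)

text \<open>A complement contains some \<open>x + y\<close> with \<open>y\<close> in
  \<open>Y\<close> and then equals \<open>Z + R(x + y)\<close>, where \<open>y\<close> counts only
  modulo \<open>Z\<close>. The assumption \<open>cond\<close> makes every \<open>y\<close>
  admissible: if a multiple of \<open>x + y\<close> has its \<open>x\<close>-part in
  \<open>Y\<close>, it already lies in \<open>Z\<close>, so the intersection with \<open>Y\<close>
  does not grow.\<close>

lemma comps_step: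
  assumes Y: "sm Y" and Z: "sm Z" "Z \<subseteq> Y" and x: "x \<in> carrier M"
    and cond: "\<And>a y. a \<in> carrier R \<Longrightarrow> a \<odot>\<^bsub>M\<^esub> x \<in> Y \<Longrightarrow> y \<in> Y \<Longrightarrow> a \<odot>\<^bsub>M\<^esub> (x \<oplus>\<^sub>M y) \<in> Z"
  shows "card (comps (Y <+>\<^sub>M cyc x) Y Z) = idx Y Z"
proof -
  note Y' = smD[OF Y] and Z' = smD[OF Z(1)]
  define W where "W y = Z <+>\<^sub>M cyc (x \<oplus>\<^sub>M y)" for y
  have smW: "sm (W y)" if "y \<in> Y" for y
    unfolding W_def using that Y' x Z by (intro sm_sum sm_cyc) auto
  have xyW: "x \<oplus>\<^sub>M y \<in> W y" if "y \<in> Y" for y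
    using sum_upper(2)[of Z "cyc (x \<oplus>\<^sub>M y)"] cyc_self[of "x \<oplus>\<^sub>M y"] that Y' x Z sm_cyc
    unfolding W_def by auto
  have ZW: "Z \<subseteq> W y" if "y \<in> Y" for y
    unfolding W_def using that Y' x Z by (intro sum_upper sm_cyc) auto
  let ?X = "Y <+>\<^sub>M cyc x"
  have X: "sm ?X" using Y x by (intro sm_sum sm_cyc)
  note X' = smD[OF X]
  have YX: "Y \<subseteq> ?X" "x \<in> ?X" using sum_upper[OF Y sm_cyc[OF x]] cyc_self[OF x] by auto
  have WX: "W y \<subseteq> ?X" if "y \<in> Y" for y
    unfolding W_def using that YX Z
    by (intro sum_least[OF X] cyc_least[OF X] X'(4)) auto
  have WY: "W y \<inter> Y = Z" if y: "y \<in> Y" for y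
  proof
    show "W y \<inter> Y \<subseteq> Z"
    proof
      fix w assume w: "w \<in> W y \<inter> Y"
      then obtain z a where za: "z \<in> Z" "a \<in> carrier R" "w = z \<oplus>\<^sub>M a \<odot>\<^bsub>M\<^esub> (x \<oplus>\<^sub>M y)"
        by (auto simp: W_def msum_iff cyc_def)
      have car: "z \<in> carrier M" "y \<in> carrier M" "w \<in> carrier M" using za Z' Y' y w by auto
      have "a \<odot>\<^bsub>M\<^esub> (x \<oplus>\<^sub>M y) = w \<ominus>\<^sub>M z" using za car x by (simp add: minus_telescope)
      moreover have "w \<ominus>\<^sub>M z \<in> Y" using w za Z Y' by auto
      ultimately have "a \<odot>\<^bsub>M\<^esub> x \<oplus>\<^sub>M a \<odot>\<^bsub>M\<^esub> y \<in> Y" using za car x by (simp add: smult_r_distr)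
      then have "a \<odot>\<^bsub>M\<^esub> x \<in> Y"
        using Y'(6)[of "a \<odot>\<^bsub>M\<^esub> x \<oplus>\<^sub>M a \<odot>\<^bsub>M\<^esub> y" "a \<odot>\<^bsub>M\<^esub> y"] Y'(7) y za car x
        by (simp add: minus_telescope)
      then show "w \<in> Z" using cond[OF za(2) _ y] za Z' by auto
    qed
    show "Z \<subseteq> W y \<inter> Y" using ZW[OF y] Z by auto
  qed
  have WsumY: "W y <+>\<^sub>M Y = ?X" if y: "y \<in> Y" for y
  proof
    show "W y <+>\<^sub>M Y \<subseteq> ?X" by (rule sum_least[OF X WX[OF y] YX(1)])
    have s: "sm (W y <+>\<^sub>M Y)" using smW y Y by (intro sm_sum)
    have "x = (x \<oplus>\<^sub>M y) \<ominus>\<^sub>M y" using x y Y' by (simp add: minus_telescope)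
    moreover have "(x \<oplus>\<^sub>M y) \<ominus>\<^sub>M y \<in> W y <+>\<^sub>M Y"
      using sum_upper[OF smW[OF y] Y] xyW[OF y] y by (intro smD(6)[OF s]) auto
    ultimately have "x \<in> W y <+>\<^sub>M Y" by simp
    then show "?X \<subseteq> W y <+>\<^sub>M Y"
      by (intro sum_least[OF s] cyc_least[OF s] sum_upper smW y Y)
  qed
  have "idx Y Z = card (W ` Y)"
  proof (rule idx_eq)
    fix y y' assume y: "y \<in> Y" "y' \<in> Y"
    then have car: "y \<in> carrier M" "y' \<in> carrier M" using Y' by auto
    have le: "W u \<subseteq> W v" if "u \<in> Y" "v \<in> Y" "u \<ominus>\<^sub>M v \<in> Z" for u v
    proof -
      have c: "u \<in> carrier M" "v \<in> carrier M" using that Y' by auto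
      have "x \<oplus>\<^sub>M u = (u \<ominus>\<^sub>M v) \<oplus>\<^sub>M (x \<oplus>\<^sub>M v)"
        using minus_telescope(1)[of "x \<oplus>\<^sub>M u" "x \<oplus>\<^sub>M v"] minus_telescope(8)[of u v x] c x by simp
      also have "\<dots> \<in> W v"
        using smD(4)[OF smW[OF that(2)]] ZW[OF that(2)] that(3) xyW[OF that(2)] by blast
      finally have "x \<oplus>\<^sub>M u \<in> W v" .
      then show ?thesis
        unfolding W_def[of u]
        by (intro sum_least[OF smW[OF that(2)]] ZW that cyc_least smW)
    qed
    show "W y = W y' \<longleftrightarrow> y \<ominus>\<^sub>M y' \<in> Z"
    proof
      assume "W y = W y'"
      then have "(x \<oplus>\<^sub>M y) \<ominus>\<^sub>M (x \<oplus>\<^sub>M y') \<in> W y'" using xyW[OF y(1)] xyW[OF y(2)] smD(6)[OF smW[OF y(2)]] by simp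
      then have "y \<ominus>\<^sub>M y' \<in> W y' \<inter> Y"
        using car x Y'(6)[OF y] by (simp only: minus_telescope(8) Int_iff)
      then show "y \<ominus>\<^sub>M y' \<in> Z" using WY[OF y(2)] by simp
    next
      assume d: "y \<ominus>\<^sub>M y' \<in> Z"
      then have "y' \<ominus>\<^sub>M y \<in> Z" using Z'(5)[OF d] car by (simp add: minus_telescope)
      then show "W y = W y'" using le d y by blast
    qed
  qed (use Z Y' in auto)
  also have "W ` Y = comps ?X Y Z"
  proof
    show "W ` Y \<subseteq> comps ?X Y Z"
      unfolding complements_def
      by (intro image_subsetI CollectI conjI smW WX WsumY WY)
    show "comps ?X Y Z \<subseteq> W ` Y"
    proof
      fix V assume V: "V \<in> comps ?X Y Z"
      note V1 = compsD[OF V] note V2 = smD[OF V1(1)]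
      from YX(2) V1(3) obtain v y1 where vy: "v \<in> V" "y1 \<in> Y" "x = v \<oplus>\<^sub>M y1" by (metis msum_iff)
      define y where "y = \<ominus>\<^bsub>M\<^esub> y1"
      have y: "y \<in> Y" using vy Y' by (auto simp: y_def)
      have car: "v \<in> carrier M" "y1 \<in> carrier M" "y \<in> carrier M" using vy V2 Y' y by auto
      have v: "v = x \<oplus>\<^sub>M y" using vy minus_telescope(3)[of v y1] car by (simp add: y_def a_minus_def)
      have "W y \<subseteq> V"
        unfolding W_def using v vy V1 by (intro sum_least cyc_least) auto
      moreover have "V \<subseteq> W y"
      proof
        fix u assume u: "u \<in> V"
        then have "u \<in> Y <+>\<^sub>M cyc x" using V1 by auto
        then obtain y2 a where ya: "y2 \<in> Y" "a \<in> carrier R" "u = y2 \<oplus>\<^sub>M a \<odot>\<^bsub>M\<^esub> x"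
          by (auto simp: msum_iff cyc_def)
        have c2: "y2 \<in> carrier M" "u \<in> carrier M" using ya Y' u V2 by auto
        have av: "a \<odot>\<^bsub>M\<^esub> v \<in> V" "a \<odot>\<^bsub>M\<^esub> v \<in> W y"
          using V2(7)[OF ya(2) vy(1)] smD(7)[OF smW[OF y] ya(2) xyW[OF y]] v by auto
        have "u \<ominus>\<^sub>M a \<odot>\<^bsub>M\<^esub> v = (a \<odot>\<^bsub>M\<^esub> x \<oplus>\<^sub>M y2) \<ominus>\<^sub>M (a \<odot>\<^bsub>M\<^esub> x \<oplus>\<^sub>M a \<odot>\<^bsub>M\<^esub> y)"
          using ya c2 car x by (simp add: v smult_r_distr M.a_comm)
        also have "\<dots> = y2 \<ominus>\<^sub>M a \<odot>\<^bsub>M\<^esub> y" using ya c2 car x by (simp only: minus_telescope(8) smult_closed)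
        also have "\<dots> \<in> Y" using ya y Y' by auto
        finally have "u \<ominus>\<^sub>M a \<odot>\<^bsub>M\<^esub> v \<in> Z" using V1(4) V2(6)[OF u av(1)] by auto
        then have "(u \<ominus>\<^sub>M a \<odot>\<^bsub>M\<^esub> v) \<oplus>\<^sub>M a \<odot>\<^bsub>M\<^esub> v \<in> W y"
          using smD(4)[OF smW[OF y]] ZW[OF y] av by blast
        then show "u \<in> W y" using c2 car ya by (simp add: minus_telescope)
      qed
      ultimately show "V \<in> W ` Y" using y by auto
    qed
  qed
  finally show ?thesis by simp
qed

text \<open>Intersecting with \<open>X1\<close> maps the complements of \<open>Y\<close> in
  \<open>X\<close> to those of \<open>Y\<close> in \<open>X1\<close>, by the modular law; the fibre
  over \<open>W\<close> consists of the complements of \<open>X1\<close> in \<open>X\<close> that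
  meet \<open>X1\<close> in \<open>W\<close>. Fibres of constant size multiply. The positivity
  assumptions provide finiteness, because \<open>card\<close> is 0 on infinite sets.\<close>

lemma comps_chain:
  assumes sm: "sm Y" "sm X1" "sm X" and sub: "Y \<subseteq> X1" "X1 \<subseteq> X"
    and c: "\<And>W. W \<in> comps X1 Y Z \<Longrightarrow> card (comps X X1 W) = c"
    and pos: "card (comps X1 Y Z) > 0" "c > 0"
  shows "card (comps X Y Z) = card (comps X1 Y Z) * c"
proof -
  have fin: "finite (comps X1 Y Z)" using pos card_ge_0_finite by blast
  have fin2: "finite (comps X X1 W)" if "W \<in> comps X1 Y Z" for W
    using pos c[OF that] card_ge_0_finite by metis
  have "comps X Y Z = (\<Union>W\<in>comps X1 Y Z. comps X X1 W)"
  proof safe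
    fix V assume V: "V \<in> comps X Y Z"
    note V1 = compsD[OF V]
    have "(Y <+>\<^sub>M V) \<inter> X1 = Y <+>\<^sub>M (V \<inter> X1)"
      by (rule modular_law) (use V1 sm sub in auto)
    moreover have "Y <+>\<^sub>M V = X" "Y <+>\<^sub>M (V \<inter> X1) = (V \<inter> X1) <+>\<^sub>M Y"
      using V1 sm by (auto simp: sum_comm smD(1) sm_Int)
    ultimately have 1: "V \<inter> X1 \<in> comps X1 Y Z"
      using V1 sm sub by (auto simp: complements_def sm_Int)
    have "X \<subseteq> V <+>\<^sub>M X1" using V1 sub sum_mono[of V V Y X1] by auto
    then have "V <+>\<^sub>M X1 = X" using sum_least[OF sm(3) V1(2) sub(2)] by auto
    then have "V \<in> comps X X1 (V \<inter> X1)" using V1 by (auto simp: complements_def)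
    then show "V \<in> (\<Union>W\<in>comps X1 Y Z. comps X X1 W)" using 1 by blast
  next
    fix V W assume W: "W \<in> comps X1 Y Z" and V: "V \<in> comps X X1 W"
    note V1 = compsD[OF V] and W1 = compsD[OF W]
    have s: "sm (V <+>\<^sub>M Y)" using V1 sm by (intro sm_sum)
    have "X1 \<subseteq> V <+>\<^sub>M Y" using W1 V1 sum_mono[of W V Y Y] by auto
    then have "X \<subseteq> V <+>\<^sub>M Y" using V1 sum_least[OF s, of V X1] sum_upper(1)[OF V1(1) sm(1)] by auto
    then have "V <+>\<^sub>M Y = X" using sum_least[OF sm(3) V1(2), of Y] sub by auto
    moreover have "V \<inter> Y = Z" using V1 W1 sub by auto
    ultimately show "V \<in> comps X Y Z" using V1 by (auto simp: complements_def)
  qed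
  moreover have "card (\<Union>W\<in>comps X1 Y Z. comps X X1 W) = (\<Sum>W\<in>comps X1 Y Z. card (comps X X1 W))"
  proof (rule card_UN_disjoint)
    show "\<forall>W\<in>comps X1 Y Z. \<forall>W'\<in>comps X1 Y Z. W \<noteq> W' \<longrightarrow> comps X X1 W \<inter> comps X X1 W' = {}"
      by (auto dest!: compsD(4))
  qed (use fin fin2 in auto)
  ultimately show ?thesis using c by simp
qed

lemma comps_trivial: assumes "sm X" "sm Z" "Z \<subseteq> X" shows "comps X X Z = {Z}"
  using assms sum_absorb[of X Z] sum_comm[of X Z] smD(1)[OF assms(1)] smD(1)[OF assms(2)]
  by (auto simp: complements_def)

text \<open>Second isomorphism theorem for \<open>X = Y + W\<close> and
  \<open>Z = Y \<inter> W\<close>.\<close>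

lemma idx_comps:
  assumes "W \<in> comps X Y Z" "sm Y" shows "idx X W = idx Y Z"
proof -
  note W = compsD[OF assms(1)]
  have "Y <+>\<^sub>M W = X"
    using sum_comm[OF smD(1)[OF W(1)] smD(1)[OF assms(2)], symmetric] W(3) by (rule trans)
  moreover have "Y \<inter> W = Z" using W(4) by (subst Int_commute)
  ultimately show ?thesis using idx_sum[OF assms(2) W(1)] by metis
qed

text \<open>A submodule containing \<open>Z\<close> is determined by the set of cosets of
  \<open>Z\<close> that it meets, and \<open>X\<close> has only finitely many of these.\<close>

lemma finite_between:
  assumes "sm X" "sm Z" "idx X Z > 0"
  shows "finite {W. sm W \<and> Z \<subseteq> W \<and> W \<subseteq> X}" (is "finite ?S")
proof -
  have "finite ((\<lambda>a. Z +>\<^bsub>M\<^esub> a) ` X)"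
    using assms(3) by (simp add: mindex_def card_ge_0_finite)
  then have fin: "finite (Pow ((\<lambda>a. Z +>\<^bsub>M\<^esub> a) ` X))" by simp
  have inj: "inj_on (\<lambda>W. (\<lambda>a. Z +>\<^bsub>M\<^esub> a) ` W) ?S"
  proof (rule inj_onI)
    fix V W assume *: "V \<in> ?S" "W \<in> ?S" "(\<lambda>a. Z +>\<^bsub>M\<^esub> a) ` V = (\<lambda>a. Z +>\<^bsub>M\<^esub> a) ` W"
    have "A \<subseteq> B" if A: "A \<in> ?S" and B: "B \<in> ?S" and e: "(\<lambda>a. Z +>\<^bsub>M\<^esub> a) ` A = (\<lambda>a. Z +>\<^bsub>M\<^esub> a) ` B" for A B
    proof
      fix a assume a: "a \<in> A"
      then obtain b where b: "b \<in> B" "Z +>\<^bsub>M\<^esub> a = Z +>\<^bsub>M\<^esub> b" using e by (metis imageE imageI)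
      have "a \<in> carrier M" "b \<in> carrier M" using a b A B smD(1)[OF assms(1)] by auto
      moreover from this have "a \<ominus>\<^sub>M b \<in> Z" using b(2) by (simp only: rcos_eq_iff[OF assms(2)])
      ultimately show "a \<in> B" using b(1) B sm_minus_cases[of B a b] by blast
    qed
    from this[OF *(1,2,3)] this[OF *(2,1) *(3)[symmetric]] show "V = W" by (rule subset_antisym)
  qed
  have sub: "(\<lambda>W. (\<lambda>a. Z +>\<^bsub>M\<^esub> a) ` W) ` ?S \<subseteq> Pow ((\<lambda>a. Z +>\<^bsub>M\<^esub> a) ` X)"
    by (intro image_subsetI PowI image_mono) simp
  show ?thesis by (rule inj_on_finite[OF inj sub fin])
qed

end

section \<open>Counting sublattices\<close>

text \<open>Gaussian binomial coefficient, defined by a Pascal rule rather than as a quotient so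
  that one definition serves counts in \<open>nat\<close>, complex values and rational functions.
  The truncated exponent \<open>n - k\<close> is harmless: for \<open>k > n\<close> its factor
  \<open>gbin q n k\<close> is 0.\<close>

fun gbin :: "'k::comm_semiring_1 \<Rightarrow> nat \<Rightarrow> nat \<Rightarrow> 'k" where
  "gbin q n 0 = 1"
| "gbin q 0 (Suc k) = 0"
| "gbin q (Suc n) (Suc k) = gbin q n (Suc k) + q ^ (n - k) * gbin q n k"

lemma gbin_eq_0: "k > n \<Longrightarrow> gbin q n k = 0"
  by (induction q n k rule: gbin.induct) auto

text \<open>Weighted count, by layers, of the lattices between \<open>p^m L\<close> and
  \<open>L\<close>. Here \<open>q^n\<close> is the index of \<open>pL\<close> in \<open>L\<close>,
  \<open>q^s\<close> that of \<open>N + pL\<close> in \<open>L\<close>, and \<open>r\<close> the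
  bound on \<open>s\<close> inherited from the layer above. The first factor counts the choices for
  one layer, as shown in \<open>card_transversal\<close>.\<close>

fun lattice_poly :: "nat \<Rightarrow> nat \<Rightarrow> (nat \<Rightarrow> 'k::comm_semiring_1) \<Rightarrow> nat \<Rightarrow> nat \<Rightarrow> 'k" where
  "lattice_poly q n w 0 r = 1"
| "lattice_poly q n w (Suc m) r =
    (\<Sum>s\<le>r. of_nat (gbin q r s * q ^ (s * (n - r))) * w (q ^ s) * lattice_poly q n w m s)"

text \<open>Isolates what the counting of layers uses: every nonunit is a multiple of
  \<open>p\<close>, and the residue ring has \<open>q\<close> elements. The condition
  \<open>q > 0\<close> expresses that the residue ring is finite.\<close>

locale uniformizer = cring R for R (structure) +
  fixes p :: 'a and q :: nat
  assumes p_closed: "p \<in> carrier R"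
    and p_nonunit: "p \<notin> Units R"
    and unit_or_dvd: "a \<in> carrier R \<Longrightarrow> a \<in> Units R \<or> (\<exists>b\<in>carrier R. a = p \<otimes> b)"
    and card_residue: "card ((\<lambda>a. PIdl p +>\<^bsub>R\<^esub> a) ` carrier R) = q"
    and q_pos: "q > 0"
begin

lemma residue_eq_iff:
  assumes "a \<in> carrier R" "b \<in> carrier R"
  shows "PIdl p +>\<^bsub>R\<^esub> a = PIdl p +>\<^bsub>R\<^esub> b \<longleftrightarrow> (\<exists>c\<in>carrier R. a \<ominus> b = p \<otimes> c)"
  using quotient_eq_iff_same_a_r_cos[OF cgenideal_ideal[OF p_closed] assms]
  by (auto simp: cgenideal_def m_comm[OF p_closed])

lemma q_gt_1: "q > 1"
proof -
  have "PIdl p +>\<^bsub>R\<^esub> \<one> \<noteq> PIdl p +>\<^bsub>R\<^esub> \<zero>"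
  proof
    assume "PIdl p +>\<^bsub>R\<^esub> \<one> = PIdl p +>\<^bsub>R\<^esub> \<zero>"
    then obtain c where "c \<in> carrier R" "\<one> \<ominus> \<zero> = p \<otimes> c" by (auto simp: residue_eq_iff)
    then have "\<one> = p \<otimes> c" by (simp add: a_minus_def)
    then have "p \<in> Units R" using \<open>c \<in> carrier R\<close> p_closed
      by (auto simp: Units_def m_comm intro!: bexI[of _ c])
    then show False using p_nonunit by simp
  qed
  moreover have "{PIdl p +>\<^bsub>R\<^esub> \<one>, PIdl p +>\<^bsub>R\<^esub> \<zero>} \<subseteq> (\<lambda>a. PIdl p +>\<^bsub>R\<^esub> a) ` carrier R" by auto
  then have "card {PIdl p +>\<^bsub>R\<^esub> \<one>, PIdl p +>\<^bsub>R\<^esub> \<zero>} \<le> q"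
    using card_mono card_ge_0_finite card_residue q_pos by metis
  ultimately show ?thesis by simp
qed

lemma q_power_eq_1: "q ^ s = Suc 0 \<longleftrightarrow> s = 0" "Suc 0 = q ^ s \<longleftrightarrow> s = 0"
  using q_gt_1 by (auto simp: nat_power_eq_Suc_0_iff) (metis less_not_refl nat_power_eq_Suc_0_iff)

end

locale uniformizer_module = module R M + uniformizer R p q
  for R :: "('a, 'q) ring_scheme" (structure) and M :: "('a, 'c, 'd) module_scheme" (structure)
    and p :: 'a and q :: nat
begin

lemma smult_unit_cancel:
  assumes "sm A" "x \<in> carrier M" "a \<in> Units R" "a \<odot>\<^bsub>M\<^esub> x \<in> A" shows "x \<in> A"
proof -
  have "x = (inv a \<otimes> a) \<odot>\<^bsub>M\<^esub> x" using assms by simp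
  also have "\<dots> = inv a \<odot>\<^bsub>M\<^esub> (a \<odot>\<^bsub>M\<^esub> x)" using assms by (intro smult_assoc1) auto
  also have "\<dots> \<in> A" using smD(7)[OF assms(1)] assms by auto
  finally show ?thesis .
qed

lemma smult_dvd:
  assumes "sm A" "x \<in> carrier M" "x \<notin> A" "p \<odot>\<^bsub>M\<^esub> x \<in> A" "a \<in> carrier R"
  shows "a \<odot>\<^bsub>M\<^esub> x \<in> A \<longleftrightarrow> (\<exists>b\<in>carrier R. a = p \<otimes> b)"
proof
  assume "a \<odot>\<^bsub>M\<^esub> x \<in> A"
  then show "\<exists>b\<in>carrier R. a = p \<otimes> b"
    using smult_unit_cancel[OF assms(1,2)] assms(3) unit_or_dvd[OF assms(5)] by blast
next
  assume "\<exists>b\<in>carrier R. a = p \<otimes> b"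
  then obtain b where b: "b \<in> carrier R" "a = b \<otimes> p" using p_closed by (auto simp: m_comm)
  then have "a \<odot>\<^bsub>M\<^esub> x = b \<odot>\<^bsub>M\<^esub> (p \<odot>\<^bsub>M\<^esub> x)" using assms p_closed by (simp add: smult_assoc1)
  then show "a \<odot>\<^bsub>M\<^esub> x \<in> A" using smD(7)[OF assms(1) b(1) assms(4)] by simp
qed

text \<open>Sending \<open>a\<close> to \<open>ax\<close> identifies \<open>R/pR\<close> with
  \<open>(A + Rx)/A\<close>: by \<open>smult_dvd\<close> the multiples of \<open>x\<close> inside
  \<open>A\<close> are exactly those by multiples of \<open>p\<close>.\<close>

lemma idx_cyc:
  assumes "sm A" "x \<in> carrier M" "x \<notin> A" "p \<odot>\<^bsub>M\<^esub> x \<in> A"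
  shows "idx (A <+>\<^sub>M cyc x) A = q"
proof -
  have "idx (A <+>\<^sub>M cyc x) A = idx (cyc x <+>\<^sub>M A) A"
    using sum_comm[of A "cyc x"] assms sm_cyc smD(1) by metis
  also have "\<dots> = idx (cyc x) (cyc x \<inter> A)" by (rule idx_sum) (use assms sm_cyc in auto)
  also have "\<dots> = card ((\<lambda>u. A +>\<^bsub>M\<^esub> u) ` cyc x)"
    by (rule idx_eq) (use assms sm_cyc[OF assms(2)] smD[OF sm_cyc[OF assms(2)]]
        in \<open>auto simp: sm_Int rcos_eq_iff\<close>)
  also have "\<dots> = card ((\<lambda>a. A +>\<^bsub>M\<^esub> (a \<odot>\<^bsub>M\<^esub> x)) ` carrier R)"
    by (simp add: cyc_def image_image)
  also have "\<dots> = card ((\<lambda>a. PIdl p +>\<^bsub>R\<^esub> a) ` carrier R)"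
  proof (rule card_image_eq_kernel)
    fix a b assume ab: "a \<in> carrier R" "b \<in> carrier R"
    have "a \<odot>\<^bsub>M\<^esub> x \<ominus>\<^sub>M b \<odot>\<^bsub>M\<^esub> x = (a \<ominus> b) \<odot>\<^bsub>M\<^esub> x"
      using ab assms by (simp add: a_minus_def smult_l_distr smult_l_minus)
    then show "(A +>\<^bsub>M\<^esub> (a \<odot>\<^bsub>M\<^esub> x) = A +>\<^bsub>M\<^esub> (b \<odot>\<^bsub>M\<^esub> x)) = (PIdl p +>\<^bsub>R\<^esub> a = PIdl p +>\<^bsub>R\<^esub> b)"
      using ab assms smult_dvd[OF assms, of "a \<ominus> b"] by (simp add: rcos_eq_iff residue_eq_iff)
  qed
  finally show ?thesis using card_residue by simp
qed

text \<open>As \<open>pX\<close> lies in \<open>Z\<close>, the quotient \<open>X/Z\<close> is a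
  vector space over the residue field, and a subspace \<open>Y/Z\<close> of codimension
  \<open>k\<close> has \<open>|Y/Z|^k\<close> complements. The induction enlarges \<open>Y\<close>
  by one vector, which lowers the index by the factor \<open>q\<close>; \<open>cond\<close> of
  \<open>comps_step\<close> holds since a scalar taking \<open>x\<close> into \<open>Y\<close> is
  divisible by \<open>p\<close>.\<close>

lemma card_comps_elementary:
  assumes "sm X" "sm Y" "sm Z" "scl p X \<subseteq> Z" "Z \<subseteq> Y" "Y \<subseteq> X" "idx X Y > 0" "idx Y Z > 0"
  shows "\<exists>k. idx X Y = q ^ k \<and> card (comps X Y Z) = idx Y Z ^ k"
  using assms
proof (induction "idx X Y" arbitrary: Y Z rule: less_induct)
  case less
  show ?case
  proof (cases "X = Y")
    case True
    then show ?thesis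
      using less.prems comps_trivial[of X Z] idx_self[of X] by (intro exI[of _ 0]) auto
  next
    case False
    then obtain x where x: "x \<in> X" "x \<notin> Y" using less.prems by auto
    have xM: "x \<in> carrier M" using x less.prems smD by blast
    let ?X = "Y <+>\<^sub>M cyc x"
    have px: "p \<odot>\<^bsub>M\<^esub> x \<in> Z" using x less.prems by (auto simp: mscale_def)
    have sX: "sm ?X" using less.prems xM by (intro sm_sum sm_cyc)
    have YX: "Y \<subseteq> ?X" using less.prems xM by (intro sum_upper sm_cyc)
    have XX: "?X \<subseteq> X" using less.prems x by (intro sum_least cyc_least) auto
    have iq: "idx ?X Y = q" by (rule idx_cyc) (use less.prems x xM px in auto)
    have mult: "idx X Y = idx X ?X * q" using idx_mult[OF less.prems(1) sX less.prems(2) YX XX] iq by simp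
    then have lt: "idx X ?X < idx X Y" "idx X ?X > 0" using less.prems q_gt_1 by auto
    have c1: "card (comps ?X Y Z) = idx Y Z"
    proof (rule comps_step)
      fix a y assume a: "a \<in> carrier R" "a \<odot>\<^bsub>M\<^esub> x \<in> Y" "y \<in> Y"
      then obtain b where b: "b \<in> carrier R" "a = p \<otimes> b"
        using smult_dvd[of Y x a] less.prems x xM px by auto
      have xy: "x \<oplus>\<^sub>M y \<in> X" using x a less.prems smD(4)[of X] by auto
      then have xyM: "x \<oplus>\<^sub>M y \<in> carrier M" using smD(3)[OF less.prems(2)] a xM by simp
      have "a \<odot>\<^bsub>M\<^esub> (x \<oplus>\<^sub>M y) = p \<odot>\<^bsub>M\<^esub> (b \<odot>\<^bsub>M\<^esub> (x \<oplus>\<^sub>M y))"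
        using b xyM p_closed by (simp only: smult_assoc1)
      also have "\<dots> \<in> scl p X" using smD(7)[OF less.prems(1) b(1) xy] by (auto simp: mscale_def)
      finally show "a \<odot>\<^bsub>M\<^esub> (x \<oplus>\<^sub>M y) \<in> Z" using less.prems by auto
    qed (use less.prems xM in auto)
    \<comment> \<open>The exponent must be fixed before \<open>W\<close> varies. It is read off from
      the induction hypothesis with the enlarged \<open>Y\<close> also in the place of
      \<open>Z\<close>.\<close>
    obtain k where k: "idx X ?X = q ^ k" using less.hyps[OF lt(1), of ?X] less.prems sX XX lt YX
      idx_self[OF sX] by force
    have c2: "card (comps X ?X W) = idx Y Z ^ k" if W: "W \<in> comps ?X Y Z" for W
    proof -
      have i: "idx ?X W = idx Y Z" by (rule idx_comps[OF W less.prems(2)])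
      note W1 = compsD[OF W]
      have "\<exists>k. idx X ?X = q ^ k \<and> card (comps X ?X W) = idx ?X W ^ k"
        by (rule less.hyps[OF lt(1)]) (use W1 less.prems sX XX lt i in auto)
      then show ?thesis using k i q_gt_1 by auto
    qed
    have "card (comps X Y Z) = card (comps ?X Y Z) * idx Y Z ^ k"
      by (rule comps_chain[OF less.prems(2) sX less.prems(1) YX XX]) (use c1 c2 less.prems in auto)
    then show ?thesis using c1 mult k by (intro exI[of _ "Suc k"]) auto
  qed
qed

lemma idx_power:
  assumes "sm X" "sm Y" "scl p X \<subseteq> Y" "Y \<subseteq> X" "idx X Y > 0"
  obtains k where "idx X Y = q ^ k"
  using card_comps_elementary[of X Y Y] assms idx_self[of Y] by auto

lemma card_comps_power:
  assumes "sm X" "sm Y" "sm Z" "scl p X \<subseteq> Z" "Z \<subseteq> Y" "Y \<subseteq> X" "idx X Y = q ^ k" "idx Y Z > 0"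
  shows "card (comps X Y Z) = idx Y Z ^ k"
  using card_comps_elementary[OF assms(1-6) _ assms(8)] assms(7) q_gt_1 by auto

definition subs :: "'c set \<Rightarrow> 'c set \<Rightarrow> nat \<Rightarrow> 'c set set" where
  "subs X Z s = {W. sm W \<and> Z \<subseteq> W \<and> W \<subseteq> X \<and> idx X W = q ^ s}"

lemma finite_subs: "sm X \<Longrightarrow> sm Z \<Longrightarrow> idx X Z > 0 \<Longrightarrow> finite (subs X Z s)"
  by (rule finite_subset[OF _ finite_between[of X Z]]) (auto simp: subs_def)

text \<open>Counts subspaces of codimension \<open>s\<close> by a line \<open>l\<close> through a
  vector \<open>x\<close> outside \<open>Z\<close>. Those containing \<open>x\<close> are subspaces
  of \<open>X/l\<close>; each of the others is a complement of \<open>l\<close> in its span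
  \<open>V\<close> with \<open>l\<close>, which has codimension \<open>s - 1\<close>. The two cases
  are the two terms of the Pascal rule defining \<open>gbin\<close>.\<close>

lemma card_subs:
  assumes "sm X" "sm Z" "scl p X \<subseteq> Z" "Z \<subseteq> X" "idx X Z = q ^ r"
  shows "card (subs X Z s) = gbin q r s"
  using assms
proof (induction r arbitrary: Z s)
  case 0
  then have XZ: "X = Z" using idx_eq_1[of X Z] by auto
  have "subs X Z s = (if s = 0 then {X} else {})"
    using XZ 0 idx_self[of X] by (auto simp: subs_def q_power_eq_1)
  then show ?case by (cases s) auto
next
  case (Suc r)
  have fin: "idx X Z > 0" using Suc.prems q_pos by simp
  have "X \<noteq> Z" using Suc.prems idx_self[of X] q_gt_1 by (auto simp: power_eq_1_iff)
  then obtain x where x: "x \<in> X" "x \<notin> Z" using Suc.prems by auto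
  have xM: "x \<in> carrier M" using x Suc.prems smD by blast
  define l where "l = Z <+>\<^sub>M cyc x"
  have px: "p \<odot>\<^bsub>M\<^esub> x \<in> Z" using x Suc.prems by (auto simp: mscale_def)
  have sl: "sm l" unfolding l_def using Suc.prems xM by (intro sm_sum sm_cyc)
  have Zl: "Z \<subseteq> l" unfolding l_def using Suc.prems xM by (intro sum_upper sm_cyc)
  have xl: "x \<in> l" unfolding l_def using sum_upper(2)[OF Suc.prems(2) sm_cyc[OF xM]] cyc_self[OF xM] by auto
  have lX: "l \<subseteq> X" unfolding l_def using Suc.prems x by (intro sum_least cyc_least) auto
  have iq: "idx l Z = q" unfolding l_def by (rule idx_cyc) (use Suc.prems x xM px in auto)
  have il: "idx X l = q ^ r"
    using idx_mult[OF Suc.prems(1) sl Suc.prems(2) Zl lX] iq Suc.prems q_pos by simp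
  have pl: "scl p X \<subseteq> l" using Suc.prems Zl by auto
  note IH = Suc.IH[OF Suc.prems(1) sl pl lX il]
  let ?B = "{W \<in> subs X Z s. x \<notin> W}"
  have lW: "l \<subseteq> W \<longleftrightarrow> Z \<subseteq> W \<and> x \<in> W" if "sm W" for W
    using Zl xl sum_least[OF that, of Z "cyc x"] cyc_least[OF that, of x] unfolding l_def by blast
  have A: "{W \<in> subs X Z s. x \<in> W} = subs X l s"
    using lW by (auto simp: subs_def)
  have "subs X Z s = subs X l s \<union> ?B" using A by auto
  moreover have "subs X l s \<inter> ?B = {}" using A by auto
  ultimately have split: "card (subs X Z s) = gbin q r s + card ?B"
    using card_Un_disjoint[of "subs X l s" ?B] finite_subs[OF Suc.prems(1,2) fin]
      finite_subs[OF Suc.prems(1) sl] il q_pos IH by auto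
  show ?case
  proof (cases s)
    case 0
    have "?B = {}" using 0 x idx_eq_1[of X] Suc.prems by (auto simp: subs_def)
    then have c: "card ?B = 0" by (simp only: card.empty)
    have "card (subs X Z s) = gbin q r s" using split unfolding c by (rule trans) simp
    then show ?thesis using 0 by simp
  next
    case (Suc k)
    note s = this
    have inter: "W \<inter> l = Z" if W: "W \<in> ?B" for W
    proof
      show "W \<inter> l \<subseteq> Z"
      proof
        fix u assume u: "u \<in> W \<inter> l"
        then obtain z a where za: "z \<in> Z" "a \<in> carrier R" "u = z \<oplus>\<^sub>M a \<odot>\<^bsub>M\<^esub> x"
          by (auto simp: l_def msum_iff cyc_def)
        have car: "z \<in> carrier M" "u \<in> carrier M"
          using za smD(3)[OF Suc.prems(2)] xM by auto
        have smW: "sm W" "Z \<subseteq> W" using W by (auto simp: subs_def)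
        have "a \<odot>\<^bsub>M\<^esub> x = u \<ominus>\<^sub>M z" using za car xM by (simp add: minus_telescope)
        also have "\<dots> \<in> W" using smD(6)[OF smW(1), of u z] smW(2) za u by auto
        finally have aW: "a \<odot>\<^bsub>M\<^esub> x \<in> W" .
        have "p \<odot>\<^bsub>M\<^esub> x \<in> W" using smW(2) px by auto
        then have "\<exists>b\<in>carrier R. a = p \<otimes> b"
          using smult_dvd[OF smW(1) xM _ _ za(2)] aW W by auto
        then have "a \<odot>\<^bsub>M\<^esub> x \<in> Z"
          using smult_dvd[OF Suc.prems(2) xM x(2) px za(2)] by simp
        then show "u \<in> Z" using za smD(4)[OF Suc.prems(2)] by simp
      qed
      show "Z \<subseteq> W \<inter> l" using W Zl by (auto simp: subs_def)
    qed
    have B: "?B = (\<Union>V\<in>subs X l k. comps V l Z)"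
    proof safe
      fix W assume W: "W \<in> subs X Z s" "x \<notin> W"
      then have smW: "sm W" "Z \<subseteq> W" "W \<subseteq> X" "idx X W = q ^ s" by (auto simp: subs_def)
      have i: "W \<inter> l = Z" by (rule inter) (use W in auto)
      let ?V = "W <+>\<^sub>M l"
      have V: "sm ?V" "W \<subseteq> ?V" "l \<subseteq> ?V" "?V \<subseteq> X"
        using smW sl lX sum_least[OF Suc.prems(1) smW(3) lX] by (auto intro: sm_sum dest: sum_upper[THEN subsetD])
      have "idx ?V W = idx (l <+>\<^sub>M W) W" using sum_comm[of W l] smW sl smD(1) by metis
      also have "\<dots> = idx l (l \<inter> W)" by (rule idx_sum[OF sl smW(1)])
      also have "\<dots> = q" using i iq by (simp add: Int_commute)
      finally have "q ^ s = idx X ?V * q"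
        using idx_mult[OF Suc.prems(1) V(1) smW(1) V(2,4)] smW(4) by simp
      then have "idx X ?V = q ^ k" using s q_pos by simp
      then have "?V \<in> subs X l k" using V by (auto simp: subs_def)
      moreover have "W \<in> comps ?V l Z" using smW V i by (auto simp: complements_def)
      ultimately show "W \<in> (\<Union>V\<in>subs X l k. comps V l Z)" by blast
    next
      fix W V assume V: "V \<in> subs X l k" and W: "W \<in> comps V l Z"
      note W1 = compsD[OF W]
      have V1: "sm V" "l \<subseteq> V" "V \<subseteq> X" "idx X V = q ^ k" using V by (auto simp: subs_def)
      have "idx V W = q" using idx_comps[OF W sl] iq by simp
      then have "idx X W = q ^ s" using idx_mult[OF Suc.prems(1) V1(1) W1(1) W1(2) V1(3)] V1 s by simp
      then show "W \<in> subs X Z s" using W1 V1 by (auto simp: subs_def)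
      assume "x \<in> W" then show False using W1(4) xl x by auto
    qed
    have cV: "card (comps V l Z) = q ^ (r - k)" "k \<le> r" if V: "V \<in> subs X l k" for V
    proof -
      have V1: "sm V" "l \<subseteq> V" "V \<subseteq> X" "idx X V = q ^ k" using V by (auto simp: subs_def)
      have e: "q ^ r = q ^ k * idx V l" using idx_mult[OF Suc.prems(1) V1(1) sl V1(2,3)] il V1 by simp
      then have dv: "q ^ k dvd q ^ r" by simp
      show kr: "k \<le> r" using power_dvd_imp_le[OF dv q_gt_1] .
      then have "q ^ r = q ^ k * q ^ (r - k)" by (simp add: power_add[symmetric])
      then have i: "idx V l = q ^ (r - k)" using e q_pos by simp
      have "scl p V \<subseteq> Z" using scale_mono[OF V1(3), of p] Suc.prems by auto
      then show "card (comps V l Z) = q ^ (r - k)"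
        using card_comps_power[OF V1(1) sl Suc.prems(2) _ Zl V1(2) i] iq q_pos by simp
    qed
    have "card ?B = (\<Sum>V\<in>subs X l k. card (comps V l Z))"
      unfolding B
    proof (rule card_UN_disjoint)
      show "finite (subs X l k)" using finite_subs[OF Suc.prems(1) sl] il q_pos by simp
      show "\<forall>V\<in>subs X l k. finite (comps V l Z)"
        using cV(1) q_pos by (metis card_ge_0_finite zero_less_power)
      show "\<forall>V\<in>subs X l k. \<forall>V'\<in>subs X l k. V \<noteq> V' \<longrightarrow> comps V l Z \<inter> comps V' l Z = {}"
        by (auto dest!: compsD(3))
    qed
    also have "\<dots> = gbin q r k * q ^ (r - k)" using cV IH[of k] by simp
    finally show ?thesis using split s by simp
  qed
qed

end

section \<open>The p-adic filtration and the layer recursion for lattices\<close>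

context uniformizer_module
begin

definition pw :: "nat \<Rightarrow> 'c set \<Rightarrow> 'c set" where "pw j A = scl (p [^] j) A"

lemma p_pow [simp]: "p [^] (j::nat) \<in> carrier R"
  using p_closed by simp

lemma sm_pw: "sm A \<Longrightarrow> sm (pw j A)"
  unfolding pw_def by (intro sm_scale) auto

lemma pw_le: "sm A \<Longrightarrow> pw j A \<subseteq> A"
  unfolding pw_def by (intro scale_le) auto

lemma pw_mono: "A \<subseteq> B \<Longrightarrow> pw j A \<subseteq> pw j B"
  unfolding pw_def by (rule scale_mono)

lemma pw_0: "sm A \<Longrightarrow> pw 0 A = A"
  using smD(3)[of A] by (force simp: pw_def mscale_def)

lemma pw_Suc: "sm A \<Longrightarrow> pw (Suc j) A = pw j (scl p A)"
  using p_closed by (simp add: pw_def scale_scale[OF smD(1)])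

lemma pw_Suc': "sm A \<Longrightarrow> pw (Suc j) A = scl p (pw j A)"
  using p_closed m_comm[OF p_closed p_pow] by (simp add: pw_def scale_scale[OF smD(1)])

lemma pw_sum: "sm A \<Longrightarrow> sm B \<Longrightarrow> pw j (A <+>\<^sub>M B) = pw j A <+>\<^sub>M pw j B"
  unfolding pw_def by (rule scale_sum) auto

lemma pw_Suc_le: "sm A \<Longrightarrow> pw (Suc j) A \<subseteq> pw j A"
  by (simp add: pw_Suc' scale_le sm_pw p_closed)

text \<open>Order of the \<open>j\<close>-th layer \<open>p^j(L/N) / p^(j+1)(L/N)\<close>. If
  \<open>L/N\<close> has type \<open>lam\<close>, it is \<open>q\<close> to the number of parts
  greater than \<open>j\<close>; the sequence of step indices is thus the conjugate partition of the
  type.\<close>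

definition step_index :: "'c set \<Rightarrow> 'c set \<Rightarrow> nat \<Rightarrow> nat" where
  "step_index L N j = idx (pw j L <+>\<^sub>M N) (pw (Suc j) L <+>\<^sub>M N)"

lemma idx_filtration:
  assumes "sm L" "sm N" "N \<subseteq> L"
  shows "idx L (pw m L <+>\<^sub>M N) = (\<Prod>j<m. step_index L N j)"
proof (induction m)
  case 0
  show ?case using assms idx_self[of L] sum_absorb[of L N] by (simp add: pw_0)
next
  case (Suc m)
  have "idx L (pw (Suc m) L <+>\<^sub>M N) = idx L (pw m L <+>\<^sub>M N) * step_index L N m"
    unfolding step_index_def
  proof (rule idx_mult)
    show "pw (Suc m) L <+>\<^sub>M N \<subseteq> pw m L <+>\<^sub>M N"
      by (rule sum_mono[OF pw_Suc_le[OF assms(1)] order_refl])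
    show "pw m L <+>\<^sub>M N \<subseteq> L"
      by (rule sum_least[OF assms(1) pw_le[OF assms(1)] assms(3)])
  qed (intro sm_sum sm_pw assms)+
  then show ?case using Suc by simp
qed

lemma idx_prod_step:
  assumes "sm L" "sm N" "N \<subseteq> L" "pw m L \<subseteq> N"
  shows "idx L N = (\<Prod>j<m. step_index L N j)"
proof -
  have "pw m L <+>\<^sub>M N = N"
    using assms sum_absorb[of N "pw m L"] sum_comm[of N "pw m L"] smD(1)[OF sm_pw] smD(1) sm_pw by metis
  then show ?thesis using idx_filtration[OF assms(1-3), of m] by simp
qed

text \<open>The condition \<open>N + E = L\<close> makes the recursion close up. It is void for
  \<open>E = L\<close>, and once the top layer \<open>A + pL = N\<close> of a lattice
  \<open>A\<close> has been fixed, the same condition reappears for the module \<open>N\<close> with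
  \<open>pL\<close> in the role of \<open>E\<close>.\<close>

definition lattices :: "nat \<Rightarrow> 'c set \<Rightarrow> 'c set \<Rightarrow> 'c set set" where
  "lattices m L E = {N. sm N \<and> pw m L \<subseteq> N \<and> N \<subseteq> L \<and> N <+>\<^sub>M E = L}"

text \<open>Such an \<open>N\<close> meets \<open>E\<close> in a submodule \<open>U\<close> of the
  same index \<open>q^s\<close>, for which there are \<open>gbin q r s\<close> choices. Given
  \<open>U\<close>, it is a complement of \<open>E\<close> over \<open>U\<close>; as
  \<open>E\<close> has index \<open>q^(n - r)\<close> in \<open>L\<close>, there are
  \<open>(q^s)^(n - r)\<close> of these.\<close>

lemma card_transversal:
  assumes "sm L" "sm E" "scl p L \<subseteq> E" "E \<subseteq> L" "idx E (scl p L) = q ^ r" "idx L (scl p L) = q ^ n"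
  shows "card {N. sm N \<and> scl p L \<subseteq> N \<and> N \<subseteq> L \<and> N <+>\<^sub>M E = L \<and> idx L N = q ^ s} =
    gbin q r s * q ^ (s * (n - r))" (is "card ?T = _")
proof -
  have pL: "sm (scl p L)" using assms p_closed by (intro sm_scale)
  have T: "?T = (\<Union>U\<in>subs E (scl p L) s. comps L E U)"
  proof (intro Set.set_eqI iffI)
    fix N assume "N \<in> ?T"
    then have N: "sm N" "scl p L \<subseteq> N" "N \<subseteq> L" "N <+>\<^sub>M E = L" "idx L N = q ^ s" by auto
    have NE: "N \<in> comps L E (N \<inter> E)" using N by (simp add: complements_def)
    then have "idx E (N \<inter> E) = q ^ s" using idx_comps[OF NE assms(2)] N(5) by simp
    then have "N \<inter> E \<in> subs E (scl p L) s" using N assms by (simp add: subs_def sm_Int)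
    then show "N \<in> (\<Union>U\<in>subs E (scl p L) s. comps L E U)" using NE by blast
  next
    fix N assume "N \<in> (\<Union>U\<in>subs E (scl p L) s. comps L E U)"
    then obtain U where U: "U \<in> subs E (scl p L) s" and N: "N \<in> comps L E U" by blast
    note N1 = compsD[OF N]
    have "scl p L \<subseteq> N" using N1(5) U by (auto simp: subs_def)
    moreover have "idx L N = q ^ s" using idx_comps[OF N assms(2)] U by (simp add: subs_def)
    ultimately show "N \<in> ?T" using N1 by simp
  qed
  have le: "r \<le> n" and i: "idx L E = q ^ (n - r)"
  proof -
    have e: "q ^ n = idx L E * q ^ r"
      using idx_mult[OF assms(1,2) pL assms(3,4)] assms by simp
    then have "q ^ r dvd q ^ n" by simp
    then show le: "r \<le> n" using power_dvd_imp_le q_gt_1 by blast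
    then have "q ^ n = q ^ (n - r) * q ^ r" by (simp add: power_add[symmetric])
    then show "idx L E = q ^ (n - r)" using e q_pos by simp
  qed
  have cU: "card (comps L E U) = q ^ (s * (n - r))" if "U \<in> subs E (scl p L) s" for U
    using that card_comps_power[OF assms(1,2) _ _ _ assms(4) i, of U] q_pos
    by (simp add: subs_def power_mult)
  have "card ?T = (\<Sum>U\<in>subs E (scl p L) s. card (comps L E U))"
    unfolding T
  proof (rule card_UN_disjoint)
    show "finite (subs E (scl p L) s)" using finite_subs[OF assms(2) pL] assms(5) q_pos by simp
    show "\<forall>U\<in>subs E (scl p L) s. finite (comps L E U)"
      using cU q_pos by (metis card_ge_0_finite zero_less_power)
    show "\<forall>U\<in>subs E (scl p L) s. \<forall>U'\<in>subs E (scl p L) s. U \<noteq> U' \<longrightarrow> comps L E U \<inter> comps L E U' = {}"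
      by (auto dest!: compsD(4))
  qed
  also have "\<dots> = gbin q r s * q ^ (s * (n - r))"
  proof -
    have "scl p E \<subseteq> scl p L" by (rule scale_mono[OF assms(4)])
    then have "card (subs E (scl p L) s) = gbin q r s"
      by (intro card_subs) (use assms pL in auto)
    then show ?thesis using cU by simp
  qed
  finally show ?thesis .
qed

text \<open>The pieces are the fibres of the map that sends \<open>A\<close> to
  \<open>N = A + pL\<close>. The inclusion \<open>p^(m+1) L\<close> in \<open>A\<close> turns into
  \<open>p^m N\<close> in \<open>A\<close>, since \<open>p^m N\<close> is the sum of
  \<open>p^m A\<close> and \<open>p^(m+1) L\<close>.\<close>

lemma lattices_Suc:
  assumes "sm L" "sm E" "scl p L \<subseteq> E" "E \<subseteq> L"
  shows "lattices (Suc m) L E =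
    (\<Union>N\<in>{N. sm N \<and> scl p L \<subseteq> N \<and> N \<subseteq> L \<and> N <+>\<^sub>M E = L}. lattices m N (scl p L))"
proof -
  have pL: "sm (scl p L)" using assms p_closed by (intro sm_scale)
  show ?thesis
  proof (intro Set.set_eqI iffI)
    fix A assume "A \<in> lattices (Suc m) L E"
    then have A: "sm A" "pw (Suc m) L \<subseteq> A" "A \<subseteq> L" "A <+>\<^sub>M E = L" by (auto simp: lattices_def)
    let ?N = "A <+>\<^sub>M scl p L"
    have N: "sm ?N" "A \<subseteq> ?N" "scl p L \<subseteq> ?N"
      using sm_sum[OF A(1) pL] sum_upper[OF A(1) pL] by auto
    have "?N \<subseteq> L" using A assms by (intro sum_least scale_le p_closed)
    moreover have "?N <+>\<^sub>M E = L"
      using sum_mono[OF N(2), of E E] A(4) sum_least[OF assms(1) \<open>?N \<subseteq> L\<close> assms(4)] by auto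
    moreover have "pw m ?N \<subseteq> A"
      using A pw_le[OF A(1)] pw_Suc[OF assms(1)]
      by (simp add: pw_sum[OF A(1) pL] sum_least)
    ultimately show "A \<in> (\<Union>N\<in>{N. sm N \<and> scl p L \<subseteq> N \<and> N \<subseteq> L \<and> N <+>\<^sub>M E = L}. lattices m N (scl p L))"
      using N A by (auto simp: lattices_def)
  next
    fix A assume "A \<in> (\<Union>N\<in>{N. sm N \<and> scl p L \<subseteq> N \<and> N \<subseteq> L \<and> N <+>\<^sub>M E = L}. lattices m N (scl p L))"
    then obtain N where N: "sm N" "scl p L \<subseteq> N" "N \<subseteq> L" "N <+>\<^sub>M E = L"
      and "A \<in> lattices m N (scl p L)" by auto
    then have A: "sm A" "pw m N \<subseteq> A" "A \<subseteq> N" "A <+>\<^sub>M scl p L = N" by (auto simp: lattices_def)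
    have "pw (Suc m) L \<subseteq> A" using pw_mono[OF N(2), of m] A(2) pw_Suc[OF assms(1)] by auto
    moreover have "A <+>\<^sub>M E = L"
    proof
      show "A <+>\<^sub>M E \<subseteq> L" using A N assms by (intro sum_least) auto
      have "N \<subseteq> A <+>\<^sub>M E" using sum_mono[of A A "scl p L" E] A(4) assms(3) by auto
      moreover have "E \<subseteq> A <+>\<^sub>M E" by (rule sum_upper[OF A(1) assms(2)])
      ultimately have "N <+>\<^sub>M E \<subseteq> A <+>\<^sub>M E" by (rule sum_least[OF sm_sum[OF A(1) assms(2)]])
      then show "L \<subseteq> A <+>\<^sub>M E" using N(4) by simp
    qed
    ultimately show "A \<in> lattices (Suc m) L E"
      using A N by (auto simp: lattices_def)
  qed
qed

text \<open>Since \<open>N = A + pL\<close>, the submodules \<open>p^j N + A\<close> and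
  \<open>p^(j+1) L + A\<close> coincide: passing from \<open>L\<close> to \<open>N\<close> removes
  the top layer and shifts the filtration of the rest.\<close>

lemma step_index_Suc:
  assumes "sm L" "sm N" "sm A" "A <+>\<^sub>M scl p L = N"
  shows "step_index N A j = step_index L A (Suc j)"
proof -
  have pL: "sm (scl p L)" using assms p_closed by (intro sm_scale)
  have e: "pw j N <+>\<^sub>M A = pw (Suc j) L <+>\<^sub>M A" for j
  proof
    have "pw j N = pw j A <+>\<^sub>M pw (Suc j) L"
      using pw_sum[OF assms(3) pL] assms(4) pw_Suc[OF assms(1)] by simp
    moreover have s: "sm (pw (Suc j) L <+>\<^sub>M A)" using assms by (intro sm_sum sm_pw)
    moreover have u: "pw (Suc j) L \<subseteq> pw (Suc j) L <+>\<^sub>M A" "A \<subseteq> pw (Suc j) L <+>\<^sub>M A"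
      using assms by (simp_all add: sum_upper sm_pw)
    moreover have "pw j A \<subseteq> A" by (rule pw_le[OF assms(3)])
    ultimately show "pw j N <+>\<^sub>M A \<subseteq> pw (Suc j) L <+>\<^sub>M A"
      by (metis order_trans sum_least)
    have "pw (Suc j) L \<subseteq> pw j N"
      using pw_mono[of "scl p L" N j] sum_upper(2)[OF assms(3) pL] assms(4) pw_Suc[OF assms(1)] by simp
    then show "pw (Suc j) L <+>\<^sub>M A \<subseteq> pw j N <+>\<^sub>M A" by (rule sum_mono) simp
  qed
  show ?thesis unfolding step_index_def e ..
qed

text \<open>After the top layer \<open>N\<close> is removed, the pair \<open>(N, pL)\<close>
  satisfies the same hypotheses as \<open>(L, E)\<close>. Torsion-freeness gives
  \<open>|pL : pN| = |L : N| = q^s\<close>, so \<open>r\<close> is replaced by \<open>s\<close>, and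
  it gives \<open>|N : pN| = |L : pL|\<close>, so \<open>n\<close> stays the same.\<close>

theorem lattice_sum:
  fixes w :: "nat \<Rightarrow> 'k::comm_semiring_1"
  assumes tf: "\<And>x. x \<in> carrier M \<Longrightarrow> p \<odot>\<^bsub>M\<^esub> x = \<zero>\<^bsub>M\<^esub> \<Longrightarrow> x = \<zero>\<^bsub>M\<^esub>"
    and "sm L" "sm E" "scl p L \<subseteq> E" "E \<subseteq> L" "idx E (scl p L) = q ^ r" "idx L (scl p L) = q ^ n"
  shows "finite (lattices m L E)"
    and "(\<Sum>N\<in>lattices m L E. \<Prod>j<m. w (step_index L N j)) = lattice_poly q n w m r"
proof -
  have "finite (lattices m L E) \<and>
    (\<Sum>N\<in>lattices m L E. \<Prod>j<m. w (step_index L N j)) = lattice_poly q n w m r"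
    using assms(2-)
  proof (induction m arbitrary: L E r)
    case 0
    have "lattices 0 L E = {L}"
      using 0 pw_0[of L] sum_absorb[of L E] by (auto simp: lattices_def)
    then show ?case by simp
  next
    case (Suc m)
    note L = Suc.prems
    have pL: "sm (scl p L)" using L p_closed by (intro sm_scale)
    have pLL: "scl p L \<subseteq> L" using L p_closed by (intro scale_le)
    define T where "T = {N. sm N \<and> scl p L \<subseteq> N \<and> N \<subseteq> L \<and> N <+>\<^sub>M E = L}"
    define T' where "T' s = {N. sm N \<and> scl p L \<subseteq> N \<and> N \<subseteq> L \<and> N <+>\<^sub>M E = L \<and> idx L N = q ^ s}" for s
    have finT: "finite T"
      by (rule finite_subset[OF _ finite_between[OF L(1) pL]]) (use L q_pos in \<open>auto simp: T_def\<close>)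
    \<comment> \<open>The index of \<open>N\<close> is a power of \<open>q\<close>: it equals the
      index of \<open>N \<inter> E\<close> in \<open>E\<close>, and the quotient of \<open>E\<close>
      by this intersection is killed by \<open>p\<close>.\<close>
    have TT: "T = (\<Union>s\<le>r. T' s)"
    proof safe
      fix N assume "N \<in> T"
      then have N: "sm N" "scl p L \<subseteq> N" "N \<subseteq> L" "N <+>\<^sub>M E = L" by (auto simp: T_def)
      have NE: "N \<in> comps L E (N \<inter> E)" using N by (simp add: complements_def)
      have sNE: "sm (N \<inter> E)" using N L by (intro sm_Int)
      have "idx E (scl p L) = idx E (N \<inter> E) * idx (N \<inter> E) (scl p L)"
        by (rule idx_mult) (use N L pL sNE in auto)
      moreover from this have pos: "idx E (N \<inter> E) > 0" using L q_pos
        by (metis mult_is_0 neq0_conv power_not_zero)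
      moreover have "scl p E \<subseteq> N \<inter> E"
        using scale_mono[OF L(4), of p] N L by auto
      ultimately obtain s where s: "idx E (N \<inter> E) = q ^ s" "q ^ r = q ^ s * idx (N \<inter> E) (scl p L)"
        using idx_power[OF L(2) sNE] L(5) by auto
      then have "q ^ s dvd q ^ r" by simp
      then have "s \<le> r" using power_dvd_imp_le q_gt_1 by blast
      moreover have "N \<in> T' s" using N s idx_comps[OF NE L(2)] by (simp add: T'_def)
      ultimately show "N \<in> (\<Union>s\<le>r. T' s)" by auto
    qed (auto simp: T_def T'_def)
    have IH: "finite (lattices m N (scl p L)) \<and>
        (\<Sum>A\<in>lattices m N (scl p L). \<Prod>j<m. w (step_index N A j)) = lattice_poly q n w m s"
      if "N \<in> T' s" for N s
    proof (rule Suc.IH)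
      have N: "sm N" "scl p L \<subseteq> N" "N \<subseteq> L" "N <+>\<^sub>M E = L" "idx L N = q ^ s"
        using that by (auto simp: T'_def)
      then show "sm N" "sm (scl p L)" "scl p N \<subseteq> scl p L" "scl p L \<subseteq> N"
        using pL by (auto intro: scale_mono[THEN subsetD])
      have sc: "idx (scl p L) (scl p N) = idx L N"
        by (rule idx_scale) (use N L p_closed tf in auto)
      then show "idx (scl p L) (scl p N) = q ^ s" using N by simp
      have "idx N (scl p N) = idx N (scl p L) * idx (scl p L) (scl p N)"
        using N pL L p_closed by (intro idx_mult sm_scale scale_mono) auto
      moreover have "idx L (scl p L) = idx L N * idx N (scl p L)"
        using N pL L by (intro idx_mult) auto
      ultimately show "idx N (scl p N) = q ^ n" using sc L by (simp add: mult.commute)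
    qed
    have lat: "lattices (Suc m) L E = (\<Union>N\<in>T. lattices m N (scl p L))"
      unfolding T_def by (rule lattices_Suc[OF L(1-4)])
    have finN: "\<forall>N\<in>T. finite (lattices m N (scl p L))" using IH TT by blast
    have wt: "(\<Prod>j<Suc m. w (step_index L A j)) = w (idx L N) * (\<Prod>j<m. w (step_index N A j))"
      if N: "N \<in> T" and A: "A \<in> lattices m N (scl p L)" for N A
    proof -
      have A1: "sm A" "A \<subseteq> N" "A <+>\<^sub>M scl p L = N" and N1: "sm N" "N \<subseteq> L"
        using A N by (auto simp: lattices_def T_def)
      have "scl p L <+>\<^sub>M A = N" using A1 sum_comm[of A "scl p L"] smD(1)[OF A1(1)] smD(1)[OF pL] by simp
      then have "step_index L A 0 = idx L N"
        using sum_absorb[OF L(1) A1(1)] A1 N1 L(1) p_closed pw_Suc'[OF L(1), of 0]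
        by (simp add: step_index_def pw_0)
      then show ?thesis
        using step_index_Suc[OF L(1) N1(1) A1(1,3)] by (simp add: prod.lessThan_Suc_shift del: prod.lessThan_Suc)
    qed
    have "(\<Sum>A\<in>lattices (Suc m) L E. \<Prod>j<Suc m. w (step_index L A j)) =
        (\<Sum>N\<in>T. \<Sum>A\<in>lattices m N (scl p L). \<Prod>j<Suc m. w (step_index L A j))"
      unfolding lat
    proof (rule sum.UNION_disjoint[OF finT finN])
      show "\<forall>N\<in>T. \<forall>N'\<in>T. N \<noteq> N' \<longrightarrow> lattices m N (scl p L) \<inter> lattices m N' (scl p L) = {}"
        by (auto simp: lattices_def)
    qed
    also have "\<dots> = (\<Sum>N\<in>T. w (idx L N) * (\<Sum>A\<in>lattices m N (scl p L). \<Prod>j<m. w (step_index N A j)))"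
      by (intro sum.cong refl) (simp add: wt sum_distrib_left del: prod.lessThan_Suc)
    also have "\<dots> = (\<Sum>s\<le>r. \<Sum>N\<in>T' s. w (idx L N) * (\<Sum>A\<in>lattices m N (scl p L). \<Prod>j<m. w (step_index N A j)))"
      unfolding TT
    proof (rule sum.UNION_disjoint)
      show "\<forall>s\<in>{..r}. finite (T' s)" using finT TT by (auto intro: finite_subset)
      show "\<forall>s\<in>{..r}. \<forall>s'\<in>{..r}. s \<noteq> s' \<longrightarrow> T' s \<inter> T' s' = {}"
        using q_gt_1 by (auto simp: T'_def)
    qed auto
    also have "\<dots> = (\<Sum>s\<le>r. of_nat (card (T' s)) * (w (q ^ s) * lattice_poly q n w m s))"
    proof (rule sum.cong[OF refl])
      fix s
      have "(\<Sum>N\<in>T' s. w (idx L N) * (\<Sum>A\<in>lattices m N (scl p L). \<Prod>j<m. w (step_index N A j))) =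
          (\<Sum>N\<in>T' s. w (q ^ s) * lattice_poly q n w m s)"
        by (intro sum.cong refl) (simp add: IH, simp add: T'_def)
      then show "(\<Sum>N\<in>T' s. w (idx L N) * (\<Sum>A\<in>lattices m N (scl p L). \<Prod>j<m. w (step_index N A j))) =
          of_nat (card (T' s)) * (w (q ^ s) * lattice_poly q n w m s)" by simp
    qed
    also have "\<dots> = lattice_poly q n w (Suc m) r"
      using card_transversal[OF L(1-6)] unfolding T'_def by (simp add: mult.assoc)
    finally show ?case using finT finN unfolding lat by simp
  qed
  then show "finite (lattices m L E)"
    "(\<Sum>N\<in>lattices m L E. \<Prod>j<m. w (step_index L N j)) = lattice_poly q n w m r" by auto
qed

end

section \<open>Gaussian binomial identities\<close>

lemma gbin_self [simp]: "gbin q n n = 1"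
  by (induction n) (auto simp: gbin_eq_0)

lemma of_nat_gbin: "of_nat (gbin q n k) = gbin (of_nat q) n k"
  by (induction q n k rule: gbin.induct) auto

text \<open>The ratio of neighbouring coefficients with its denominator cleared, hence valid in
  every commutative ring and at roots of unity.\<close>

lemma gbin_absorb:
  fixes q :: "'k::comm_ring_1"
  shows "gbin q n (Suc k) * (q ^ Suc k - 1) = gbin q n k * (q ^ (n - k) - 1)"
proof (induction n arbitrary: k)
  case 0
  show ?case by (cases k) auto
next
  case (Suc n)
  show ?case
  proof (cases k)
    case 0
    then show ?thesis using Suc.IH[of 0] by (simp add: algebra_simps)
  next
    case (Suc l)
    show ?thesis
    proof (cases "k \<le> n")
      case True
      have IH1: "gbin q n (Suc k) * (q ^ Suc k - 1) = gbin q n k * (q ^ (n - k) - 1)" by (rule Suc.IH)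
      have IH2: "gbin q n k * (q ^ k - 1) = gbin q n l * (q ^ (n - l) - 1)" using Suc.IH[of l] Suc by simp
      have e: "q ^ (n - l) * q ^ k = q ^ Suc n" "q ^ (n - k) * q ^ Suc k = q ^ Suc n"
        using True Suc by (simp_all flip: power_add power_Suc)
      have "gbin q (Suc n) (Suc k) * (q ^ Suc k - 1) =
          gbin q n (Suc k) * (q ^ Suc k - 1) + gbin q n k * (q ^ (n - k) * q ^ Suc k - q ^ (n - k))"
        by (simp add: algebra_simps)
      also have "\<dots> = gbin q n k * (q ^ Suc n - 1)" unfolding IH1 e by (simp add: algebra_simps)
      also have "\<dots> = gbin q n k * (q ^ (n - l) - 1) + q ^ (n - l) * (gbin q n k * (q ^ k - 1))"
        unfolding e(1)[symmetric] by (simp add: algebra_simps)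
      also have "\<dots> = (gbin q n k + q ^ (n - l) * gbin q n l) * (q ^ (n - l) - 1)"
        unfolding IH2 by (simp add: algebra_simps)
      finally show ?thesis using Suc by simp
    qed (simp_all add: gbin_eq_0)
  qed
qed

text \<open>The second Pascal rule; its difference from the defining one is exactly the absorption
  identity.\<close>

lemma gbin_Suc_Suc':
  fixes q :: "'k::comm_ring_1"
  shows "gbin q (Suc n) (Suc k) = q ^ Suc k * gbin q n (Suc k) + gbin q n k"
  using gbin_absorb[of q n k] by (simp add: algebra_simps)

text \<open>The coefficient is a palindromic polynomial in \<open>q\<close> of degree
  \<open>k(n - k)\<close>. Inverting \<open>q\<close> exchanges the two Pascal rules, which drives
  the induction.\<close>

lemma gbin_inverse:
  fixes q :: "'k::field"
  assumes "q \<noteq> 0" "k \<le> n"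
  shows "gbin (inverse q) n k * q ^ (k * (n - k)) = gbin q n k"
  using assms(2)
proof (induction n arbitrary: k)
  case 0
  then show ?case by simp
next
  case (Suc n)
  show ?case
  proof (cases k)
    case (Suc l)
    show ?thesis
    proof (cases "k \<le> n")
      case True
      have 1: "gbin (inverse q) n k * q ^ (k * (n - k)) = gbin q n k" using Suc.IH True .
      have 2: "gbin (inverse q) n l * q ^ (l * (n - l)) = gbin q n l" using Suc.IH[of l] True Suc by simp
      have e1: "q ^ (k * (Suc n - k)) = q ^ (k * (n - k)) * q ^ k"
        using True by (simp add: Suc_diff_le power_add[symmetric] add.commute)
      have e2: "inverse q ^ (n - l) * q ^ (k * (Suc n - k)) = q ^ (l * (n - l))"
      proof -
        have "k * (Suc n - k) = l * (n - l) + (n - l)" using Suc by simp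
        then show ?thesis using assms(1) by (simp add: power_add power_inverse)
      qed
      have "gbin (inverse q) (Suc n) k * q ^ (k * (Suc n - k)) =
          gbin (inverse q) n k * q ^ (k * (Suc n - k)) +
          gbin (inverse q) n l * (inverse q ^ (n - l) * q ^ (k * (Suc n - k)))"
        unfolding Suc gbin.simps(3) by (simp only: distrib_right distrib_left mult_ac)
      also have "\<dots> = (gbin (inverse q) n k * q ^ (k * (n - k))) * q ^ k + gbin q n l"
        by (subst e2, subst 2, subst e1) (simp only: mult.assoc)
      also have "\<dots> = q ^ k * gbin q n k + gbin q n l"
        unfolding 1 by (simp only: mult.commute)
      finally show ?thesis using gbin_Suc_Suc'[of q n l] Suc by simp
    next
      case False
      then have "k = Suc n" using Suc.prems by simp
      then show ?thesis by (simp add: gbin_eq_0)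
    qed
  qed simp
qed

section \<open>q-factorials, and the eigenvectors of the layer recursion\<close>

definition qfact :: "'k::comm_ring_1 \<Rightarrow> nat \<Rightarrow> 'k" where
  "qfact q n = (\<Prod>i<n. q ^ Suc i - 1)"

lemma gbin_qfact:
  fixes q :: "'k::comm_ring_1"
  assumes "k \<le> n"
  shows "gbin q n k * qfact q k * qfact q (n - k) = qfact q n"
  using assms
proof (induction k)
  case 0
  then show ?case by (simp add: qfact_def)
next
  case (Suc k)
  have "n - k = Suc (n - Suc k)" using Suc.prems by simp
  then have e: "qfact q (n - k) = qfact q (n - Suc k) * (q ^ (n - k) - 1)"
    unfolding qfact_def by (metis prod.lessThan_Suc)
  have "gbin q n (Suc k) * qfact q (Suc k) * qfact q (n - Suc k) =
    (gbin q n (Suc k) * (q ^ Suc k - 1)) * qfact q k * qfact q (n - Suc k)"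
    by (simp add: qfact_def algebra_simps)
  also have "\<dots> = gbin q n k * qfact q k * qfact q (n - k)"
    unfolding gbin_absorb e by (simp add: algebra_simps)
  finally show ?case using Suc by simp
qed

text \<open>The inverse \<open>Q\<close> is carried as a parameter of its own, so that negative
  powers of \<open>q\<close> become natural powers of \<open>Q\<close>. The condition
  \<open>q_root\<close> keeps the q-factorials and the factors \<open>1 - Q^r\<close> below away
  from 0.\<close>

locale qbase =
  fixes q Q :: "'k::field"
  assumes qQ: "q * Q = 1" and q_root: "\<And>i. i > 0 \<Longrightarrow> q ^ i \<noteq> 1"
begin

lemma qQ_nz: "q \<noteq> 0" "Q \<noteq> 0"
  using qQ by auto

lemma Q_inv: "Q = inverse q"
  using qQ qQ_nz by (metis inverse_unique)

lemma pow_cancel: "q ^ j * Q ^ j = 1" "q ^ j * (Q ^ j * c) = c" "Q ^ j * (q ^ j * c) = c"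
proof -
  show 1: "q ^ j * Q ^ j = 1" using qQ by (simp flip: power_mult_distrib)
  show "q ^ j * (Q ^ j * c) = c" using 1 by (simp flip: mult.assoc)
  show "Q ^ j * (q ^ j * c) = c" using 1 by (simp add: mult.commute[of "Q ^ j"] flip: mult.assoc)
qed

lemma Q_root: "i > 0 \<Longrightarrow> Q ^ i \<noteq> 1"
  using q_root[of i] by (auto simp: Q_inv power_inverse)

lemma gbin_Q: "k \<le> n \<Longrightarrow> gbin Q n k = Q ^ (k * (n - k)) * gbin q n k"
  using gbin_inverse[of q k n] qQ_nz pow_cancel(1)[of "k * (n - k)"]
  by (metis Q_inv mult.assoc mult.commute mult.right_neutral)

lemma qfact_nz: "qfact q n \<noteq> 0"
  using q_root by (auto simp: qfact_def simp del: power_Suc)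

text \<open>Both sides are the q-trinomial coefficient: \<open>qfact q r\<close> divided by the
  q-factorials of \<open>k\<close>, \<open>j\<close> and \<open>r - k - j\<close>. These are nonzero
  because \<open>q\<close> is not a root of unity.\<close>

lemma gbin_trinomial:
  assumes "k + j \<le> r"
  shows "gbin q r (k + j) * gbin q (k + j) k = gbin q r k * gbin q (r - k) j"
proof -
  have "gbin q r (k + j) * gbin q (k + j) k * (qfact q k * qfact q j * qfact q (r - k - j)) = qfact q r"
  proof -
    have "gbin q r (k + j) * gbin q (k + j) k * (qfact q k * qfact q j * qfact q (r - k - j)) =
      gbin q r (k + j) * (gbin q (k + j) k * qfact q k * qfact q j) * qfact q (r - (k + j))"
      by (simp add: algebra_simps)
    also have "\<dots> = qfact q r"
      using gbin_qfact[of "k + j" r q] gbin_qfact[of k "k + j" q] assms by simp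
    finally show ?thesis .
  qed
  moreover have "gbin q r k * gbin q (r - k) j * (qfact q k * qfact q j * qfact q (r - k - j)) = qfact q r"
  proof -
    have "gbin q r k * gbin q (r - k) j * (qfact q k * qfact q j * qfact q (r - k - j)) =
      gbin q r k * qfact q k * (gbin q (r - k) j * qfact q j * qfact q (r - k - j))"
      by (simp add: algebra_simps)
    also have "\<dots> = qfact q r"
      using gbin_qfact[of k r q] gbin_qfact[of j "r - k" q] assms by simp
    finally show ?thesis .
  qed
  ultimately show ?thesis using qfact_nz by (metis mult_cancel_right mult_eq_0_iff)
qed

text \<open>The q-Pochhammer symbol with base \<open>Q\<close> and first argument
  \<open>Q * w\<close>.\<close>

definition D :: "'k \<Rightarrow> nat \<Rightarrow> 'k" where "D w j = (\<Prod>i<j. 1 - Q ^ Suc i * w)"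

lemma D_Suc: "D w (Suc j) = D w j * (1 - Q ^ Suc j * w)"
  by (simp add: D_def)

lemma D_Suc': "D w (Suc j) = (1 - Q * w) * D (Q * w) j"
  unfolding D_def prod.lessThan_Suc_shift by (simp add: algebra_simps)

text \<open>Pascal's rule expresses the sum for \<open>r + 1\<close> at \<open>w\<close> by those for \<open>r\<close> at \<open>w\<close> and at \<open>w / q\<close>.\<close>

lemma cauchy_sum:
  assumes "\<And>i. i \<in> {1..r} \<Longrightarrow> Q ^ i * w \<noteq> 1"
  shows "(\<Sum>j\<le>r. gbin q r j * Q ^ (r * j) * w ^ j / D w j) = 1 / D w r"
  using assms
proof (induction r arbitrary: w)
  case 0
  then show ?case by (simp add: D_def)
next
  case (Suc r)
  have nz: "D w j \<noteq> 0" if "j \<le> Suc r" for j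
    using Suc.prems that by (auto simp: D_def simp del: power_Suc)
  have Q1: "1 - Q * w \<noteq> 0" using Suc.prems[of 1] by auto
  have split: "gbin q (Suc r) j * Q ^ (Suc r * j) * w ^ j / D w j =
      gbin q r j * Q ^ (r * j) * w ^ j / D w j +
      (if j = 0 then 0 else gbin q r (j - 1) * Q ^ (Suc r * j) * w ^ j / D w j)" for j
  proof (cases j)
    case (Suc l)
    have "q ^ j * Q ^ (Suc r * j) = Q ^ (r * j)"
      using pow_cancel(2)[of j "Q ^ (r * j)"] by (simp add: power_add)
    then show ?thesis using Suc gbin_Suc_Suc'[of q r l]
      by (simp add: add_divide_distrib ring_distribs del: gbin.simps power_Suc)
  qed simp
  have 1: "(\<Sum>j\<le>Suc r. gbin q r j * Q ^ (r * j) * w ^ j / D w j) = 1 / D w r"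
    using Suc.IH[of w] Suc.prems by (simp add: gbin_eq_0)
  have "(\<Sum>j\<le>Suc r. if j = 0 then 0 else gbin q r (j - 1) * Q ^ (Suc r * j) * w ^ j / D w j) =
      (\<Sum>l\<le>r. gbin q r l * Q ^ (Suc r * Suc l) * w ^ Suc l / D w (Suc l))"
    by (subst sum.atMost_Suc_shift) simp
  also have "\<dots> = (\<Sum>l\<le>r. (Q ^ Suc r * w / (1 - Q * w)) * (gbin q r l * Q ^ (r * l) * (Q * w) ^ l / D (Q * w) l))"
    by (intro sum.cong refl) (simp add: D_Suc' power_mult_distrib power_add algebra_simps)
  also have "\<dots> = (Q ^ Suc r * w / (1 - Q * w)) * (1 / D (Q * w) r)"
    unfolding sum_distrib_left[symmetric]
  proof (subst Suc.IH)
    fix i assume "i \<in> {1..r}"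
    then show "Q ^ i * (Q * w) \<noteq> 1" using Suc.prems[of "Suc i"] by (simp add: algebra_simps)
  qed simp
  also have "\<dots> = Q ^ Suc r * w / D w (Suc r)" by (simp add: D_Suc')
  finally have 2: "(\<Sum>j\<le>Suc r. if j = 0 then 0 else gbin q r (j - 1) * Q ^ (Suc r * j) * w ^ j / D w j) =
      Q ^ Suc r * w / D w (Suc r)" .
  have "(\<Sum>j\<le>Suc r. gbin q (Suc r) j * Q ^ (Suc r * j) * w ^ j / D w j) =
      1 / D w r + Q ^ Suc r * w / D w (Suc r)"
    unfolding split sum.distrib 1 2 ..
  also have "\<dots> = 1 / D w (Suc r)"
    using nz[of r] nz[of "Suc r"] by (simp add: D_Suc field_simps del: power_Suc)
  finally show ?case .
qed

text \<open>The diagonal entry \<open>T X k k\<close>, hence an eigenvalue of the lower triangular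
  matrix \<open>T X\<close>.\<close>

definition y :: "'k \<Rightarrow> nat \<Rightarrow> 'k" where "y X k = Q ^ (k * k) * X ^ k"

text \<open>One step of \<open>lattice_poly\<close> in normalised form: for
  \<open>X = q^(n+d) * t\<close> this entry equals
  \<open>gbin q r s * q^(s*(n-r)) * (q^d * t)^s\<close>, so the rank \<open>n\<close> occurs only
  inside \<open>X\<close>.\<close>

definition T :: "'k \<Rightarrow> nat \<Rightarrow> nat \<Rightarrow> 'k" where "T X r s = gbin q r s * Q ^ (r * s) * X ^ s"

definition A :: "'k \<Rightarrow> nat \<Rightarrow> nat \<Rightarrow> 'k" where "A X r k = D (Q ^ (2 * k) * X) (r - k)"

text \<open>Normalises the \<open>k\<close>-th eigenvector in such a way that all of them together
  add up to the constant vector 1; this is \<open>coeff_sum\<close>.\<close>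

definition B :: "'k \<Rightarrow> nat \<Rightarrow> 'k" where "B X k = (\<Prod>i<k. 1 - inverse (Q ^ (k + i) * X))"

definition v :: "'k \<Rightarrow> nat \<Rightarrow> nat \<Rightarrow> 'k" where "v X k r = gbin Q r k / A X r k"

definition coeff :: "'k \<Rightarrow> nat \<Rightarrow> nat \<Rightarrow> 'k" where "coeff X r k = v X k r / B X k"

text \<open>With \<open>s = k + j\<close> the trinomial identity separates \<open>k\<close> from
  \<open>j\<close>, and what is left is the Cauchy sum of length \<open>r - k\<close> at
  \<open>Q^(2k) * X\<close>. The shift by \<open>Q^(2k)\<close> collects one factor
  \<open>Q^(k*j)\<close> from \<open>Q^(r*s)\<close> and another from the reciprocity of
  \<open>gbin Q (k + j) k\<close>.\<close>

lemma eigenvector: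
  assumes "k \<le> r" and nz: "\<And>i. Q ^ i * X \<noteq> 1"
  shows "(\<Sum>s\<le>r. T X r s * v X k s) = y X k * v X k r"
proof -
  let ?w = "Q ^ (2 * k) * X"
  have nzw: "Q ^ i * ?w \<noteq> 1" for i using nz[of "i + 2 * k"] by (simp add: power_add mult.assoc)
  have "(\<Sum>s\<le>r. T X r s * v X k s) = (\<Sum>s\<in>{k..r}. T X r s * v X k s)"
    by (rule sum.mono_neutral_right) (auto simp: v_def gbin_eq_0)
  also have "\<dots> = (\<Sum>j\<le>r - k. T X r (k + j) * v X k (k + j))"
    by (rule sum.reindex_bij_witness[of _ "\<lambda>j. k + j" "\<lambda>s. s - k"]) (use assms in auto)
  also have "\<dots> = (\<Sum>j\<le>r - k. gbin q r k * Q ^ (r * k) * X ^ k *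
      (gbin q (r - k) j * Q ^ ((r - k) * j) * ?w ^ j / D ?w j))"
  proof (intro sum.cong refl)
    fix j assume "j \<in> {..r - k}"
    then have j: "k + j \<le> r" using assms by auto
    have e: "Q ^ (r * (k + j)) * X ^ (k + j) * Q ^ (k * j) =
        Q ^ (r * k) * X ^ k * (Q ^ ((r - k) * j) * ?w ^ j)"
    proof -
      have "r * (k + j) + k * j = r * k + ((r - k) * j + 2 * k * j)"
        using assms by (auto simp: algebra_simps diff_mult_distrib le_imp_diff_is_add)
      then have "Q ^ (r * (k + j)) * Q ^ (k * j) = Q ^ (r * k) * (Q ^ ((r - k) * j) * Q ^ (2 * k * j))"
        by (simp only: power_add[symmetric] add_ac)
      then show ?thesis by (simp add: power_mult_distrib power_mult[symmetric] power_add[of X] algebra_simps)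
    qed
    have "T X r (k + j) * v X k (k + j) =
      (gbin q r (k + j) * gbin q (k + j) k) * (Q ^ (r * (k + j)) * X ^ (k + j) * Q ^ (k * j)) / D ?w j"
      using gbin_Q[of k "k + j"] by (simp add: T_def v_def A_def algebra_simps)
    also have "\<dots> = gbin q r k * Q ^ (r * k) * X ^ k *
      (gbin q (r - k) j * Q ^ ((r - k) * j) * ?w ^ j / D ?w j)"
      unfolding gbin_trinomial[OF j] e by (simp add: algebra_simps)
    finally show "T X r (k + j) * v X k (k + j) = gbin q r k * Q ^ (r * k) * X ^ k *
      (gbin q (r - k) j * Q ^ ((r - k) * j) * ?w ^ j / D ?w j)" .
  qed
  also have "\<dots> = gbin q r k * Q ^ (r * k) * X ^ k / D ?w (r - k)"
    unfolding sum_distrib_left[symmetric] by (subst cauchy_sum) (use nzw in auto)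
  also have "\<dots> = y X k * v X k r"
  proof -
    have "k * k + k * (r - k) = r * k" using assms(1) by (simp flip: distrib_left)
    then have "Q ^ (k * k) * Q ^ (k * (r - k)) = Q ^ (r * k)" by (simp flip: power_add)
    then show ?thesis using gbin_Q[OF assms(1)] by (simp add: y_def v_def A_def algebra_simps)
  qed
  finally show ?thesis .
qed

end

section \<open>Expansion of the constant vector in eigenvectors\<close>

context qbase
begin

lemma A_nz: "(\<And>i. Q ^ i * X \<noteq> 1) \<Longrightarrow> A X r k \<noteq> 0"
  using power_add[of Q _ "2 * k"]
  by (auto simp: A_def D_def mult.assoc[symmetric] simp del: power_Suc) (metis power_add)

lemma B_nz: "(\<And>i. Q ^ i * X \<noteq> 1) \<Longrightarrow> B X k \<noteq> 0"
  by (auto simp: B_def) (metis inverse_1 inverse_inverse_eq inverse_mult_distrib)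

lemma A_Suc_left:
  "k \<le> r \<Longrightarrow> A X (Suc r) k = A X r k * (1 - Q ^ (k + Suc r) * X)"
proof -
  assume "k \<le> r"
  then have "Suc r - k = Suc (r - k)" "Suc (r - k) + 2 * k = k + Suc r" by auto
  then show ?thesis
    unfolding A_def by (simp add: D_Suc mult.assoc[symmetric] power_add[symmetric] del: power_Suc)
qed

text \<open>\<open>A X r k\<close> has the factors with exponents \<open>2k+1\<close> to
  \<open>r+k\<close> of \<open>Q\<close>. Passing to \<open>k+1\<close> removes the two lowest and
  adds the one with exponent \<open>r+k+1\<close>.\<close>

lemma A_shift:
  assumes "k < r"
  shows "A X r k * (1 - Q ^ (k + Suc r) * X) =
    (1 - Q ^ (2 * k + 1) * X) * (1 - Q ^ (2 * k + 2) * X) * A X r (Suc k)"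
proof -
  obtain j where j: "r = k + Suc j" using assms less_imp_Suc_add by auto
  let ?w = "Q ^ (2 * k) * X"
  have 1: "A X r k * (1 - Q ^ (k + Suc r) * X) = D ?w (Suc (Suc j))"
  proof -
    have "Q ^ (k + Suc r) * X = Q ^ Suc (Suc j) * ?w"
    proof -
      have "k + Suc r = Suc (Suc j) + 2 * k" using j by simp
      then show ?thesis by (simp only: power_add mult_ac)
    qed
    then show ?thesis using j by (simp add: A_def D_Suc[of _ "Suc j"] del: power_Suc)
  qed
  have "D ?w (Suc (Suc j)) = (1 - Q * ?w) * ((1 - Q * (Q * ?w)) * D (Q * (Q * ?w)) j)"
    unfolding D_Suc' ..
  also have "Q * (Q * ?w) = Q ^ (2 * Suc k) * X" by (simp add: power_add mult_ac)
  finally show ?thesis unfolding 1 using j by (simp add: A_def mult_ac power_add)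
qed

text \<open>The exponents in \<open>B X k\<close> run from \<open>k\<close> to \<open>2k-1\<close>,
  those in \<open>B X (Suc k)\<close> from \<open>k+1\<close> to \<open>2k+1\<close>: one factor is
  lost at the bottom and two are gained at the top.\<close>

lemma B_shift:
  assumes "X \<noteq> 0"
  shows "B X (Suc k) * (1 - inverse (Q ^ k * X)) =
    B X k * (1 - inverse (Q ^ (2 * k) * X)) * (1 - inverse (Q ^ (2 * k + 1) * X))"
proof -
  let ?f = "\<lambda>i. 1 - inverse (Q ^ (k + i) * X)"
  have "B X (Suc k) = (\<Prod>i<Suc k. ?f (Suc i))" unfolding B_def by simp
  then have "B X (Suc k) * ?f 0 = (\<Prod>i<Suc (Suc k). ?f i)"
    unfolding prod.lessThan_Suc_shift[of ?f "Suc k"] by (simp add: mult_ac)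
  also have "\<dots> = B X k * ?f k * ?f (Suc k)" by (simp add: B_def)
  finally show ?thesis by (simp add: mult_2)
qed

lemma gbin_Q_ratio:
  "k \<le> r \<Longrightarrow> gbin Q (Suc r) k * (1 - Q ^ (Suc r - k)) = gbin Q r k * (1 - Q ^ Suc r)"
proof (induction k)
  case (Suc k)
  have e: "Q ^ (Suc r - Suc k) * Q ^ Suc k = Q ^ Suc r" using Suc.prems by (simp flip: power_add power_Suc)
  have ab: "gbin Q r (Suc k) * (Q ^ Suc k - 1) = gbin Q r k * (Q ^ (r - k) - 1)" by (rule gbin_absorb)
  have "gbin Q (Suc r) (Suc k) * (1 - Q ^ (Suc r - Suc k)) =
     gbin Q r (Suc k) * (1 - Q ^ (r - k)) + Q ^ (r - k) * (gbin Q r k * (1 - Q ^ (r - k)))"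
    by (simp add: algebra_simps)
  also have "gbin Q r k * (1 - Q ^ (r - k)) = gbin Q r (Suc k) * (1 - Q ^ Suc k)"
    using ab by (simp add: algebra_simps)
  also have "gbin Q r (Suc k) * (1 - Q ^ (r - k)) + Q ^ (r - k) * (gbin Q r (Suc k) * (1 - Q ^ Suc k)) =
     gbin Q r (Suc k) * (1 - Q ^ (Suc r - Suc k) * Q ^ Suc k)"
    by (simp add: algebra_simps)
  finally show ?case unfolding e .
qed simp

lemma gbin_Q_step:
  "gbin Q r (Suc k) * (1 - Q ^ Suc k) = gbin Q r k * (1 - Q ^ (r - k))"
  using gbin_absorb[of Q r k] by (simp add: algebra_simps)

text \<open>The sum over \<open>k\<close> does not depend on \<open>r\<close>: the differences telescope with the
  Wilf-Zeilberger certificate \<open>cert\<close>.\<close>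

definition cert :: "'k \<Rightarrow> nat \<Rightarrow> nat \<Rightarrow> 'k" where
  "cert X r k = (if k = 0 then 0 else - (Q ^ (r - k)) * coeff X r k * (1 - Q ^ k) *
     (1 - Q ^ (r + k) * X) / ((1 - Q ^ (2 * k) * X) * (1 - Q ^ r)))"

text \<open>The ratio of the terms at \<open>k+1\<close> and \<open>k\<close> with denominators
  cleared, assembled from the shifts of \<open>A\<close>, \<open>B\<close> and \<open>gbin\<close>.
  The monomial \<open>Q^(3k+1) * X\<close> appears when the inverses in \<open>B_shift\<close> are
  cleared: it is \<open>b * c\<close> divided by \<open>a\<close>.\<close>

lemma coeff_step:
  assumes X: "X \<noteq> 0" and nz: "\<And>i. Q ^ i * X \<noteq> 1" and k: "k < r"
  shows "coeff X r (Suc k) * (1 - Q ^ Suc k) * (1 - Q ^ (r + Suc k) * X) * (1 - Q ^ (2 * k) * X) =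
    - coeff X r k * (1 - Q ^ (r - k)) * (1 - Q ^ k * X) * (1 - Q ^ (2 * k + 2) * X) * (Q ^ (3 * k + 1) * X)"
proof -
  define a b c e f where "a = Q ^ k * X" and "b = Q ^ (2 * k) * X" and "c = Q ^ (2 * k + 1) * X"
    and "e = Q ^ (2 * k + 2) * X" and "f = Q ^ (r + Suc k) * X"
  define A0 A1 B0 B1 g0 g1 where "A0 = A X r k" and "A1 = A X r (Suc k)" and "B0 = B X k"
    and "B1 = B X (Suc k)" and "g0 = gbin Q r k" and "g1 = gbin Q r (Suc k)"
  have ne: "a \<noteq> 0" "b \<noteq> 0" "c \<noteq> 0" "1 - a \<noteq> 0" "1 - b \<noteq> 0" "1 - c \<noteq> 0" "1 - e \<noteq> 0" "1 - f \<noteq> 0"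
    "A0 \<noteq> 0" "A1 \<noteq> 0" "B0 \<noteq> 0" "B1 \<noteq> 0"
    using X qQ_nz nz A_nz[OF nz] B_nz[OF nz]
    by (simp_all add: a_def b_def c_def e_def f_def A0_def A1_def B0_def B1_def del: power_Suc)
  have hA: "A0 * (1 - f) = (1 - c) * (1 - e) * A1"
    using A_shift[OF k, of X] by (simp add: A0_def A1_def c_def e_def f_def add.commute)
  have hB: "B1 * (1 - inverse a) = B0 * (1 - inverse b) * (1 - inverse c)"
    using B_shift[OF X, of k] by (simp add: B0_def B1_def a_def b_def c_def)
  have hg: "g1 * (1 - Q ^ Suc k) = g0 * (1 - Q ^ (r - k))"
    using gbin_Q_step[of r k] by (simp add: g0_def g1_def)
  have bc: "b * c = a * (Q ^ (3 * k + 1) * X)"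
    by (simp add: a_def b_def c_def mult_ac flip: power_add power_Suc)
  have hB': "B1 * (a - 1) * (b * c) = B0 * (b - 1) * (c - 1) * a"
    using hB ne by (simp add: field_simps)
  have hB'': "B1 * (1 - a) * (Q ^ (3 * k + 1) * X) = - B0 * (1 - b) * (1 - c)"
  proof -
    have "a * (B1 * (1 - a) * (Q ^ (3 * k + 1) * X)) = a * (- B0 * (1 - b) * (1 - c))"
      using hB' unfolding bc by (simp add: algebra_simps)
    then show ?thesis by (rule mult_left_cancel[THEN iffD1, OF ne(1)])
  qed
  have "g1 * (1 - Q ^ Suc k) * (1 - f) * (1 - b) * (A0 * B0) =
     - g0 * (1 - Q ^ (r - k)) * (1 - a) * (1 - e) * (Q ^ (3 * k + 1) * X) * (A1 * B1)"
  proof -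
    have "g1 * (1 - Q ^ Suc k) * (1 - f) * (1 - b) * (A0 * B0) =
      (g1 * (1 - Q ^ Suc k)) * (A0 * (1 - f)) * (B0 * (1 - b))" by (simp only: mult_ac)
    also have "\<dots> = g0 * (1 - Q ^ (r - k)) * (1 - e) * A1 * (B0 * (1 - b) * (1 - c))"
      unfolding hA hg by (simp only: mult_ac)
    also have "B0 * (1 - b) * (1 - c) = - (B1 * (1 - a) * (Q ^ (3 * k + 1) * X))"
      unfolding hB'' by simp
    finally show ?thesis by (simp add: mult_ac)
  qed
  then have "g1 / A1 / B1 * (1 - Q ^ Suc k) * (1 - f) * (1 - b) =
     - (g0 / A0 / B0) * (1 - Q ^ (r - k)) * (1 - a) * (1 - e) * (Q ^ (3 * k + 1) * X)"
    using ne(9-12) by (simp add: divide_simps mult_ac)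
  then show ?thesis
    by (simp add: coeff_def v_def a_def b_def c_def e_def f_def A0_def A1_def B0_def B1_def g0_def g1_def)
qed

text \<open>All four terms are multiples of \<open>c\<close>, the coefficient at
  \<open>Suc r\<close> and \<open>k\<close>, by rational functions of \<open>u = Q^k\<close>,
  \<open>p = Q^(Suc r - k)\<close> and \<open>X\<close>; these multiples are \<open>cr\<close>,
  \<open>ck\<close> and \<open>ck1\<close>. Over the common denominator, as in \<open>gen2\<close>,
  only a polynomial identity remains.\<close>

lemma cert_diff:
  assumes X: "X \<noteq> 0" and nz: "\<And>i. Q ^ i * X \<noteq> 1" and k: "k \<le> r"
  shows "coeff X (Suc r) k - coeff X r k = cert X (Suc r) (Suc k) - cert X (Suc r) k"
proof -
  let ?r = "Suc r"
  define c where "c = coeff X ?r k"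
  define u where "u = Q ^ k"
  define p where "p = Q ^ (?r - k)"
  have up: "Q ^ ?r = u * p" using k by (simp add: u_def p_def flip: power_add power_Suc)
  have r1: "1 - u * p \<noteq> 0" using Q_root[of ?r] up by auto
  have b1: "1 - u ^ 2 * X \<noteq> 0" using nz[of "2 * k"] by (auto simp: u_def power_mult mult.commute power2_eq_square power_add mult_2)
  have e1: "1 - Q ^ (2 * k + 2) * X \<noteq> 0" using nz[of "2 * k + 2"] by auto
  have p1: "1 - p \<noteq> 0" using Q_root[of "?r - k"] k by (auto simp: p_def)
  have f1: "1 - u * u * p * X \<noteq> 0"
  proof -
    have "Q ^ (k + ?r) * X = u * u * p * X" unfolding power_add up by (simp add: u_def mult_ac)
    then show ?thesis using nz[of "k + ?r"] by auto
  qed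
  have ck: "cert X ?r k = - p * c * (1 - u) * (1 - u * u * p * X) / ((1 - u ^ 2 * X) * (1 - u * p))"
  proof (cases "k = 0")
    case True
    then show ?thesis by (simp add: cert_def u_def)
  next
    case False
    have F: "Q ^ (?r + k) = u * u * p" unfolding power_add up by (simp add: u_def mult_ac)
    have G: "Q ^ (2 * k) = u ^ 2" by (simp add: u_def power_mult[symmetric] mult.commute)
    show ?thesis
      unfolding cert_def F G up c_def[symmetric] u_def[symmetric] p_def[symmetric] using False by simp
  qed
  have cr: "coeff X r k = c * (1 - p) * (1 - u * u * p * X) / (1 - u * p)"
  proof -
    have g: "gbin Q ?r k * (1 - p) = gbin Q r k * (1 - u * p)"
      using gbin_Q_ratio[OF k] unfolding p_def[symmetric] up .
    have a: "A X ?r k = A X r k * (1 - u * u * p * X)"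
      using A_Suc_left[OF k, of X] unfolding power_add up by (simp add: u_def mult_ac)
    have "c * (1 - p) * (1 - u * u * p * X) / (1 - u * p) =
      (gbin Q ?r k * (1 - p)) * (1 - u * u * p * X) / (A X ?r k * B X k * (1 - u * p))"
      by (simp add: c_def coeff_def v_def)
    also have "\<dots> = gbin Q r k * ((1 - u * p) * (1 - u * u * p * X)) /
        (A X r k * B X k * ((1 - u * p) * (1 - u * u * p * X)))"
      unfolding g a by (simp only: mult_ac)
    also have "\<dots> = coeff X r k"
      using r1 f1 by (simp add: coeff_def v_def)
    finally show ?thesis ..
  qed
  have ck1: "cert X ?r (Suc k) = p * c * (1 - p) * (1 - u * X) * (u ^ 3 * X) / ((1 - u ^ 2 * X) * (1 - u * p))"
  proof -
    let ?e = "1 - Q ^ (2 * k + 2) * X"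
    have s: "coeff X ?r (Suc k) * (1 - Q ^ Suc k) * (1 - Q ^ (?r + Suc k) * X) * (1 - u ^ 2 * X) =
        - c * (1 - p) * (1 - u * X) * ?e * (Q * u ^ 3 * X)"
    proof -
      have U: "Q ^ (2 * k) = u ^ 2" "Q ^ (3 * k + 1) = Q * u ^ 3"
        by (simp_all add: u_def power_mult[symmetric] mult.commute[of k])
      have "k < ?r" using k by simp
      from coeff_step[OF X nz this] show ?thesis
        unfolding U u_def[symmetric] p_def[symmetric] c_def[symmetric] .
    qed
    have pQ: "Q ^ (?r - Suc k) * Q = p" using k by (simp add: p_def Suc_diff_le mult.commute)
    have gen: "- a * (- c * x1 * x2 * E * (Q * x3 * X)) / (E * x4) = (a * Q) * c * x1 * x2 * (x3 * X) / x4"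
      if "E \<noteq> 0" for a E x1 x2 x3 x4
    proof -
      have "- a * (- c * x1 * x2 * E * (Q * x3 * X)) = E * ((a * Q) * c * x1 * x2 * (x3 * X))"
        by (simp add: mult_ac)
      then show ?thesis using that by simp
    qed
    have "cert X ?r (Suc k) * (1 - u ^ 2 * X) =
      - (Q ^ (?r - Suc k)) * (coeff X ?r (Suc k) * (1 - Q ^ Suc k) * (1 - Q ^ (?r + Suc k) * X) * (1 - u ^ 2 * X))
        / (?e * (1 - u * p))"
      unfolding cert_def up by (simp add: mult_ac del: power_Suc)
    also have "\<dots> = (Q ^ (?r - Suc k) * Q) * c * (1 - p) * (1 - u * X) * (u ^ 3 * X) / (1 - u * p)"
      unfolding s by (rule gen[OF e1])
    finally have *: "cert X ?r (Suc k) * (1 - u ^ 2 * X) =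
      p * c * (1 - p) * (1 - u * X) * (u ^ 3 * X) / (1 - u * p)" unfolding pQ .
    have "cert X ?r (Suc k) = cert X ?r (Suc k) * (1 - u ^ 2 * X) / (1 - u ^ 2 * X)" using b1 by simp
    then show ?thesis unfolding * divide_divide_eq_left by (simp only: mult.commute)
  qed
  have gen2: "c - x0 / R = x1 / (b * R) - x2 / (b * R)"
    if "R \<noteq> 0" "b \<noteq> 0" "(c * R - x0) * b = x1 - x2" for x0 x1 x2 R b
  proof -
    have "x1 / (b * R) - x2 / (b * R) = (c * R - x0) * b / (b * R)"
      unfolding that(3) by (simp only: diff_divide_distrib)
    also have "\<dots> = (c * R - x0) / R" using that(2) by simp
    also have "\<dots> = c - x0 / R" using that(1) by (simp add: diff_divide_distrib)
    finally show ?thesis ..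
  qed
  show ?thesis
    unfolding cr ck ck1 c_def[symmetric]
    by (rule gen2[OF r1 b1]) (simp add: algebra_simps power2_eq_square power3_eq_cube)
qed

text \<open>Says that the constant vector 1, the initial value of the recursion, is the sum of the
  eigenvectors \<open>v X k\<close> divided by \<open>B X k\<close>. Without a closed form for these
  coefficients there would be no closed form for the lattice sum.\<close>

lemma coeff_sum:
  assumes X: "X \<noteq> 0" and nz: "\<And>i. Q ^ i * X \<noteq> 1"
  shows "(\<Sum>k\<le>r. coeff X r k) = 1"
proof (induction r)
  case 0
  show ?case by (simp add: coeff_def v_def A_def D_def B_def)
next
  case (Suc r)
  have "(\<Sum>k\<le>r. coeff X (Suc r) k - coeff X r k) = cert X (Suc r) (Suc r) - cert X (Suc r) 0"
    using sum_telescope[of "cert X (Suc r)" r]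
    by (simp add: cert_diff[OF X nz] sum_subtractf)
      (metis (no_types, lifting) sum.cong sum_lessThan_telescope lessThan_Suc_atMost sum_subtractf)
  \<comment> \<open>On the diagonal the power of \<open>Q\<close> in the certificate has exponent 0
    and the remaining factors cancel, which leaves minus the coefficient; at \<open>k = 0\<close>
    the certificate is 0 by definition.\<close>
  also have "\<dots> = - coeff X (Suc r) (Suc r)"
  proof -
    have "1 - Q ^ Suc r \<noteq> 0" "1 - Q ^ (2 * Suc r) * X \<noteq> 0"
      using Q_root[of "Suc r"] nz[of "2 * Suc r"] by auto
    moreover have "Suc r + Suc r = 2 * Suc r" by simp
    ultimately show ?thesis by (simp add: cert_def del: power_Suc mult_Suc_right)
  qed
  finally show ?case using Suc by (simp add: sum_subtractf algebra_simps)
qed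

text \<open>\<open>f m\<close> is the \<open>m\<close>-th power of the matrix \<open>T X\<close>
  applied to the constant vector, which \<open>coeff_sum\<close> has expanded in eigenvectors; the
  eigenvalues accumulate. In the inner sums the range of \<open>k\<close> may be extended from
  \<open>s\<close> to \<open>r\<close>, as \<open>v X k s\<close> vanishes for
  \<open>s < k\<close>.\<close>

theorem closed_form:
  assumes X: "X \<noteq> 0" and nz: "\<And>i. Q ^ i * X \<noteq> 1"
    and f0: "\<And>r. f 0 r = 1" and fS: "\<And>m r. r \<le> n \<Longrightarrow> f (Suc m) r = (\<Sum>s\<le>r. T X r s * f m s)"
    and "r \<le> n"
  shows "f m r = (\<Sum>k\<le>r. coeff X r k * y X k ^ m)"
  using assms(5)
proof (induction m arbitrary: r)
  case 0
  then show ?case using coeff_sum[OF X nz] f0 by simp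
next
  case (Suc m)
  have c: "coeff X s k = v X k s / B X k" for s k by (simp add: coeff_def)
  have v0: "v X k s = 0" if "s < k" for s k using that by (simp add: v_def gbin_eq_0)
  have "f (Suc m) r = (\<Sum>s\<le>r. T X r s * (\<Sum>k\<le>s. coeff X s k * y X k ^ m))"
    using fS Suc by simp
  also have "\<dots> = (\<Sum>s\<le>r. \<Sum>k\<le>r. T X r s * (coeff X s k * y X k ^ m))"
  proof (intro sum.cong refl)
    fix s assume "s \<in> {..r}"
    then have "(\<Sum>k\<le>s. coeff X s k * y X k ^ m) = (\<Sum>k\<le>r. coeff X s k * y X k ^ m)"
      by (intro sum.mono_neutral_left) (auto simp: c v0)
    then show "T X r s * (\<Sum>k\<le>s. coeff X s k * y X k ^ m) = (\<Sum>k\<le>r. T X r s * (coeff X s k * y X k ^ m))"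
      by (simp add: sum_distrib_left)
  qed
  also have "\<dots> = (\<Sum>k\<le>r. y X k ^ m / B X k * (\<Sum>s\<le>r. T X r s * v X k s))"
    unfolding sum_distrib_left by (subst sum.swap) (intro sum.cong refl, simp add: c)
  also have "\<dots> = (\<Sum>k\<le>r. coeff X r k * y X k ^ Suc m)"
    by (intro sum.cong refl) (simp add: eigenvector[OF _ nz] c)
  finally show ?case .
qed

end

section \<open>The rational function and its inversion symmetry\<close>

text \<open>Closed form of the sum of \<open>t^(\<lambda>_1 + ... + \<lambda>_d) *
  z^(\<lambda>_(d-1) + \<lambda>_d)\<close> over the lattices of rank \<open>d\<close>, where
  \<lambda> is the type; it is obtained in \<open>zeta_factor_limit\<close>. At \<open>z = 1\<close>
  the numerator cancels the first two denominators generically, and the zeta function of sublattices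
  with factors \<open>1 - q^i * t\<close> for \<open>i < d\<close> is left.\<close>

definition zeta_factor :: "nat \<Rightarrow> 'k::field \<Rightarrow> 'k \<Rightarrow> 'k \<Rightarrow> 'k" where
  "zeta_factor d q t z =
    ((1 - t ^ d) * (1 - (q * t) ^ (d - 1) * z) - gbin q d (d - 1) * t ^ (d - 1) * (1 - t) * (1 - z)) *
    inverse ((1 - t ^ d * z ^ 2) * (1 - (q * t) ^ (d - 1) * z) * (\<Prod>i<d. 1 - q ^ i * t))"

text \<open>Sum over \<open>k\<close> of the expansion coefficient \<open>coeff X n k\<close> times
  \<open>zeta_factor\<close> at the eigenvalue \<open>y X k\<close>, written out for an arbitrary
  field: the same term is read at complex points, at the variables of the rational function field
  and at their inverses.\<close>

definition zeta_expr :: "nat \<Rightarrow> 'k::field \<Rightarrow> 'k \<Rightarrow> 'k" where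
  "zeta_expr d q t = (let n = d choose 2; Q = inverse q; X = q ^ (n + d) * t in
    \<Sum>k\<le>n. gbin Q n k * inverse (\<Prod>i<n - k. 1 - Q ^ Suc i * (Q ^ (2 * k) * X)) *
      inverse (\<Prod>i<k. 1 - inverse (Q ^ (k + i) * X)) * zeta_factor d q t (Q ^ (k * k) * X ^ k))"

text \<open>At \<open>w = 1\<close> both sides are 0 by the convention for \<open>inverse 0\<close>.
  Hence the inversion formulas that rest on it ask only for nonzero variables and not for nonzero
  denominators.\<close>

lemma inverse_one_minus: "w \<noteq> 0 \<Longrightarrow> inverse (1 - inverse w) = - w * inverse (1 - w :: 'k::field)"
  by (cases "w = 1") (auto simp: field_simps)

text \<open>The numerator together with the first two denominators contributes just
  \<open>z^2\<close>; the sign and the powers of \<open>q\<close> and \<open>t\<close> come from the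
  product of the \<open>1 - q^i * t\<close>. The numerator is stable because
  \<open>gbin q d (d - 1)\<close> is palindromic of degree \<open>d - 1\<close>, which matches the
  factor \<open>(q * t)^(d - 1)\<close>.\<close>

lemma zeta_factor_inverse:
  fixes q t z :: "'k::field"
  assumes nz: "q \<noteq> 0" "t \<noteq> 0" "z \<noteq> 0" and d: "d > 0"
  shows "zeta_factor d (inverse q) (inverse t) (inverse z) =
    (-1) ^ d * q ^ (d choose 2) * t ^ d * z ^ 2 * zeta_factor d q t z"
proof -
  define a b g where "a = t ^ (d - 1)" and "b = q ^ (d - 1)" and "g = gbin q d (d - 1)"
  define P where "P = (\<Prod>i<d. 1 - q ^ i * t)"
  have ab: "a \<noteq> 0" "b \<noteq> 0" using nz by (auto simp: a_def b_def)
  have td: "t ^ d = t * a" using d by (cases d) (auto simp: a_def)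
  have g: "gbin (inverse q) d (d - 1) = g * inverse b"
    using gbin_inverse[of q "d - 1" d] d nz by (simp add: g_def b_def field_simps)
  have P: "inverse (\<Prod>i<d. 1 - inverse q ^ i * inverse t) = (-1) ^ d * q ^ (d choose 2) * t ^ d * inverse P"
  proof -
    have "inverse (\<Prod>i<d. 1 - inverse q ^ i * inverse t) = (\<Prod>i<d. - (q ^ i * t) * inverse (1 - q ^ i * t))"
      unfolding prod_inversef[symmetric]
      by (intro prod.cong refl) (use nz inverse_one_minus[of "q ^ _ * t"] in \<open>simp add: power_inverse mult.commute\<close>)
    also have "\<dots> = (\<Prod>i<d. (-1) * q ^ i * t) * inverse P"
      unfolding P_def prod_inversef[symmetric] prod.distrib[symmetric] by simp
    also have "(\<Prod>i<d. (-1) * q ^ i * t) = (-1) ^ d * q ^ (\<Sum>i<d. i) * t ^ d"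
      unfolding prod.distrib by (simp add: power_sum)
    also have "(\<Sum>i<d. i) = d choose 2"
      by (induction d) (auto simp: numeral_2_eq_2)
    finally show ?thesis .
  qed
  define N where "N = (1 - t * a) * (1 - b * a * z) - g * a * (1 - t) * (1 - z)"
  have N: "(1 - inverse (t * a)) * (1 - inverse (b * a * z)) -
      g * inverse b * inverse a * (1 - inverse t) * (1 - inverse z) = N * inverse (t * a * (b * a) * z)"
    using nz ab by (simp add: N_def field_simps)
  have 1: "inverse (1 - inverse (t * a * z ^ 2)) = - (t * a * z ^ 2) * inverse (1 - t * a * z ^ 2)"
    "inverse (1 - inverse (b * a * z)) = - (b * a * z) * inverse (1 - b * a * z)"
    using nz ab inverse_one_minus[of "t * a * z ^ 2"] inverse_one_minus[of "b * a * z"] by simp_all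
  have i: "inverse t ^ d = inverse (t * a)" "inverse t ^ (d - 1) = inverse a"
    "(inverse q * inverse t) ^ (d - 1) = inverse (b * a)" "(q * t) ^ (d - 1) = b * a"
    by (simp_all only: td power_inverse) (simp_all add: a_def b_def power_mult_distrib power_inverse)
  have "zeta_factor d (inverse q) (inverse t) (inverse z) =
      ((1 - inverse (t * a)) * (1 - inverse (b * a * z)) -
        g * inverse b * inverse a * (1 - inverse t) * (1 - inverse z)) *
      (inverse (1 - inverse (t * a * z ^ 2)) * inverse (1 - inverse (b * a * z)) *
       inverse (\<Prod>i<d. 1 - inverse q ^ i * inverse t))"
    unfolding zeta_factor_def i g by (simp add: power_inverse)
  also have "\<dots> = N * inverse (t * a * (b * a) * z) * (t * a * z ^ 2 * (b * a * z)) * ((-1) ^ d * q ^ (d choose 2) * t ^ d) *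
      (inverse (1 - t * a * z ^ 2) * inverse (1 - b * a * z) * inverse P)"
    unfolding N 1 P by (simp add: mult_ac)
  also have "inverse (t * a * (b * a) * z) * (t * a * z ^ 2 * (b * a * z)) = z ^ 2"
    using nz ab by (simp add: field_simps)
  hence "N * inverse (t * a * (b * a) * z) * (t * a * z ^ 2 * (b * a * z)) = N * z ^ 2"
    by (simp only: mult.assoc)
  also have "N * z ^ 2 * ((-1) ^ d * q ^ (d choose 2) * t ^ d) *
      (inverse (1 - t * a * z ^ 2) * inverse (1 - b * a * z) * inverse P) =
    (-1) ^ d * q ^ (d choose 2) * t ^ d * z ^ 2 * zeta_factor d q t z"
    unfolding zeta_factor_def i td N_def g_def[symmetric] a_def[symmetric] P_def
    by (simp add: mult_ac)
  finally show ?thesis .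
qed

lemma sum_lessThan_choose: "(\<Sum>i<j. i) = (j choose 2 :: nat)"
  by (induction j) (auto simp: numeral_2_eq_2)

lemma choose_2_add: "(k + j) choose 2 = (k choose 2) + (j choose 2) + k * j"
  by (induction j) (auto simp: numeral_2_eq_2)

lemma choose_2_double: "2 * (j choose 2) + j = j * j"
  by (induction j) (auto simp: numeral_2_eq_2)

text \<open>Inverting \<open>q\<close> and \<open>t\<close> inverts \<open>X\<close> and every
  eigenvalue, and each summand acquires the same monomial, so the symmetry holds term by term. Of
  the signs, \<open>n - k\<close> come from the first product, \<open>k\<close> from the second and
  \<open>d\<close> from \<open>zeta_factor\<close>.\<close>

theorem zeta_expr_inverse:
  fixes q t :: "'k::field"
  assumes nz: "q \<noteq> 0" "t \<noteq> 0" and d: "d > 0"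
  shows "zeta_expr d (inverse q) (inverse t) =
    (-1) ^ ((d + 1) choose 2) * q ^ (((d + 1) choose 2) choose 2) * t ^ ((d + 1) choose 2) * zeta_expr d q t"
proof -
  define n Q X where "n = d choose 2" and "Q = inverse q" and "X = q ^ (n + d) * t"
  have D: "(d + 1) choose 2 = n + d" by (simp add: n_def numeral_2_eq_2)
  have DD: "(n + d) choose 2 = (n choose 2) + (d choose 2) + n * d" by (rule choose_2_add)
  have Xnz: "X \<noteq> 0" "Q \<noteq> 0" using nz by (auto simp: X_def Q_def)
  have qQ: "q ^ i * Q ^ i = 1" for i using nz by (simp add: Q_def power_inverse)
  have Xi: "inverse q ^ (n + d) * inverse t = inverse X" by (simp add: X_def power_inverse)
  have Qi: "inverse (inverse q) = inverse Q" "inverse Q = q" by (simp_all add: Q_def)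
  let ?g = "\<lambda>k. gbin Q n k" and ?P = "\<lambda>k. inverse (\<Prod>i<n - k. 1 - Q ^ Suc i * (Q ^ (2 * k) * X))"
    and ?R = "\<lambda>k. inverse (\<Prod>i<k. 1 - inverse (Q ^ (k + i) * X))"
    and ?Z = "\<lambda>k. zeta_factor d q t (Q ^ (k * k) * X ^ k)"
  have term_eq: "gbin q n k * inverse (\<Prod>i<n - k. 1 - q ^ Suc i * (q ^ (2 * k) * inverse X)) *
      inverse (\<Prod>i<k. 1 - inverse (q ^ (k + i) * inverse X)) *
      zeta_factor d (inverse q) (inverse t) (q ^ (k * k) * inverse X ^ k) =
      (-1) ^ (n + d) * q ^ ((n + d) choose 2) * t ^ (n + d) * (?g k * ?P k * ?R k * ?Z k)" if k: "k \<le> n" for k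
  proof -
    obtain j where j: "n = k + j" using k le_Suc_ex by blast
    have g: "gbin q n k = q ^ (k * j) * ?g k"
      using gbin_inverse[OF nz(1) k] j by (simp add: Q_def mult.commute)
    have w: "inverse (1 - q ^ Suc i * (q ^ (2 * k) * inverse X)) =
        (-1) * Q ^ i * (Q ^ (2 * k + 1) * X) * inverse (1 - Q ^ Suc i * (Q ^ (2 * k) * X))" for i
    proof -
      have "q ^ Suc i * (q ^ (2 * k) * inverse X) = inverse (Q ^ Suc i * (Q ^ (2 * k) * X))"
        by (simp add: Q_def power_inverse)
      then show ?thesis
        using inverse_one_minus[of "Q ^ Suc i * (Q ^ (2 * k) * X)"] Xnz by (simp add: mult_ac)
    qed
    have P: "inverse (\<Prod>i<n - k. 1 - q ^ Suc i * (q ^ (2 * k) * inverse X)) =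
        (-1) ^ j * Q ^ (j choose 2) * (Q ^ ((2 * k + 1) * j) * X ^ j) * ?P k"
    proof -
      have "inverse (\<Prod>i<n - k. 1 - q ^ Suc i * (q ^ (2 * k) * inverse X)) =
        (\<Prod>i<j. inverse (1 - q ^ Suc i * (q ^ (2 * k) * inverse X)))"
        unfolding prod_inversef[symmetric] using j by simp
      also have "\<dots> = (\<Prod>i<j. (-1) * Q ^ i * (Q ^ (2 * k + 1) * X) * inverse (1 - Q ^ Suc i * (Q ^ (2 * k) * X)))"
        by (rule prod.cong[OF refl w])
      also have "\<dots> = (-1) ^ j * Q ^ (\<Sum>i<j. i) * (Q ^ (2 * k + 1) * X) ^ j * ?P k"
        unfolding prod.distrib using j
        by (simp add: power_sum prod_inversef[symmetric] comp_def power_mult_distrib del: power_Suc)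
      finally show ?thesis unfolding sum_lessThan_choose power_mult_distrib power_mult .
    qed
    have u: "inverse (1 - inverse (q ^ (k + i) * inverse X)) =
        (-1) * q ^ i * (q ^ k * inverse X) * inverse (1 - inverse (Q ^ (k + i) * X))" for i
    proof -
      have "q ^ (k + i) * inverse X = inverse (Q ^ (k + i) * X)" by (simp add: Q_def power_inverse)
      then show ?thesis
        using inverse_one_minus[of "inverse (Q ^ (k + i) * X)"] Xnz
        by (simp add: mult_ac power_add)
    qed
    have R: "inverse (\<Prod>i<k. 1 - inverse (q ^ (k + i) * inverse X)) =
        (-1) ^ k * q ^ (k choose 2) * (q ^ (k * k) * inverse X ^ k) * ?R k"
    proof -
      have "inverse (\<Prod>i<k. 1 - inverse (q ^ (k + i) * inverse X)) =
        (\<Prod>i<k. (-1) * q ^ i * (q ^ k * inverse X) * inverse (1 - inverse (Q ^ (k + i) * X)))"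
        unfolding prod_inversef[symmetric] comp_def by (rule prod.cong[OF refl u])
      also have "\<dots> = (-1) ^ k * q ^ (\<Sum>i<k. i) * (q ^ k * inverse X) ^ k * ?R k"
        unfolding prod.distrib
        by (simp add: power_sum prod_inversef[symmetric] comp_def power_mult_distrib)
      finally show ?thesis unfolding sum_lessThan_choose power_mult_distrib power_mult .
    qed
    have z: "q ^ (k * k) * inverse X ^ k = inverse (Q ^ (k * k) * X ^ k)"
      by (simp add: Q_def power_inverse)
    have Z: "zeta_factor d (inverse q) (inverse t) (q ^ (k * k) * inverse X ^ k) =
        (-1) ^ d * q ^ (d choose 2) * t ^ d * (Q ^ (k * k) * X ^ k) ^ 2 * ?Z k"
      unfolding z by (rule zeta_factor_inverse) (use nz Xnz d in auto)
    \<comment> \<open>Balance of exponents. On the left stand the powers of \<open>q\<close> from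
      \<open>gbin\<close>, from the second product and from \<open>X^n\<close>; on the right the
      powers of \<open>Q\<close> from the first product and from the square of the eigenvalue, and
      the surplus \<open>n choose 2\<close>.\<close>
    have ex: "k * j + (k choose 2) + k * k + n * n =
        (j choose 2) + (2 * k + 1) * j + 2 * (k * k) + (n choose 2)"
      using choose_2_add[of k j] choose_2_double[of j] choose_2_double[of k]
      unfolding j by (simp add: algebra_simps)
    have qpow: "q ^ (k * j) * q ^ (k choose 2) * q ^ (k * k) * q ^ (n * n) *
        (Q ^ (j choose 2) * Q ^ ((2 * k + 1) * j) * Q ^ (2 * (k * k))) = q ^ (n choose 2)"
    proof -
      have "q ^ (k * j) * q ^ (k choose 2) * q ^ (k * k) * q ^ (n * n) =
        q ^ (n choose 2) * q ^ ((j choose 2) + (2 * k + 1) * j + 2 * (k * k))"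
        unfolding power_add[symmetric] ex by (simp add: add_ac)
      moreover have "Q ^ (j choose 2) * Q ^ ((2 * k + 1) * j) * Q ^ (2 * (k * k)) =
        Q ^ ((j choose 2) + (2 * k + 1) * j + 2 * (k * k))"
        unfolding power_add[symmetric] ..
      ultimately show ?thesis by (simp only: mult.assoc qQ mult_1_right)
    qed
    \<comment> \<open>The first product contributes \<open>X^j\<close>, the second the inverse of
      \<open>X^k\<close>, and the square of the eigenvalue \<open>X^(2k)\<close>.\<close>
    have Xpow: "X ^ j * inverse X ^ k * (X ^ k) ^ 2 = q ^ (n * n) * q ^ (n * d) * t ^ n"
    proof -
      have "X ^ j * inverse X ^ k * (X ^ k) ^ 2 = X ^ j * X ^ k"
        using Xnz by (simp add: power2_eq_square power_inverse)
      also have "\<dots> = X ^ n" unfolding j by (simp add: power_add mult.commute)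
      finally show ?thesis
        by (simp add: X_def power_mult_distrib power_mult[symmetric] power_add[symmetric] algebra_simps)
    qed
    have "gbin q n k * inverse (\<Prod>i<n - k. 1 - q ^ Suc i * (q ^ (2 * k) * inverse X)) *
      inverse (\<Prod>i<k. 1 - inverse (q ^ (k + i) * inverse X)) *
      zeta_factor d (inverse q) (inverse t) (q ^ (k * k) * inverse X ^ k) =
      ((-1) ^ j * (-1) ^ k * (-1) ^ d) * (X ^ j * inverse X ^ k * (X ^ k) ^ 2) *
      (q ^ (k * j) * q ^ (k choose 2) * q ^ (k * k) *
        (Q ^ (j choose 2) * Q ^ ((2 * k + 1) * j) * Q ^ (2 * (k * k)))) *
      (q ^ (d choose 2) * t ^ d) * (?g k * ?P k * ?R k * ?Z k)"
      unfolding g P R Z power_mult_distrib power_mult[symmetric] by (simp only: mult_ac)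
    also have "\<dots> = ((-1) ^ j * (-1) ^ k * (-1) ^ d) *
      (q ^ (k * j) * q ^ (k choose 2) * q ^ (k * k) * q ^ (n * n) *
        (Q ^ (j choose 2) * Q ^ ((2 * k + 1) * j) * Q ^ (2 * (k * k)))) *
      (q ^ (d choose 2) * q ^ (n * d)) * (t ^ n * t ^ d) * (?g k * ?P k * ?R k * ?Z k)"
      unfolding Xpow by (simp only: mult_ac)
    also have "(-1) ^ j * (-1) ^ k * (-1) ^ d = ((-1) ^ (n + d) :: 'k)"
      unfolding j by (simp add: power_add mult_ac)
    finally show ?thesis unfolding qpow DD by (simp only: power_add mult_ac)
  qed
  have "zeta_expr d (inverse q) (inverse t) =
    (\<Sum>k\<le>n. gbin q n k * inverse (\<Prod>i<n - k. 1 - q ^ Suc i * (q ^ (2 * k) * inverse X)) *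
      inverse (\<Prod>i<k. 1 - inverse (q ^ (k + i) * inverse X)) *
      zeta_factor d (inverse q) (inverse t) (q ^ (k * k) * inverse X ^ k))"
    unfolding zeta_expr_def Let_def n_def[symmetric] Xi by (simp only: inverse_inverse_eq)
  also have "\<dots> = (-1) ^ (n + d) * q ^ ((n + d) choose 2) * t ^ (n + d) *
      (\<Sum>k\<le>n. ?g k * ?P k * ?R k * ?Z k)"
    unfolding sum_distrib_left by (intro sum.cong refl term_eq) simp
  also have "(\<Sum>k\<le>n. ?g k * ?P k * ?R k * ?Z k) = zeta_expr d q t"
    unfolding zeta_expr_def Let_def n_def[symmetric] Q_def[symmetric] X_def[symmetric] ..
  finally show ?thesis unfolding D .
qed

section \<open>Limits of affine and triangular recursions\<close>

lemma affine_recursion_tendsto: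
  fixes a b :: "nat \<Rightarrow> 'k::real_normed_field"
  assumes rec: "\<And>m. a (Suc m) = u * a m + b m" and b: "b \<longlonglongrightarrow> c" and u: "norm u < 1"
  shows "a \<longlonglongrightarrow> c / (1 - u)"
proof -
  define l where "l = c / (1 - u)"
  have u1: "1 - u \<noteq> 0" using u by auto
  have l: "l = u * l + c" using u1 by (simp add: l_def field_simps)
  have step: "a (Suc m) - l = u * (a m - l) + (b m - c)" for m
    by (subst l) (simp add: rec algebra_simps)
  have "(\<lambda>m. a m - l) \<longlonglongrightarrow> 0"
  proof (rule LIMSEQ_I)
    fix e :: real assume e: "e > 0"
    define r where "r = norm u"
    have r: "0 \<le> r" "r < 1" using u by (auto simp: r_def)
    \<comment> \<open>This bound on the perturbation makes \<open>e / 2\<close> reproduce itself in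
      the error estimate, since \<open>r * (e / 2) + (1 - r) * (e / 2) = e / 2\<close>.\<close>
    have "(1 - r) * (e / 2) > 0" using r e by simp
    then obtain N where N: "\<And>m. m \<ge> N \<Longrightarrow> norm (b m - c) < (1 - r) * (e / 2)"
      using LIMSEQ_D[OF b] by blast
    have bd: "norm (a (N + k) - l) \<le> r ^ k * norm (a N - l) + e / 2" for k
    proof (induction k)
      case 0
      then show ?case using e by simp
    next
      case (Suc k)
      have "norm (a (Suc (N + k)) - l) \<le> norm (u * (a (N + k) - l)) + norm (b (N + k) - c)"
        unfolding step by (rule norm_triangle_ineq)
      also have "\<dots> \<le> r * (r ^ k * norm (a N - l) + e / 2) + (1 - r) * (e / 2)"
        using Suc N[of "N + k"] r by (intro add_mono) (auto simp: norm_mult r_def intro!: mult_left_mono)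
      also have "\<dots> = r ^ Suc k * norm (a N - l) + e / 2" by (simp add: field_simps)
      finally show ?case by simp
    qed
    have "(\<lambda>k. r ^ k * norm (a N - l)) \<longlonglongrightarrow> 0 * norm (a N - l)"
      using r by (intro tendsto_mult_right LIMSEQ_power_zero) auto
    then have lim: "(\<lambda>k. r ^ k * norm (a N - l)) \<longlonglongrightarrow> 0" by simp
    then obtain K where K: "\<And>k. k \<ge> K \<Longrightarrow> norm (r ^ k * norm (a N - l) - 0) < e / 2"
      using LIMSEQ_D[OF lim, of "e / 2"] e by auto
    have "norm (a n - l - 0) < e" if n: "n \<ge> N + K" for n
    proof -
      obtain k where k: "n = N + k" "k \<ge> K" using n by (metis add_le_cancel_left le_add1 le_iff_add le_trans)
      have "norm (a n - l) \<le> r ^ k * norm (a N - l) + e / 2" using bd k by simp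
      also have "\<dots> < e" using K[OF k(2)] by simp
      finally show ?thesis by simp
    qed
    then show "\<exists>no. \<forall>n\<ge>no. norm (a n - l - 0) < e" by blast
  qed
  then show ?thesis unfolding l_def[symmetric] by (rule LIM_zero_cancel)
qed

text \<open>Row \<open>r\<close> is an affine recursion with multiplier \<open>K r r\<close> whose
  inhomogeneous part converges by induction over the lower rows; \<open>h\<close> is the fixed
  vector. Row 0 is prescribed separately because its diagonal entry is 1 in the application.\<close>

lemma triangular_recursion_tendsto:
  fixes K :: "nat \<Rightarrow> nat \<Rightarrow> 'k::real_normed_field"
  assumes g: "\<And>m r. r \<le> d \<Longrightarrow> g (Suc m) r = (\<Sum>s\<le>r. K r s * g m s)" and g0: "\<And>m. g m 0 = h 0"
    and K: "\<And>r. 0 < r \<Longrightarrow> r \<le> d \<Longrightarrow> norm (K r r) < 1"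
    and h: "\<And>r. 0 < r \<Longrightarrow> r \<le> d \<Longrightarrow> h r * (1 - K r r) = (\<Sum>s<r. K r s * h s)"
    and "r \<le> d"
  shows "(\<lambda>m. g m r) \<longlonglongrightarrow> h r"
  using assms(5)
proof (induction r rule: less_induct)
  case (less r)
  show ?case
  proof (cases "r = 0")
    case True
    then show ?thesis using g0 by simp
  next
    case False
    have "(\<lambda>m. g m r) \<longlonglongrightarrow> (\<Sum>s<r. K r s * h s) / (1 - K r r)"
    proof (rule affine_recursion_tendsto)
      show "g (Suc m) r = K r r * g m r + (\<Sum>s<r. K r s * g m s)" for m
        using g[OF less.prems, of m] by (simp add: lessThan_Suc_atMost[symmetric] add.commute)
      show "(\<lambda>m. \<Sum>s<r. K r s * g m s) \<longlonglongrightarrow> (\<Sum>s<r. K r s * h s)"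
        using less by (intro tendsto_sum tendsto_mult_left) auto
      show "norm (K r r) < 1" using K False less.prems by simp
    qed
    moreover have "1 - K r r \<noteq> 0" using K[of r] False less.prems by auto
    then have "(\<Sum>s<r. K r s * h s) / (1 - K r r) = h r"
      using h[of r] False less.prems by (simp add: field_simps)
    ultimately show ?thesis by simp
  qed
qed

section \<open>Values of rational functions in two variables\<close>

lemma poly_map_poly_hom:
  fixes h :: "'a::comm_ring_1 \<Rightarrow> 'b::comm_ring_1"
  assumes h0: "h 0 = 0" and h1: "h 1 = 1" and ha: "\<And>a b. h (a + b) = h a + h b"
    and hm: "\<And>a b. h (a * b) = h a * h b"
  shows "poly (map_poly h (P + Q)) y = poly (map_poly h P) y + poly (map_poly h Q) y"
    and "poly (map_poly h (P * Q)) y = poly (map_poly h P) y * poly (map_poly h Q) y"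
    and "poly (map_poly h 1) y = 1"
proof -
  let ?e = "\<lambda>P. poly (map_poly h P) y"
  have pC: "?e (pCons a P) = h a + y * ?e P" for a P
    using h0 by (cases "a = 0 \<and> P = 0") (auto simp: map_poly_pCons)
  have add: "?e (P + Q) = ?e P + ?e Q" for P Q
    by (induction P Q rule: poly_induct2) (simp_all add: pC ha algebra_simps)
  show "?e (P + Q) = ?e P + ?e Q" by (rule add)
  have smult: "?e (Polynomial.smult a Q) = h a * ?e Q" for a Q
    by (induction Q) (simp_all add: pC hm algebra_simps h0)
  show "?e (P * Q) = ?e P * ?e Q"
    by (induction P) (simp_all add: pC add smult algebra_simps h0)
  have "?e (pCons 1 0) = 1" unfolding pC using h1 by simp
  then show "?e 1 = 1" by (simp add: one_pCons)
qed

lemma poly_of_rat_hom: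
  fixes x :: "'k::field_char_0"
  shows "poly (map_poly of_rat (P + Q)) x = poly (map_poly of_rat P) x + poly (map_poly of_rat Q) x"
    and "poly (map_poly of_rat (P * Q)) x = poly (map_poly of_rat P) x * poly (map_poly of_rat Q) x"
    and "poly (map_poly of_rat 1) x = 1"
  by (rule poly_map_poly_hom; simp add: of_rat_add of_rat_mult)+

lemma poly2_eval_hom:
  "poly2_eval x y (P + Q) = poly2_eval x y P + poly2_eval x y Q"
  "poly2_eval x y (P * Q) = poly2_eval x y P * poly2_eval x y Q"
  "poly2_eval x y 1 = 1"
  "poly2_eval x y 0 = 0"
  unfolding poly2_eval_def
  by ((rule poly_map_poly_hom; simp add: poly_of_rat_hom) | simp)+

lemma poly2_eval_uminus: "poly2_eval x y (- P) = - poly2_eval x y P"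
  using poly2_eval_hom(1)[of x y P "- P"] poly2_eval_hom(4)[of x y]
  by (simp add: eq_neg_iff_add_eq_0 add.commute)

text \<open>Relational form of \<open>ratfun2_eval\<close>: being defined at a point and having a
  certain value there are treated as one statement, which can be derived along the structure of an
  expression without choosing numerators and denominators.\<close>

definition rat_val :: "'k::field_char_0 \<Rightarrow> 'k \<Rightarrow> ratfun2 \<Rightarrow> 'k \<Rightarrow> bool" where
  "rat_val x y W z \<longleftrightarrow> (\<exists>P Q. W = Fraction_Field.Fract P Q \<and> poly2_eval x y Q \<noteq> 0 \<and>
     z = poly2_eval x y P / poly2_eval x y Q)"

lemma rat_valE:
  assumes "rat_val x y W z"
  obtains P Q where "W = Fraction_Field.Fract P Q" "poly2_eval x y Q \<noteq> 0" "Q \<noteq> 0"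
    "z = poly2_eval x y P / poly2_eval x y Q"
proof -
  obtain P Q where "W = Fraction_Field.Fract P Q" "poly2_eval x y Q \<noteq> 0"
    "z = poly2_eval x y P / poly2_eval x y Q" using assms by (auto simp: rat_val_def)
  moreover from this have "Q \<noteq> 0" using poly2_eval_hom(4) by auto
  ultimately show ?thesis using that by blast
qed

lemma rat_val_unique:
  assumes "rat_val x y W z" "rat_val x y W z'" shows "z = z'"
proof -
  obtain P Q where 1: "W = Fraction_Field.Fract P Q" "poly2_eval x y Q \<noteq> 0" "Q \<noteq> 0"
    "z = poly2_eval x y P / poly2_eval x y Q" using assms(1) by (rule rat_valE)
  obtain P' Q' where 2: "W = Fraction_Field.Fract P' Q'" "poly2_eval x y Q' \<noteq> 0" "Q' \<noteq> 0"
    "z' = poly2_eval x y P' / poly2_eval x y Q'" using assms(2) by (rule rat_valE)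
  have "P * Q' = P' * Q" using 1 2 by (simp add: eq_fract)
  then have "poly2_eval x y P * poly2_eval x y Q' = poly2_eval x y P' * poly2_eval x y Q"
    by (metis poly2_eval_hom(2))
  then show ?thesis using 1 2 by (simp add: frac_eq_eq)
qed

lemma ratfun2_eval_eq:
  assumes "rat_val x y W z" shows "ratfun2_eval x y W = z" "ratfun2_defined x y W"
proof -
  have "(THE z. rat_val x y W z) = z" using assms rat_val_unique by (blast intro: the_equality)
  then show "ratfun2_eval x y W = z" unfolding ratfun2_eval_def rat_val_def .
  show "ratfun2_defined x y W" using assms by (auto simp: ratfun2_defined_def rat_val_def)
qed

lemma rat_val_eval: "ratfun2_defined x y W \<Longrightarrow> rat_val x y W (ratfun2_eval x y W)"
  using ratfun2_eval_eq(1)[of x y W] by (auto simp: ratfun2_defined_def rat_val_def) blast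

lemma rat_val_add: assumes "rat_val x y V a" "rat_val x y W b" shows "rat_val x y (V + W) (a + b)"
  using assms(1)
proof (rule rat_valE)
  fix P Q assume 1: "V = Fraction_Field.Fract P Q" "poly2_eval x y Q \<noteq> 0" "Q \<noteq> 0"
    "a = poly2_eval x y P / poly2_eval x y Q"
  obtain P' Q' where 2: "W = Fraction_Field.Fract P' Q'" "poly2_eval x y Q' \<noteq> 0" "Q' \<noteq> 0"
    "b = poly2_eval x y P' / poly2_eval x y Q'" using assms(2) by (rule rat_valE)
  show ?thesis unfolding rat_val_def
    using 1 2 by (intro exI[of _ "P * Q' + P' * Q"] exI[of _ "Q * Q'"])
      (simp add: poly2_eval_hom add_frac_eq)
qed

lemma rat_val_mult: assumes "rat_val x y V a" "rat_val x y W b" shows "rat_val x y (V * W) (a * b)"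
  using assms(1)
proof (rule rat_valE)
  fix P Q assume 1: "V = Fraction_Field.Fract P Q" "poly2_eval x y Q \<noteq> 0" "Q \<noteq> 0"
    "a = poly2_eval x y P / poly2_eval x y Q"
  obtain P' Q' where 2: "W = Fraction_Field.Fract P' Q'" "poly2_eval x y Q' \<noteq> 0" "Q' \<noteq> 0"
    "b = poly2_eval x y P' / poly2_eval x y Q'" using assms(2) by (rule rat_valE)
  show ?thesis unfolding rat_val_def
    using 1 2 by (intro exI[of _ "P * P'"] exI[of _ "Q * Q'"]) (simp add: poly2_eval_hom)
qed

lemma rat_val_uminus: assumes "rat_val x y V a" shows "rat_val x y (- V) (- a)"
  using assms(1)
proof (rule rat_valE)
  fix P Q assume 1: "V = Fraction_Field.Fract P Q" "poly2_eval x y Q \<noteq> 0" "Q \<noteq> 0"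
    "a = poly2_eval x y P / poly2_eval x y Q"
  show ?thesis unfolding rat_val_def
    using 1 by (intro exI[of _ "- P"] exI[of _ "Q"]) (simp add: poly2_eval_uminus)
qed

lemma rat_val_diff: "rat_val x y V a \<Longrightarrow> rat_val x y W b \<Longrightarrow> rat_val x y (V - W) (a - b)"
  using rat_val_add[of x y V a "- W" "- b"] rat_val_uminus by fastforce

lemma rat_val_inverse: assumes "rat_val x y V a" "a \<noteq> 0" shows "rat_val x y (inverse V) (inverse a)"
  using assms(1)
proof (rule rat_valE)
  fix P Q assume 1: "V = Fraction_Field.Fract P Q" "poly2_eval x y Q \<noteq> 0" "Q \<noteq> 0"
    "a = poly2_eval x y P / poly2_eval x y Q"
  show ?thesis unfolding rat_val_def
    using 1 assms(2) by (intro exI[of _ "Q"] exI[of _ "P"]) auto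
qed

lemma rat_val_1: "rat_val x y 1 1"
  unfolding rat_val_def by (intro exI[of _ 1] exI[of _ 1]) (simp add: poly2_eval_hom One_fract_def)

lemma rat_val_0: "rat_val x y 0 0"
  using rat_val_diff[OF rat_val_1 rat_val_1] by simp

lemma rat_val_q: "rat_val x y q_var x"
  unfolding rat_val_def q_var_def
  by (intro exI[of _ "[:[:0, 1:]:]"] exI[of _ 1])
    (simp add: poly2_eval_hom, simp add: poly2_eval_def map_poly_pCons)

lemma rat_val_t: "rat_val x y t_var y"
  unfolding rat_val_def t_var_def
  by (intro exI[of _ "[:0, 1:]"] exI[of _ 1])
    (simp add: poly2_eval_hom, simp add: poly2_eval_def map_poly_pCons)

lemma rat_val_power: "rat_val x y V a \<Longrightarrow> rat_val x y (V ^ n) (a ^ n)"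
  by (induction n) (auto intro: rat_val_1 rat_val_mult)

lemma rat_val_sum: "(\<And>i. i \<in> I \<Longrightarrow> rat_val x y (f i) (g i)) \<Longrightarrow> rat_val x y (sum f I) (sum g I)"
  by (induction I rule: infinite_finite_induct) (auto intro: rat_val_0 rat_val_add)

lemma rat_val_prod: "(\<And>i. i \<in> I \<Longrightarrow> rat_val x y (f i) (g i)) \<Longrightarrow> rat_val x y (prod f I) (prod g I)"
  by (induction I rule: infinite_finite_induct) (auto intro: rat_val_1 rat_val_mult)

lemma rat_val_gbin: "rat_val x y V a \<Longrightarrow> rat_val x y (gbin V n k) (gbin a n k)"
proof (induction n arbitrary: k)
  case 0
  then show ?case by (cases k) (auto intro: rat_val_1 rat_val_0)
next
  case (Suc n)
  then show ?case
    by (cases k) (auto intro!: rat_val_1 rat_val_add rat_val_mult rat_val_power)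
qed

lemmas rat_val_intros = rat_val_diff rat_val_mult rat_val_power rat_val_1 rat_val_q rat_val_t
  rat_val_gbin rat_val_prod

text \<open>Every denominator of \<open>zeta_expr\<close> is built from factors \<open>1 - w\<close>
  or \<open>1 - inverse w\<close>, where \<open>w\<close> is \<open>x^a * y^c\<close> divided by a
  power of \<open>x\<close>, with \<open>c > 0\<close> and \<open>a \<le> N * c\<close> for
  \<open>N = (d choose 2) + d\<close>. The bound on \<open>a\<close> is what a point
  \<open>(q, q^(-s))\<close> with \<open>Re s > N\<close> can guarantee, as \<open>q^N * y\<close>
  then has norm below 1.\<close>

definition regular_at :: "nat \<Rightarrow> 'k::field \<Rightarrow> 'k \<Rightarrow> bool" where
  "regular_at N x y \<longleftrightarrow> x \<noteq> 0 \<and> y \<noteq> 0 \<and> (\<forall>a b c. 0 < c \<longrightarrow> a \<le> N * c \<longrightarrow> x ^ a * y ^ c \<noteq> x ^ b)"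

lemma regular_atD:
  assumes "regular_at N x y" "0 < c" "a \<le> N * c"
  shows "inverse x ^ b * (x ^ a * y ^ c) \<noteq> 1"
proof
  assume "inverse x ^ b * (x ^ a * y ^ c) = 1"
  then have "x ^ b * (inverse x ^ b * (x ^ a * y ^ c)) = x ^ b" by simp
  moreover have "x ^ b * (inverse x ^ b * (x ^ a * y ^ c)) = x ^ a * y ^ c"
    using assms(1) by (simp add: regular_at_def power_inverse)
  ultimately show False using assms by (simp add: regular_at_def)
qed

text \<open>A structural computation of the value; its content is that the monomials occurring in
  the denominators obey the exponent bound of \<open>regular_at\<close>. For the eigenvalue the
  exponents are \<open>(n + d) * k\<close> of \<open>x\<close> and \<open>k\<close> of
  \<open>y\<close>, up to a negative power of \<open>x\<close>.\<close>

lemma zeta_expr_rat_val: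
  assumes reg: "regular_at ((d choose 2) + d) x y" and d: "d \<ge> 2"
  shows "rat_val x y (zeta_expr d q_var t_var) (zeta_expr d x y)"
proof -
  define n where "n = d choose 2"
  have nz: "x \<noteq> 0" "y \<noteq> 0" using reg by (auto simp: regular_at_def)
  let ?X = "q_var ^ (n + d) * t_var" and ?x = "x ^ (n + d) * y"
  have X: "rat_val x y ?X ?x" by (intro rat_val_intros)
  have Q: "rat_val x y (inverse q_var) (inverse x)" by (intro rat_val_inverse rat_val_q nz)
  have x1: "inverse x ^ b * ?x \<noteq> 1" for b
    using regular_atD[OF reg, of 1 "n + d" b] by (simp add: n_def)
  have Z: "rat_val x y (zeta_factor d q_var t_var (inverse q_var ^ (k * k) * ?X ^ k))
      (zeta_factor d x y (inverse x ^ (k * k) * ?x ^ k))" for k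
  proof -
    let ?Z = "inverse q_var ^ (k * k) * ?X ^ k" and ?z = "inverse x ^ (k * k) * ?x ^ k"
    have z: "rat_val x y ?Z ?z" by (intro rat_val_intros Q)
    have zz: "?z = inverse x ^ (k * k) * (x ^ ((n + d) * k) * y ^ k)"
      by (simp add: power_mult_distrib power_mult)
    have "y ^ d * ?z ^ 2 = inverse x ^ (2 * (k * k)) * (x ^ (2 * ((n + d) * k)) * y ^ (d + 2 * k))"
      unfolding zz by (simp add: power_mult_distrib power_mult[symmetric] power_add mult_ac)
    also have "\<dots> \<noteq> 1"
      by (rule regular_atD[OF reg]) (use d in \<open>auto simp: n_def algebra_simps\<close>)
    finally have 1: "1 - y ^ d * ?z ^ 2 \<noteq> 0" by auto
    have "(x * y) ^ (d - 1) * ?z = inverse x ^ (k * k) * (x ^ (d - 1 + (n + d) * k) * y ^ (d - 1 + k))"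
      unfolding zz by (simp add: power_mult_distrib power_add mult_ac)
    also have "\<dots> \<noteq> 1"
    proof (rule regular_atD[OF reg])
      have "(d - 1) * 1 \<le> (d - 1) * (n + d)" using d by (intro mult_left_mono) auto
      then show "d - 1 + (n + d) * k \<le> ((d choose 2) + d) * (d - 1 + k)"
        unfolding n_def[symmetric] distrib_left by (intro add_mono) (simp_all add: mult.commute)
    qed (use d in auto)
    finally have 2: "1 - (x * y) ^ (d - 1) * ?z \<noteq> 0" by auto
    have "x ^ i * y \<noteq> 1" if "i < d" for i
      using regular_atD[OF reg, of 1 i 0] that by simp
    then have 3: "(\<Prod>i<d. 1 - x ^ i * y) \<noteq> 0" by auto
    show ?thesis
      unfolding zeta_factor_def
      by (intro rat_val_intros rat_val_inverse z) (use 1 2 3 in auto)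
  qed
  show ?thesis
    unfolding zeta_expr_def Let_def n_def[symmetric]
  proof (intro rat_val_sum rat_val_mult Z rat_val_gbin Q rat_val_inverse rat_val_prod rat_val_diff
      rat_val_1 rat_val_power X)
    show "inverse x ^ (k + i) * ?x \<noteq> 0" for k i using nz by simp
    show "(\<Prod>i<n - k. 1 - inverse x ^ Suc i * (inverse x ^ (2 * k) * ?x)) \<noteq> 0" for k
    proof -
      have "1 - inverse x ^ Suc i * (inverse x ^ (2 * k) * ?x) \<noteq> 0" for i
        using x1[of "Suc i + 2 * k"] unfolding power_add[of _ "Suc i"] by (auto simp: mult.assoc)
      then show ?thesis by auto
    qed
    show "(\<Prod>i<k. 1 - inverse (inverse x ^ (k + i) * ?x)) \<noteq> 0" for k
    proof -
      have "1 - inverse (inverse x ^ (k + i) * ?x) \<noteq> 0" for i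
        using x1[of "k + i"] by (metis eq_iff_diff_eq_0 inverse_1 inverse_inverse_eq)
      then show ?thesis by auto
    qed
  qed (rule rat_val_q rat_val_t)+
qed

text \<open>Comparison of degrees in the outer variable: a power of \<open>q_var\<close> has degree
  0 in \<open>t_var\<close>, a monomial with \<open>c > 0\<close> does not.\<close>

lemma regular_at_inverse_vars: "regular_at N (inverse q_var) (inverse t_var)"
proof -
  have q: "q_var ^ a = Fraction_Field.Fract [:[:0, 1:] ^ a:] 1" for a
    by (induction a) (simp_all add: q_var_def One_fract_def one_pCons)
  have t: "t_var ^ c = Fraction_Field.Fract ([:0, 1:] ^ c) 1" for c
    by (induction c) (simp_all add: t_var_def One_fract_def)
  have nz: "q_var \<noteq> 0" "t_var \<noteq> 0"
    by (simp_all add: q_var_def t_var_def Zero_fract_def eq_fract)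
  have ne: "q_var ^ b \<noteq> q_var ^ a * t_var ^ c" if "c > 0" for a b c
  proof
    assume "q_var ^ b = q_var ^ a * t_var ^ c"
    then have "[:[:0, 1:] ^ b:] = Polynomial.smult ([:0, 1:] ^ a) ([:0, 1:] ^ c :: rat poly poly)"
      unfolding q t by (simp add: eq_fract)
    then have "degree ([:0, 1:] ^ c :: rat poly poly) = 0"
      by (metis degree_pCons_0 degree_smult_eq pCons_eq_0_iff power_not_zero zero_neq_one)
    then show False using that by (simp add: degree_power_eq)
  qed
  have "inverse q_var ^ a * inverse t_var ^ c \<noteq> inverse q_var ^ b" if "c > 0" for a b c
    using ne[OF that, of b a] nz by (simp add: power_inverse field_simps)
  then show ?thesis using nz by (simp add: regular_at_def)
qed

text \<open>Substituting the inverse variables is evaluation at a point of the rational function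
  field over itself. As no denominator vanishes there, the value is the same expression in the
  inverse variables, to which \<open>zeta_expr_inverse\<close> applies in that field.\<close>

lemma ratfun2_functional_equation:
  assumes "d \<ge> 2"
  shows "ratfun2_eval (inverse q_var) (inverse t_var) (zeta_expr d q_var t_var) =
    (-1) ^ ((d + 1) choose 2) * q_var ^ (((d + 1) choose 2) choose 2) * t_var ^ ((d + 1) choose 2) *
    zeta_expr d q_var t_var"
proof -
  have "q_var \<noteq> 0" "t_var \<noteq> 0"
    using regular_at_inverse_vars[of 0] by (auto simp: regular_at_def)
  then show ?thesis
    using ratfun2_eval_eq(1)[OF zeta_expr_rat_val[OF regular_at_inverse_vars assms]]
      zeta_expr_inverse[of q_var t_var d] assms by simp
qed

text \<open>A rational function is determined by its values at infinitely many \<open>t\<close> for infinitely many \<open>q\<close>.\<close>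

lemma ratfun2_eqI:
  fixes V W :: ratfun2
  assumes inf: "infinite A" and inf2: "\<And>x :: complex. x \<in> A \<Longrightarrow> infinite (B x)"
    and val: "\<And>x y. x \<in> A \<Longrightarrow> y \<in> B x \<Longrightarrow> \<exists>z. rat_val x y V z \<and> rat_val x y W z"
  shows "V = W"
proof -
  obtain P Q where PQ: "V - W = Fraction_Field.Fract P Q" "Q \<noteq> 0" by (cases "V - W")
  have zero: "poly2_eval x y P = 0" if xy: "x \<in> A" "y \<in> B x" for x y
  proof -
    obtain z where "rat_val x y V z" "rat_val x y W z" using val[OF xy] by blast
    then have "rat_val x y (V - W) 0" using rat_val_diff by fastforce
    then obtain P' Q' where "V - W = Fraction_Field.Fract P' Q'" "poly2_eval x y Q' \<noteq> 0" "Q' \<noteq> 0"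
      "0 = poly2_eval x y P' / poly2_eval x y Q'" by (rule rat_valE)
    moreover from this have "P * Q' = P' * Q" using PQ by (simp add: eq_fract)
    then have "poly2_eval x y P * poly2_eval x y Q' = poly2_eval x y P' * poly2_eval x y Q"
      by (metis poly2_eval_hom(2))
    ultimately show ?thesis by simp
  qed
  have "P = 0"
  proof (rule ccontr)
    assume "P \<noteq> 0"
    let ?h = "\<lambda>x c. poly (map_poly of_rat c) x :: complex"
    \<comment> \<open>For fixed \<open>x\<close> the polynomial in the outer variable has infinitely
      many roots, so all its coefficients vanish at \<open>x\<close>. The leading coefficient of
      \<open>P\<close> then vanishes at all of the infinitely many \<open>x\<close>, a
      contradiction.\<close>
    have "?h x (poly.coeff P i) = 0" if x: "x \<in> A" for x i
    proof -
      have "map_poly (?h x) P = 0"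
      proof (rule ccontr)
        assume "map_poly (?h x) P \<noteq> 0"
        then have "finite {y. poly (map_poly (?h x) P) y = 0}" by (rule poly_roots_finite)
        moreover have "B x \<subseteq> {y. poly (map_poly (?h x) P) y = 0}"
          using zero[OF x] by (auto simp: poly2_eval_def)
        ultimately show False using inf2[OF x] finite_subset by blast
      qed
      then have "poly.coeff (map_poly (?h x) P) i = 0" by simp
      then show ?thesis by (simp add: coeff_map_poly)
    qed
    then have "A \<subseteq> {x. poly (map_poly of_rat (lead_coeff P)) x = 0}" by auto
    moreover have "map_poly of_rat (lead_coeff P) \<noteq> (0 :: complex poly)"
    proof
      assume "map_poly of_rat (lead_coeff P) = (0 :: complex poly)"
      then have "of_rat (poly.coeff (lead_coeff P) i) = (0 :: complex)" for i
        by (metis coeff_0 coeff_map_poly of_rat_0)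
      then have "lead_coeff P = 0" by (simp add: poly_eq_iff)
      then show False using \<open>P \<noteq> 0\<close> by simp
    qed
    ultimately show False using inf finite_subset poly_roots_finite by blast
  qed
  then have "V - W = 0" using PQ by (simp add: Zero_fract_def eq_fract)
  then show ?thesis by simp
qed

section \<open>Uniformizers, and power series over a prime field\<close>

context cring
begin

lemma PIdl_iff: "p \<in> carrier R \<Longrightarrow> x \<in> PIdl p \<longleftrightarrow> (\<exists>c\<in>carrier R. x = p \<otimes> c)"
  by (auto simp: cgenideal_def m_comm)

lemma PIdl_Unit: "a \<in> Units R \<Longrightarrow> ideal I R \<Longrightarrow> a \<in> I \<Longrightarrow> I = carrier R"
  by (metis Units_closed Units_l_inv ideal.I_l_closed ideal.one_imp_carrier Units_inv_closed)

text \<open>A proper ideal consists of nonunits, and these are multiples of \<open>p\<close>; hence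
  every proper ideal lies in \<open>PIdl p\<close>.\<close>

lemma unique_maximalideal:
  assumes p: "p \<in> carrier R" "p \<notin> Units R"
    and dich: "\<And>a. a \<in> carrier R \<Longrightarrow> a \<in> Units R \<or> (\<exists>b\<in>carrier R. a = p \<otimes> b)"
  shows "maximalideal P R \<longleftrightarrow> P = PIdl p"
proof -
  have proper: "PIdl p \<noteq> carrier R"
    using ideal_eq_carrier_iff[OF p(1)] p(2) by auto
  have mem: "a \<in> PIdl p" if "a \<in> carrier R" "a \<notin> Units R" for a
    using dich[OF that(1)] that(2) PIdl_iff[OF p(1)] by auto
  have sub: "I \<subseteq> PIdl p" if "ideal I R" "I \<noteq> carrier R" for I
    using mem PIdl_Unit[OF _ that(1)] that ideal.Icarr[OF that(1)] by blast
  have max: "maximalideal (PIdl p) R"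
  proof (rule maximalidealI)
    show "ideal (PIdl p) R" by (rule cgenideal_ideal[OF p(1)])
    show "carrier R \<noteq> PIdl p" using proper by simp
    fix J assume J: "ideal J R" "PIdl p \<subseteq> J" "J \<subseteq> carrier R"
    then show "J = PIdl p \<or> J = carrier R" using sub[OF J(1)] by auto
  qed
  show ?thesis
  proof
    assume P: "maximalideal P R"
    then interpret P: maximalideal P R .
    have "P \<subseteq> PIdl p" by (rule sub[OF P.is_ideal]) (use P.I_notcarr in auto)
    then show "P = PIdl p"
      using P.I_maximal[OF cgenideal_ideal[OF p(1)]] proper ideal.Icarr[OF cgenideal_ideal[OF p(1)]] by blast
  qed (use max in simp)
qed

lemma max_ideal_pow_PIdl:
  assumes "max_ideal R = PIdl p" "p \<in> carrier R"
  shows "max_ideal_pow R n = PIdl (p [^] n)"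
proof (induction n)
  case 0
  have "PIdl \<one> = carrier R" using ideal_eq_carrier_iff[of \<one>] by simp
  then show ?case by (simp add: max_ideal_pow_def ideals_set_def nat_pow_def)
next
  case (Suc n)
  have id: "ideal (PIdl a) R" if "a \<in> carrier R" for a by (rule cgenideal_ideal[OF that])
  have "max_ideal_pow R (Suc n) = ideal_prod R (max_ideal_pow R n) (PIdl p)"
    by (simp add: max_ideal_pow_def assms ideals_set_def nat_pow_def)
  also have "\<dots> = Idl (PIdl (p [^] n) <#> PIdl p)"
    unfolding Suc by (rule ideal_prod_eq_genideal) (use assms id in auto)
  also have "PIdl (p [^] n) <#> PIdl p = PIdl (p [^] Suc n)"
    using cgenideal_prod[of "p [^] n" p] assms by simp
  also have "Idl \<dots> = \<dots>"
  proof
    have i: "ideal (PIdl (p [^] Suc n)) R" using assms by (intro id) auto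
    show "Idl (PIdl (p [^] Suc n)) \<subseteq> PIdl (p [^] Suc n)" by (rule genideal_minimal[OF i]) simp
    show "PIdl (p [^] Suc n) \<subseteq> Idl (PIdl (p [^] Suc n))"
      using ideal.Icarr[OF i] by (intro genideal_self) auto
  qed
  finally show ?case .
qed

lemma istopology_adic:
  assumes p: "max_ideal R = PIdl p" "p \<in> carrier R"
  shows "istopology (\<lambda>U. U \<subseteq> carrier R \<and> (\<forall>x\<in>U. \<exists>n. max_ideal_pow R n +>\<^bsub>R\<^esub> x \<subseteq> U))"
proof -
  have mono: "max_ideal_pow R (n + m) \<subseteq> max_ideal_pow R n" for n m
    using to_contain_is_to_divide[of "p [^] n" "p [^] (n + m)"] p
    unfolding max_ideal_pow_PIdl[OF p] by (auto simp: nat_pow_mult[symmetric])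
  have co: "I +>\<^bsub>R\<^esub> x \<subseteq> J +>\<^bsub>R\<^esub> x" if "I \<subseteq> J" for I J x
    using that by (auto simp: a_r_coset_def r_coset_def)
  have "\<exists>n. max_ideal_pow R n +>\<^bsub>R\<^esub> x \<subseteq> S \<inter> T"
    if "max_ideal_pow R n +>\<^bsub>R\<^esub> x \<subseteq> S" "max_ideal_pow R m +>\<^bsub>R\<^esub> x \<subseteq> T" for S T x n m
    using that co[OF mono[of n m], of x] co[OF mono[of m n], of x]
    by (intro exI[of _ "n + m"]) (auto simp: add.commute)
  then show ?thesis
    unfolding istopology_def by (auto; meson Union_upper subset_trans)
qed

lemma openin_adic:
  assumes "max_ideal R = PIdl p" "p \<in> carrier R"
  shows "openin (adic_topology R) U \<longleftrightarrow>
    U \<subseteq> carrier R \<and> (\<forall>x\<in>U. \<exists>n::nat. PIdl (p [^] n) +>\<^bsub>R\<^esub> x \<subseteq> U)"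
  unfolding adic_topology_def using topology_inverse'[OF istopology_adic[OF assms]]
    max_ideal_pow_PIdl[OF assms] by simp

lemma topspace_adic:
  assumes "max_ideal R = PIdl p" "p \<in> carrier R"
  shows "topspace (adic_topology R) = carrier R"
proof
  show "topspace (adic_topology R) \<subseteq> carrier R"
    using openin_topspace[of "adic_topology R"] unfolding openin_adic[OF assms] by simp
  have "PIdl (p [^] (0::nat)) +>\<^bsub>R\<^esub> x \<subseteq> carrier R" if "x \<in> carrier R" for x
    using that ideal.Icarr[OF cgenideal_ideal[of \<one>]]
    by (auto simp: a_r_coset_def r_coset_def)
  then have "openin (adic_topology R) (carrier R)" unfolding openin_adic[OF assms] by blast
  then show "carrier R \<subseteq> topspace (adic_topology R)" by (rule openin_subset)
qed

end

text \<open>A generator of the maximal ideal works: an irreducible divisor of a nonzero nonunit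
  generates a maximal ideal, which is the only one. Compactness enters through the finiteness of the
  residue ring, the cosets of the maximal ideal being an open cover.\<close>

lemma is_cDVR_uniformizer:
  fixes R (structure)
  assumes "is_cDVR R"
  obtains p where "uniformizer R p (residue_card R)" "principal_domain R" "p \<noteq> \<zero>\<^bsub>R\<^esub>"
    "\<And>n::nat. max_ideal_pow R n = PIdl\<^bsub>R\<^esub> (p [^]\<^bsub>R\<^esub> n)"
proof -
  interpret principal_domain R using assms by (simp add: is_cDVR_def is_dvr_def)
  have notfield: "\<not> field R" and ex1: "\<exists>!P. maximalideal P R" using assms by (auto simp: is_cDVR_def is_dvr_def)
  have mx: "maximalideal (max_ideal R) R" unfolding max_ideal_def by (rule theI'[OF ex1])
  obtain p where p: "p \<in> carrier R" "max_ideal R = PIdl p"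
    using exists_gen[OF maximalideal.axioms(1)[OF mx]] by blast
  have proper: "PIdl p \<noteq> carrier R" using mx p maximalideal.I_notcarr by metis
  have nonunit: "p \<notin> Units R" using proper ideal_eq_carrier_iff[OF p(1)] by auto
  have "p \<noteq> \<zero>"
  proof
    assume "p = \<zero>"
    then have "PIdl p = {\<zero>}" using PIdl_iff[of \<zero>] by auto
    then show False using mx p zeromaximalideal_eq_field notfield by simp
  qed
  have dich: "a \<in> Units R \<or> (\<exists>b\<in>carrier R. a = p \<otimes> b)" if a: "a \<in> carrier R" for a
  proof (cases "a = \<zero>")
    case True
    then show ?thesis using p by (intro disjI2 bexI[of _ \<zero>]) auto
  next
    case False
    show ?thesis
    proof (cases "a \<in> Units R")
      case False
      then obtain b where b: "b \<in> carrier R" "ring_irreducible b" "b divides a"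
        using exists_irreducible_divisor[of a] \<open>a \<noteq> \<zero>\<close> a by blast
      have "PIdl b = PIdl p" using irreducible_imp_maximalideal[OF b(1,2)] ex1 mx p by auto
      moreover have "a \<in> PIdl b" using b PIdl_iff[OF b(1)] a by (auto simp: factor_def)
      ultimately show ?thesis using PIdl_iff[OF p(1)] by auto
    qed simp
  qed
  let ?C = "(\<lambda>a. PIdl p +>\<^bsub>R\<^esub> a) ` carrier R"
  have card: "card ?C = residue_card R"
    unfolding residue_card_def p(2) by (simp add: FactRing_def A_RCOSETS_def' UNION_singleton_eq_range)
  have I: "ideal (PIdl p) R" by (rule cgenideal_ideal[OF p(1)])
  have P: "additive_subgroup (PIdl p) R" using I by (rule ideal.axioms)
  have fin: "finite ?C"
  proof -
    have op: "openin (adic_topology R) X" if X: "X \<in> ?C" for X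
    proof -
      obtain a where a: "a \<in> carrier R" "X = PIdl p +>\<^bsub>R\<^esub> a" using X by auto
      have "PIdl (p [^] (1::nat)) +>\<^bsub>R\<^esub> x \<subseteq> X" if "x \<in> X" for x
        using that a a_repr_independence'[OF _ _ additive_subgroup.a_subgroup[OF P], of x a]
          p by (simp add: a_r_coset_def)
      moreover have "X \<subseteq> carrier R"
        using a ideal.Icarr[OF I] by (auto simp: a_r_coset_def r_coset_def)
      ultimately show ?thesis unfolding openin_adic[OF p(2,1)] by blast
    qed
    have "a \<in> PIdl p +>\<^bsub>R\<^esub> a" if "a \<in> carrier R" for a
      using additive_subgroup.zero_closed[OF P] that unfolding a_r_coset_def'
      by (intro UN_I[of \<zero>]) auto
    then have cov: "carrier R \<subseteq> \<Union>?C" by auto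
    have "compactin (adic_topology R) (carrier R)"
      using assms topspace_adic[OF p(2,1)] by (simp add: is_cDVR_def compact_space_def)
    then obtain F where F: "finite F" "F \<subseteq> ?C" "carrier R \<subseteq> \<Union>F"
      using op cov unfolding compactin_def by (metis (no_types, lifting))
    \<comment> \<open>Cosets that share an element coincide, so none can be omitted from a cover:
      the finite subcover contains all of them.\<close>
    have "?C \<subseteq> F"
    proof
      fix X assume "X \<in> ?C"
      then obtain a where a: "a \<in> carrier R" "X = PIdl p +>\<^bsub>R\<^esub> a" by auto
      then obtain Y where Y: "Y \<in> F" "a \<in> Y" using F(3) by blast
      then obtain b where b: "b \<in> carrier R" "Y = PIdl p +>\<^bsub>R\<^esub> b" using F(2) by blast
      have "Y = X"
        using a_repr_independence'[OF _ _ additive_subgroup.a_subgroup[OF P], of a b] Y b a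
        by (simp add: a_r_coset_def)
      then show "X \<in> F" using Y by simp
    qed
    then show ?thesis using F(1) by (rule finite_subset)
  qed
  have "?C \<noteq> {}" by auto
  then have "card ?C > 0" using fin by (simp add: card_gt_0_iff)
  then have "residue_card R > 0" unfolding card .
  then have "uniformizer R p (residue_card R)"
    using p nonunit dich card by (unfold_locales) auto
  then show ?thesis
    using that principal_domain_axioms \<open>p \<noteq> \<zero>\<close> max_ideal_pow_PIdl[OF p(2,1)] by blast
qed

section \<open>The discrete valuation ring of power series over a prime field\<close>

no_notation vec_nth (infixl \<open>$\<close> 90)
unbundle fps_syntax

text \<open>Elements are sequences of residues below \<open>p\<close>, which gives the ring a
  carrier in the type that \<open>is_no_overlap_zeta\<close> quantifies over. Through this lift and
  \<open>fps_red\<close> all ring laws are inherited from integer power series.\<close>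

definition fps_lift :: "(nat \<Rightarrow> nat) \<Rightarrow> int fps" where
  "fps_lift f = Abs_fps (\<lambda>n. int (f n))"

definition fps_red :: "nat \<Rightarrow> int fps \<Rightarrow> nat \<Rightarrow> nat" where
  "fps_red p F = (\<lambda>n. nat (fps_nth F n mod int p))"

text \<open>\<open>\<bbbF>\<^sub>p[[T]]\<close>, realised as \<open>\<int>[[T]]\<close> modulo \<open>p\<close>.\<close>

definition power_series_ring :: "nat \<Rightarrow> (nat \<Rightarrow> nat) ring" where
  "power_series_ring p = \<lparr>carrier = {f. \<forall>n. f n < p},
     mult = (\<lambda>f g. fps_red p (fps_lift f * fps_lift g)), one = fps_red p 1,
     zero = fps_red p 0, add = (\<lambda>f g. fps_red p (fps_lift f + fps_lift g))\<rparr>"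

context
  fixes p :: nat and S :: "(nat \<Rightarrow> nat) ring"
  assumes p: "Factorial_Ring.prime p" defines "S \<equiv> power_series_ring p"
begin

lemma p_pos: "int p > 0" "p > 1"
  using p prime_gt_1_nat prime_gt_0_nat by auto

lemma fps_red_add_multiple: "fps_red p (F + fps_const (int p) * G) = fps_red p F"
  by (auto simp: fps_red_def)

lemma lift_red: "\<exists>H. fps_lift (fps_red p F) = F + fps_const (int p) * H"
proof
  show "fps_lift (fps_red p F) = F + fps_const (int p) * Abs_fps (\<lambda>n. - (F $ n div int p))"
  proof (rule fps_ext)
    fix n
    have "int (nat (F $ n mod int p)) = F $ n mod int p" using p_pos by simp
    also have "\<dots> = F $ n - int p * (F $ n div int p)" by (simp only: minus_mult_div_eq_mod)
    finally show "fps_lift (fps_red p F) $ n = (F + fps_const (int p) * Abs_fps (\<lambda>n. - (F $ n div int p))) $ n"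
      by (simp add: fps_lift_def fps_red_def)
  qed
qed

lemma red_lift: "f \<in> carrier S \<Longrightarrow> fps_red p (fps_lift f) = f"
  by (auto simp: S_def power_series_ring_def fps_red_def fps_lift_def)

lemma fps_red_closed: "fps_red p F \<in> carrier S"
  using p_pos by (auto simp: S_def power_series_ring_def fps_red_def nat_less_iff)

text \<open>\<open>fps_red\<close> is compatible with the operations because lifting a reduced
  series changes it only by a multiple of \<open>p\<close>, which the outer reduction
  removes.\<close>

lemma S_ops:
  "fps_red p F \<otimes>\<^bsub>S\<^esub> fps_red p G = fps_red p (F * G)"
  "fps_red p F \<oplus>\<^bsub>S\<^esub> fps_red p G = fps_red p (F + G)"
  "\<one>\<^bsub>S\<^esub> = fps_red p 1" "\<zero>\<^bsub>S\<^esub> = fps_red p 0"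
proof -
  obtain H K where HK: "fps_lift (fps_red p F) = F + fps_const (int p) * H"
    "fps_lift (fps_red p G) = G + fps_const (int p) * K" using lift_red by blast
  have "(F + fps_const (int p) * H) * (G + fps_const (int p) * K) =
    F * G + fps_const (int p) * (F * K + H * G + fps_const (int p) * (H * K))"
    by (simp add: algebra_simps)
  then show "fps_red p F \<otimes>\<^bsub>S\<^esub> fps_red p G = fps_red p (F * G)"
    by (simp add: S_def power_series_ring_def HK fps_red_add_multiple)
  have eq: "F + fps_const (int p) * H + (G + fps_const (int p) * K) = F + G + fps_const (int p) * (H + K)"
    by (simp add: algebra_simps)
  show "fps_red p F \<oplus>\<^bsub>S\<^esub> fps_red p G = fps_red p (F + G)"
    by (simp add: S_def power_series_ring_def HK) (simp only: eq fps_red_add_multiple)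
qed (simp_all add: S_def power_series_ring_def)

lemma S_cases: assumes "f \<in> carrier S" obtains F where "f = fps_red p F" "F = fps_lift f"
  using red_lift[OF assms] by metis

lemma cring_S: "cring S"
proof (rule cringI)
  show "abelian_group S"
  proof (rule abelian_groupI)
    fix x assume "x \<in> carrier S"
    then obtain F where "x = fps_red p F" using S_cases by blast
    then show "\<exists>y\<in>carrier S. y \<oplus>\<^bsub>S\<^esub> x = \<zero>\<^bsub>S\<^esub>"
      by (intro bexI[of _ "fps_red p (- F)"]) (simp_all add: S_ops fps_red_closed)
  qed (auto simp: S_ops fps_red_closed algebra_simps elim!: S_cases)
  show "comm_monoid S"
    by (rule comm_monoidI) (auto simp: S_ops fps_red_closed algebra_simps elim!: S_cases)
qed (auto simp: S_ops fps_red_closed algebra_simps elim!: S_cases)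

interpretation S: cring S by (rule cring_S)

lemma red_0_iff: "f \<in> carrier S \<Longrightarrow> f = \<zero>\<^bsub>S\<^esub> \<longleftrightarrow> (\<forall>n. f n = 0)"
  by (auto simp: S_ops fps_red_def)

lemma lift_nz: "f \<in> carrier S \<Longrightarrow> f \<noteq> \<zero>\<^bsub>S\<^esub> \<Longrightarrow> fps_lift f \<noteq> 0"
  by (auto simp: red_0_iff fps_lift_def fps_eq_iff)

lemma domain_S: "domain S"
proof (intro domain.intro domain_axioms.intro cring_S)
  have "fps_red p 1 0 \<noteq> fps_red p 0 0" using p_pos by (simp add: fps_red_def)
  then show "\<one>\<^bsub>S\<^esub> \<noteq> \<zero>\<^bsub>S\<^esub>" unfolding S_ops by metis
  fix f g assume fg: "f \<otimes>\<^bsub>S\<^esub> g = \<zero>\<^bsub>S\<^esub>" and c: "f \<in> carrier S" "g \<in> carrier S"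
  show "f = \<zero>\<^bsub>S\<^esub> \<or> g = \<zero>\<^bsub>S\<^esub>"
  proof (rule ccontr)
    assume "\<not> (f = \<zero>\<^bsub>S\<^esub> \<or> g = \<zero>\<^bsub>S\<^esub>)"
    then have nz: "fps_lift f \<noteq> 0" "fps_lift g \<noteq> 0" using lift_nz c by auto
    \<comment> \<open>In degree \<open>?a + ?b\<close> the product has the single term formed by the
      two lowest coefficients. Both lie strictly between 0 and \<open>p\<close>, so the prime
      \<open>p\<close> does not divide it.\<close>
    let ?a = "subdegree (fps_lift f)" and ?b = "subdegree (fps_lift g)"
    have "f \<otimes>\<^bsub>S\<^esub> g = fps_red p (fps_lift f * fps_lift g)" by (simp add: S_def power_series_ring_def)
    then have "nat ((fps_lift f * fps_lift g) $ (?a + ?b) mod int p) = 0"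
      using fg unfolding S_ops by (metis fps_red_def fps_zero_nth mod_0 nat_0)
    moreover have "(fps_lift f * fps_lift g) $ (?a + ?b) mod int p \<ge> 0" using p_pos(1) by (rule pos_mod_sign)
    ultimately have "int p dvd (fps_lift f * fps_lift g) $ (?a + ?b)" by (simp only: dvd_eq_mod_eq_0)
    then have "int p dvd fps_lift f $ ?a * fps_lift g $ ?b" by (simp only: nth_subdegree_mult)
    then have "int p dvd int (f ?a) \<or> int p dvd int (g ?b)"
      using p by (simp add: fps_lift_def prime_dvd_mult_iff)
    moreover have "f ?a < p" "g ?b < p" using c by (auto simp: S_def power_series_ring_def)
    moreover have "f ?a > 0" "g ?b > 0" using nth_subdegree_nonzero[OF nz(1)] nth_subdegree_nonzero[OF nz(2)]
      by (auto simp: fps_lift_def)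
    ultimately show False by (auto dest: dvd_imp_le)
  qed
qed

definition T_elem :: "nat \<Rightarrow> nat" where "T_elem = fps_red p fps_X"

lemma T_closed: "T_elem \<in> carrier S"
  by (simp add: T_elem_def fps_red_closed)

lemma T_pow: "T_elem [^]\<^bsub>S\<^esub> (n::nat) = fps_red p (fps_X ^ n)"
  by (induction n) (simp_all add: T_elem_def S_ops mult.commute)

lemma dvd_T_pow_iff:
  assumes "f \<in> carrier S"
  shows "(\<exists>g\<in>carrier S. f = T_elem [^]\<^bsub>S\<^esub> n \<otimes>\<^bsub>S\<^esub> g) \<longleftrightarrow> (\<forall>i<n. f i = 0)"
proof
  assume "\<exists>g\<in>carrier S. f = T_elem [^]\<^bsub>S\<^esub> n \<otimes>\<^bsub>S\<^esub> g"
  then obtain G where "f = fps_red p (fps_X ^ n * G)"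
    by (metis S_cases S_ops(1) T_pow)
  then show "\<forall>i<n. f i = 0" by (simp add: fps_red_def fps_X_power_mult_nth)
next
  assume "\<forall>i<n. f i = 0"
  then have "fps_lift f = fps_X ^ n * fps_shift n (fps_lift f)"
    by (intro fps_ext) (auto simp: fps_X_power_mult_nth fps_lift_def)
  then have "f = T_elem [^]\<^bsub>S\<^esub> n \<otimes>\<^bsub>S\<^esub> fps_red p (fps_shift n (fps_lift f))"
    unfolding T_pow S_ops using red_lift[OF assms] by simp
  then show "\<exists>g\<in>carrier S. f = T_elem [^]\<^bsub>S\<^esub> n \<otimes>\<^bsub>S\<^esub> g" using fps_red_closed by blast
qed

lemma unit_S: assumes f: "f \<in> carrier S" "f 0 \<noteq> 0" shows "f \<in> Units S"
proof -
  have "coprime (int (f 0)) (int p)"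
  proof -
    have "f 0 < p" using f by (simp add: S_def power_series_ring_def)
    then have "\<not> p dvd f 0" using f(2) by (auto dest: dvd_imp_le)
    then show ?thesis using p prime_imp_coprime[of p "f 0"] by (simp add: coprime_commute)
  qed
  then obtain c v where "c * int (f 0) + v * int p = 1"
    using bezout_int[of "int (f 0)" "int p"] by auto
  then have e: "c * int (f 0) - 1 = int p * (- v)" by (simp add: algebra_simps)
  \<comment> \<open>The number \<open>c\<close> inverts \<open>f 0\<close> modulo \<open>p\<close>.
    Adding \<open>p * v\<close> in \<open>G\<close> makes the constant term exactly 1, so that
    \<open>G\<close> is invertible over the integers, and does not change the reduction.\<close>
  define F where "F = fps_const c * fps_lift f"
  define G where "G = F + fps_const (int p) * fps_const v"
  have "G $ 0 = 1" using e by (simp add: G_def F_def fps_lift_def)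
  then have inv: "G * fps_right_inverse G 1 = 1" by (intro fps_right_inverse) simp
  let ?g = "fps_red p (fps_const c * fps_right_inverse G 1)"
  have "f \<otimes>\<^bsub>S\<^esub> ?g = fps_red p (fps_lift f) \<otimes>\<^bsub>S\<^esub> ?g" using red_lift[OF f(1)] by simp
  also have "\<dots> = fps_red p F \<otimes>\<^bsub>S\<^esub> fps_red p (fps_right_inverse G 1)"
    unfolding S_ops F_def by (simp add: mult_ac)
  also have "fps_red p F = fps_red p G" unfolding G_def fps_red_add_multiple ..
  also have "fps_red p G \<otimes>\<^bsub>S\<^esub> fps_red p (fps_right_inverse G 1) = \<one>\<^bsub>S\<^esub>" unfolding S_ops inv ..
  finally have "f \<otimes>\<^bsub>S\<^esub> ?g = \<one>\<^bsub>S\<^esub>" .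
  then show ?thesis using f(1) fps_red_closed S.m_comm by (fastforce simp: Units_def)
qed

lemma PIdl_T_pow: "f \<in> PIdl\<^bsub>S\<^esub> (T_elem [^]\<^bsub>S\<^esub> (n::nat)) \<longleftrightarrow> f \<in> carrier S \<and> (\<forall>i<n. f i = 0)"
  using dvd_T_pow_iff[of f n] S.PIdl_iff[of "T_elem [^]\<^bsub>S\<^esub> n" f] T_closed by auto

lemma principal_S: "principal_domain S"
proof -
  interpret domain S by (rule domain_S)
  show ?thesis
  proof
    fix I assume I: "ideal I S"
    interpret I: ideal I S by fact
    show "\<exists>a\<in>carrier S. I = PIdl\<^bsub>S\<^esub> a"
    proof (cases "I = {\<zero>\<^bsub>S\<^esub>}")
      case True
      then show ?thesis using S.PIdl_iff[of "\<zero>\<^bsub>S\<^esub>"] by (intro bexI[of _ "\<zero>\<^bsub>S\<^esub>"]) auto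
    next
      case False
      then obtain f0 where "f0 \<in> I" "f0 \<noteq> \<zero>\<^bsub>S\<^esub>" using I.zero_closed by blast
      then have "\<exists>n. \<exists>f\<in>I. f n \<noteq> 0" using red_0_iff I.Icarr by metis
      define n where "n = (LEAST n. \<exists>f\<in>I. f n \<noteq> 0)"
      obtain f where f: "f \<in> I" "f n \<noteq> 0"
        using LeastI_ex[OF \<open>\<exists>n. \<exists>f\<in>I. f n \<noteq> 0\<close>] unfolding n_def by blast
      have z: "g i = 0" if "g \<in> I" "i < n" for g i
        using that not_less_Least unfolding n_def by blast
      have fc: "f \<in> carrier S" using f I.Icarr by auto
      then obtain g where g: "g \<in> carrier S" "f = T_elem [^]\<^bsub>S\<^esub> n \<otimes>\<^bsub>S\<^esub> g"
        using dvd_T_pow_iff[of f n] z[OF f(1)] by auto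
      obtain G where G: "g = fps_red p G" using S_cases g(1) by blast
      have "f n = g 0" using g(2) unfolding G T_pow S_ops by (simp add: fps_red_def fps_X_power_mult_nth)
      then have u: "g \<in> Units S" using unit_S g f by auto
      have "T_elem [^]\<^bsub>S\<^esub> n = f \<otimes>\<^bsub>S\<^esub> inv\<^bsub>S\<^esub> g"
        using g u T_closed by (simp add: S.m_assoc)
      then have "T_elem [^]\<^bsub>S\<^esub> n \<in> I" using I.I_r_closed f u by auto
      then have "PIdl\<^bsub>S\<^esub> (T_elem [^]\<^bsub>S\<^esub> n) \<subseteq> I" by (intro S.cgenideal_minimal I)
      moreover have "I \<subseteq> PIdl\<^bsub>S\<^esub> (T_elem [^]\<^bsub>S\<^esub> n)" using z I.Icarr by (auto simp: PIdl_T_pow)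
      ultimately show ?thesis using T_closed by (intro bexI[of _ "T_elem [^]\<^bsub>S\<^esub> n"]) auto
    qed
  qed
qed

lemma T_nonunit: "T_elem \<notin> Units S"
proof
  assume "T_elem \<in> Units S"
  then obtain g where "g \<in> carrier S" "T_elem \<otimes>\<^bsub>S\<^esub> g = \<one>\<^bsub>S\<^esub>" by (auto simp: Units_def)
  then have "\<exists>g\<in>carrier S. \<one>\<^bsub>S\<^esub> = T_elem [^]\<^bsub>S\<^esub> (1::nat) \<otimes>\<^bsub>S\<^esub> g"
    using T_closed by (intro bexI[of _ g]) simp_all
  then have "\<forall>i<1. \<one>\<^bsub>S\<^esub> i = 0" by (subst (asm) dvd_T_pow_iff) simp_all
  then have "\<one>\<^bsub>S\<^esub> 0 = 0" by simp
  then show False using p_pos by (simp add: S_ops fps_red_def)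
qed

lemma maximalideal_S: "maximalideal P S \<longleftrightarrow> P = PIdl\<^bsub>S\<^esub> T_elem"
proof (rule S.unique_maximalideal[OF T_closed T_nonunit])
  fix a assume a: "a \<in> carrier S"
  then show "a \<in> Units S \<or> (\<exists>b\<in>carrier S. a = T_elem \<otimes>\<^bsub>S\<^esub> b)"
    using unit_S[OF a] dvd_T_pow_iff[OF a, of 1] T_closed by auto
qed

lemma max_ideal_S: "max_ideal S = PIdl\<^bsub>S\<^esub> T_elem"
  unfolding max_ideal_def maximalideal_S by simp

text \<open>The product topology on sequences over a finite discrete set is compact by Tychonoff,
  and adically open sets are open in it because a coset of the \<open>n\<close>-th power of
  \<open>T\<close> prescribes the first \<open>n\<close> coefficients. Compactness passes to the
  coarser topology.\<close>

lemma compact_S: "compact_space (adic_topology S)"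
proof -
  note ad = max_ideal_S T_closed
  let ?P = "product_topology (\<lambda>_::nat. discrete_topology {..<p}) UNIV"
  have car: "carrier S = topspace ?P"
    by (auto simp: S_def power_series_ring_def PiE_def)
  have op: "openin ?P U" if U: "openin (adic_topology S) U" for U
    unfolding openin_product_topology_alt
  proof
    fix x assume x: "x \<in> U"
    then obtain n :: nat where n: "PIdl\<^bsub>S\<^esub> (T_elem [^]\<^bsub>S\<^esub> n) +>\<^bsub>S\<^esub> x \<subseteq> U" and xc: "x \<in> carrier S"
      using U unfolding S.openin_adic[OF ad] by blast
    let ?V = "\<lambda>i. if i < n then {x i} else {..<p}"
    have "PiE UNIV ?V \<subseteq> U"
    proof
      fix y assume y: "y \<in> PiE UNIV ?V"
      have "y i < p" for i
        using PiE_mem[OF y, of i] xc by (cases "i < n") (auto simp: S_def power_series_ring_def)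
      then have yc: "y \<in> carrier S" by (auto simp: S_def power_series_ring_def)
      obtain X Y where XY: "x = fps_red p X" "X = fps_lift x" "y = fps_red p Y" "Y = fps_lift y"
        using S_cases[OF xc] S_cases[OF yc] by metis
      let ?d = "fps_red p (Y - X)"
      have "y i = x i" if "i < n" for i using y that by (auto simp: PiE_iff split: if_splits)
      then have "?d \<in> PIdl\<^bsub>S\<^esub> (T_elem [^]\<^bsub>S\<^esub> n)"
        unfolding PIdl_T_pow by (auto simp: fps_red_closed) (simp add: fps_red_def XY(2,4) fps_lift_def)
      moreover have "y = ?d \<oplus>\<^bsub>S\<^esub> x" unfolding XY(1,3) S_ops by simp
      ultimately have "y \<in> PIdl\<^bsub>S\<^esub> (T_elem [^]\<^bsub>S\<^esub> n) +>\<^bsub>S\<^esub> x"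
        by (auto simp: a_r_coset_def r_coset_def)
      then show "y \<in> U" using n by auto
    qed
    moreover have "x \<in> PiE UNIV ?V" using xc by (auto simp: S_def power_series_ring_def)
    moreover have "finite {i \<in> UNIV. ?V i \<noteq> topspace (discrete_topology {..<p})}"
      by (rule finite_subset[of _ "{..<n}"]) auto
    moreover have "\<forall>i\<in>UNIV. openin (discrete_topology {..<p}) (?V i)"
      using xc by (auto simp: S_def power_series_ring_def)
    ultimately show "\<exists>V. finite {i \<in> UNIV. V i \<noteq> topspace (discrete_topology {..<p})} \<and>
        (\<forall>i\<in>UNIV. openin (discrete_topology {..<p}) (V i)) \<and> x \<in> PiE UNIV V \<and> PiE UNIV V \<subseteq> U"
      by (intro exI[of _ ?V]) blast
  qed
  have "compact_space ?P" by (simp add: compact_space_product_topology compact_space_discrete_topology)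
  then have c: "compactin ?P (carrier S)" unfolding compact_space_def car .
  have "compactin (adic_topology S) (carrier S)"
    unfolding compactin_def
  proof (intro conjI allI impI)
    show "carrier S \<subseteq> topspace (adic_topology S)" unfolding S.topspace_adic[OF ad] ..
    fix \<U> assume "Ball \<U> (openin (adic_topology S)) \<and> carrier S \<subseteq> \<Union>\<U>"
    then have "Ball \<U> (openin ?P) \<and> carrier S \<subseteq> \<Union>\<U>" using op by blast
    then show "\<exists>\<F>. finite \<F> \<and> \<F> \<subseteq> \<U> \<and> carrier S \<subseteq> \<Union>\<F>" using c unfolding compactin_def by blast
  qed
  then show ?thesis unfolding compact_space_def S.topspace_adic[OF ad] .
qed

lemma is_cDVR_S: "is_cDVR S"
proof -
  have "\<not> field S"
  proof
    assume "field S"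
    then have "T_elem = \<zero>\<^bsub>S\<^esub>" using field.field_Units[of S] T_nonunit T_closed by auto
    then have "T_elem 1 = 0" using red_0_iff[OF T_closed] by simp
    then show False using p_pos by (simp add: T_elem_def fps_red_def)
  qed
  then show ?thesis
    unfolding is_cDVR_def is_dvr_def maximalideal_S using principal_S compact_S by auto
qed

lemma residue_card_S: "residue_card S = p"
proof -
  have "residue_card S = card ((\<lambda>a. PIdl\<^bsub>S\<^esub> T_elem +>\<^bsub>S\<^esub> a) ` carrier S)"
    unfolding residue_card_def max_ideal_S by (simp add: FactRing_def A_RCOSETS_def' UNION_singleton_eq_range)
  also have "\<dots> = card ((\<lambda>f. f 0) ` carrier S)"
  proof (rule card_image_eq_kernel)
    fix a b assume ab: "a \<in> carrier S" "b \<in> carrier S"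
    obtain F G where FG: "a = fps_red p F" "F = fps_lift a" "b = fps_red p G" "G = fps_lift b"
      using S_cases[OF ab(1)] S_cases[OF ab(2)] by metis
    have "\<ominus>\<^bsub>S\<^esub> b = fps_red p (- G)"
      by (rule S.minus_equality) (simp_all add: FG(3) S_ops fps_red_closed)
    then have m: "a \<ominus>\<^bsub>S\<^esub> b = fps_red p (F - G)" unfolding a_minus_def FG(1) by (simp add: S_ops)
    have lt: "a 0 < p" "b 0 < p" using ab by (auto simp: S_def power_series_ring_def)
    have "PIdl\<^bsub>S\<^esub> T_elem +>\<^bsub>S\<^esub> a = PIdl\<^bsub>S\<^esub> T_elem +>\<^bsub>S\<^esub> b \<longleftrightarrow> a \<ominus>\<^bsub>S\<^esub> b \<in> PIdl\<^bsub>S\<^esub> T_elem"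
      by (rule S.quotient_eq_iff_same_a_r_cos[symmetric]) (use ab S.cgenideal_ideal[OF T_closed] in auto)
    also have "\<dots> \<longleftrightarrow> (a \<ominus>\<^bsub>S\<^esub> b) 0 = 0"
      using PIdl_T_pow[of "a \<ominus>\<^bsub>S\<^esub> b" 1] T_closed ab by simp
    also have "\<dots> \<longleftrightarrow> int p dvd int (a 0) - int (b 0)"
    proof -
      have k: "(a \<ominus>\<^bsub>S\<^esub> b) 0 = nat ((int (a 0) - int (b 0)) mod int p)"
        unfolding m fps_red_def fps_sub_nth FG(2,4) fps_lift_def by simp
      have "(int (a 0) - int (b 0)) mod int p \<ge> 0" using p_pos(1) by (rule pos_mod_sign)
      then show ?thesis unfolding k dvd_eq_mod_eq_0 by linarith
    qed
    also have "\<dots> \<longleftrightarrow> a 0 = b 0"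
      using lt by (simp add: mod_eq_dvd_iff[symmetric])
    finally show "PIdl\<^bsub>S\<^esub> T_elem +>\<^bsub>S\<^esub> a = PIdl\<^bsub>S\<^esub> T_elem +>\<^bsub>S\<^esub> b \<longleftrightarrow> a 0 = b 0" .
  qed
  also have "(\<lambda>f. f 0) ` carrier S = {..<p}"
  proof
    show "(\<lambda>f. f 0) ` carrier S \<subseteq> {..<p}" by (auto simp: S_def power_series_ring_def)
    show "{..<p} \<subseteq> (\<lambda>f. f 0) ` carrier S"
    proof
      fix i assume "i \<in> {..<p}"
      then have "(\<lambda>_. i) \<in> carrier S" by (simp add: S_def power_series_ring_def)
      then show "i \<in> (\<lambda>f. f 0) ` carrier S" by (rule rev_image_eqI) simp
    qed
  qed
  finally show ?thesis by simp
qed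

end

section \<open>Free modules and elementary divisor types\<close>

lemma module_regular: fixes R (structure) assumes "cring R" shows "module R (regular_module R)"
proof -
  interpret cring R by fact
  show ?thesis
  proof (rule moduleI)
    show "abelian_group (regular_module R)"
    proof (rule abelian_groupI)
      fix x assume "x \<in> carrier (regular_module R)"
      then show "\<exists>y\<in>carrier (regular_module R). y \<oplus>\<^bsub>regular_module R\<^esub> x = \<zero>\<^bsub>regular_module R\<^esub>"
        by (intro bexI[of _ "\<ominus> x"]) (simp_all add: regular_module_def l_neg)
    qed (simp_all add: regular_module_def a_ac)
  qed (simp_all add: regular_module_def cring_axioms l_distr r_distr m_assoc)
qed

lemma regular_sel:
  "carrier (regular_module R) = carrier R" "x \<oplus>\<^bsub>regular_module R\<^esub> y = x \<oplus>\<^bsub>R\<^esub> y"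
  "r \<odot>\<^bsub>regular_module R\<^esub> x = r \<otimes>\<^bsub>R\<^esub> x" "\<zero>\<^bsub>regular_module R\<^esub> = \<zero>\<^bsub>R\<^esub>"
  "a_r_coset (regular_module R) = a_r_coset R"
  by (simp_all add: regular_module_def a_r_coset_def r_coset_def fun_eq_iff)

lemma regular_minus:
  assumes "cring R" "x \<in> carrier R" "y \<in> carrier R"
  shows "x \<ominus>\<^bsub>regular_module R\<^esub> y = x \<ominus>\<^bsub>R\<^esub> y"
proof -
  interpret cring R by fact
  interpret M: module R "regular_module R" by (rule module_regular[OF assms(1)])
  have "\<ominus>\<^bsub>regular_module R\<^esub> y = \<ominus>\<^bsub>R\<^esub> y"
    by (rule M.M.minus_equality) (use assms in \<open>simp_all add: regular_sel l_neg\<close>)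
  then show ?thesis by (simp add: a_minus_def regular_sel)
qed

context module
begin

lemma rcos_iff:
  assumes "sm N" "c \<in> carrier M"
  shows "x \<in> N +>\<^bsub>M\<^esub> c \<longleftrightarrow> x \<in> carrier M \<and> x \<ominus>\<^sub>M c \<in> N"
  using assms(2) smD(3)[OF assms(1)]
  by (auto simp: a_r_coset_def r_coset_def minus_telescope intro!: bexI[of _ "x \<ominus>\<^sub>M c"])

lemma quot_carrier: "carrier (quot_module M N) = (\<lambda>x. N +>\<^bsub>M\<^esub> x) ` carrier M"
  by (auto simp: quot_module_def A_RCOSETS_def')

lemma abelian_subgroup_sm: assumes "sm N" shows "abelian_subgroup N M"
  using assms by (intro abelian_subgroupI3 additive_subgroup.intro M.abelian_group_axioms)
    (simp add: submodule_def)

lemma quot_add: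
  assumes "sm N" "x \<in> carrier M" "y \<in> carrier M"
  shows "(N +>\<^bsub>M\<^esub> x) \<oplus>\<^bsub>quot_module M N\<^esub> (N +>\<^bsub>M\<^esub> y) = N +>\<^bsub>M\<^esub> (x \<oplus>\<^sub>M y)"
  using abelian_subgroup.a_rcos_sum[OF abelian_subgroup_sm[OF assms(1)] assms(2,3)]
  by (simp add: quot_module_def)

lemma quot_smult:
  assumes "sm N" "x \<in> carrier M" "r \<in> carrier R"
  shows "r \<odot>\<^bsub>quot_module M N\<^esub> (N +>\<^bsub>M\<^esub> x) = N +>\<^bsub>M\<^esub> (r \<odot>\<^bsub>M\<^esub> x)"
proof -
  have e: "N +>\<^bsub>M\<^esub> (r \<odot>\<^bsub>M\<^esub> y) = N +>\<^bsub>M\<^esub> (r \<odot>\<^bsub>M\<^esub> x)" if "y \<in> N +>\<^bsub>M\<^esub> x" for y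
    using that assms smD(7)[OF assms(1,3), of "y \<ominus>\<^sub>M x"]
    by (simp add: rcos_iff rcos_eq_iff smult_minus)
  have "x \<ominus>\<^sub>M x \<in> N" using assms smD(2)[OF assms(1)] by (simp add: a_minus_def M.r_neg)
  then have "x \<in> N +>\<^bsub>M\<^esub> x" using assms(2) rcos_iff[OF assms(1,2), of x] by simp
  then have "(\<Union>y\<in>N +>\<^bsub>M\<^esub> x. N +>\<^bsub>M\<^esub> (r \<odot>\<^bsub>M\<^esub> y)) = N +>\<^bsub>M\<^esub> (r \<odot>\<^bsub>M\<^esub> x)"
    by (intro SUP_eq_const e) auto
  then show ?thesis by (simp add: quot_module_def)
qed

lemma minus_0: "x \<in> carrier M \<Longrightarrow> x \<ominus>\<^sub>M \<zero>\<^bsub>M\<^esub> = x"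
  using minus_telescope(3)[of x "\<zero>\<^bsub>M\<^esub>"] by simp

lemma quot_zero: assumes "sm N" shows "\<zero>\<^bsub>quot_module M N\<^esub> = N +>\<^bsub>M\<^esub> \<zero>\<^bsub>M\<^esub>"
proof -
  have "x \<in> N +>\<^bsub>M\<^esub> \<zero>\<^bsub>M\<^esub> \<longleftrightarrow> x \<in> N" for x
    using rcos_iff[OF assms M.zero_closed, of x] smD(3)[OF assms, of x] minus_0[of x] by metis
  then show ?thesis by (simp add: quot_module_def Set.set_eq_iff)
qed

lemma module_quot: assumes "sm N" shows "module R (quot_module M N)"
proof (rule moduleI)
  note q = quot_add[OF assms] quot_smult[OF assms] quot_zero[OF assms]
  let ?Q = "quot_module M N"
  have cl: "N +>\<^bsub>M\<^esub> x \<in> carrier ?Q" if "x \<in> carrier M" for x using that by (auto simp: quot_carrier)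
  have el: "\<exists>x\<in>carrier M. X = N +>\<^bsub>M\<^esub> x" if "X \<in> carrier ?Q" for X using that by (auto simp: quot_carrier)
  show "cring R" by (rule is_cring)
  show "abelian_group ?Q"
  proof (rule abelian_groupI)
    show "\<zero>\<^bsub>?Q\<^esub> \<in> carrier ?Q" unfolding q by (intro cl) simp
    fix X assume "X \<in> carrier ?Q"
    then obtain x where x: "x \<in> carrier M" "X = N +>\<^bsub>M\<^esub> x" using el by blast
    show "\<zero>\<^bsub>?Q\<^esub> \<oplus>\<^bsub>?Q\<^esub> X = X" using x by (simp add: q)
    show "\<exists>Y\<in>carrier ?Q. Y \<oplus>\<^bsub>?Q\<^esub> X = \<zero>\<^bsub>?Q\<^esub>"
      using x by (intro bexI[of _ "N +>\<^bsub>M\<^esub> (\<ominus>\<^bsub>M\<^esub> x)"]) (simp_all add: q M.l_neg cl)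
    fix Y assume "Y \<in> carrier ?Q"
    then obtain y where y: "y \<in> carrier M" "Y = N +>\<^bsub>M\<^esub> y" using el by blast
    show "X \<oplus>\<^bsub>?Q\<^esub> Y \<in> carrier ?Q" using x y by (simp add: q cl)
    show "X \<oplus>\<^bsub>?Q\<^esub> Y = Y \<oplus>\<^bsub>?Q\<^esub> X" using x y by (simp add: q M.a_comm)
    fix Z assume "Z \<in> carrier ?Q"
    then obtain z where z: "z \<in> carrier M" "Z = N +>\<^bsub>M\<^esub> z" using el by blast
    show "X \<oplus>\<^bsub>?Q\<^esub> Y \<oplus>\<^bsub>?Q\<^esub> Z = X \<oplus>\<^bsub>?Q\<^esub> (Y \<oplus>\<^bsub>?Q\<^esub> Z)" using x y z by (simp add: q M.a_assoc)
  qed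
  fix X assume "X \<in> carrier ?Q"
  then obtain x where x: "x \<in> carrier M" "X = N +>\<^bsub>M\<^esub> x" using el by blast
  show "\<one> \<odot>\<^bsub>?Q\<^esub> X = X" using x by (simp add: q)
  fix a assume a: "a \<in> carrier R"
  show "a \<odot>\<^bsub>?Q\<^esub> X \<in> carrier ?Q" using x a by (simp add: q cl)
  fix b assume b: "b \<in> carrier R"
  show "(a \<oplus> b) \<odot>\<^bsub>?Q\<^esub> X = a \<odot>\<^bsub>?Q\<^esub> X \<oplus>\<^bsub>?Q\<^esub> b \<odot>\<^bsub>?Q\<^esub> X" using x a b by (simp add: q smult_l_distr)
  show "a \<otimes> b \<odot>\<^bsub>?Q\<^esub> X = a \<odot>\<^bsub>?Q\<^esub> (b \<odot>\<^bsub>?Q\<^esub> X)" using x a b by (simp add: q smult_assoc1)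
next
  note q = quot_add[OF assms] quot_smult[OF assms] quot_zero[OF assms]
  let ?Q = "quot_module M N"
  fix a X Y assume a: "a \<in> carrier R" and "X \<in> carrier ?Q" "Y \<in> carrier ?Q"
  then obtain x y where x: "x \<in> carrier M" "X = N +>\<^bsub>M\<^esub> x" "y \<in> carrier M" "Y = N +>\<^bsub>M\<^esub> y"
    by (auto simp: quot_carrier)
  show "a \<odot>\<^bsub>?Q\<^esub> (X \<oplus>\<^bsub>?Q\<^esub> Y) = a \<odot>\<^bsub>?Q\<^esub> X \<oplus>\<^bsub>?Q\<^esub> a \<odot>\<^bsub>?Q\<^esub> Y"
    using x a by (simp add: q smult_r_distr)
qed

end

lemma prod_sel:
  "carrier (prod_module I M) = (\<Pi>\<^sub>E i\<in>I. carrier (M i))"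
  "x \<oplus>\<^bsub>prod_module I M\<^esub> y = (\<lambda>i\<in>I. x i \<oplus>\<^bsub>M i\<^esub> y i)"
  "r \<odot>\<^bsub>prod_module I M\<^esub> x = (\<lambda>i\<in>I. r \<odot>\<^bsub>M i\<^esub> x i)"
  "\<zero>\<^bsub>prod_module I M\<^esub> = (\<lambda>i\<in>I. \<zero>\<^bsub>M i\<^esub>)"
  by (simp_all add: prod_module_def)

lemma module_prod:
  assumes "cring R" "\<And>i. i \<in> I \<Longrightarrow> module R (M i)"
  shows "module R (prod_module I M)"
proof -
  have ag: "abelian_group (M i)" if "i \<in> I" for i using assms(2)[OF that] by (simp add: module_def)
  have cl: "u \<oplus>\<^bsub>M i\<^esub> v \<in> carrier (M i)" if "i \<in> I" "u \<in> carrier (M i)" "v \<in> carrier (M i)" for i u v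
    using abelian_monoid.a_closed[OF abelian_group.axioms(1)[OF ag[OF that(1)]] that(2,3)] .
  note ops = cl
    module.smult_closed[OF assms(2)] module.smult_l_distr[OF assms(2)] module.smult_r_distr[OF assms(2)]
    module.smult_assoc1[OF assms(2)] module.smult_one[OF assms(2)]
  have z: "\<zero>\<^bsub>M i\<^esub> \<in> carrier (M i)" if "i \<in> I" for i
    using abelian_monoid.zero_closed[OF abelian_group.axioms(1)[OF ag[OF that]]] .
  show ?thesis
  proof (rule moduleI)
  show "abelian_group (prod_module I M)"
  proof (rule abelian_groupI)
    fix x assume x: "x \<in> carrier (prod_module I M)"
    then show "\<exists>y\<in>carrier (prod_module I M). y \<oplus>\<^bsub>prod_module I M\<^esub> x = \<zero>\<^bsub>prod_module I M\<^esub>"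
      using abelian_group.a_inv_closed[OF ag] abelian_group.l_neg[OF ag]
      by (intro bexI[of _ "\<lambda>i\<in>I. \<ominus>\<^bsub>M i\<^esub> x i"]) (auto simp: prod_sel PiE_iff)
    show "\<zero>\<^bsub>prod_module I M\<^esub> \<oplus>\<^bsub>prod_module I M\<^esub> x = x"
      using x abelian_monoid.l_zero[OF abelian_group.axioms(1)[OF ag]]
      by (intro extensionalityI[of _ I]) (auto simp: prod_sel PiE_iff)
    fix y assume y: "y \<in> carrier (prod_module I M)"
    show "x \<oplus>\<^bsub>prod_module I M\<^esub> y = y \<oplus>\<^bsub>prod_module I M\<^esub> x"
      using x y abelian_monoid.a_comm[OF abelian_group.axioms(1)[OF ag]]
      by (intro extensionalityI[of _ I]) (auto simp: prod_sel PiE_iff)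
    fix w assume w: "w \<in> carrier (prod_module I M)"
    show "x \<oplus>\<^bsub>prod_module I M\<^esub> y \<oplus>\<^bsub>prod_module I M\<^esub> w = x \<oplus>\<^bsub>prod_module I M\<^esub> (y \<oplus>\<^bsub>prod_module I M\<^esub> w)"
      using x y w abelian_monoid.a_assoc[OF abelian_group.axioms(1)[OF ag]]
      by (intro extensionalityI[of _ I]) (auto simp: prod_sel PiE_iff)
  qed (auto simp: prod_sel PiE_iff ops z)
  show "\<one>\<^bsub>R\<^esub> \<odot>\<^bsub>prod_module I M\<^esub> x = x" if "x \<in> carrier (prod_module I M)" for x
    using that by (intro extensionalityI[of _ I]) (auto simp: prod_sel PiE_iff ops)
qed (auto simp: prod_sel PiE_iff ops assms(1) fun_eq_iff)
qed

text \<open>A surjection from \<open>X\<close> onto \<open>P\<close> with kernel \<open>N\<close>.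
  It stands in for an isomorphism from the quotient module, so that types can be handled without
  cosets.\<close>

definition presents ::
  "('r, 'q) ring_scheme \<Rightarrow> ('r, 'a, 'm) module_scheme \<Rightarrow> 'a set \<Rightarrow> ('r, 'b, 'n) module_scheme \<Rightarrow> ('a \<Rightarrow> 'b) \<Rightarrow> bool" where
  "presents R X N P F \<longleftrightarrow> F \<in> lin_hom R X P \<and> F ` carrier X = carrier P \<and>
     (\<forall>x\<in>carrier X. F x = \<zero>\<^bsub>P\<^esub> \<longleftrightarrow> x \<in> N)"

lemma presentsD:
  assumes "presents R X N P F"
  shows "x \<in> carrier X \<Longrightarrow> F x \<in> carrier P"
    "x \<in> carrier X \<Longrightarrow> y \<in> carrier X \<Longrightarrow> F (x \<oplus>\<^bsub>X\<^esub> y) = F x \<oplus>\<^bsub>P\<^esub> F y"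
    "r \<in> carrier R \<Longrightarrow> x \<in> carrier X \<Longrightarrow> F (r \<odot>\<^bsub>X\<^esub> x) = r \<odot>\<^bsub>P\<^esub> F x"
    "F ` carrier X = carrier P"
    "x \<in> carrier X \<Longrightarrow> F x = \<zero>\<^bsub>P\<^esub> \<longleftrightarrow> x \<in> N"
  using assms by (auto simp: presents_def lin_hom_def)

lemma presentsI:
  assumes "\<And>x. x \<in> carrier X \<Longrightarrow> F x \<in> carrier P"
    "\<And>x y. x \<in> carrier X \<Longrightarrow> y \<in> carrier X \<Longrightarrow> F (x \<oplus>\<^bsub>X\<^esub> y) = F x \<oplus>\<^bsub>P\<^esub> F y"
    "\<And>r x. r \<in> carrier R \<Longrightarrow> x \<in> carrier X \<Longrightarrow> F (r \<odot>\<^bsub>X\<^esub> x) = r \<odot>\<^bsub>P\<^esub> F x"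
    "\<And>z. z \<in> carrier P \<Longrightarrow> \<exists>x\<in>carrier X. F x = z"
    "\<And>x. x \<in> carrier X \<Longrightarrow> F x = \<zero>\<^bsub>P\<^esub> \<longleftrightarrow> x \<in> N"
  shows "presents R X N P F"
  using assms unfolding presents_def lin_hom_def by (auto simp: image_iff) (metis)

lemma presents_minus:
  assumes "module R X" "module R P" "presents R X N P F" "x \<in> carrier X" "y \<in> carrier X"
  shows "F (x \<ominus>\<^bsub>X\<^esub> y) = F x \<ominus>\<^bsub>P\<^esub> F y"
proof -
  interpret X: module R X by fact
  interpret P: module R P by fact
  note F = presentsD[OF assms(3)]
  have "F ((x \<ominus>\<^bsub>X\<^esub> y) \<oplus>\<^bsub>X\<^esub> y) = F (x \<ominus>\<^bsub>X\<^esub> y) \<oplus>\<^bsub>P\<^esub> F y" using assms(4,5) by (intro F) auto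
  then have "F x = F (x \<ominus>\<^bsub>X\<^esub> y) \<oplus>\<^bsub>P\<^esub> F y" using assms(4,5) by (simp add: X.minus_telescope)
  then show ?thesis using assms(4,5) F(1) by (simp add: P.minus_telescope(3))
qed

lemma presents_eq_iff:
  assumes "module R X" "module R P" "presents R X N P F" "x \<in> carrier X" "y \<in> carrier X"
  shows "F x = F y \<longleftrightarrow> x \<ominus>\<^bsub>X\<^esub> y \<in> N"
proof -
  interpret X: module R X by fact
  interpret P: module R P by fact
  note F = presentsD[OF assms(3)]
  have "x \<ominus>\<^bsub>X\<^esub> y \<in> N \<longleftrightarrow> F x \<ominus>\<^bsub>P\<^esub> F y = \<zero>\<^bsub>P\<^esub>"
    using F(5)[of "x \<ominus>\<^bsub>X\<^esub> y"] presents_minus[OF assms] assms(4,5) by simp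
  also have "\<dots> \<longleftrightarrow> F x = F y"
    using F(1) assms(4,5) P.minus_telescope(1)[of "F x" "F y"] by (auto simp: a_minus_def P.M.r_neg)
  finally show ?thesis by simp
qed

lemma lin_iso_quot_iff:
  assumes "module R X" "module R P" "submodule N R X"
  shows "lin_iso R (quot_module X N) P \<longleftrightarrow> (\<exists>F. presents R X N P F)"
proof
  interpret X: module R X by fact
  interpret P: module R P by fact
  interpret Q: module R "quot_module X N" by (rule X.module_quot[OF assms(3)])
  let ?Q = "quot_module X N"
  note q = X.quot_add[OF assms(3)] X.quot_smult[OF assms(3)] X.quot_zero[OF assms(3)]
  have Qc: "N +>\<^bsub>X\<^esub> x \<in> carrier ?Q" if "x \<in> carrier X" for x using that by (auto simp: X.quot_carrier)
  {
    assume "lin_iso R ?Q P"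
    then obtain f where f: "f \<in> lin_hom R ?Q P" "bij_betw f (carrier ?Q) (carrier P)"
      by (auto simp: lin_iso_def)
    have fz: "f \<zero>\<^bsub>?Q\<^esub> = \<zero>\<^bsub>P\<^esub>"
    proof -
      have "f (\<zero>\<^bsub>R\<^esub> \<odot>\<^bsub>?Q\<^esub> \<zero>\<^bsub>?Q\<^esub>) = \<zero>\<^bsub>R\<^esub> \<odot>\<^bsub>P\<^esub> f \<zero>\<^bsub>?Q\<^esub>"
        using f(1) Q.M.zero_closed X.zero_closed unfolding lin_hom_def by blast
      moreover have "f \<zero>\<^bsub>?Q\<^esub> \<in> carrier P" using f(1) Q.M.zero_closed unfolding lin_hom_def by blast
      ultimately show ?thesis by simp
    qed
    have "presents R X N P (\<lambda>x. f (N +>\<^bsub>X\<^esub> x))"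
    proof (rule presentsI)
      fix x assume x: "x \<in> carrier X"
      show "f (N +>\<^bsub>X\<^esub> x) \<in> carrier P" using f(1) Qc[OF x] by (auto simp: lin_hom_def)
      have "f (N +>\<^bsub>X\<^esub> x) = \<zero>\<^bsub>P\<^esub> \<longleftrightarrow> N +>\<^bsub>X\<^esub> x = \<zero>\<^bsub>?Q\<^esub>"
        using bij_betw_imp_inj_on[OF f(2)] Qc[OF x] Q.M.zero_closed fz by (metis inj_onD)
      also have "\<dots> \<longleftrightarrow> x \<in> N"
        using X.rcos_eq_iff[OF assms(3) x X.M.zero_closed] x unfolding q(3) by (simp add: X.minus_0)
      finally show "f (N +>\<^bsub>X\<^esub> x) = \<zero>\<^bsub>P\<^esub> \<longleftrightarrow> x \<in> N" .
      fix y assume y: "y \<in> carrier X"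
      show "f (N +>\<^bsub>X\<^esub> (x \<oplus>\<^bsub>X\<^esub> y)) = f (N +>\<^bsub>X\<^esub> x) \<oplus>\<^bsub>P\<^esub> f (N +>\<^bsub>X\<^esub> y)"
      proof -
        have "f ((N +>\<^bsub>X\<^esub> x) \<oplus>\<^bsub>?Q\<^esub> (N +>\<^bsub>X\<^esub> y)) = f (N +>\<^bsub>X\<^esub> x) \<oplus>\<^bsub>P\<^esub> f (N +>\<^bsub>X\<^esub> y)"
          using f(1) Qc[OF x] Qc[OF y] unfolding lin_hom_def by blast
        then show ?thesis unfolding q(1)[OF x y] .
      qed
    next
      fix r x assume x: "r \<in> carrier R" "x \<in> carrier X"
      show "f (N +>\<^bsub>X\<^esub> (r \<odot>\<^bsub>X\<^esub> x)) = r \<odot>\<^bsub>P\<^esub> f (N +>\<^bsub>X\<^esub> x)"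
      proof -
        have "f (r \<odot>\<^bsub>?Q\<^esub> (N +>\<^bsub>X\<^esub> x)) = r \<odot>\<^bsub>P\<^esub> f (N +>\<^bsub>X\<^esub> x)"
          using f(1) Qc[OF x(2)] x(1) unfolding lin_hom_def by blast
        then show ?thesis unfolding q(2)[OF x(2,1)] .
      qed
    next
      fix z assume z: "z \<in> carrier P"
      have "(\<lambda>x. f (N +>\<^bsub>X\<^esub> x)) ` carrier X = carrier P"
        using bij_betw_imp_surj_on[OF f(2)] unfolding X.quot_carrier image_image .
      then show "\<exists>x\<in>carrier X. f (N +>\<^bsub>X\<^esub> x) = z" using z by (metis imageE)
    qed
    then show "\<exists>F. presents R X N P F" by blast
  next
    assume "\<exists>F. presents R X N P F"
    then obtain F where pF: "presents R X N P F" by blast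
    note F = presentsD[OF pF]
    define rep where "rep C = (SOME x. x \<in> carrier X \<and> C = N +>\<^bsub>X\<^esub> x)" for C
    define f where "f C = F (rep C)" for C
    have fx: "f (N +>\<^bsub>X\<^esub> x) = F x" if x: "x \<in> carrier X" for x
    proof -
      have r: "rep (N +>\<^bsub>X\<^esub> x) \<in> carrier X \<and> N +>\<^bsub>X\<^esub> x = N +>\<^bsub>X\<^esub> rep (N +>\<^bsub>X\<^esub> x)"
        unfolding rep_def by (rule someI[of _ x]) (use x in simp)
      then have "rep (N +>\<^bsub>X\<^esub> x) \<ominus>\<^bsub>X\<^esub> x \<in> N"
        using X.rcos_eq_iff[OF assms(3), of "rep (N +>\<^bsub>X\<^esub> x)" x] x by simp
      then show ?thesis using presents_eq_iff[OF assms(1,2) pF] r x by (simp add: f_def)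
    qed
    have "f \<in> lin_hom R ?Q P"
      unfolding lin_hom_def by (auto simp: X.quot_carrier fx q(1,2) F)
    moreover have "inj_on f (carrier ?Q)"
    proof (rule inj_onI)
      fix A B assume "A \<in> carrier ?Q" "B \<in> carrier ?Q" and e: "f A = f B"
      then obtain x y where xy: "x \<in> carrier X" "y \<in> carrier X" "A = N +>\<^bsub>X\<^esub> x" "B = N +>\<^bsub>X\<^esub> y"
        by (auto simp: X.quot_carrier)
      then have "x \<ominus>\<^bsub>X\<^esub> y \<in> N" using e presents_eq_iff[OF assms(1,2) pF] by (simp add: fx)
      then show "A = B" using xy X.rcos_eq_iff[OF assms(3)] by simp
    qed
    moreover have "f ` carrier ?Q = carrier P"
      unfolding X.quot_carrier image_image using F(4) fx by (simp cong: image_cong)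
    ultimately show "lin_iso R ?Q P" by (auto simp: lin_iso_def bij_betw_def)
  }
qed

text \<open>If \<open>N\<close> is the full preimage of \<open>N'\<close> under a surjection
  \<open>h\<close>, then \<open>h\<close> induces an isomorphism of the quotients. In the converse
  direction a set-theoretic section of \<open>h\<close> is enough, as \<open>F\<close> does not see
  the kernel of \<open>h\<close>, which lies in \<open>N\<close>.\<close>

lemma presents_transfer:
  assumes "module R X" "module R X'" "module R P"
    and h: "h \<in> lin_hom R X X'" "h ` carrier X = carrier X'"
    and N: "\<And>x. x \<in> carrier X \<Longrightarrow> x \<in> N \<longleftrightarrow> h x \<in> N'" and zN: "\<zero>\<^bsub>X'\<^esub> \<in> N'"
  shows "(\<exists>F. presents R X N P F) \<longleftrightarrow> (\<exists>F. presents R X' N' P F)"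
proof
  interpret X: module R X by fact
  interpret X': module R X' by fact
  interpret P: module R P by fact
  have hc: "h x \<in> carrier X'" if "x \<in> carrier X" for x using h(1) that by (auto simp: lin_hom_def)
  have ha: "h (x \<oplus>\<^bsub>X\<^esub> y) = h x \<oplus>\<^bsub>X'\<^esub> h y" if "x \<in> carrier X" "y \<in> carrier X" for x y
    using h(1) that by (auto simp: lin_hom_def)
  have hs: "h (r \<odot>\<^bsub>X\<^esub> x) = r \<odot>\<^bsub>X'\<^esub> h x" if "r \<in> carrier R" "x \<in> carrier X" for r x
    using h(1) that by (auto simp: lin_hom_def)
  {
    assume "\<exists>F. presents R X' N' P F"
    then obtain F where pF: "presents R X' N' P F" by blast
    note F = presentsD[OF pF]
    have "presents R X N P (\<lambda>x. F (h x))"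
    proof (rule presentsI)
      fix z assume "z \<in> carrier P"
      then obtain x' where "x' \<in> carrier X'" "F x' = z" using F(4) by (metis imageE)
      then show "\<exists>x\<in>carrier X. F (h x) = z" using h(2) by (metis imageE)
    qed (auto simp: hc ha hs F N)
    then show "\<exists>F. presents R X N P F" by blast
  next
    assume "\<exists>F. presents R X N P F"
    then obtain F where pF: "presents R X N P F" by blast
    note F = presentsD[OF pF]
    define s where "s x' = (SOME x. x \<in> carrier X \<and> h x = x')" for x'
    have s: "s x' \<in> carrier X" "h (s x') = x'" if x': "x' \<in> carrier X'" for x'
    proof -
      obtain x where "x \<in> carrier X \<and> h x = x'" using h(2) x' by (metis imageE)
      then have "s x' \<in> carrier X \<and> h (s x') = x'" unfolding s_def by (rule someI)
      then show "s x' \<in> carrier X" "h (s x') = x'" by auto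
    qed
    have eq: "F x = F y" if "x \<in> carrier X" "y \<in> carrier X" "h x = h y" for x y
    proof -
      have "h x = h ((x \<ominus>\<^bsub>X\<^esub> y) \<oplus>\<^bsub>X\<^esub> y)" using that by (simp add: X.minus_telescope)
      then have "h y = h (x \<ominus>\<^bsub>X\<^esub> y) \<oplus>\<^bsub>X'\<^esub> h y" using that ha[of "x \<ominus>\<^bsub>X\<^esub> y" y] by simp
      then have "h (x \<ominus>\<^bsub>X\<^esub> y) = \<zero>\<^bsub>X'\<^esub>"
        using hc that X'.minus_telescope(3)[of "h (x \<ominus>\<^bsub>X\<^esub> y)" "h y"]
        by (simp add: a_minus_def X'.M.r_neg)
      then have "x \<ominus>\<^bsub>X\<^esub> y \<in> N" using N[of "x \<ominus>\<^bsub>X\<^esub> y"] zN that by simp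
      then show ?thesis using presents_eq_iff[OF assms(1,3) pF that(1,2)] by simp
    qed
    have "presents R X' N' P (\<lambda>x'. F (s x'))"
    proof (rule presentsI)
      fix x y assume "x \<in> carrier X'" "y \<in> carrier X'"
      then show "F (s (x \<oplus>\<^bsub>X'\<^esub> y)) = F (s x) \<oplus>\<^bsub>P\<^esub> F (s y)"
        using eq[of "s (x \<oplus>\<^bsub>X'\<^esub> y)" "s x \<oplus>\<^bsub>X\<^esub> s y"] by (simp add: s ha F)
    next
      fix r x assume "r \<in> carrier R" "x \<in> carrier X'"
      then show "F (s (r \<odot>\<^bsub>X'\<^esub> x)) = r \<odot>\<^bsub>P\<^esub> F (s x)"
        using eq[of "s (r \<odot>\<^bsub>X'\<^esub> x)" "r \<odot>\<^bsub>X\<^esub> s x"] by (simp add: s hs F)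
    next
      fix z assume "z \<in> carrier P"
      then obtain x where "x \<in> carrier X" "F x = z" using F(4) by (metis imageE)
      then show "\<exists>x'\<in>carrier X'. F (s x') = z"
        using eq[of "s (h x)" x] by (intro bexI[of _ "h x"]) (auto simp: s hc)
    qed (auto simp: s F N)
    then show "\<exists>F. presents R X' N' P F" by blast
  }
qed

section \<open>Free modules, diagonal submodules and types over a discrete valuation ring\<close>

abbreviation free_module :: "('r, 'q) ring_scheme \<Rightarrow> 'i set \<Rightarrow> ('r, 'i \<Rightarrow> 'r) module" where
  "free_module R J \<equiv> prod_module J (\<lambda>_. regular_module R)"

lemma module_free: "cring R \<Longrightarrow> module R (free_module R J)"
  by (intro module_prod module_regular)

lemma free_sel:
  "carrier (free_module R J) = (J \<rightarrow>\<^sub>E carrier R)"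
  "x \<oplus>\<^bsub>free_module R J\<^esub> y = (\<lambda>i\<in>J. x i \<oplus>\<^bsub>R\<^esub> y i)"
  "r \<odot>\<^bsub>free_module R J\<^esub> x = (\<lambda>i\<in>J. r \<otimes>\<^bsub>R\<^esub> x i)"
  "\<zero>\<^bsub>free_module R J\<^esub> = (\<lambda>i\<in>J. \<zero>\<^bsub>R\<^esub>)"
  by (simp_all add: prod_sel regular_sel)

lemma free_minus:
  assumes "cring R" "x \<in> carrier (free_module R J)" "y \<in> carrier (free_module R J)"
  shows "x \<ominus>\<^bsub>free_module R J\<^esub> y = (\<lambda>i\<in>J. x i \<ominus>\<^bsub>R\<^esub> y i)"
proof -
  interpret cring R by fact
  interpret M: module R "free_module R J" by (rule module_free[OF assms(1)])
  have "\<ominus>\<^bsub>free_module R J\<^esub> y = (\<lambda>i\<in>J. \<ominus>\<^bsub>R\<^esub> y i)"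
    by (rule M.M.minus_equality) (use assms in \<open>auto simp: free_sel PiE_iff l_neg\<close>)
  then show ?thesis unfolding a_minus_def by (simp only: free_sel) (rule restrict_ext, simp)
qed

text \<open>The submodule \<open>aX + N\<close> is the preimage of \<open>aP\<close> under
  \<open>F\<close>; its index therefore depends only on the isomorphism class of the quotient of
  \<open>X\<close> by \<open>N\<close>.\<close>

lemma idx_presents:
  assumes X: "module R X" and P: "module R P" and N: "submodule N R X" and F: "presents R X N P F"
    and a: "a \<in> carrier R"
  shows "mindex X (carrier X) (mscale X a (carrier X) <+>\<^bsub>X\<^esub> N) = mindex P (carrier P) (mscale P a (carrier P))"
proof -
  interpret X: module R X by fact
  interpret P: module R P by fact
  note F' = presentsD[OF F]
  have sX: "X.sm (mscale X a (carrier X))" and sP: "P.sm (mscale P a (carrier P))"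
    using a by (auto intro: X.sm_scale P.sm_scale X.sm_carrier P.sm_carrier)
  have "mindex X (carrier X) (mscale X a (carrier X) <+>\<^bsub>X\<^esub> N) =
    card ((\<lambda>x. mscale P a (carrier P) +>\<^bsub>P\<^esub> F x) ` carrier X)"
  proof (rule X.idx_eq)
    fix x y assume xy: "x \<in> carrier X" "y \<in> carrier X"
    have "mscale P a (carrier P) +>\<^bsub>P\<^esub> F x = mscale P a (carrier P) +>\<^bsub>P\<^esub> F y \<longleftrightarrow>
      F (x \<ominus>\<^bsub>X\<^esub> y) \<in> mscale P a (carrier P)"
      using xy P.rcos_eq_iff[OF sP] F'(1) presents_minus[OF X P F xy] by simp
    also have "\<dots> \<longleftrightarrow> x \<ominus>\<^bsub>X\<^esub> y \<in> mscale X a (carrier X) <+>\<^bsub>X\<^esub> N"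
    proof
      assume "F (x \<ominus>\<^bsub>X\<^esub> y) \<in> mscale P a (carrier P)"
      then obtain u where u: "u \<in> carrier P" "F (x \<ominus>\<^bsub>X\<^esub> y) = a \<odot>\<^bsub>P\<^esub> u" by (auto simp: mscale_def)
      then obtain w where w: "w \<in> carrier X" "F w = u" using F'(4) by (metis imageE)
      have "F (x \<ominus>\<^bsub>X\<^esub> y) = F (a \<odot>\<^bsub>X\<^esub> w)" using u w a F'(3) by simp
      then have "(x \<ominus>\<^bsub>X\<^esub> y) \<ominus>\<^bsub>X\<^esub> a \<odot>\<^bsub>X\<^esub> w \<in> N"
        using presents_eq_iff[OF X P F] xy w a by simp
      moreover have "x \<ominus>\<^bsub>X\<^esub> y = a \<odot>\<^bsub>X\<^esub> w \<oplus>\<^bsub>X\<^esub> ((x \<ominus>\<^bsub>X\<^esub> y) \<ominus>\<^bsub>X\<^esub> a \<odot>\<^bsub>X\<^esub> w)"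
        using xy w a by (simp add: X.minus_telescope(2))
      moreover have "a \<odot>\<^bsub>X\<^esub> w \<in> mscale X a (carrier X)" using w by (simp add: mscale_def)
      ultimately show "x \<ominus>\<^bsub>X\<^esub> y \<in> mscale X a (carrier X) <+>\<^bsub>X\<^esub> N" by (metis X.msumI)
    next
      assume "x \<ominus>\<^bsub>X\<^esub> y \<in> mscale X a (carrier X) <+>\<^bsub>X\<^esub> N"
      then obtain w v where w: "w \<in> carrier X" "v \<in> N" "x \<ominus>\<^bsub>X\<^esub> y = a \<odot>\<^bsub>X\<^esub> w \<oplus>\<^bsub>X\<^esub> v"
        by (auto simp: X.msum_iff mscale_def)
      have v: "v \<in> carrier X" using w X.smD(3)[OF N] by simp
      then have "F (x \<ominus>\<^bsub>X\<^esub> y) = a \<odot>\<^bsub>P\<^esub> F w" using w a F'(1,2,3,5) by simp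
      then show "F (x \<ominus>\<^bsub>X\<^esub> y) \<in> mscale P a (carrier P)" using w F'(1) by (simp add: mscale_def)
    qed
    finally show "mscale P a (carrier P) +>\<^bsub>P\<^esub> F x = mscale P a (carrier P) +>\<^bsub>P\<^esub> F y \<longleftrightarrow>
      x \<ominus>\<^bsub>X\<^esub> y \<in> mscale X a (carrier X) <+>\<^bsub>X\<^esub> N" .
  qed (use sX N X.sm_sum in auto)
  also have "(\<lambda>x. mscale P a (carrier P) +>\<^bsub>P\<^esub> F x) ` carrier X = (\<lambda>u. mscale P a (carrier P) +>\<^bsub>P\<^esub> u) ` carrier P"
    using F'(4) by (metis image_image)
  finally show ?thesis by (simp add: mindex_def)
qed

locale dvr = uniformizer R p q + principal_domain R
  for R (structure) and p :: 'a and q :: nat +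
  assumes p_nz: "p \<noteq> \<zero>" and pow_ideal: "\<And>n. max_ideal_pow R n = PIdl (p [^] n)"
begin

lemma R_cring: "cring R" by (rule is_cring)

sublocale reg: uniformizer_module R "regular_module R" p q
  by (intro uniformizer_module.intro module_regular R_cring uniformizer_axioms)

lemma um_free: "uniformizer_module R (free_module R J) p q"
  by (intro uniformizer_module.intro module_free R_cring uniformizer_axioms)

lemma p_pow [simp]: "p [^] (k::nat) \<in> carrier R"
  using p_closed by simp

lemma p_pow_nz: "p [^] (k::nat) \<noteq> \<zero>"
  by (induction k) (use p_nz p_closed integral in auto)

lemma p_pow_cancel: "x \<in> carrier R \<Longrightarrow> y \<in> carrier R \<Longrightarrow> p [^] (k::nat) \<otimes> x = p [^] k \<otimes> y \<longleftrightarrow> x = y"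
  using p_pow_nz m_lcancel by simp

lemma PIdl_pw: "PIdl (p [^] (k::nat)) = reg.pw k (carrier (regular_module R))"
  by (auto simp: reg.pw_def mscale_def regular_sel PIdl_iff)

lemma sm_PIdl: "reg.sm (PIdl (p [^] (k::nat)))"
  unfolding PIdl_pw by (intro reg.sm_pw reg.sm_carrier)

lemma PIdl_mono: "k \<le> l \<Longrightarrow> PIdl (p [^] (l::nat)) \<subseteq> PIdl (p [^] (k::nat))"
proof
  fix x assume kl: "k \<le> l" and "x \<in> PIdl (p [^] l)"
  then obtain c where c: "c \<in> carrier R" "x = p [^] l \<otimes> c" by (auto simp: PIdl_iff)
  have "p [^] k \<otimes> (p [^] (l - k) \<otimes> c) = p [^] l \<otimes> c"
    using c kl p_closed by (simp add: m_assoc[symmetric] nat_pow_mult)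
  then show "x \<in> PIdl (p [^] k)" using c by (auto simp: PIdl_iff intro!: bexI[of _ "p [^] (l - k) \<otimes> c"])
qed

lemma pow_mem_PIdl: "p [^] (k::nat) \<in> PIdl (p [^] (l::nat)) \<longleftrightarrow> l \<le> k"
proof
  assume "p [^] k \<in> PIdl (p [^] l)"
  then obtain c where c: "c \<in> carrier R" "p [^] k = p [^] l \<otimes> c" by (auto simp: PIdl_iff)
  show "l \<le> k"
  proof (rule ccontr)
    assume "\<not> l \<le> k"
    then obtain j where j: "l = k + Suc j" by (metis less_imp_Suc_add not_le add_Suc_right)
    have e: "p [^] l = p [^] k \<otimes> (p \<otimes> p [^] j)"
      using p_closed nat_pow_mult[OF p_closed, of k "Suc j"] m_comm[of p "p [^] j"] by (simp add: j)
    have "p [^] k \<otimes> \<one> = p [^] k" by simp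
    also note c(2)
    also have "p [^] l \<otimes> c = p [^] k \<otimes> (p \<otimes> (p [^] j \<otimes> c))"
      unfolding e using c(1) p_closed by (simp add: m_assoc)
    finally have "p [^] k \<otimes> \<one> = p [^] k \<otimes> (p \<otimes> (p [^] j \<otimes> c))" .
    then have "\<one> = p \<otimes> (p [^] j \<otimes> c)"
      using p_pow_cancel[of \<one> "p \<otimes> (p [^] j \<otimes> c)" k] c(1) p_closed by simp
    then have "p \<in> Units R" using c(1) p_closed m_comm[of p "p [^] j \<otimes> c"]
      unfolding Units_def by (intro CollectI conjI bexI[of _ "p [^] j \<otimes> c"]) auto
    then show False using p_nonunit by simp
  qed
next
  assume "l \<le> k"
  then show "p [^] k \<in> PIdl (p [^] l)" using PIdl_mono[of l k] cgenideal_self[of "p [^] k"] by auto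
qed

lemma reg_tf: "x \<in> carrier (regular_module R) \<Longrightarrow> p \<odot>\<^bsub>regular_module R\<^esub> x = \<zero>\<^bsub>regular_module R\<^esub> \<Longrightarrow> x = \<zero>\<^bsub>regular_module R\<^esub>"
  using integral[of p x] p_nz p_closed by (simp add: regular_sel)

lemma card_residue_pow: "card ((\<lambda>a. PIdl (p [^] (k::nat)) +>\<^bsub>R\<^esub> a) ` carrier R) = q ^ k"
proof -
  let ?C = "carrier (regular_module R)"
  have 1: "reg.idx ?C (reg.scl p ?C) = q"
  proof -
    have "PIdl p = reg.scl p ?C" using PIdl_pw[of 1] p_closed by (simp add: reg.pw_def)
    then show ?thesis using card_residue by (simp add: mindex_def regular_sel)
  qed
  have "reg.idx ?C (reg.pw k ?C) = q ^ k"
  proof (induction k)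
    case 0
    then show ?case using reg.idx_self[OF reg.sm_carrier] by (simp add: reg.pw_0[OF reg.sm_carrier])
  next
    case (Suc k)
    have s: "reg.sm (reg.scl p ?C)" by (intro reg.sm_scale reg.sm_carrier p_closed)
    have "reg.idx ?C (reg.pw (Suc k) ?C) = reg.idx ?C (reg.scl p ?C) * reg.idx (reg.scl p ?C) (reg.scl p (reg.pw k ?C))"
      unfolding reg.pw_Suc'[OF reg.sm_carrier]
    proof (rule reg.idx_mult)
      show "reg.scl p (reg.pw k ?C) \<subseteq> reg.scl p ?C" by (intro reg.scale_mono reg.pw_le reg.sm_carrier)
      show "reg.scl p ?C \<subseteq> ?C" by (intro reg.scale_le reg.sm_carrier p_closed)
    qed (simp_all add: reg.sm_scale reg.sm_pw reg.sm_carrier p_closed)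
    also have "reg.idx (reg.scl p ?C) (reg.scl p (reg.pw k ?C)) = reg.idx ?C (reg.pw k ?C)"
      by (rule reg.idx_scale[OF reg.sm_carrier reg.sm_pw[OF reg.sm_carrier] reg.pw_le[OF reg.sm_carrier] p_closed reg_tf])
    finally show ?case using 1 Suc by simp
  qed
  then show ?thesis unfolding PIdl_pw by (simp add: mindex_def regular_sel)
qed

definition diag :: "'i set \<Rightarrow> ('i \<Rightarrow> nat) \<Rightarrow> ('i \<Rightarrow> 'a) set" where
  "diag J e = {x \<in> carrier (free_module R J). \<forall>i\<in>J. x i \<in> PIdl (p [^] e i)}"

lemma PIdl_ops:
  "x \<in> PIdl (p [^] (k::nat)) \<Longrightarrow> y \<in> PIdl (p [^] k) \<Longrightarrow> x \<oplus> y \<in> PIdl (p [^] k)"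
  "r \<in> carrier R \<Longrightarrow> x \<in> PIdl (p [^] k) \<Longrightarrow> r \<otimes> x \<in> PIdl (p [^] k)"
  "\<zero> \<in> PIdl (p [^] k)" "x \<in> PIdl (p [^] k) \<Longrightarrow> x \<in> carrier R"
  using reg.smD[OF sm_PIdl[of k]] by (simp_all add: regular_sel)

lemma sm_diag: "module.sm R (free_module R J) (diag J e)"
proof -
  interpret F: uniformizer_module R "free_module R J" p q by (rule um_free)
  show ?thesis
  proof (rule F.smI)
    show "diag J e \<subseteq> carrier (free_module R J)" by (auto simp: diag_def)
    show "\<zero>\<^bsub>free_module R J\<^esub> \<in> diag J e" by (simp add: diag_def free_sel PIdl_ops(3))
    fix x y assume "x \<in> diag J e" "y \<in> diag J e"
    then show "x \<oplus>\<^bsub>free_module R J\<^esub> y \<in> diag J e"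
      by (simp add: diag_def free_sel PIdl_ops(1) PiE_iff)
  next
    fix r x assume "r \<in> carrier R" "x \<in> diag J e"
    then show "r \<odot>\<^bsub>free_module R J\<^esub> x \<in> diag J e"
      by (simp add: diag_def free_sel PIdl_ops(2) PiE_iff)
  qed
qed

lemma PIdl_rcos_iff:
  "a \<in> carrier R \<Longrightarrow> b \<in> carrier R \<Longrightarrow>
    PIdl (p [^] (k::nat)) +>\<^bsub>R\<^esub> a = PIdl (p [^] k) +>\<^bsub>R\<^esub> b \<longleftrightarrow> a \<ominus> b \<in> PIdl (p [^] k)"
  using reg.rcos_eq_iff[OF sm_PIdl[of k], of a b] by (simp add: regular_sel regular_minus[OF R_cring])

lemma idx_diag:
  assumes "finite J"
  shows "mindex (free_module R J) (carrier (free_module R J)) (diag J e) = (\<Prod>i\<in>J. q ^ e i)"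
proof -
  interpret F: uniformizer_module R "free_module R J" p q by (rule um_free)
  define g where "g x = (\<lambda>i\<in>J. PIdl (p [^] e i) +>\<^bsub>R\<^esub> x i)" for x :: "_ \<Rightarrow> 'a"
  have "F.idx (carrier (free_module R J)) (diag J e) = card (g ` carrier (free_module R J))"
  proof (rule F.idx_eq[OF sm_diag])
    fix x y assume xy: "x \<in> carrier (free_module R J)" "y \<in> carrier (free_module R J)"
    have "g x = g y \<longleftrightarrow> (\<forall>i\<in>J. PIdl (p [^] e i) +>\<^bsub>R\<^esub> x i = PIdl (p [^] e i) +>\<^bsub>R\<^esub> y i)"
      by (auto simp: g_def restrict_def fun_eq_iff)
    also have "\<dots> \<longleftrightarrow> (\<forall>i\<in>J. x i \<ominus> y i \<in> PIdl (p [^] e i))"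
      using xy by (intro ball_cong refl PIdl_rcos_iff) (auto simp: free_sel)
    also have "\<dots> \<longleftrightarrow> x \<ominus>\<^bsub>free_module R J\<^esub> y \<in> diag J e"
      using F.M.minus_closed[OF xy] unfolding diag_def free_minus[OF R_cring xy] by simp
    finally show "g x = g y \<longleftrightarrow> x \<ominus>\<^bsub>free_module R J\<^esub> y \<in> diag J e" .
  qed simp
  also have "g ` carrier (free_module R J) = (\<Pi>\<^sub>E i\<in>J. (\<lambda>a. PIdl (p [^] e i) +>\<^bsub>R\<^esub> a) ` carrier R)"
  proof
    show "g ` carrier (free_module R J) \<subseteq> (\<Pi>\<^sub>E i\<in>J. (\<lambda>a. PIdl (p [^] e i) +>\<^bsub>R\<^esub> a) ` carrier R)"
      by (auto simp: g_def free_sel)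
    show "(\<Pi>\<^sub>E i\<in>J. (\<lambda>a. PIdl (p [^] e i) +>\<^bsub>R\<^esub> a) ` carrier R) \<subseteq> g ` carrier (free_module R J)"
    proof
      fix z assume z: "z \<in> (\<Pi>\<^sub>E i\<in>J. (\<lambda>a. PIdl (p [^] e i) +>\<^bsub>R\<^esub> a) ` carrier R)"
      then have "\<forall>i\<in>J. \<exists>a. a \<in> carrier R \<and> z i = PIdl (p [^] e i) +>\<^bsub>R\<^esub> a" by (auto simp: PiE_iff)
      then obtain x where x: "\<forall>i\<in>J. x i \<in> carrier R \<and> z i = PIdl (p [^] e i) +>\<^bsub>R\<^esub> x i" by metis
      have "z = g (restrict x J)"
        by (rule extensionalityI[of _ J]) (use z x in \<open>auto simp: g_def PiE_iff\<close>)
      moreover have "restrict x J \<in> carrier (free_module R J)" using x by (auto simp: free_sel)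
      ultimately show "z \<in> g ` carrier (free_module R J)" by blast
    qed
  qed
  also have "card \<dots> = (\<Prod>i\<in>J. q ^ e i)"
    using assms by (simp add: card_PiE card_residue_pow)
  finally show ?thesis .
qed

lemma scale_free:
  "mscale (free_module R J) (p [^] (k::nat)) (carrier (free_module R J)) = diag J (\<lambda>_. k)"
proof
  show "mscale (free_module R J) (p [^] k) (carrier (free_module R J)) \<subseteq> diag J (\<lambda>_. k)"
    by (auto simp: mscale_def diag_def free_sel PIdl_iff PiE_iff)
  show "diag J (\<lambda>_. k) \<subseteq> mscale (free_module R J) (p [^] k) (carrier (free_module R J))"
  proof
    fix x assume x: "x \<in> diag J (\<lambda>_. k)"
    then have "\<forall>i\<in>J. \<exists>c. c \<in> carrier R \<and> x i = p [^] k \<otimes> c" by (auto simp: diag_def PIdl_iff)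
    then obtain c where c: "\<forall>i\<in>J. c i \<in> carrier R \<and> x i = p [^] k \<otimes> c i" by metis
    have "x = p [^] k \<odot>\<^bsub>free_module R J\<^esub> restrict c J"
      by (rule extensionalityI[of _ J]) (use x c in \<open>auto simp: diag_def free_sel PiE_iff\<close>)
    moreover have "restrict c J \<in> carrier (free_module R J)" using c by (auto simp: free_sel)
    ultimately show "x \<in> mscale (free_module R J) (p [^] k) (carrier (free_module R J))"
      unfolding mscale_def by blast
  qed
qed

lemma scale_plus_diag:
  "diag J (\<lambda>_. k) <+>\<^bsub>free_module R J\<^esub> diag J e = diag J (\<lambda>i. min (e i) k)"
proof
  interpret F: uniformizer_module R "free_module R J" p q by (rule um_free)
  show "diag J (\<lambda>_. k) <+>\<^bsub>free_module R J\<^esub> diag J e \<subseteq> diag J (\<lambda>i. min (e i) k)"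
    by (rule F.sum_least[OF sm_diag])
      (auto simp: diag_def intro: PIdl_mono[THEN subsetD, rotated])
  show "diag J (\<lambda>i. min (e i) k) \<subseteq> diag J (\<lambda>_. k) <+>\<^bsub>free_module R J\<^esub> diag J e"
  proof
    fix x assume x: "x \<in> diag J (\<lambda>i. min (e i) k)"
    let ?u = "\<lambda>i\<in>J. if k \<le> e i then x i else \<zero>" and ?v = "\<lambda>i\<in>J. if k \<le> e i then \<zero> else x i"
    have uv: "?u \<in> diag J (\<lambda>_. k)" "?v \<in> diag J e"
    proof -
      have "x i \<in> PIdl (p [^] k)" if "i \<in> J" "k \<le> e i" for i
      proof -
        have "min (e i) k = k" using that by simp
        then show ?thesis using x that unfolding diag_def by force
      qed
      moreover have "x i \<in> PIdl (p [^] e i)" if "i \<in> J" "\<not> k \<le> e i" for i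
      proof -
        have "min (e i) k = e i" using that by simp
        then show ?thesis using x that unfolding diag_def by force
      qed
      ultimately show "?u \<in> diag J (\<lambda>_. k)" "?v \<in> diag J e"
        using x PIdl_ops(3) by (simp_all add: diag_def free_sel PiE_iff)
    qed
    have "?u \<oplus>\<^bsub>free_module R J\<^esub> ?v = x"
      using x by (intro extensionalityI[of _ J]) (simp_all add: diag_def free_sel PiE_iff)
    then show "x \<in> diag J (\<lambda>_. k) <+>\<^bsub>free_module R J\<^esub> diag J e" using F.msumI[OF uv] by simp
  qed
qed

abbreviation quot_prod :: "nat \<Rightarrow> nat list \<Rightarrow> ('a, nat \<Rightarrow> 'a set) module" where
  "quot_prod n lam \<equiv> prod_module {..<n} (\<lambda>i. quot_module (regular_module R) (max_ideal_pow R (lam ! i)))"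

lemma module_quot_prod: "module R (quot_prod n lam)"
  unfolding pow_ideal by (intro module_prod R_cring reg.module_quot sm_PIdl)

lemma presents_free:
  "presents R (free_module R {..<n}) (diag {..<n} (\<lambda>i. lam ! i)) (quot_prod n lam)
    (\<lambda>z. \<lambda>i\<in>{..<n}. PIdl (p [^] (lam ! i)) +>\<^bsub>R\<^esub> z i)"
proof (rule presentsI)
  note q = reg.quot_add[OF sm_PIdl, unfolded regular_sel] reg.quot_smult[OF sm_PIdl, unfolded regular_sel]
    reg.quot_zero[OF sm_PIdl, unfolded regular_sel] reg.quot_carrier[unfolded regular_sel]
  fix x assume x: "x \<in> carrier (free_module R {..<n})"
  show "(\<lambda>i\<in>{..<n}. PIdl (p [^] (lam ! i)) +>\<^bsub>R\<^esub> x i) \<in> carrier (quot_prod n lam)"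
    using x by (auto simp: prod_sel pow_ideal q regular_sel PiE_iff)
  have "(\<lambda>i\<in>{..<n}. PIdl (p [^] (lam ! i)) +>\<^bsub>R\<^esub> x i) = \<zero>\<^bsub>quot_prod n lam\<^esub> \<longleftrightarrow>
    (\<forall>i<n. PIdl (p [^] (lam ! i)) +>\<^bsub>R\<^esub> x i = PIdl (p [^] (lam ! i)) +>\<^bsub>R\<^esub> \<zero>)"
    by (auto simp: prod_sel pow_ideal q restrict_def fun_eq_iff)
  also have "\<dots> \<longleftrightarrow> (\<forall>i<n. x i \<in> PIdl (p [^] (lam ! i)))"
    using x reg.minus_0 by (auto simp: PIdl_rcos_iff free_sel regular_sel regular_minus[OF R_cring, symmetric] PiE_iff)
  finally show "(\<lambda>i\<in>{..<n}. PIdl (p [^] (lam ! i)) +>\<^bsub>R\<^esub> x i) = \<zero>\<^bsub>quot_prod n lam\<^esub> \<longleftrightarrow>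
    x \<in> diag {..<n} (\<lambda>i. lam ! i)" using x by (auto simp: diag_def)
  fix y assume y: "y \<in> carrier (free_module R {..<n})"
  show "(\<lambda>i\<in>{..<n}. PIdl (p [^] (lam ! i)) +>\<^bsub>R\<^esub> (x \<oplus>\<^bsub>free_module R {..<n}\<^esub> y) i) =
    (\<lambda>i\<in>{..<n}. PIdl (p [^] (lam ! i)) +>\<^bsub>R\<^esub> x i) \<oplus>\<^bsub>quot_prod n lam\<^esub> (\<lambda>i\<in>{..<n}. PIdl (p [^] (lam ! i)) +>\<^bsub>R\<^esub> y i)"
    using x y unfolding prod_sel pow_ideal
    by (intro restrict_ext) (auto simp: q regular_sel PiE_iff)
next
  note q = reg.quot_add[OF sm_PIdl, unfolded regular_sel] reg.quot_smult[OF sm_PIdl, unfolded regular_sel]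
    reg.quot_zero[OF sm_PIdl, unfolded regular_sel] reg.quot_carrier[unfolded regular_sel]
  fix r x assume x: "x \<in> carrier (free_module R {..<n})" and r: "r \<in> carrier R"
  show "(\<lambda>i\<in>{..<n}. PIdl (p [^] (lam ! i)) +>\<^bsub>R\<^esub> (r \<odot>\<^bsub>free_module R {..<n}\<^esub> x) i) =
    r \<odot>\<^bsub>quot_prod n lam\<^esub> (\<lambda>i\<in>{..<n}. PIdl (p [^] (lam ! i)) +>\<^bsub>R\<^esub> x i)"
    using x r unfolding prod_sel pow_ideal
    by (intro restrict_ext) (auto simp: q regular_sel PiE_iff)
next
  note q = reg.quot_carrier[unfolded regular_sel]
  fix z assume "z \<in> carrier (quot_prod n lam)"
  then have z: "z \<in> extensional {..<n}" "\<forall>i<n. z i \<in> (\<lambda>a. PIdl (p [^] (lam ! i)) +>\<^bsub>R\<^esub> a) ` carrier R"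
    by (auto simp: prod_sel pow_ideal q PiE_iff)
  then have "\<forall>i\<in>{..<n}. \<exists>a. a \<in> carrier R \<and> z i = PIdl (p [^] (lam ! i)) +>\<^bsub>R\<^esub> a" by auto
  then obtain a where a: "\<forall>i\<in>{..<n}. a i \<in> carrier R \<and> z i = PIdl (p [^] (lam ! i)) +>\<^bsub>R\<^esub> a i" by metis
  have "(\<lambda>i\<in>{..<n}. PIdl (p [^] (lam ! i)) +>\<^bsub>R\<^esub> (restrict a {..<n}) i) = z"
    by (rule extensionalityI[of _ "{..<n}"]) (use z a in auto)
  moreover have "restrict a {..<n} \<in> carrier (free_module R {..<n})" using a by (auto simp: free_sel)
  ultimately show "\<exists>x\<in>carrier (free_module R {..<n}).
    (\<lambda>i\<in>{..<n}. PIdl (p [^] (lam ! i)) +>\<^bsub>R\<^esub> x i) = z" by blast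
qed

lemma has_elem_div_type_iff:
  assumes "module R X" "submodule N R X"
  shows "has_elem_div_type R n X N lam \<longleftrightarrow> length lam = n \<and> sorted_wrt (\<ge>) lam \<and>
    (\<exists>F. presents R X N (quot_prod n lam) F)"
  unfolding has_elem_div_type_def lin_iso_quot_iff[OF assms(1) module_quot_prod assms(2)] ..

lemma has_elem_div_type_transfer:
  assumes "module R X" "submodule N R X" "module R X'" "submodule N' R X'"
    and "h \<in> lin_hom R X X'" "h ` carrier X = carrier X'"
    and "\<And>x. x \<in> carrier X \<Longrightarrow> x \<in> N \<longleftrightarrow> h x \<in> N'"
  shows "has_elem_div_type R n X N lam \<longleftrightarrow> has_elem_div_type R n X' N' lam"
  unfolding has_elem_div_type_iff[OF assms(1,2)] has_elem_div_type_iff[OF assms(3,4)]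
  using presents_transfer[OF assms(1,3) module_quot_prod assms(5,6,7) module.smD(2)[OF assms(3,4)]] by simp

text \<open>\<open>X\<close> with \<open>N\<close> and the free module with the diagonal submodule
  present the same product of cyclic modules. By \<open>idx_presents\<close> the index may be
  computed in the diagonal case, where adding \<open>p^m\<close> cuts every exponent off at
  \<open>m\<close>.\<close>

lemma type_idx:
  assumes X: "module R X" and N: "submodule N R X" and t: "has_elem_div_type R n X N lam"
  shows "mindex X (carrier X) (mscale X (p [^] (m::nat)) (carrier X) <+>\<^bsub>X\<^esub> N) = (\<Prod>i<n. q ^ min (lam ! i) m)"
proof -
  obtain F where F: "presents R X N (quot_prod n lam) F" using t has_elem_div_type_iff[OF X N] by auto
  have "mindex X (carrier X) (mscale X (p [^] m) (carrier X) <+>\<^bsub>X\<^esub> N) =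
    mindex (free_module R {..<n}) (carrier (free_module R {..<n}))
      (diag {..<n} (\<lambda>_. m) <+>\<^bsub>free_module R {..<n}\<^esub> diag {..<n} (\<lambda>i. lam ! i))"
    unfolding idx_presents[OF X module_quot_prod N F p_pow] scale_free[symmetric]
    by (rule idx_presents[OF module_free[OF R_cring] module_quot_prod sm_diag presents_free p_pow, symmetric])
  then show ?thesis unfolding scale_plus_diag by (simp add: idx_diag)
qed

text \<open>Quotient of the indices for \<open>j + 1\<close> and \<open>j\<close>: the cut-off
  exponent grows by one exactly for the parts greater than \<open>j\<close>.\<close>

lemma type_step_index:
  assumes X: "module R X" and N: "submodule N R X" and t: "has_elem_div_type R n X N lam"
  shows "uniformizer_module.step_index R X p (carrier X) N j = q ^ card {i. i < n \<and> j < lam ! i}"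
proof -
  interpret X: uniformizer_module R X p q by (intro uniformizer_module.intro X uniformizer_axioms)
  have id: "(\<Prod>j<m. X.step_index (carrier X) N j) = (\<Prod>i<n. q ^ min (lam ! i) m)" for m
    using X.idx_filtration[OF X.sm_carrier N X.smD(1)[OF N], of m] type_idx[OF assms, of m]
    by (simp add: X.pw_def)
  have "(\<Prod>i<n. q ^ min (lam ! i) (Suc j)) = (\<Prod>i<n. q ^ min (lam ! i) j) * (\<Prod>i<n. if j < lam ! i then q else 1)"
  proof -
    have "min (lam ! i) (Suc j) = min (lam ! i) j + (if j < lam ! i then 1 else 0)" for i by auto
    then show ?thesis unfolding prod.distrib[symmetric] by (intro prod.cong refl) (simp add: power_add)
  qed
  also have "(\<Prod>i<n. if j < lam ! i then q else 1) = (\<Prod>i\<in>{i. i < n \<and> j < lam ! i}. q)"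
    by (subst prod.inter_filter[symmetric]) auto
  finally have "(\<Prod>i<n. q ^ min (lam ! i) j) * X.step_index (carrier X) N j =
      (\<Prod>i<n. q ^ min (lam ! i) j) * q ^ card {i. i < n \<and> j < lam ! i}"
    using id[of "Suc j"] id[of j] by simp
  moreover have "(\<Prod>i<n. q ^ min (lam ! i) j) \<noteq> 0" using q_pos by simp
  ultimately show ?thesis by simp
qed

end

section \<open>Smith normal form\<close>

text \<open>Conjugation of partitions: a part and the number of parts exceeding \<open>j\<close>
  describe the same Ferrers diagram by rows and by columns. \<open>Suc k\<close> accounts for
  numbering parts from 0.\<close>

lemma card_desc_ge_iff:
  assumes "sorted_wrt (\<ge>) lam" "length lam = n" "k < n"
  shows "Suc k \<le> card {i. i < n \<and> (j::nat) < lam ! i} \<longleftrightarrow> j < lam ! k"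
proof
  have mono: "lam ! i \<ge> lam ! i'" if "i \<le> i'" "i' < n" for i i'
    using that assms sorted_wrt_nth_less[OF assms(1), of i i'] by (cases "i = i'") auto
  {
    assume "j < lam ! k"
    then have "{..k} \<subseteq> {i. i < n \<and> j < lam ! i}" using mono[of _ k] assms(3) by force
    then have "card {..k} \<le> card {i. i < n \<and> j < lam ! i}" by (intro card_mono) auto
    then show "Suc k \<le> card {i. i < n \<and> j < lam ! i}" by simp
  next
    assume c: "Suc k \<le> card {i. i < n \<and> j < lam ! i}"
    show "j < lam ! k"
    proof (rule ccontr)
      assume "\<not> j < lam ! k"
      then have "lam ! k \<le> j" by simp
      have "i < k" if i: "i < n" "j < lam ! i" for i
      proof (rule ccontr)
        assume "\<not> i < k"
        then have "lam ! i \<le> lam ! k" using mono[of k i] i by simp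
        then show False using i \<open>lam ! k \<le> j\<close> by simp
      qed
      then have "{i. i < n \<and> j < lam ! i} \<subseteq> {..<k}" by blast
      then have "card {i. i < n \<and> j < lam ! i} \<le> card {..<k}" by (intro card_mono) auto
      then show False using c by simp
    qed
  }
qed

context uniformizer_module
begin

text \<open>Pigeonhole on the cosets of \<open>v\<close>, \<open>pv\<close>, ..., up to the exponent
  \<open>|L : N|\<close>: two of them agree, so \<open>N\<close> contains
  \<open>(1 - p^(e+1)) p^i v\<close> for some \<open>i\<close> below that exponent. The scalar in
  front is a unit, hence \<open>p^i v\<close> lies in \<open>N\<close>. The exponent
  \<open>i\<close> varies with \<open>v\<close>, but the bound does not.\<close>

lemma finite_idx_pw:
  assumes N: "sm N" and L: "sm L" "N \<subseteq> L" and k: "idx L N > 0"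
  shows "pw (idx L N) L \<subseteq> N"
proof
  fix w assume "w \<in> pw (idx L N) L"
  then obtain v where v: "v \<in> L" "w = p [^] (idx L N) \<odot>\<^bsub>M\<^esub> v" by (auto simp: pw_def mscale_def)
  have vM: "v \<in> carrier M" using v(1) smD(3)[OF L(1)] by blast
  let ?f = "\<lambda>j::nat. N +>\<^bsub>M\<^esub> (p [^] j \<odot>\<^bsub>M\<^esub> v)"
  have "?f ` {..idx L N} \<subseteq> (\<lambda>a. N +>\<^bsub>M\<^esub> a) ` L" using smD(7)[OF L(1) p_pow v(1)] by blast
  moreover have "finite ((\<lambda>a. N +>\<^bsub>M\<^esub> a) ` L)" using k unfolding mindex_def by (rule card_ge_0_finite)
  ultimately have "card (?f ` {..idx L N}) \<le> idx L N" unfolding mindex_def by (rule card_mono[rotated])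
  then have "\<not> inj_on ?f {..idx L N}" using card_image[of ?f "{..idx L N}"] by auto
  then obtain i j where ij: "i < j" "j \<le> idx L N" "?f i = ?f j"
    by (auto simp: inj_on_def) (metis linorder_neqE_nat)
  obtain e where e: "j = i + Suc e" using less_imp_Suc_add[OF ij(1)] by auto
  obtain b where b: "idx L N = i + b" using ij by (metis le_add_diff_inverse less_imp_le order_trans)
  have pe: "p [^] Suc e = p \<otimes> p [^] e" using p_closed by (simp add: m_comm)
  have u: "\<one> \<ominus> p [^] Suc e \<in> Units R"
  proof (rule ccontr)
    assume "\<one> \<ominus> p [^] Suc e \<notin> Units R"
    then obtain c where c: "c \<in> carrier R" "\<one> \<ominus> p [^] Suc e = p \<otimes> c"
      using unit_or_dvd[of "\<one> \<ominus> p [^] Suc e"] p_pow[of "Suc e"] by blast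
    have "\<one> = (\<one> \<ominus> p [^] Suc e) \<oplus> p [^] Suc e"
      using p_pow[of "Suc e"] by (simp only: a_minus_def R.a_assoc R.l_neg R.one_closed R.a_inv_closed R.r_zero)
    also have "\<dots> = p \<otimes> c \<oplus> p [^] Suc e" unfolding c(2) ..
    also have "\<dots> = p \<otimes> (c \<oplus> p [^] e)" unfolding pe using c(1) p_closed by (simp add: r_distr)
    finally have "p \<in> Units R" using c(1) p_closed m_comm[of p "c \<oplus> p [^] e"]
      unfolding Units_def by (intro CollectI conjI bexI[of _ "c \<oplus> p [^] e"]) auto
    then show False using p_nonunit by simp
  qed
  have "p [^] i \<odot>\<^bsub>M\<^esub> v \<ominus>\<^sub>M p [^] j \<odot>\<^bsub>M\<^esub> v \<in> N"
    using ij(3) rcos_eq_iff[OF N, of "p [^] i \<odot>\<^bsub>M\<^esub> v" "p [^] j \<odot>\<^bsub>M\<^esub> v"] vM by simp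
  moreover have "p [^] i \<odot>\<^bsub>M\<^esub> v \<ominus>\<^sub>M p [^] j \<odot>\<^bsub>M\<^esub> v = (\<one> \<ominus> p [^] Suc e) \<odot>\<^bsub>M\<^esub> (p [^] i \<odot>\<^bsub>M\<^esub> v)"
  proof -
    have "p [^] j \<odot>\<^bsub>M\<^esub> v = p [^] Suc e \<odot>\<^bsub>M\<^esub> (p [^] i \<odot>\<^bsub>M\<^esub> v)"
      unfolding e using vM p_pow[of "Suc e"] nat_pow_mult[OF p_closed, of i "Suc e"]
        m_comm[OF p_pow[of i] p_pow[of "Suc e"]]
      by (metis p_pow smult_assoc1)
    then show ?thesis using vM p_pow[of "Suc e"]
      by (simp only: a_minus_def[of R] smult_l_distr smult_l_minus smult_one R.one_closed R.a_inv_closed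
          smult_closed p_pow a_minus_def[of M])
  qed
  ultimately have iN: "p [^] i \<odot>\<^bsub>M\<^esub> v \<in> N"
    using smult_unit_cancel[OF N _ u, of "p [^] i \<odot>\<^bsub>M\<^esub> v"] vM by simp
  have "w = p [^] b \<odot>\<^bsub>M\<^esub> (p [^] i \<odot>\<^bsub>M\<^esub> v)"
    using nat_pow_mult[OF p_closed, of b i] vM unfolding v(2) b by (metis add.commute p_pow smult_assoc1)
  then show "w \<in> N" using smD(7)[OF N p_pow iN] by simp
qed

end

context dvr
begin

text \<open>Linear coordinates \<open>f i\<close> that identify the free module with
  \<open>R^n\<close> and turn \<open>N\<close> into a diagonal submodule: Smith normal form without
  matrices or bases. Surjectivity and injectivity are the conditions on \<open>z\<close> and on
  pairs \<open>x\<close>, \<open>y\<close>.\<close>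

definition smith_coords ::
  "'i set \<Rightarrow> ('i \<Rightarrow> 'a) set \<Rightarrow> nat \<Rightarrow> nat list \<Rightarrow> (nat \<Rightarrow> ('i \<Rightarrow> 'a) \<Rightarrow> 'a) \<Rightarrow> bool" where
  "smith_coords J N n lam f \<longleftrightarrow> length lam = n \<and> sorted_wrt (\<ge>) lam \<and>
    (\<forall>i<n. \<forall>x\<in>carrier (free_module R J). f i x \<in> carrier R) \<and>
    (\<forall>i<n. \<forall>x\<in>carrier (free_module R J). \<forall>y\<in>carrier (free_module R J).
       f i (x \<oplus>\<^bsub>free_module R J\<^esub> y) = f i x \<oplus> f i y) \<and>
    (\<forall>i<n. \<forall>r\<in>carrier R. \<forall>x\<in>carrier (free_module R J). f i (r \<odot>\<^bsub>free_module R J\<^esub> x) = r \<otimes> f i x) \<and>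
    (\<forall>z. (\<forall>i<n. z i \<in> carrier R) \<longrightarrow> (\<exists>x\<in>carrier (free_module R J). \<forall>i<n. f i x = z i)) \<and>
    (\<forall>x\<in>carrier (free_module R J). x \<in> N \<longleftrightarrow> (\<forall>i<n. f i x \<in> PIdl (p [^] (lam ! i)))) \<and>
    (\<forall>x\<in>carrier (free_module R J). \<forall>y\<in>carrier (free_module R J). (\<forall>i<n. f i x = f i y) \<longrightarrow> x = y)"

lemma smith_coordsD:
  assumes "smith_coords J N n lam f"
  shows "length lam = n" "sorted_wrt (\<ge>) lam"
    "i < n \<Longrightarrow> x \<in> carrier (free_module R J) \<Longrightarrow> f i x \<in> carrier R"
    "i < n \<Longrightarrow> x \<in> carrier (free_module R J) \<Longrightarrow> y \<in> carrier (free_module R J) \<Longrightarrow>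
       f i (x \<oplus>\<^bsub>free_module R J\<^esub> y) = f i x \<oplus> f i y"
    "i < n \<Longrightarrow> r \<in> carrier R \<Longrightarrow> x \<in> carrier (free_module R J) \<Longrightarrow> f i (r \<odot>\<^bsub>free_module R J\<^esub> x) = r \<otimes> f i x"
    "(\<And>i. i < n \<Longrightarrow> z i \<in> carrier R) \<Longrightarrow> \<exists>x\<in>carrier (free_module R J). \<forall>i<n. f i x = z i"
    "x \<in> carrier (free_module R J) \<Longrightarrow> x \<in> N \<longleftrightarrow> (\<forall>i<n. f i x \<in> PIdl (p [^] (lam ! i)))"
    "x \<in> carrier (free_module R J) \<Longrightarrow> y \<in> carrier (free_module R J) \<Longrightarrow> (\<And>i. i < n \<Longrightarrow> f i x = f i y) \<Longrightarrow> x = y"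
proof -
  note * = assms[unfolded smith_coords_def]
  show "length lam = n" using * by (rule conjunct1)
  note * = *[THEN conjunct2]
  show "sorted_wrt (\<ge>) lam" using * by (rule conjunct1)
  note * = *[THEN conjunct2]
  show "i < n \<Longrightarrow> x \<in> carrier (free_module R J) \<Longrightarrow> f i x \<in> carrier R"
    using *[THEN conjunct1] by blast
  note * = *[THEN conjunct2]
  show "i < n \<Longrightarrow> x \<in> carrier (free_module R J) \<Longrightarrow> y \<in> carrier (free_module R J) \<Longrightarrow>
       f i (x \<oplus>\<^bsub>free_module R J\<^esub> y) = f i x \<oplus> f i y"
    using *[THEN conjunct1] by blast
  note * = *[THEN conjunct2]
  show "i < n \<Longrightarrow> r \<in> carrier R \<Longrightarrow> x \<in> carrier (free_module R J) \<Longrightarrow> f i (r \<odot>\<^bsub>free_module R J\<^esub> x) = r \<otimes> f i x"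
    using *[THEN conjunct1] by blast
  note * = *[THEN conjunct2]
  show "(\<And>i. i < n \<Longrightarrow> z i \<in> carrier R) \<Longrightarrow> \<exists>x\<in>carrier (free_module R J). \<forall>i<n. f i x = z i"
    using *[THEN conjunct1, rule_format, of z] by blast
  note * = *[THEN conjunct2]
  show "x \<in> carrier (free_module R J) \<Longrightarrow> x \<in> N \<longleftrightarrow> (\<forall>i<n. f i x \<in> PIdl (p [^] (lam ! i)))"
    using *[THEN conjunct1] by blast
  show "x \<in> carrier (free_module R J) \<Longrightarrow> y \<in> carrier (free_module R J) \<Longrightarrow> (\<And>i. i < n \<Longrightarrow> f i x = f i y) \<Longrightarrow> x = y"
    using *[THEN conjunct2, rule_format, of x y] by blast
qed

lemma ring_identities:
  "\<lbrakk>x \<in> carrier R; y \<in> carrier R; x0 \<in> carrier R; y0 \<in> carrier R; w \<in> carrier R; u \<in> carrier R\<rbrakk> \<Longrightarrow>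
    (x \<oplus> y) \<ominus> ((x0 \<oplus> y0) \<otimes> w) \<otimes> u = (x \<ominus> (x0 \<otimes> w) \<otimes> u) \<oplus> (y \<ominus> (y0 \<otimes> w) \<otimes> u)"
  "\<lbrakk>x \<in> carrier R; r \<in> carrier R; x0 \<in> carrier R; w \<in> carrier R; u \<in> carrier R\<rbrakk> \<Longrightarrow>
    (r \<otimes> x) \<ominus> ((r \<otimes> x0) \<otimes> w) \<otimes> u = r \<otimes> (x \<ominus> (x0 \<otimes> w) \<otimes> u)"
  "\<lbrakk>x \<in> carrier R; y \<in> carrier R\<rbrakk> \<Longrightarrow> y \<oplus> (x \<ominus> y) = x"
  "\<lbrakk>x \<in> carrier R; y \<in> carrier R\<rbrakk> \<Longrightarrow> (x \<oplus> y) \<ominus> x = y"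
proof -
  show "\<lbrakk>x \<in> carrier R; y \<in> carrier R; x0 \<in> carrier R; y0 \<in> carrier R; w \<in> carrier R; u \<in> carrier R\<rbrakk> \<Longrightarrow>
    (x \<oplus> y) \<ominus> ((x0 \<oplus> y0) \<otimes> w) \<otimes> u = (x \<ominus> (x0 \<otimes> w) \<otimes> u) \<oplus> (y \<ominus> (y0 \<otimes> w) \<otimes> u)"
  proof -
    assume c: "x \<in> carrier R" "y \<in> carrier R" "x0 \<in> carrier R" "y0 \<in> carrier R" "w \<in> carrier R" "u \<in> carrier R"
    define s t where "s = \<ominus> ((x0 \<otimes> w) \<otimes> u)" and "t = \<ominus> ((y0 \<otimes> w) \<otimes> u)"
    have st: "s \<in> carrier R" "t \<in> carrier R" using c by (auto simp: s_def t_def)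
    have "\<ominus> (((x0 \<oplus> y0) \<otimes> w) \<otimes> u) = s \<oplus> t"
      unfolding s_def t_def using c by (simp add: l_distr minus_add)
    then show ?thesis using a_minus_def[of R] s_def[symmetric] t_def[symmetric] c st
      by (simp add: a_assoc a_lcomm)
  qed
  show "\<lbrakk>x \<in> carrier R; r \<in> carrier R; x0 \<in> carrier R; w \<in> carrier R; u \<in> carrier R\<rbrakk> \<Longrightarrow>
    (r \<otimes> x) \<ominus> ((r \<otimes> x0) \<otimes> w) \<otimes> u = r \<otimes> (x \<ominus> (x0 \<otimes> w) \<otimes> u)"
    by (simp add: a_minus_def r_distr r_minus m_assoc)
  show "\<lbrakk>x \<in> carrier R; y \<in> carrier R\<rbrakk> \<Longrightarrow> y \<oplus> (x \<ominus> y) = x"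
    using reg.minus_telescope(2)[of x y] by (simp add: regular_sel regular_minus[OF R_cring])
  show "\<lbrakk>x \<in> carrier R; y \<in> carrier R\<rbrakk> \<Longrightarrow> (x \<oplus> y) \<ominus> x = y"
    using reg.minus_telescope(4)[of x y] by (simp add: regular_sel regular_minus[OF R_cring])
qed

text \<open>Divide \<open>N\<close> by the largest possible power of \<open>p\<close>: then \<open>N\<close> contains \<open>p\<^sup>a u\<close> with some coordinate
  of \<open>u\<close> a unit, and one splits off the summand spanned by \<open>u\<close>.\<close>

theorem smith_coords_exist:
  assumes "finite J" "card J = n" "submodule N R (free_module R J)" "diag J (\<lambda>_. m) \<subseteq> N"
  shows "\<exists>lam f. smith_coords J N n lam f"
  using assms
proof (induction n arbitrary: J N)
  case 0
  then have J: "J = {}" by simp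
  interpret F: uniformizer_module R "free_module R J" p q by (rule um_free)
  have "x \<in> N" if "x \<in> carrier (free_module R J)" for x
    using that F.smD(2)[OF 0(3)] unfolding J by (simp add: free_sel restrict_def)
  moreover have "\<exists>x. x \<in> carrier (free_module R J)" using F.M.zero_closed by blast
  moreover have "x = y" if "x \<in> carrier (free_module R J)" "y \<in> carrier (free_module R J)" for x y
    using that unfolding J by (simp add: free_sel)
  ultimately have "smith_coords J N 0 [] (\<lambda>_ _. \<zero>)" by (auto simp: smith_coords_def)
  then show ?case by blast
next
  case (Suc n)
  let ?C = "carrier (free_module R J)"
  interpret F: uniformizer_module R "free_module R J" p q by (rule um_free)
  note N = F.smD[OF Suc.prems(3)]
  \<comment> \<open>The exponents by which all of \<open>N\<close> is divisible. They are bounded by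
    \<open>m\<close>, since \<open>N\<close> contains the vector with all coordinates
    \<open>p^m\<close>.\<close>
  define A where "A = {a. N \<subseteq> diag J (\<lambda>_. a)}"
  obtain j0 where j0: "j0 \<in> J" using Suc.prems by fastforce
  have bd: "a \<le> m" if "a \<in> A" for a
  proof -
    have "(\<lambda>i\<in>J. p [^] m) \<in> diag J (\<lambda>_. m)" by (auto simp: diag_def free_sel pow_mem_PIdl)
    then have "(\<lambda>i\<in>J. p [^] m) \<in> diag J (\<lambda>_. a)" using that Suc.prems(4) by (auto simp: A_def)
    then have "p [^] m \<in> PIdl (p [^] a)" using j0 by (auto simp: diag_def)
    then show ?thesis by (simp add: pow_mem_PIdl)
  qed
  then have finA: "finite A" using finite_nat_set_iff_bounded_le by blast
  have "x \<in> PIdl (p [^] (0::nat))" if "x \<in> carrier R" for x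
    using that by (simp add: PIdl_iff)
  then have "0 \<in> A" using N(1) by (auto simp: A_def diag_def free_sel PiE_iff)
  define a where "a = Max A"
  have aA: "N \<subseteq> diag J (\<lambda>_. a)" using Max_in[OF finA] \<open>0 \<in> A\<close> by (auto simp: a_def A_def)
  have "Suc a \<notin> A" using Max_ge[OF finA, of "Suc a"] by (auto simp: a_def)
  \<comment> \<open>Maximality of \<open>a\<close> provides an element of \<open>N\<close> with a
    coordinate not divisible by \<open>p^(a+1)\<close>; after division by \<open>p^a\<close> this
    coordinate is a unit.\<close>
  then obtain v i0 where v: "v \<in> N" "i0 \<in> J" "v i0 \<notin> PIdl (p [^] Suc a)"
    using N(1) by (auto simp: A_def diag_def)
  have "v \<in> mscale (free_module R J) (p [^] a) ?C" using v(1) aA scale_free by blast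
  then obtain u where u: "u \<in> ?C" "v = p [^] a \<odot>\<^bsub>free_module R J\<^esub> u" by (auto simp: mscale_def)
  have uR: "u i \<in> carrier R" if "i \<in> J" for i using u(1) that by (auto simp: free_sel)
  have unit: "u i0 \<in> Units R"
  proof (rule ccontr)
    assume "u i0 \<notin> Units R"
    then obtain c where c: "c \<in> carrier R" "u i0 = p \<otimes> c" using unit_or_dvd[OF uR[OF v(2)]] by blast
    have "v i0 = p [^] Suc a \<otimes> c" using u(2) v(2) c p_closed by (simp add: free_sel m_assoc)
    then have "v i0 \<in> PIdl (p [^] Suc a)" unfolding PIdl_iff[OF p_pow] using c(1) by blast
    then show False using v(3) by simp
  qed
  define w where "w = inv (u i0)"
  have w: "w \<in> carrier R" "u i0 \<otimes> w = \<one>" "w \<otimes> u i0 = \<one>" using unit by (simp_all add: w_def)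
  define J' where "J' = J - {i0}"
  let ?C' = "carrier (free_module R J')"
  interpret F': uniformizer_module R "free_module R J'" p q by (rule um_free)
  have xR: "x i \<in> carrier R" if "x \<in> ?C" "i \<in> J" for x i using that by (auto simp: free_sel)
  have yR: "y i \<in> carrier R" if "y \<in> ?C'" "i \<in> J'" for y i using that by (auto simp: free_sel)
  \<comment> \<open>The coefficient of \<open>u\<close> when \<open>x\<close> is written as a
    multiple of \<open>u\<close> plus a vector with coordinate 0 at \<open>i0\<close>; that
    remaining vector is \<open>prj x\<close>.\<close>
  define c where "c x = x i0 \<otimes> w" for x :: "_ \<Rightarrow> 'a"
  define prj where "prj x = (\<lambda>i\<in>J'. x i \<ominus> c x \<otimes> u i)" for x
  define emb where "emb y = (\<lambda>i\<in>J. if i = i0 then \<zero> else y i)" for y :: "_ \<Rightarrow> 'a"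
  have cR: "c x \<in> carrier R" if "x \<in> ?C" for x using xR[OF that v(2)] w by (simp add: c_def)
  have prjC: "prj x \<in> ?C'" if "x \<in> ?C" for x
    using xR[OF that] cR[OF that] uR by (auto simp: prj_def free_sel J'_def)
  have embC: "emb y \<in> ?C" if "y \<in> ?C'" for y using yR[OF that] by (auto simp: emb_def free_sel J'_def)
  have prj_add: "prj (x \<oplus>\<^bsub>free_module R J\<^esub> y) = prj x \<oplus>\<^bsub>free_module R J'\<^esub> prj y"
    if "x \<in> ?C" "y \<in> ?C" for x y
    unfolding free_sel(2)[where R = R and J = J']
    by (rule extensionalityI[of _ J'])
      (use xR[OF that(1)] xR[OF that(2)] uR w v(2) in \<open>simp_all add: prj_def c_def free_sel J'_def ring_identities(1)\<close>)
  have prj_smult: "prj (r \<odot>\<^bsub>free_module R J\<^esub> x) = r \<odot>\<^bsub>free_module R J'\<^esub> prj x"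
    if "x \<in> ?C" "r \<in> carrier R" for x r
    unfolding free_sel(3)[where R = R and J = J']
    by (rule extensionalityI[of _ J'])
      (use xR[OF that(1)] uR w v(2) that(2) in \<open>simp_all add: prj_def c_def free_sel J'_def ring_identities(2)\<close>)
  have c_add: "c (x \<oplus>\<^bsub>free_module R J\<^esub> y) = c x \<oplus> c y" if "x \<in> ?C" "y \<in> ?C" for x y
    using xR[OF that(1)] xR[OF that(2)] w v(2) by (simp add: c_def free_sel l_distr)
  have c_smult: "c (r \<odot>\<^bsub>free_module R J\<^esub> x) = r \<otimes> c x" if "x \<in> ?C" "r \<in> carrier R" for x r
    using xR[OF that(1)] w v(2) that(2) by (simp add: c_def free_sel m_assoc)
  have dec: "c x \<odot>\<^bsub>free_module R J\<^esub> u \<oplus>\<^bsub>free_module R J\<^esub> emb (prj x) = x" if x: "x \<in> ?C" for x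
  proof (rule extensionalityI[of _ J])
    fix i assume i: "i \<in> J"
    show "(c x \<odot>\<^bsub>free_module R J\<^esub> u \<oplus>\<^bsub>free_module R J\<^esub> emb (prj x)) i = x i"
    proof (cases "i = i0")
      case True
      then show ?thesis using i xR[OF x i] w uR[OF i] by (simp add: free_sel emb_def c_def m_assoc)
    next
      case False
      then show ?thesis
        using i xR[OF x i] cR[OF x] uR[OF i] by (simp add: free_sel emb_def prj_def J'_def ring_identities(3))
    qed
  qed (use x in \<open>auto simp: free_sel PiE_iff\<close>)
  have comb: "c (s \<odot>\<^bsub>free_module R J\<^esub> u \<oplus>\<^bsub>free_module R J\<^esub> emb y) = s"
    "prj (s \<odot>\<^bsub>free_module R J\<^esub> u \<oplus>\<^bsub>free_module R J\<^esub> emb y) = y" if y: "y \<in> ?C'" and s: "s \<in> carrier R" for s y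
  proof -
    show 1: "c (s \<odot>\<^bsub>free_module R J\<^esub> u \<oplus>\<^bsub>free_module R J\<^esub> emb y) = s"
      using uR[OF v(2)] w s v(2) by (simp add: c_def free_sel emb_def m_assoc)
    show "prj (s \<odot>\<^bsub>free_module R J\<^esub> u \<oplus>\<^bsub>free_module R J\<^esub> emb y) = y"
    proof (rule extensionalityI[of _ J'])
      fix i assume i: "i \<in> J'"
      then have "i \<in> J" "i \<noteq> i0" by (auto simp: J'_def)
      then show "prj (s \<odot>\<^bsub>free_module R J\<^esub> u \<oplus>\<^bsub>free_module R J\<^esub> emb y) i = y i"
        using i yR[OF y i] uR s unfolding prj_def 1 by (simp add: free_sel emb_def ring_identities(4))
    qed (use y in \<open>auto simp: prj_def free_sel PiE_iff\<close>)
  qed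
  define N' where "N' = {y \<in> ?C'. emb y \<in> N}"
  have N'sm: "submodule N' R (free_module R J')"
  proof (rule F'.smI)
    show "N' \<subseteq> ?C'" by (auto simp: N'_def)
    have "emb \<zero>\<^bsub>free_module R J'\<^esub> = \<zero>\<^bsub>free_module R J\<^esub>"
      by (rule extensionalityI[of _ J]) (auto simp: emb_def free_sel J'_def)
    then show "\<zero>\<^bsub>free_module R J'\<^esub> \<in> N'" using N(2) F'.M.zero_closed by (simp add: N'_def)
    fix x y assume xy: "x \<in> N'" "y \<in> N'"
    have "emb (x \<oplus>\<^bsub>free_module R J'\<^esub> y) = emb x \<oplus>\<^bsub>free_module R J\<^esub> emb y"
      by (rule extensionalityI[of _ J]) (auto simp: emb_def free_sel J'_def)
    then show "x \<oplus>\<^bsub>free_module R J'\<^esub> y \<in> N'"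
      using xy N(4)[of "emb x" "emb y"] F'.M.a_closed[of x y] by (simp add: N'_def)
  next
    fix r x assume rx: "r \<in> carrier R" "x \<in> N'"
    have "emb (r \<odot>\<^bsub>free_module R J'\<^esub> x) = r \<odot>\<^bsub>free_module R J\<^esub> emb x"
      by (rule extensionalityI[of _ J]) (use rx in \<open>auto simp: emb_def free_sel J'_def\<close>)
    then show "r \<odot>\<^bsub>free_module R J'\<^esub> x \<in> N'"
      using rx N(7)[of r "emb x"] F'.smult_closed[of r x] by (simp add: N'_def)
  qed
  have "diag J' (\<lambda>_. m) \<subseteq> N'"
  proof
    fix y assume y: "y \<in> diag J' (\<lambda>_. m)"
    then have yC: "y \<in> ?C'" by (simp add: diag_def)
    have "emb y \<in> diag J (\<lambda>_. m)"
      using y embC[OF yC] PIdl_ops(3) by (auto simp: diag_def emb_def J'_def)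
    then show "y \<in> N'" using yC Suc.prems(4) by (auto simp: N'_def)
  qed
  moreover have "finite J'" "card J' = n" using Suc.prems v(2) by (auto simp: J'_def)
  ultimately obtain lam f where sc: "smith_coords J' N' n lam f" using Suc.IH[of J' N'] N'sm by blast
  note f = smith_coordsD[OF sc]
  \<comment> \<open>Because \<open>N\<close> is divisible by \<open>p^a\<close>, so are all types
    found for the smaller lattice; appending \<open>a\<close> at the end therefore keeps the list
    weakly decreasing.\<close>
  have lam_ge: "a \<le> lam ! i" if i: "i < n" for i
  proof -
    obtain y where y: "y \<in> ?C'" "\<And>k. k < n \<Longrightarrow> f k y = (if k = i then p [^] (lam ! i) else \<zero>)"
    proof -
      have "(if k = i then p [^] (lam ! i) else \<zero>) \<in> carrier R" for k using p_pow by simp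
      then have "\<exists>y\<in>?C'. \<forall>k<n. f k y = (if k = i then p [^] (lam ! i) else \<zero>)"
        by (rule f(6))
      then show ?thesis using that by blast
    qed
    have "\<forall>k<n. f k y \<in> PIdl (p [^] (lam ! k))" using y(2) PIdl_ops(3) by (simp add: pow_mem_PIdl)
    then have "y \<in> N'" using f(7)[OF y(1)] by simp
    then have "emb y \<in> diag J (\<lambda>_. a)" using aA by (auto simp: N'_def)
    then have ey: "\<forall>k\<in>J. emb y k \<in> PIdl (p [^] a)" by (simp add: diag_def)
    have "y k \<in> PIdl (p [^] a)" if k: "k \<in> J'" for k
      using bspec[OF ey, of k] k by (simp add: emb_def J'_def)
    then have "y \<in> diag J' (\<lambda>_. a)" using y(1) by (simp add: diag_def)
    then obtain y'' where y'': "y'' \<in> ?C'" "y = p [^] a \<odot>\<^bsub>free_module R J'\<^esub> y''"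
      unfolding scale_free[symmetric] by (auto simp: mscale_def)
    then have "f i y = p [^] a \<otimes> f i y''" using f(5)[OF i p_pow] by simp
    then have "f i y \<in> PIdl (p [^] a)" unfolding PIdl_iff[OF p_pow] using f(3)[OF i y''(1)] by blast
    then show ?thesis using y(2)[OF i] by (simp add: pow_mem_PIdl)
  qed
  have mem: "x \<in> N \<longleftrightarrow> c x \<in> PIdl (p [^] a) \<and> prj x \<in> N'" if x: "x \<in> ?C" for x
  proof -
    have cu: "c x \<odot>\<^bsub>free_module R J\<^esub> u \<in> N" if c: "c x \<in> PIdl (p [^] a)"
    proof -
      obtain e where e: "e \<in> carrier R" "c x = p [^] a \<otimes> e" using c PIdl_iff[OF p_pow] by blast
      have "c x \<odot>\<^bsub>free_module R J\<^esub> u = e \<odot>\<^bsub>free_module R J\<^esub> v"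
        unfolding e(2) u(2) using e(1) u(1) by (simp add: m_comm F.smult_assoc1[symmetric])
      then show ?thesis using N(7)[OF e(1) v(1)] by simp
    qed
    have cuC: "c x \<odot>\<^bsub>free_module R J\<^esub> u \<in> ?C" using cR[OF x] u(1) by simp
    have embp: "emb (prj x) \<in> ?C" using embC prjC x by simp
    show ?thesis
    proof
      assume xN: "x \<in> N"
      then have "x i0 \<in> PIdl (p [^] a)" using aA v(2) by (auto simp: diag_def)
      then have c: "c x \<in> PIdl (p [^] a)"
        using PIdl_ops(2)[OF w(1), of "x i0" a] m_comm[OF xR[OF x v(2)] w(1)] by (simp add: c_def)
      have "x \<ominus>\<^bsub>free_module R J\<^esub> c x \<odot>\<^bsub>free_module R J\<^esub> u \<in> N" using N(6)[OF xN cu[OF c]] .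
      moreover have "x \<ominus>\<^bsub>free_module R J\<^esub> c x \<odot>\<^bsub>free_module R J\<^esub> u = emb (prj x)"
        using F.minus_telescope(4)[OF cuC embp] unfolding dec[OF x] .
      ultimately show "c x \<in> PIdl (p [^] a) \<and> prj x \<in> N'" using c prjC[OF x] by (simp add: N'_def)
    next
      assume "c x \<in> PIdl (p [^] a) \<and> prj x \<in> N'"
      then have "c x \<odot>\<^bsub>free_module R J\<^esub> u \<oplus>\<^bsub>free_module R J\<^esub> emb (prj x) \<in> N"
        using cu by (intro N(4)) (auto simp: N'_def)
      then show "x \<in> N" unfolding dec[OF x] .
    qed
  qed
  define g where "g i x = (if i < n then f i (prj x) else c x)" for i x
  have "smith_coords J N (Suc n) (lam @ [a]) g"
    unfolding smith_coords_def
  proof (intro conjI allI impI ballI)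
    show "length (lam @ [a]) = Suc n" using f(1) by simp
    show "sorted_wrt (\<ge>) (lam @ [a])"
      using f(1,2) lam_ge by (auto simp: sorted_wrt_append in_set_conv_nth)
    fix i x assume i: "i < Suc n" and x: "x \<in> ?C"
    show "g i x \<in> carrier R" using f(3) prjC[OF x] cR[OF x] by (simp add: g_def)
    show "g i (x \<oplus>\<^bsub>free_module R J\<^esub> y) = g i x \<oplus> g i y" if "y \<in> ?C" for y
      using f(4) prjC[OF x] prjC[OF that] by (simp add: g_def prj_add[OF x that] c_add[OF x that])
    show "g i (r \<odot>\<^bsub>free_module R J\<^esub> x) = r \<otimes> g i x" if "r \<in> carrier R" for r
      using f(5) prjC[OF x] that by (simp add: g_def prj_smult[OF x that] c_smult[OF x that])
  next
    fix z assume z: "\<forall>i<Suc n. z i \<in> carrier R"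
    then obtain y where y: "y \<in> ?C'" "\<forall>i<n. f i y = z i" using f(6)[of z] by auto
    let ?x = "z n \<odot>\<^bsub>free_module R J\<^esub> u \<oplus>\<^bsub>free_module R J\<^esub> emb y"
    have zn: "z n \<in> carrier R" using z by simp
    have "?x \<in> ?C" using zn u(1) embC[OF y(1)] by simp
    moreover have "\<forall>i<Suc n. g i ?x = z i"
      using y(2) comb[OF y(1) zn] by (auto simp: g_def less_Suc_eq)
    ultimately show "\<exists>x\<in>?C. \<forall>i<Suc n. g i x = z i" by blast
  next
    fix x assume x: "x \<in> ?C"
    have "(\<forall>i<Suc n. g i x \<in> PIdl (p [^] ((lam @ [a]) ! i))) \<longleftrightarrow>
      (\<forall>i<n. f i (prj x) \<in> PIdl (p [^] (lam ! i))) \<and> c x \<in> PIdl (p [^] a)"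
      using f(1) by (auto simp: g_def less_Suc_eq nth_append)
    then show "x \<in> N \<longleftrightarrow> (\<forall>i<Suc n. g i x \<in> PIdl (p [^] ((lam @ [a]) ! i)))"
      using mem[OF x] f(7)[OF prjC[OF x]] by blast
    fix y assume y: "y \<in> ?C" and e: "\<forall>i<Suc n. g i x = g i y"
    have "f i (prj x) = f i (prj y)" if "i < n" for i using e[rule_format, of i] that by (simp add: g_def)
    then have "prj x = prj y" by (rule f(8)[OF prjC[OF x] prjC[OF y]])
    moreover have "c x = c y" using e[rule_format, of n] by (simp add: g_def)
    ultimately have "c x \<odot>\<^bsub>free_module R J\<^esub> u \<oplus>\<^bsub>free_module R J\<^esub> emb (prj x) =
      c y \<odot>\<^bsub>free_module R J\<^esub> u \<oplus>\<^bsub>free_module R J\<^esub> emb (prj y)" by simp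
    then show "x = y" unfolding dec[OF x] dec[OF y] .
  qed
  then show ?case by blast
qed

text \<open>The coordinates are returned along with the type, because the bracket estimate in
  \<open>bracket_auto\<close> works with both for one and the same \<open>lam\<close>.\<close>

theorem elem_div_type_exists:
  assumes "finite J" "card J = n" "submodule N R (free_module R J)"
    and "mindex (free_module R J) (carrier (free_module R J)) N > 0"
  shows "\<exists>lam f. has_elem_div_type R n (free_module R J) N lam \<and> smith_coords J N n lam f"
proof -
  interpret F: uniformizer_module R "free_module R J" p q by (rule um_free)
  have "F.pw (F.idx (carrier (free_module R J)) N) (carrier (free_module R J)) \<subseteq> N"
    using F.finite_idx_pw[OF assms(3) F.sm_carrier F.smD(1)[OF assms(3)] assms(4)] .
  then have "diag J (\<lambda>_. F.idx (carrier (free_module R J)) N) \<subseteq> N"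
    unfolding F.pw_def scale_free .
  then obtain lam f where sc: "smith_coords J N n lam f"
    using smith_coords_exist[OF assms(1-3)] by blast
  note f = smith_coordsD[OF sc]
  define h where "h x = (\<lambda>i\<in>{..<n}. f i x)" for x
  have "h \<in> lin_hom R (free_module R J) (free_module R {..<n})"
    unfolding lin_hom_def
  proof (intro CollectI conjI ballI Pi_I)
    fix x assume x: "x \<in> carrier (free_module R J)"
    show "h x \<in> carrier (free_module R {..<n})" using f(3) x by (simp add: h_def free_sel restrict_PiE_iff)
    show "h (x \<oplus>\<^bsub>free_module R J\<^esub> y) = h x \<oplus>\<^bsub>free_module R {..<n}\<^esub> h y"
      if "y \<in> carrier (free_module R J)" for y
      unfolding free_sel(2)[where R = R and J = "{..<n}"] h_def by (rule restrict_ext) (use f(4) x that in simp)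
  next
    fix r x assume "r \<in> carrier R" "x \<in> carrier (free_module R J)"
    then show "h (r \<odot>\<^bsub>free_module R J\<^esub> x) = r \<odot>\<^bsub>free_module R {..<n}\<^esub> h x"
      unfolding free_sel(3)[where R = R and J = "{..<n}"] h_def by (intro restrict_ext) (use f(5) in simp)
  qed
  moreover have "h ` carrier (free_module R J) = carrier (free_module R {..<n})"
  proof
    show "h ` carrier (free_module R J) \<subseteq> carrier (free_module R {..<n})"
      using f(3) by (intro image_subsetI) (simp add: h_def free_sel restrict_PiE_iff)
    show "carrier (free_module R {..<n}) \<subseteq> h ` carrier (free_module R J)"
    proof
      fix z assume z: "z \<in> carrier (free_module R {..<n})"
      then obtain x where x: "x \<in> carrier (free_module R J)" "\<forall>i<n. f i x = z i"
      proof -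
        have "z i \<in> carrier R" if "i < n" for i using z that by (auto simp: free_sel)
        then show ?thesis using f(6)[of z] that by blast
      qed
      have "h x = z" by (rule extensionalityI[of _ "{..<n}"]) (use x z in \<open>auto simp: h_def free_sel PiE_iff\<close>)
      then show "z \<in> h ` carrier (free_module R J)" using x by blast
    qed
  qed
  moreover have "x \<in> N \<longleftrightarrow> h x \<in> diag {..<n} (\<lambda>i. lam ! i)" if "x \<in> carrier (free_module R J)" for x
    using f(3,7) that by (auto simp: h_def diag_def free_sel)
  ultimately have "(\<exists>F. presents R (free_module R J) N (quot_prod n lam) F) \<longleftrightarrow>
    (\<exists>F. presents R (free_module R {..<n}) (diag {..<n} (\<lambda>i. lam ! i)) (quot_prod n lam) F)"
    by (intro presents_transfer[OF F.module_axioms module_free[OF R_cring] module_quot_prod]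
        module.smD(2)[OF module_free[OF R_cring] sm_diag])
  then have "\<exists>F. presents R (free_module R J) N (quot_prod n lam) F"
    using presents_free[of n lam] by blast
  then show ?thesis using has_elem_div_type_iff[OF F.module_axioms assms(3)] f(1,2) sc by blast
qed

text \<open>The vector \<open>b\<close> is dual to the last coordinate. All other coordinates of an
  element of \<open>N\<close> are divisible by the second smallest power of \<open>p\<close>, so up
  to that power the element is a multiple of \<open>b\<close>.\<close>

lemma smith_last:
  assumes sc: "smith_coords J N n lam f" and n: "n \<ge> 2"
  obtains b where "b \<in> carrier (free_module R J)"
    "\<And>x. x \<in> carrier (free_module R J) \<Longrightarrow> x \<in> N \<Longrightarrow> \<exists>c\<in>carrier R. \<exists>u\<in>carrier (free_module R J).
       x = (c \<otimes> p [^] (lam ! (n - 1))) \<odot>\<^bsub>free_module R J\<^esub> b \<oplus>\<^bsub>free_module R J\<^esub> p [^] (lam ! (n - 2)) \<odot>\<^bsub>free_module R J\<^esub> u"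
proof -
  interpret F: uniformizer_module R "free_module R J" p q by (rule um_free)
  note f = smith_coordsD[OF sc]
  let ?C = "carrier (free_module R J)"
  obtain b where b: "b \<in> ?C" "\<And>i. i < n \<Longrightarrow> f i b = (if i = n - 1 then \<one> else \<zero>)"
  proof -
    have "(if i = n - 1 then \<one> else \<zero>) \<in> carrier R" for i by simp
    then have "\<exists>b\<in>?C. \<forall>i<n. f i b = (if i = n - 1 then \<one> else \<zero>)"
      by (rule f(6))
    then show ?thesis using that by blast
  qed
  have "\<exists>c\<in>carrier R. \<exists>u\<in>?C. x = (c \<otimes> p [^] (lam ! (n - 1))) \<odot>\<^bsub>free_module R J\<^esub> b
      \<oplus>\<^bsub>free_module R J\<^esub> p [^] (lam ! (n - 2)) \<odot>\<^bsub>free_module R J\<^esub> u" if x: "x \<in> ?C" "x \<in> N" for x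
  proof -
    have fx: "f i x \<in> PIdl (p [^] (lam ! i))" if "i < n" for i using f(7)[OF x(1)] x(2) that by simp
    have "lam ! (n - 2) \<le> lam ! i" if "i < n - 1" for i
      using sorted_wrt_nth_less[OF f(2), of i "n - 2"] f(1) that n by (cases "i = n - 2") auto
    then have "f i x \<in> PIdl (p [^] (lam ! (n - 2)))" if "i < n - 1" for i
      using fx[of i] PIdl_mono[of "lam ! (n - 2)" "lam ! i"] that by auto
    then have "\<forall>i\<in>{..<n - 1}. \<exists>e. e \<in> carrier R \<and> f i x = p [^] (lam ! (n - 2)) \<otimes> e"
      by (auto simp: PIdl_iff)
    then obtain e where e: "\<And>i. i < n - 1 \<Longrightarrow> e i \<in> carrier R \<and> f i x = p [^] (lam ! (n - 2)) \<otimes> e i"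
      by (metis lessThan_iff)
    obtain u where u: "u \<in> ?C" "\<And>i. i < n \<Longrightarrow> f i u = (if i < n - 1 then e i else \<zero>)"
    proof -
      have "(if i < n - 1 then e i else \<zero>) \<in> carrier R" for i using e by simp
      then have "\<exists>u\<in>?C. \<forall>i<n. f i u = (if i < n - 1 then e i else \<zero>)"
        by (rule f(6))
      then show ?thesis using that by blast
    qed
    obtain c where c: "c \<in> carrier R" "f (n - 1) x = p [^] (lam ! (n - 1)) \<otimes> c"
      using fx[of "n - 1"] n by (auto simp: PIdl_iff)
    let ?y = "(c \<otimes> p [^] (lam ! (n - 1))) \<odot>\<^bsub>free_module R J\<^esub> b \<oplus>\<^bsub>free_module R J\<^esub> p [^] (lam ! (n - 2)) \<odot>\<^bsub>free_module R J\<^esub> u"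
    have "x = ?y"
    proof (rule f(8)[OF x(1)])
      show "?y \<in> ?C" using c(1) b(1) u(1) by simp
      fix i assume i: "i < n"
      have "f i ?y = (c \<otimes> p [^] (lam ! (n - 1))) \<otimes> f i b \<oplus> p [^] (lam ! (n - 2)) \<otimes> f i u"
        using f(4)[OF i] f(5)[OF i] c(1) b(1) u(1) by simp
      also have "\<dots> = f i x"
      proof (cases "i = n - 1")
        case True
        then show ?thesis using b(2)[OF i] u(2)[OF i] c by (simp add: m_comm)
      next
        case False
        then have "i < n - 1" using i by simp
        then show ?thesis using b(2)[OF i] u(2)[OF i] e[of i] c(1) by simp
      qed
      finally show "f i x = f i ?y" by simp
    qed
    then show ?thesis using c(1) u(1) by blast
  qed
  then show ?thesis using that[OF b(1)] by blast
qed

text \<open>\<open>p^m X\<close> lies in \<open>N\<close> exactly if adding it to \<open>N\<close>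
  leaves the index unchanged, that is, if cutting the parts off at \<open>m\<close> does not lower
  their sum.\<close>

lemma type_pw_iff:
  assumes "module R X" "submodule N R X" "has_elem_div_type R n X N lam"
    and "mindex X (carrier X) N > 0"
  shows "uniformizer_module.pw R X p m (carrier X) \<subseteq> N \<longleftrightarrow> (\<forall>i<n. lam ! i \<le> m)"
proof -
  interpret X: uniformizer_module R X p q by (intro uniformizer_module.intro assms(1) uniformizer_axioms)
  note t = type_idx[OF assms(1-3)]
  let ?C = "carrier X"
  have absorb: "X.pw k ?C <+>\<^bsub>X\<^esub> N = N" if "X.pw k ?C \<subseteq> N" for k
  proof
    show "X.pw k ?C <+>\<^bsub>X\<^esub> N \<subseteq> N" by (rule X.sum_least[OF assms(2) that order_refl])
    show "N \<subseteq> X.pw k ?C <+>\<^bsub>X\<^esub> N" by (rule X.sum_upper(2)[OF X.sm_pw[OF X.sm_carrier] assms(2)])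
  qed
  have t': "X.idx ?C (X.pw k ?C <+>\<^bsub>X\<^esub> N) = q ^ (\<Sum>i<n. min (lam ! i) k)" for k
    using t[of k] by (simp add: X.pw_def power_sum)
  \<comment> \<open>Large enough for two purposes at once: \<open>b\<close> bounds every part, so
    that cutting off has no effect, and \<open>p^b X\<close> lies in \<open>N\<close>. This yields
    the index of \<open>N\<close> itself.\<close>
  define b where "b = X.idx ?C N + (\<Sum>i<n. lam ! i)"
  have lamb: "lam ! i \<le> b" if "i < n" for i
    using member_le_sum[of i "{..<n}" "\<lambda>i. lam ! i"] that by (simp add: b_def)
  have anti: "X.pw (k + l) ?C \<subseteq> X.pw k ?C" for k l
    by (induction l) (use X.pw_Suc_le[OF X.sm_carrier] in auto)
  have pb: "X.pw b ?C \<subseteq> N"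
    using anti[of "X.idx ?C N" "\<Sum>i<n. lam ! i"]
      X.finite_idx_pw[OF assms(2) X.sm_carrier X.smD(1)[OF assms(2)] assms(4)] by (auto simp: b_def)
  have "(\<Sum>i<n. min (lam ! i) b) = (\<Sum>i<n. lam ! i)" using lamb by (intro sum.cong) auto
  then have idxN: "X.idx ?C N = q ^ (\<Sum>i<n. lam ! i)" using t'[of b] absorb[OF pb] by simp
  show ?thesis
  proof
    assume "X.pw m ?C \<subseteq> N"
    then have "q ^ (\<Sum>i<n. min (lam ! i) m) = q ^ (\<Sum>i<n. lam ! i)" using t'[of m] idxN absorb by simp
    then have e: "(\<Sum>i<n. min (lam ! i) m) = (\<Sum>i<n. lam ! i)" using q_gt_1 by simp
    show "\<forall>i<n. lam ! i \<le> m"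
    proof (rule ccontr)
      assume "\<not> (\<forall>i<n. lam ! i \<le> m)"
      then obtain i where "i < n" "\<not> lam ! i \<le> m" by blast
      then have "\<exists>i\<in>{..<n}. min (lam ! i) m < lam ! i" by (intro bexI[of _ i]) auto
      then have "(\<Sum>i<n. min (lam ! i) m) < (\<Sum>i<n. lam ! i)" by (intro sum_strict_mono_ex1) auto
      then show False using e by simp
    qed
  next
    assume "\<forall>i<n. lam ! i \<le> m"
    then have "(\<Sum>i<n. min (lam ! i) m) = (\<Sum>i<n. lam ! i)" by (intro sum.cong) auto
    then have e: "X.idx ?C (X.pw m ?C <+>\<^bsub>X\<^esub> N) = X.idx ?C N" using t'[of m] idxN by simp
    have s: "X.sm (X.pw m ?C <+>\<^bsub>X\<^esub> N)" by (intro X.sm_sum X.sm_pw X.sm_carrier assms(2))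
    have NS: "N \<subseteq> X.pw m ?C <+>\<^bsub>X\<^esub> N" by (rule X.sum_upper(2)[OF X.sm_pw[OF X.sm_carrier] assms(2)])
    have "X.idx ?C N = X.idx ?C (X.pw m ?C <+>\<^bsub>X\<^esub> N) * X.idx (X.pw m ?C <+>\<^bsub>X\<^esub> N) N"
      by (rule X.idx_mult[OF X.sm_carrier s assms(2) NS X.smD(1)[OF s]])
    then have "X.idx (X.pw m ?C <+>\<^bsub>X\<^esub> N) N = 1" using e assms(4) by simp
    then have "X.pw m ?C <+>\<^bsub>X\<^esub> N = N" by (rule X.idx_eq_1[OF s assms(2) NS])
    then show "X.pw m ?C \<subseteq> N" using X.sum_upper(1)[OF X.sm_pw[OF X.sm_carrier] assms(2), of m] by simp
  qed
qed

text \<open>Expresses the sum of the two smallest parts through step indices: the part with 0-based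
  position \<open>d - 2\<close> is the number of layers of index at least \<open>q^(d-1)\<close>,
  the last part the number of those of index at least \<open>q^d\<close>.\<close>

lemma type_last_two:
  assumes "module R X" "submodule N R X" "has_elem_div_type R d X N lam" "d \<ge> 2"
  shows "card {j. q ^ (d - 1) \<le> uniformizer_module.step_index R X p (carrier X) N j} +
    card {j. q ^ d \<le> uniformizer_module.step_index R X p (carrier X) N j} = lam ! (d - 2) + lam ! (d - 1)"
proof -
  have lam: "length lam = d" "sorted_wrt (\<ge>) lam" using assms(3) by (auto simp: has_elem_div_type_def)
  note s = type_step_index[OF assms(1-3)]
  have "{j. q ^ (d - 1) \<le> q ^ card {i. i < d \<and> j < lam ! i}} = {..<lam ! (d - 2)}"
  proof -
    have "Suc (d - 2) = d - 1" using assms(4) by simp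
    then show ?thesis
      using card_desc_ge_iff[OF lam(2,1), of "d - 2"] q_gt_1 assms(4) by auto
  qed
  moreover have "{j. q ^ d \<le> q ^ card {i. i < d \<and> j < lam ! i}} = {..<lam ! (d - 1)}"
  proof -
    have "Suc (d - 1) = d" using assms(4) by simp
    then show ?thesis
      using card_desc_ge_iff[OF lam(2,1), of "d - 1"] q_gt_1 assms(4) by auto
  qed
  ultimately show ?thesis unfolding s by simp
qed

end

section \<open>Subalgebras of the free class-2-nilpotent Lie ring\<close>

context module
begin

text \<open>Each step of the flag adjoins a generator that is free over the previous term, so
  \<open>cond\<close> of \<open>comps_step\<close> concerns only the scalar 0 and every step
  contributes the same factor.\<close>

lemma card_comps_flag:
  assumes sm: "\<And>k. k \<le> d \<Longrightarrow> sm (X k)"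
    and step: "\<And>k. k < d \<Longrightarrow> \<exists>x\<in>carrier M. X (Suc k) = X k <+>\<^sub>M cyc x \<and>
      (\<forall>a\<in>carrier R. a \<odot>\<^bsub>M\<^esub> x \<in> X k \<longrightarrow> a = \<zero>)"
    and Z: "sm Z" "Z \<subseteq> X 0" "idx (X 0) Z > 0"
  shows "card (comps (X d) (X 0) Z) = idx (X 0) Z ^ d"
proof -
  have "k \<le> d \<Longrightarrow> X 0 \<subseteq> X k \<and> card (comps (X k) (X 0) Z) = idx (X 0) Z ^ k" for k
  proof (induction k)
    case 0
    then show ?case using comps_trivial[OF sm[of 0] Z(1,2)] by simp
  next
    case (Suc k)
    then have k: "k < d" and IH: "X 0 \<subseteq> X k" "card (comps (X k) (X 0) Z) = idx (X 0) Z ^ k" by auto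
    obtain x where x: "x \<in> carrier M" "X (Suc k) = X k <+>\<^sub>M cyc x"
      "\<And>a. a \<in> carrier R \<Longrightarrow> a \<odot>\<^bsub>M\<^esub> x \<in> X k \<Longrightarrow> a = \<zero>" using step[OF k] by blast
    have smk: "sm (X k)" "sm (X 0)" "sm (X (Suc k))" using sm k by auto
    have up: "X k \<subseteq> X (Suc k)" unfolding x(2) by (rule sum_upper(1)[OF smk(1) sm_cyc[OF x(1)]])
    have "card (comps (X (Suc k)) (X k) W) = idx (X 0) Z" if W: "W \<in> comps (X k) (X 0) Z" for W
    proof -
      note W' = compsD[OF W]
      have "a \<odot>\<^bsub>M\<^esub> (x \<oplus>\<^sub>M y) \<in> W" if a: "a \<in> carrier R" "a \<odot>\<^bsub>M\<^esub> x \<in> X k" and y: "y \<in> X k" for a y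
        using x(3)[OF a] x(1) smD(3)[OF smk(1) y] smD(2)[OF W'(1)] by simp
      then have "card (comps (X k <+>\<^sub>M cyc x) (X k) W) = idx (X k) W"
        by (rule comps_step[OF smk(1) W'(1,2) x(1)])
      then show ?thesis using idx_comps[OF W smk(2)] x(2) by simp
    qed
    then have "card (comps (X (Suc k)) (X 0) Z) = card (comps (X k) (X 0) Z) * idx (X 0) Z"
      by (rule comps_chain[OF smk(2,1,3) IH(1) up]) (use IH Z in auto)
    then show ?case using IH up by auto
  qed
  then show ?thesis by blast
qed

lemma finsum_sm:
  assumes "sm N" "finite I" "f \<in> I \<rightarrow> N" shows "finsum M f I \<in> N"
  using assms(2,3)
proof (induction I rule: finite_induct)
  case empty then show ?case using smD(2)[OF assms(1)] by simp
next
  case (insert i I)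
  then have f: "f i \<in> N" "f \<in> I \<rightarrow> N" by auto
  then have "f i \<in> carrier M" "f \<in> I \<rightarrow> carrier M" using smD(1)[OF assms(1)] by auto
  then have "finsum M f (insert i I) = f i \<oplus>\<^sub>M finsum M f I" using insert.hyps by (simp add: M.finsum_insert)
  then show ?case using smD(4)[OF assms(1) f(1) insert.IH[OF f(2)]] by simp
qed

end

locale nil2_dvr = dvr R p q for R (structure) and p q + fixes d :: nat
begin

abbreviation "LL \<equiv> free_nil2 d R"
abbreviation "FF \<equiv> free_module R {..<d}"
abbreviation "PP \<equiv> free_module R (index_pairs d)"

sublocale L: uniformizer_module R LL p q
  using free_nil2_lie_algebra[OF R_cring] by (intro uniformizer_module.intro uniformizer_axioms) (rule lie_algebra.axioms)
sublocale F: uniformizer_module R FF p q by (rule um_free)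
sublocale P: uniformizer_module R PP p q by (rule um_free)

lemma nil_iff: "x \<in> carrier LL \<longleftrightarrow> fst x \<in> carrier FF \<and> snd x \<in> carrier PP"
  by (simp add: free_nil2_carrier free_sel)

lemma nil_sel:
  "fst (x \<oplus>\<^bsub>LL\<^esub> y) = fst x \<oplus>\<^bsub>FF\<^esub> fst y" "snd (x \<oplus>\<^bsub>LL\<^esub> y) = snd x \<oplus>\<^bsub>PP\<^esub> snd y"
  "fst (r \<odot>\<^bsub>LL\<^esub> x) = r \<odot>\<^bsub>FF\<^esub> fst x" "snd (r \<odot>\<^bsub>LL\<^esub> x) = r \<odot>\<^bsub>PP\<^esub> snd x"
  "fst \<zero>\<^bsub>LL\<^esub> = \<zero>\<^bsub>FF\<^esub>" "snd \<zero>\<^bsub>LL\<^esub> = \<zero>\<^bsub>PP\<^esub>" "fst (x \<otimes>\<^bsub>LL\<^esub> y) = \<zero>\<^bsub>FF\<^esub>"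
  by (cases x; cases y; simp add: free_nil2_def free_sel)+

lemma nil_minus:
  assumes "x \<in> carrier LL" "y \<in> carrier LL"
  shows "fst (x \<ominus>\<^bsub>LL\<^esub> y) = fst x \<ominus>\<^bsub>FF\<^esub> fst y" "snd (x \<ominus>\<^bsub>LL\<^esub> y) = snd x \<ominus>\<^bsub>PP\<^esub> snd y"
proof -
  have c: "x \<ominus>\<^bsub>LL\<^esub> y \<in> carrier LL" using assms by simp
  have e: "(x \<ominus>\<^bsub>LL\<^esub> y) \<oplus>\<^bsub>LL\<^esub> y = x" by (rule L.minus_telescope(1)[OF assms])
  show "fst (x \<ominus>\<^bsub>LL\<^esub> y) = fst x \<ominus>\<^bsub>FF\<^esub> fst y"
    using arg_cong[OF e, of fst] F.minus_telescope(3)[of "fst (x \<ominus>\<^bsub>LL\<^esub> y)" "fst y"] c assms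
    unfolding nil_sel nil_iff by simp
  show "snd (x \<ominus>\<^bsub>LL\<^esub> y) = snd x \<ominus>\<^bsub>PP\<^esub> snd y"
    using arg_cong[OF e, of snd] P.minus_telescope(3)[of "snd (x \<ominus>\<^bsub>LL\<^esub> y)" "snd y"] c assms
    unfolding nil_sel nil_iff by simp
qed

text \<open>\<open>ctr\<close> is the derived algebra, by \<open>derived_eq\<close>.
  \<open>XX\<close> forms the preimage in \<open>L\<close> of a lattice of first components,
  \<open>ZZ\<close> places a lattice of second components inside \<open>[L,L]\<close>, and
  \<open>sect H\<close> is the intersection of \<open>H\<close> with \<open>[L,L]\<close> in
  coordinates.\<close>

definition ctr where "ctr = {x \<in> carrier LL. fst x = \<zero>\<^bsub>FF\<^esub>}"
definition XX where "XX \<Lambda> = {x \<in> carrier LL. fst x \<in> \<Lambda>}"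
definition ZZ where "ZZ N = {x \<in> ctr. snd x \<in> N}"
definition sect where "sect H = {b \<in> carrier PP. (\<zero>\<^bsub>FF\<^esub>, b) \<in> H}"

lemma sm_XX: assumes "F.sm \<Lambda>" shows "L.sm (XX \<Lambda>)"
  by (rule L.smI) (use F.smD(2,4,7)[OF assms] in \<open>auto simp: XX_def nil_sel\<close>)

lemma ctr_XX: "ctr = XX {\<zero>\<^bsub>FF\<^esub>}" by (auto simp: ctr_def XX_def)

lemma sm_ctr: "L.sm ctr"
  unfolding ctr_XX by (intro sm_XX F.smI) auto

lemma sm_ZZ: assumes "P.sm N" shows "L.sm (ZZ N)"
  by (rule L.smI) (use P.smD(2,4,7)[OF assms] L.smD(2,3,4,7)[OF sm_ctr] in \<open>auto simp: ZZ_def nil_sel\<close>)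

text \<open>For the second inclusion, \<open>free_nil2_expansion\<close> writes an element with zero
  first component as a combination of brackets of generators.\<close>

lemma derived_eq: "derived_alg R LL = ctr"
proof
  have "x \<otimes>\<^bsub>LL\<^esub> y \<in> ctr" if "x \<in> carrier LL" "y \<in> carrier LL" for x y
    using free_nil2_closed(4)[OF R_cring that] by (simp add: ctr_def nil_sel)
  then show "derived_alg R LL \<subseteq> ctr" unfolding derived_alg_def using sm_ctr by (intro Inter_lower) blast
  show "ctr \<subseteq> derived_alg R LL" unfolding derived_alg_def
  proof (intro subsetI InterI)
    fix x N assume x: "x \<in> ctr" and "N \<in> {N. submodule N R LL \<and> (\<forall>x\<in>carrier LL. \<forall>y\<in>carrier LL. x \<otimes>\<^bsub>LL\<^esub> y \<in> N)}"
    then have N: "L.sm N" "\<And>x y. x \<in> carrier LL \<Longrightarrow> y \<in> carrier LL \<Longrightarrow> x \<otimes>\<^bsub>LL\<^esub> y \<in> N" by auto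
    note g = free_nil2_closed(5)[OF R_cring, of d]
    have xc: "x \<in> carrier LL" and x0: "fst x = \<zero>\<^bsub>FF\<^esub>" using x by (auto simp: ctr_def)
    have "fst x i \<odot>\<^bsub>LL\<^esub> free_nil2_gen d R i \<in> N" if "i < d" for i
      using that g L.smD(2)[OF N(1)] by (simp add: x0 free_sel)
    then have A: "finsum LL (\<lambda>i. fst x i \<odot>\<^bsub>LL\<^esub> free_nil2_gen d R i) {..<d} \<in> N"
      by (intro L.finsum_sm[OF N(1)]) auto
    have "snd x k \<in> carrier R" if "k \<in> index_pairs d" for k
      using xc that by (auto simp: free_nil2_carrier)
    then have B: "finsum LL (\<lambda>p. snd x p \<odot>\<^bsub>LL\<^esub> (free_nil2_gen d R (fst p) \<otimes>\<^bsub>LL\<^esub> free_nil2_gen d R (snd p)))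
        (index_pairs d) \<in> N"
      using N(2)[OF g g] L.smD(7)[OF N(1)] by (intro L.finsum_sm[OF N(1) finite_index_pairs]) blast
    show "x \<in> N" by (subst free_nil2_expansion[OF R_cring xc]) (rule L.smD(4)[OF N(1) A B])
  qed
qed

lemma fst_surj: "fst ` carrier LL = carrier FF"
proof -
  have "x \<in> fst ` carrier LL" if "x \<in> carrier FF" for x
    using that by (intro image_eqI[of _ _ "(x, \<zero>\<^bsub>PP\<^esub>)"]) (auto simp: nil_iff)
  then show ?thesis by (auto simp: nil_iff)
qed

lemma ctr_pair: "x \<in> ctr \<longleftrightarrow> (\<exists>b\<in>carrier PP. x = (\<zero>\<^bsub>FF\<^esub>, b))"
  by (cases x) (auto simp: ctr_def nil_iff)

lemma snd_surj: "snd ` ctr = carrier PP"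
proof -
  have "x \<in> snd ` ctr" if "x \<in> carrier PP" for x
    using that by (intro image_eqI[of _ _ "(\<zero>\<^bsub>FF\<^esub>, x)"]) (auto simp: ctr_pair)
  then show ?thesis by (auto simp: ctr_def nil_iff)
qed

lemma idx_XX:
  assumes "F.sm \<Lambda>" shows "L.idx (carrier LL) (XX \<Lambda>) = F.idx (carrier FF) \<Lambda>"
proof -
  have "L.idx (carrier LL) (XX \<Lambda>) = card ((\<lambda>x. \<Lambda> +>\<^bsub>FF\<^esub> fst x) ` carrier LL)"
  proof (rule L.idx_eq[OF sm_XX[OF assms]])
    fix a b assume ab: "a \<in> carrier LL" "b \<in> carrier LL"
    then have "a \<ominus>\<^bsub>LL\<^esub> b \<in> XX \<Lambda> \<longleftrightarrow> fst a \<ominus>\<^bsub>FF\<^esub> fst b \<in> \<Lambda>" by (simp add: XX_def nil_minus)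
    then show "\<Lambda> +>\<^bsub>FF\<^esub> fst a = \<Lambda> +>\<^bsub>FF\<^esub> fst b \<longleftrightarrow> a \<ominus>\<^bsub>LL\<^esub> b \<in> XX \<Lambda>"
      using F.rcos_eq_iff[OF assms, of "fst a" "fst b"] ab by (simp add: nil_iff)
  qed simp
  also have "\<dots> = F.idx (carrier FF) \<Lambda>" unfolding mindex_def fst_surj[symmetric] image_image ..
  finally show ?thesis .
qed

lemma idx_ZZ:
  assumes "P.sm N" shows "L.idx ctr (ZZ N) = P.idx (carrier PP) N"
proof -
  have "L.idx ctr (ZZ N) = card ((\<lambda>x. N +>\<^bsub>PP\<^esub> snd x) ` ctr)"
  proof (rule L.idx_eq[OF sm_ZZ[OF assms]])
    show "ctr \<subseteq> carrier LL" by (auto simp: ctr_def)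
    fix a b assume ab: "a \<in> ctr" "b \<in> ctr"
    then have c: "a \<in> carrier LL" "b \<in> carrier LL" by (auto simp: ctr_def)
    have "a \<ominus>\<^bsub>LL\<^esub> b \<in> ZZ N \<longleftrightarrow> snd a \<ominus>\<^bsub>PP\<^esub> snd b \<in> N"
      using L.smD(6)[OF sm_ctr ab] c by (simp add: ZZ_def nil_minus)
    then show "N +>\<^bsub>PP\<^esub> snd a = N +>\<^bsub>PP\<^esub> snd b \<longleftrightarrow> a \<ominus>\<^bsub>LL\<^esub> b \<in> ZZ N"
      using P.rcos_eq_iff[OF assms, of "snd a" "snd b"] c by (simp add: nil_iff)
  qed
  also have "\<dots> = P.idx (carrier PP) N" unfolding mindex_def snd_surj[symmetric] image_image ..
  finally show ?thesis .
qed

lemma sm_fst: assumes "L.sm H" shows "F.sm (fst ` H)"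
proof (rule F.smI)
  note H = L.smD[OF assms]
  show "fst ` H \<subseteq> carrier FF" using H(3) by (auto simp: nil_iff)
  show "\<zero>\<^bsub>FF\<^esub> \<in> fst ` H" using H(2) nil_sel(5) by (metis image_eqI)
  fix x y assume "x \<in> fst ` H" "y \<in> fst ` H"
  then obtain x' y' where "x' \<in> H" "y' \<in> H" "x = fst x'" "y = fst y'" by blast
  then show "x \<oplus>\<^bsub>FF\<^esub> y \<in> fst ` H" using H(4)[of x' y'] nil_sel(1)[of x' y', symmetric] by simp
next
  note H = L.smD[OF assms]
  fix r x assume r: "r \<in> carrier R" and "x \<in> fst ` H"
  then obtain x' where "x' \<in> H" "x = fst x'" by blast
  then show "r \<odot>\<^bsub>FF\<^esub> x \<in> fst ` H" using H(7)[OF r, of x'] nil_sel(3)[of r x', symmetric] by simp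
qed

lemma pair_ops:
  "(\<zero>\<^bsub>FF\<^esub>, x) \<oplus>\<^bsub>LL\<^esub> (\<zero>\<^bsub>FF\<^esub>, y) = (\<zero>\<^bsub>FF\<^esub>, x \<oplus>\<^bsub>PP\<^esub> y)"
  "r \<in> carrier R \<Longrightarrow> r \<odot>\<^bsub>LL\<^esub> (\<zero>\<^bsub>FF\<^esub>, x) = (\<zero>\<^bsub>FF\<^esub>, r \<odot>\<^bsub>PP\<^esub> x)"
  "(\<zero>\<^bsub>FF\<^esub>, \<zero>\<^bsub>PP\<^esub>) = \<zero>\<^bsub>LL\<^esub>"
  by (rule prod_eqI; simp add: nil_sel)+

lemma sm_sect: assumes "L.sm H" shows "P.sm (sect H)"
proof (rule P.smI)
  note H = L.smD[OF assms]
  show "sect H \<subseteq> carrier PP" by (auto simp: sect_def)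
  show "\<zero>\<^bsub>PP\<^esub> \<in> sect H" using H(2) by (simp add: sect_def pair_ops)
  fix x y assume "x \<in> sect H" "y \<in> sect H"
  then show "x \<oplus>\<^bsub>PP\<^esub> y \<in> sect H"
    using H(4)[of "(\<zero>\<^bsub>FF\<^esub>, x)" "(\<zero>\<^bsub>FF\<^esub>, y)"] by (simp add: sect_def pair_ops)
next
  note H = L.smD[OF assms]
  fix r x assume "r \<in> carrier R" "x \<in> sect H"
  then show "r \<odot>\<^bsub>PP\<^esub> x \<in> sect H"
    using H(7)[of r "(\<zero>\<^bsub>FF\<^esub>, x)"] by (simp add: sect_def pair_ops)
qed

lemma sum_ctr: assumes "L.sm H" shows "H <+>\<^bsub>LL\<^esub> ctr = XX (fst ` H)"
proof (intro Set.set_eqI iffI)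
  note H = L.smD[OF assms]
  fix x assume "x \<in> H <+>\<^bsub>LL\<^esub> ctr"
  then obtain h c where hc: "h \<in> H" "c \<in> ctr" "x = h \<oplus>\<^bsub>LL\<^esub> c" by (auto simp: L.msum_iff)
  then have "h \<in> carrier LL" "c \<in> carrier LL" "fst c = \<zero>\<^bsub>FF\<^esub>" using H(3) by (auto simp: ctr_def)
  then have "x \<in> carrier LL" "fst x = fst h" using hc(3) by (auto simp: nil_sel nil_iff)
  then show "x \<in> XX (fst ` H)" using hc(1) by (simp add: XX_def)
next
  note H = L.smD[OF assms]
  fix x assume "x \<in> XX (fst ` H)"
  then obtain h where h: "x \<in> carrier LL" "h \<in> H" "fst x = fst h" by (auto simp: XX_def)
  have hc: "h \<in> carrier LL" using H(3)[OF h(2)] .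
  have "fst h \<in> carrier FF" using hc by (simp add: nil_iff)
  then have "fst h \<ominus>\<^bsub>FF\<^esub> fst h = \<zero>\<^bsub>FF\<^esub>" by (simp add: a_minus_def F.M.r_neg)
  then have "x \<ominus>\<^bsub>LL\<^esub> h \<in> ctr" using h hc by (simp add: ctr_def nil_minus)
  then show "x \<in> H <+>\<^bsub>LL\<^esub> ctr"
    using L.msumI[OF h(2), of "x \<ominus>\<^bsub>LL\<^esub> h" ctr] L.minus_telescope(2)[OF h(1) hc] by simp
qed

lemma Int_ctr: assumes "L.sm H" shows "H \<inter> ctr = ZZ (sect H)"
  by (rule Set.set_eqI) (auto simp: ZZ_def ctr_pair sect_def)

lemma sm_comps: assumes "L.sm H" shows "H \<in> L.comps (XX (fst ` H)) ctr (ZZ (sect H))"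
  using assms L.smD(3)[OF assms] by (auto simp: complements_def sum_ctr Int_ctr XX_def)

text \<open>Together with \<open>sm_comps\<close> this shows that a submodule of \<open>L\<close>
  belongs to exactly one pair of lattices, which is what allows the sum over subalgebras to be
  rearranged.\<close>

lemma comps_determine:
  assumes H: "H \<in> L.comps (XX \<Lambda>) ctr (ZZ N)" and "F.sm \<Lambda>" "P.sm N"
  shows "fst ` H = \<Lambda>" "sect H = N"
proof -
  note c = L.compsD[OF H]
  have "XX (fst ` H) = XX \<Lambda>" using sum_ctr[OF c(1)] c(3) by simp
  moreover have "fst ` XX S = S" if "F.sm S" for S
    using F.smD(1)[OF that] fst_surj by (fastforce simp: XX_def)
  ultimately show "fst ` H = \<Lambda>" using sm_fst[OF c(1)] assms(2) by metis
  have "ZZ (sect H) = ZZ N" using Int_ctr[OF c(1)] c(4) by simp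
  moreover have "snd ` ZZ S = S" if "P.sm S" for S
    using P.smD(1)[OF that] snd_surj by (fastforce simp: ZZ_def)
  ultimately show "sect H = N" using sm_sect[OF c(1)] assms(3) by metis
qed

lemma idx_split:
  assumes "L.sm H"
  shows "L.idx (carrier LL) H = F.idx (carrier FF) (fst ` H) * P.idx (carrier PP) (sect H)"
proof -
  note X = sm_XX[OF sm_fst[OF assms]] and c = sm_comps[OF assms]
  have "L.idx (carrier LL) H = L.idx (carrier LL) (XX (fst ` H)) * L.idx (XX (fst ` H)) H"
    by (rule L.idx_mult[OF L.sm_carrier X assms L.compsD(2)[OF c] L.smD(1)[OF X]])
  then show ?thesis
    unfolding L.idx_comps[OF c sm_ctr] idx_XX[OF sm_fst[OF assms]] idx_ZZ[OF sm_sect[OF assms]] .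
qed

text \<open>The image lattice is free of rank \<open>d\<close>, so the submodules in question
  correspond to homomorphisms from it into the quotient of \<open>[L,L]\<close> by \<open>N\<close>.
  Freeness is used in the form of an echelon flag: \<open>X k\<close> requires the coordinates from
  \<open>k\<close> on to vanish.\<close>

lemma card_sections:
  assumes L: "F.sm \<Lambda>" "F.idx (carrier FF) \<Lambda> > 0" and N: "P.sm N" "P.idx (carrier PP) N > 0"
  shows "card (L.comps (XX \<Lambda>) ctr (ZZ N)) = P.idx (carrier PP) N ^ d"
proof -
  define X where "X k = {x \<in> XX \<Lambda>. \<forall>i. k \<le> i \<longrightarrow> i < d \<longrightarrow> fst x i = \<zero>}" for k
  have XL: "x \<in> carrier LL" "fst x \<in> carrier FF" if "x \<in> X k" for x k
    using that by (auto simp: X_def XX_def nil_iff)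
  have coord: "fst x i \<in> carrier R" if "x \<in> X k" "i < d" for x k i
    using XL(2)[OF that(1)] that(2) by (auto simp: free_sel)
  note op = nil_sel(1,3,5) free_sel(2-4)
  have smX: "L.sm (X k)" for k
  proof (rule L.smI)
    note S = L.smD[OF sm_XX[OF L(1)]]
    show "X k \<subseteq> carrier LL" using XL by blast
    show "\<zero>\<^bsub>LL\<^esub> \<in> X k" using S(2) by (simp add: X_def op)
    fix x y assume "x \<in> X k" "y \<in> X k"
    then show "x \<oplus>\<^bsub>LL\<^esub> y \<in> X k" using S(4) by (simp add: X_def op)
  next
    note S = L.smD[OF sm_XX[OF L(1)]]
    fix r x assume "r \<in> carrier R" "x \<in> X k"
    then show "r \<odot>\<^bsub>LL\<^esub> x \<in> X k" using S(7) by (simp add: X_def op)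
  qed
  have X0: "X 0 = ctr"
  proof (intro Set.set_eqI iffI)
    fix x assume x: "x \<in> X 0"
    have "fst x = \<zero>\<^bsub>FF\<^esub>"
      by (rule extensionalityI[of _ "{..<d}"]) (use XL(2)[OF x] x in \<open>auto simp: X_def free_sel PiE_iff\<close>)
    then show "x \<in> ctr" using XL(1)[OF x] by (simp add: ctr_def)
  next
    fix x assume "x \<in> ctr"
    then show "x \<in> X 0" using F.smD(2)[OF L(1)] by (simp add: X_def XX_def ctr_def free_sel(4))
  qed
  have Xd: "X d = XX \<Lambda>" by (auto simp: X_def)
  obtain m where m: "diag {..<d} (\<lambda>_. m) \<subseteq> \<Lambda>"
    using F.finite_idx_pw[OF L(1) F.sm_carrier F.smD(1)[OF L(1)] L(2)] scale_free[of "{..<d}"]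
    unfolding F.pw_def by metis
  have step: "\<exists>x\<in>carrier LL. X (Suc k) = X k <+>\<^bsub>LL\<^esub> L.cyc x \<and> (\<forall>a\<in>carrier R. a \<odot>\<^bsub>LL\<^esub> x \<in> X k \<longrightarrow> a = \<zero>)"
    if k: "k < d" for k
  proof -
    note S = L.smD[OF smX[of "Suc k"]]
    \<comment> \<open>The leading coefficients in coordinate \<open>k\<close> form an ideal. It is
      principal, and an element realising its generator is the next vector of the echelon
      basis.\<close>
    define I where "I = (\<lambda>x. fst x k) ` X (Suc k)"
    have "ideal I R"
    proof (rule idealI[OF ring_axioms])
      show "subgroup I (add_monoid R)"
      proof (rule add.subgroupI)
        show "I \<subseteq> carrier R" using coord k by (auto simp: I_def)
        show "I \<noteq> {}" using S(2) by (auto simp: I_def)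
        fix a assume "a \<in> I"
        then obtain x where x: "x \<in> X (Suc k)" "a = fst x k" by (auto simp: I_def)
        have "fst ((\<ominus> \<one>) \<odot>\<^bsub>LL\<^esub> x) k = \<ominus> a" using coord[OF x(1) k] k x(2) by (simp add: op l_minus)
        then show "\<ominus> a \<in> I" using S(7)[of "\<ominus> \<one>", OF _ x(1)] unfolding I_def by (metis one_closed a_inv_closed image_eqI)
      next
        fix a b assume "a \<in> I" "b \<in> I"
        then obtain x y where x: "x \<in> X (Suc k)" "a = fst x k" "y \<in> X (Suc k)" "b = fst y k" by (auto simp: I_def)
        have "fst (x \<oplus>\<^bsub>LL\<^esub> y) k = a \<oplus> b" using k x by (simp add: op)
        then show "a \<oplus> b \<in> I" using S(4)[OF x(1,3)] unfolding I_def by (metis image_eqI)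
      qed
      show I: "r \<otimes> a \<in> I" if a: "a \<in> I" and r: "r \<in> carrier R" for a r
      proof -
        obtain x where x: "x \<in> X (Suc k)" "a = fst x k" using a by (auto simp: I_def)
        have "fst (r \<odot>\<^bsub>LL\<^esub> x) k = r \<otimes> a" using k x by (simp add: op)
        then show ?thesis using S(7)[OF r x(1)] unfolding I_def by (metis image_eqI)
      qed
      show "a \<otimes> r \<in> I" if a: "a \<in> I" and r: "r \<in> carrier R" for a r
      proof -
        have "a \<in> carrier R" using a coord k by (auto simp: I_def)
        then show ?thesis using I[OF a r] m_comm[OF r] by simp
      qed
    qed
    then obtain g where g: "g \<in> carrier R" "I = PIdl g" using exists_gen by blast
    have "g \<in> I" unfolding g(2) PIdl_iff[OF g(1)] using g(1) by (intro bexI[of _ \<one>]) auto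
    then obtain x where x: "x \<in> X (Suc k)" "fst x k = g" by (auto simp: I_def)
    have g0: "g \<noteq> \<zero>"
    proof
      assume "g = \<zero>"
      then have I0: "I \<subseteq> {\<zero>}" unfolding g(2) by (auto simp: PIdl_iff)
      \<comment> \<open>The ideal is nonzero since the lattice has finite index and so contains
        \<open>p^m\<close> times the \<open>k\<close>-th unit vector; this is what makes the new
        generator free.\<close>
      let ?z = "(\<lambda>i\<in>{..<d}. if i = k then p [^] m else \<zero>, \<zero>\<^bsub>PP\<^esub>)"
      have "fst ?z \<in> diag {..<d} (\<lambda>_. m)"
        using PIdl_ops(3) pow_mem_PIdl by (simp add: diag_def free_sel restrict_PiE_iff)
      then have "?z \<in> X (Suc k)" using m by (auto simp: X_def XX_def nil_iff diag_def)
      then have "fst ?z k \<in> I" unfolding I_def by (rule imageI)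
      then show False using I0 k p_pow_nz[of m] by auto
    qed
    have "X k \<subseteq> X (Suc k)" by (auto simp: X_def)
    then have "X k <+>\<^bsub>LL\<^esub> L.cyc x \<subseteq> X (Suc k)"
      by (intro L.sum_least[OF smX] L.cyc_least[OF smX x(1)])
    moreover have "X (Suc k) \<subseteq> X k <+>\<^bsub>LL\<^esub> L.cyc x"
    proof
      fix z assume z: "z \<in> X (Suc k)"
      have "fst z k \<in> PIdl g" using z g(2) by (auto simp: I_def)
      then obtain c where c: "c \<in> carrier R" "fst z k = g \<otimes> c" using PIdl_iff[OF g(1)] by blast
      let ?c = "c \<odot>\<^bsub>LL\<^esub> x"
      have cx: "?c \<in> X (Suc k)" by (rule S(7)[OF c(1) x(1)])
      have zc: "z \<ominus>\<^bsub>LL\<^esub> ?c \<in> X (Suc k)" by (rule S(6)[OF z cx])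
      have "fst (z \<ominus>\<^bsub>LL\<^esub> ?c) k = fst z k \<ominus> fst ?c k"
        using k nil_minus(1)[OF XL(1)[OF z] XL(1)[OF cx]] free_minus[OF R_cring XL(2)[OF z] XL(2)[OF cx]] by simp
      also have "fst ?c k = fst z k" using k x(2) c g(1) by (simp add: op m_comm)
      finally have "fst (z \<ominus>\<^bsub>LL\<^esub> ?c) k = \<zero>" using coord[OF z k] by (simp add: a_minus_def r_neg)
      then have "fst (z \<ominus>\<^bsub>LL\<^esub> ?c) i = \<zero>" if "k \<le> i" "i < d" for i
        using zc that by (cases "i = k") (auto simp: X_def)
      then have "z \<ominus>\<^bsub>LL\<^esub> ?c \<in> X k" using zc by (auto simp: X_def)
      moreover have "?c \<in> L.cyc x" using c(1) by (auto simp: L.cyc_def)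
      ultimately show "z \<in> X k <+>\<^bsub>LL\<^esub> L.cyc x"
        using L.msumI[of "z \<ominus>\<^bsub>LL\<^esub> ?c" "X k" ?c "L.cyc x"] L.minus_telescope(1)[OF XL(1)[OF z] XL(1)[OF cx]] by simp
    qed
    moreover have "a = \<zero>" if a: "a \<in> carrier R" "a \<odot>\<^bsub>LL\<^esub> x \<in> X k" for a
    proof -
      have "fst (a \<odot>\<^bsub>LL\<^esub> x) k = \<zero>" using a(2) k by (simp add: X_def)
      then have "a \<otimes> g = \<zero>" using k x(2) by (simp add: op)
      then show ?thesis using integral[OF _ a(1) g(1)] g0 by blast
    qed
    ultimately show ?thesis using XL(1)[OF x(1)] by blast
  qed
  have "card (L.comps (X d) (X 0) (ZZ N)) = L.idx (X 0) (ZZ N) ^ d"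
    by (rule L.card_comps_flag[where X = X and d = d, OF smX step]) (use sm_ZZ[OF N(1)] idx_ZZ[OF N(1)] N(2) in \<open>auto simp: X0 ZZ_def\<close>)
  then show ?thesis unfolding X0 Xd idx_ZZ[OF N(1)] .
qed

end

section \<open>No overlap as a condition on pairs of lattices\<close>

lemma set_pair_sums: "set (pair_sums lam) = {lam ! i + lam ! j | i j. i < j \<and> j < length lam}"
proof -
  have "lam ! i + lam ! j \<in> set (pair_sums lam)" if "i < j" "j < length lam" for i j
    using that unfolding pair_sums_def
    by (simp add: image_iff) (rule bexI[of _ j], rule bexI[of _ i], auto)
  moreover have "set (pair_sums lam) \<subseteq> {lam ! i + lam ! j | i j. i < j \<and> j < length lam}"
    unfolding pair_sums_def by (simp add: subset_iff) fastforce
  ultimately show ?thesis by blast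
qed

lemma sorted_pair_sums: "sorted_wrt (\<ge>) (pair_sums lam)"
  unfolding pair_sums_def sorted_wrt_rev by simp

text \<open>Both lists are already sorted, so only the junction matters: no entry of
  \<open>nu\<close> may exceed the least pair sum, which is formed by the two smallest
  parts.\<close>

lemma sorted_pair_sums_append_iff:
  assumes "length lam = d" "sorted_wrt (\<ge>) lam" "d \<ge> 2" "sorted_wrt (\<ge>) nu" "length nu = n"
  shows "sorted_wrt (\<ge>) (pair_sums lam @ nu) \<longleftrightarrow> (\<forall>i<n. nu ! i \<le> lam ! (d - 2) + lam ! (d - 1))"
proof -
  have mono: "lam ! j \<le> lam ! i" if "i \<le> j" "j < d" for i j
    using sorted_wrt_nth_less[OF assms(2), of i j] assms(1) that by (cases "i = j") auto
  have ge: "lam ! (d - 2) + lam ! (d - 1) \<le> x" if x: "x \<in> set (pair_sums lam)" for x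
  proof -
    obtain i j where ij: "x = lam ! i + lam ! j" "i < j" "j < d"
      using x assms(1) by (auto simp: set_pair_sums)
    show ?thesis unfolding ij(1) by (intro add_mono mono) (use ij assms(3) in auto)
  qed
  have mem: "lam ! (d - 2) + lam ! (d - 1) \<in> set (pair_sums lam)"
    unfolding set_pair_sums using assms(1,3)
    by (intro CollectI exI[of _ "d - 2"] exI[of _ "d - 1"]) auto
  have "sorted_wrt (\<ge>) (pair_sums lam @ nu) \<longleftrightarrow> (\<forall>x\<in>set (pair_sums lam). \<forall>y\<in>set nu. y \<le> x)"
    unfolding sorted_wrt_append using sorted_pair_sums assms(4) by auto
  also have "\<dots> \<longleftrightarrow> (\<forall>y\<in>set nu. y \<le> lam ! (d - 2) + lam ! (d - 1))"
    using ge mem le_trans by blast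
  also have "\<dots> \<longleftrightarrow> (\<forall>i<n. nu ! i \<le> lam ! (d - 2) + lam ! (d - 1))"
    using assms(5) all_set_conv_all_nth[of nu "\<lambda>y. y \<le> lam ! (d - 2) + lam ! (d - 1)"] by simp
  finally show ?thesis .
qed

lemma card_index_pairs: "card (index_pairs d) = d choose 2"
proof -
  have e: "index_pairs d = (\<lambda>(j, i). (i, j)) ` (SIGMA j:{..<d}. {..<j})"
    by (auto simp: index_pairs_def image_iff)
  have "card (index_pairs d) = card (SIGMA j:{..<d}. {..<j})"
    unfolding e by (rule card_image) (auto simp: inj_on_def)
  also have "\<dots> = (\<Sum>j<d. j)" by simp
  also have "\<dots> = d choose 2" by (induction d) (auto simp: numeral_2_eq_2)
  finally show ?thesis .
qed

context nil2_dvr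
begin

text \<open>\<open>L/[L,L]\<close> and the module of first components are both images of
  \<open>L\<close>, and the preimage of the submodule in question is \<open>XX\<close> of the image
  of \<open>H\<close> under \<open>fst\<close> in either case. Both types agree with the type of
  this preimage in \<open>L\<close>.\<close>

lemma type_fst:
  assumes H: "L.sm H"
  shows "has_elem_div_type R d (quot_module LL ctr) ((\<lambda>x. ctr +>\<^bsub>LL\<^esub> x) ` (H <+>\<^bsub>LL\<^esub> ctr)) lam \<longleftrightarrow>
    has_elem_div_type R d FF (fst ` H) lam"
proof -
  let ?Q = "quot_module LL ctr"
  let ?X = "XX (fst ` H)"
  let ?h = "\<lambda>x. ctr +>\<^bsub>LL\<^esub> x"
  note X = sm_XX[OF sm_fst[OF H]]
  note X' = L.smD[OF X]
  note q = L.quot_add[OF sm_ctr] L.quot_smult[OF sm_ctr] L.quot_zero[OF sm_ctr] L.quot_carrier[of ctr]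
  have mQ: "module R ?Q" by (rule L.module_quot[OF sm_ctr])
  have smQ: "submodule (?h ` ?X) R ?Q"
  proof (rule module.smI[OF mQ])
    show "?h ` ?X \<subseteq> carrier ?Q" unfolding q(4) using X'(1) by (rule image_mono)
    show "\<zero>\<^bsub>?Q\<^esub> \<in> ?h ` ?X" unfolding q(3) using X'(2) by (rule imageI)
    fix u v assume "u \<in> ?h ` ?X" "v \<in> ?h ` ?X"
    then obtain x y where "x \<in> ?X" "y \<in> ?X" "u = ?h x" "v = ?h y" by blast
    then show "u \<oplus>\<^bsub>?Q\<^esub> v \<in> ?h ` ?X" using q(1)[of x y] X'(3,4) by simp
  next
    fix r u assume r: "r \<in> carrier R" and "u \<in> ?h ` ?X"
    then obtain x where "x \<in> ?X" "u = ?h x" by blast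
    then show "r \<odot>\<^bsub>?Q\<^esub> u \<in> ?h ` ?X" using q(2)[of x r] r X'(3)[of x] X'(7)[OF r, of x] by simp
  qed
  have mem: "x \<in> ?X \<longleftrightarrow> ?h x \<in> ?h ` ?X" if x: "x \<in> carrier LL" for x
  proof
    assume "?h x \<in> ?h ` ?X"
    then obtain y where y: "y \<in> ?X" "?h x = ?h y" by blast
    then have yc: "y \<in> carrier LL" using X'(3) by blast
    have "x \<ominus>\<^bsub>LL\<^esub> y \<in> ctr" using L.rcos_eq_iff[OF sm_ctr x yc] y(2) by blast
    moreover have "ctr \<subseteq> ?X" using F.smD(2)[OF sm_fst[OF H]] by (simp add: ctr_def XX_def subset_iff)
    ultimately have "x \<ominus>\<^bsub>LL\<^esub> y \<in> ?X" by blast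
    then show "x \<in> ?X" using L.sm_minus_cases[OF X x yc] y(1) by simp
  qed (rule imageI)
  have "has_elem_div_type R d LL ?X lam \<longleftrightarrow> has_elem_div_type R d ?Q (?h ` ?X) lam"
    by (rule has_elem_div_type_transfer[OF L.module_axioms X mQ smQ _ _ mem])
      (auto simp: lin_hom_def q)
  moreover have "has_elem_div_type R d LL ?X lam \<longleftrightarrow> has_elem_div_type R d FF (fst ` H) lam"
    by (rule has_elem_div_type_transfer[OF L.module_axioms X F.module_axioms sm_fst[OF H] _ fst_surj])
      (auto simp: lin_hom_def nil_sel nil_iff XX_def)
  ultimately show ?thesis using sum_ctr[OF H] by simp
qed

lemma type_snd:
  assumes H: "L.sm H"
  shows "has_elem_div_type R n (LL\<lparr>carrier := ctr\<rparr>) (H \<inter> ctr) nu \<longleftrightarrow> has_elem_div_type R n PP (sect H) nu"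
proof -
  let ?C = "LL\<lparr>carrier := ctr\<rparr>"
  have mC: "module R ?C" by (rule submodule.submodule_is_module[OF sm_ctr L.module_axioms])
  note I = L.smD[OF L.sm_Int[OF H sm_ctr]]
  have sI: "submodule (H \<inter> ctr) R ?C"
    by (rule module.smI[OF mC]) (use I in \<open>simp_all\<close>)
  show ?thesis
  proof (rule has_elem_div_type_transfer[OF mC sI P.module_axioms sm_sect[OF H]])
    show "snd \<in> lin_hom R ?C PP" by (auto simp: lin_hom_def nil_sel nil_iff ctr_def)
    show "snd ` carrier ?C = carrier PP" using snd_surj by simp
    show "x \<in> H \<inter> ctr \<longleftrightarrow> snd x \<in> sect H" if "x \<in> carrier ?C" for x
      using that by (auto simp: ctr_pair sect_def)
  qed
qed

text \<open>The threshold \<open>M\<close>, by \<open>type_last_two\<close> the sum of the two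
  smallest parts. The formulation by step indices mentions no type and makes it additive over the
  layers of the lattice.\<close>

definition last_two where
  "last_two \<Lambda> = card {j. q ^ (d - 1) \<le> F.step_index (carrier FF) \<Lambda> j} +
    card {j. q ^ d \<le> F.step_index (carrier FF) \<Lambda> j}"

lemma idx_pw:
  assumes "finite J"
  shows "mindex (free_module R J) (carrier (free_module R J)) (diag J (\<lambda>_. m)) = (q ^ m) ^ card J"
  using idx_diag[OF assms, of "\<lambda>_. m"] by simp

lemma pw_free: "uniformizer_module.pw R (free_module R J) p m (carrier (free_module R J)) = diag J (\<lambda>_. m)"
proof -
  interpret J: uniformizer_module R "free_module R J" p q by (rule um_free)
  show ?thesis unfolding J.pw_def by (rule scale_free)
qed

lemma idx_pos_of_pw:
  assumes "finite J" "module.sm R (free_module R J) N" "diag J (\<lambda>_. m) \<subseteq> N"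
  shows "mindex (free_module R J) (carrier (free_module R J)) N > 0"
proof -
  interpret J: uniformizer_module R "free_module R J" p q by (rule um_free)
  show ?thesis
    by (rule J.idx_mono_pos(1)[OF J.sm_carrier assms(2) sm_diag assms(3) J.smD(1)[OF assms(2)]])
      (simp add: idx_pw[OF assms(1)] q_pos)
qed

text \<open>The existential over types is resolved without proving types unique: by
  \<open>key\<close> the sorting condition has the same truth value for all pairs of types, and some
  pair exists.\<close>

lemma no_overlap_iff:
  assumes d: "d \<ge> 2" and H: "L.sm H" and pos: "L.idx (carrier LL) H > 0"
  shows "no_overlap d R H \<longleftrightarrow> diag (index_pairs d) (\<lambda>_. last_two (fst ` H)) \<subseteq> sect H"
proof -
  have pos': "F.idx (carrier FF) (fst ` H) > 0" "P.idx (carrier PP) (sect H) > 0"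
    using pos idx_split[OF H] by auto
  note sm = sm_fst[OF H] sm_sect[OF H]
  have key: "sorted_wrt (\<ge>) (pair_sums lam @ nu) \<longleftrightarrow> diag (index_pairs d) (\<lambda>_. last_two (fst ` H)) \<subseteq> sect H"
    if l: "has_elem_div_type R d FF (fst ` H) lam" and n: "has_elem_div_type R (d choose 2) PP (sect H) nu"
    for lam nu
  proof -
    have "sorted_wrt (\<ge>) (pair_sums lam @ nu) \<longleftrightarrow> (\<forall>i<d choose 2. nu ! i \<le> last_two (fst ` H))"
      unfolding last_two_def type_last_two[OF F.module_axioms sm(1) l d]
      by (rule sorted_pair_sums_append_iff[OF _ _ d]) (use l n in \<open>auto simp: has_elem_div_type_def\<close>)
    also have "\<dots> \<longleftrightarrow> P.pw (last_two (fst ` H)) (carrier PP) \<subseteq> sect H"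
      by (rule type_pw_iff[OF P.module_axioms sm(2) n pos'(2), symmetric])
    finally show ?thesis unfolding pw_free .
  qed
  obtain lam where l: "has_elem_div_type R d FF (fst ` H) lam"
    using elem_div_type_exists[OF finite_lessThan card_lessThan sm(1) pos'(1)] by blast
  obtain nu where n: "has_elem_div_type R (d choose 2) PP (sect H) nu"
    using elem_div_type_exists[OF finite_index_pairs card_index_pairs sm(2) pos'(2)] by blast
  show ?thesis
    unfolding no_overlap_def Let_def derived_eq type_fst[OF H] type_snd[OF H] using key l n by blast
qed

lemma PIdl_mult:
  assumes "x \<in> PIdl (p [^] (k::nat))" "y \<in> PIdl (p [^] (l::nat))" shows "x \<otimes> y \<in> PIdl (p [^] (k + l))"
proof -
  obtain a b where a: "a \<in> carrier R" "x = p [^] k \<otimes> a" and b: "b \<in> carrier R" "y = p [^] l \<otimes> b"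
    using assms PIdl_iff[OF p_pow] by blast
  have "x \<otimes> y = p [^] (k + l) \<otimes> (a \<otimes> b)"
    unfolding a(2) b(2) nat_pow_mult[OF p_closed, symmetric]
    using a(1) b(1) p_pow[of k] p_pow[of l] by (simp add: m_assoc m_lcomm)
  then show ?thesis unfolding PIdl_iff[OF p_pow] using a(1) b(1) by blast
qed

text \<open>With \<open>e \<le> r\<close> the two smallest parts, elements of the image have
  coordinates \<open>s * b i + u i\<close> with one vector \<open>b\<close>, with \<open>s\<close>
  divisible by \<open>p^e\<close> and \<open>u i\<close> by \<open>p^r\<close>. The products of two
  multiples of \<open>b\<close> are symmetric in the indices and cancel in the bracket, which leaves
  multiples of \<open>p^(r+e)\<close>.\<close>

lemma bracket_auto:
  assumes d: "d \<ge> 2" and H: "L.sm H" and pos: "F.idx (carrier FF) (fst ` H) > 0"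
    and sub: "diag (index_pairs d) (\<lambda>_. last_two (fst ` H)) \<subseteq> sect H"
  shows "lie_subalgebra R LL H"
  unfolding lie_subalgebra_def
proof (intro conjI ballI H)
  fix x y assume xH: "x \<in> H" and yH: "y \<in> H"
  note sm = sm_fst[OF H]
  obtain lam f where l: "has_elem_div_type R d FF (fst ` H) lam" and sc: "smith_coords {..<d} (fst ` H) d lam f"
    using elem_div_type_exists[OF finite_lessThan card_lessThan sm pos] by blast
  define r e where "r = lam ! (d - 2)" and "e = lam ! (d - 1)"
  have er: "e \<le> r" unfolding r_def e_def
    using sorted_wrt_nth_less[OF smith_coordsD(2)[OF sc], of "d - 2" "d - 1"] smith_coordsD(1)[OF sc] d by auto
  have lt: "last_two (fst ` H) = r + e"
    unfolding last_two_def type_last_two[OF F.module_axioms sm l d] r_def e_def ..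
  obtain b where b: "b \<in> carrier FF" "\<And>x. x \<in> carrier FF \<Longrightarrow> x \<in> fst ` H \<Longrightarrow> \<exists>c\<in>carrier R. \<exists>u\<in>carrier FF.
       x = (c \<otimes> p [^] e) \<odot>\<^bsub>FF\<^esub> b \<oplus>\<^bsub>FF\<^esub> p [^] r \<odot>\<^bsub>FF\<^esub> u"
    using smith_last[OF sc d] unfolding r_def e_def by metis
  have xy: "x \<in> carrier LL" "y \<in> carrier LL" using L.smD(3)[OF H] xH yH by auto
  have dec: "\<exists>s\<in>PIdl (p [^] e). \<exists>u. \<forall>i<d. u i \<in> PIdl (p [^] r) \<and> fst z i = s \<otimes> b i \<oplus> u i" if z: "z \<in> H" for z
  proof -
    have "fst z \<in> carrier FF" using L.smD(3)[OF H z] by (simp add: nil_iff)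
    then obtain c u where cu: "c \<in> carrier R" "u \<in> carrier FF"
      "fst z = (c \<otimes> p [^] e) \<odot>\<^bsub>FF\<^esub> b \<oplus>\<^bsub>FF\<^esub> p [^] r \<odot>\<^bsub>FF\<^esub> u"
      using b(2)[of "fst z"] z by blast
    have "c \<otimes> p [^] e \<in> PIdl (p [^] e)" using PIdl_ops(2)[OF cu(1)] pow_mem_PIdl by simp
    moreover have "p [^] r \<otimes> u i \<in> PIdl (p [^] r)" if "i < d" for i
      using cu(2) that unfolding PIdl_iff[OF p_pow] by (auto simp: free_sel)
    moreover have "fst z i = (c \<otimes> p [^] e) \<otimes> b i \<oplus> p [^] r \<otimes> u i" if "i < d" for i
      using that unfolding cu(3) by (simp add: free_sel)
    ultimately show ?thesis by (intro bexI[of _ "c \<otimes> p [^] e"] exI[of _ "\<lambda>i. p [^] r \<otimes> u i"]) auto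
  qed
  obtain s u where s: "s \<in> PIdl (p [^] e)" and u: "\<And>i. i < d \<Longrightarrow> u i \<in> PIdl (p [^] r)"
    "\<And>i. i < d \<Longrightarrow> fst x i = s \<otimes> b i \<oplus> u i" using dec[OF xH] by blast
  obtain s' u' where s': "s' \<in> PIdl (p [^] e)" and u': "\<And>i. i < d \<Longrightarrow> u' i \<in> PIdl (p [^] r)"
    "\<And>i. i < d \<Longrightarrow> fst y i = s' \<otimes> b i \<oplus> u' i" using dec[OF yH] by blast
  have bc: "b i \<in> carrier R" if "i < d" for i using b(1) that by (auto simp: free_sel)
  \<comment> \<open>Only the product of the two leading terms escapes divisibility by
    \<open>p^(r+e)\<close>; for the product of \<open>u\<close> with the second factor
    \<open>e \<le> r\<close> is used, which makes all of \<open>fst y j\<close> divisible by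
    \<open>p^e\<close>.\<close>
  have prod: "\<exists>w\<in>PIdl (p [^] (r + e)). fst x i \<otimes> fst y j = (s \<otimes> s') \<otimes> (b i \<otimes> b j) \<oplus> w"
    if i: "i < d" and j: "j < d" for i j
  proof -
    note c = PIdl_ops(4)[OF s] PIdl_ops(4)[OF s'] PIdl_ops(4)[OF u(1)[OF i]] PIdl_ops(4)[OF u'(1)[OF j]] bc[OF i] bc[OF j]
    have bs: "s' \<otimes> b j \<in> PIdl (p [^] e)" using PIdl_ops(2)[OF c(6) s'] m_comm[OF c(2,6)] by simp
    have yj: "fst y j \<in> PIdl (p [^] e)"
      unfolding u'(2)[OF j] using bs subsetD[OF PIdl_mono[OF er] u'(1)[OF j]] by (rule PIdl_ops(1))
    have "s \<otimes> b i \<in> PIdl (p [^] e)" using PIdl_ops(2)[OF c(5) s] m_comm[OF c(1,5)] by simp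
    then have w1: "(s \<otimes> b i) \<otimes> u' j \<in> PIdl (p [^] (r + e))"
      using PIdl_mult[OF _ u'(1)[OF j]] by (simp add: add.commute)
    have w2: "u i \<otimes> fst y j \<in> PIdl (p [^] (r + e))" by (rule PIdl_mult[OF u(1)[OF i] yj])
    have yc: "fst y j \<in> carrier R" by (rule PIdl_ops(4)[OF yj])
    have "fst x i \<otimes> fst y j = (s \<otimes> b i) \<otimes> fst y j \<oplus> u i \<otimes> fst y j"
      unfolding u(2)[OF i] using c yc by (simp add: l_distr)
    also have "(s \<otimes> b i) \<otimes> fst y j = (s \<otimes> b i) \<otimes> (s' \<otimes> b j) \<oplus> (s \<otimes> b i) \<otimes> u' j"
      unfolding u'(2)[OF j] using c by (simp add: r_distr)
    also have "(s \<otimes> b i) \<otimes> (s' \<otimes> b j) = (s \<otimes> s') \<otimes> (b i \<otimes> b j)"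
      using c by (simp add: m_assoc m_lcomm)
    also have "(s \<otimes> s') \<otimes> (b i \<otimes> b j) \<oplus> (s \<otimes> b i) \<otimes> u' j \<oplus> u i \<otimes> fst y j =
      (s \<otimes> s') \<otimes> (b i \<otimes> b j) \<oplus> ((s \<otimes> b i) \<otimes> u' j \<oplus> u i \<otimes> fst y j)"
      using c yc by (simp add: a_assoc)
    finally show ?thesis using PIdl_ops(1)[OF w1 w2] by blast
  qed
  have "snd (x \<otimes>\<^bsub>LL\<^esub> y) (i, j) \<in> PIdl (p [^] (r + e))" if ij: "(i, j) \<in> index_pairs d" for i j
  proof -
    have lt: "i < d" "j < d" using ij by (auto simp: index_pairs_def)
    obtain w where w: "w \<in> PIdl (p [^] (r + e))" "fst x i \<otimes> fst y j = (s \<otimes> s') \<otimes> (b i \<otimes> b j) \<oplus> w"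
      using prod[OF lt] by blast
    obtain w' where w': "w' \<in> PIdl (p [^] (r + e))" "fst x j \<otimes> fst y i = (s \<otimes> s') \<otimes> (b j \<otimes> b i) \<oplus> w'"
      using prod[OF lt(2,1)] by blast
    have c: "(s \<otimes> s') \<otimes> (b i \<otimes> b j) \<in> carrier R" "w \<in> carrier R" "w' \<in> carrier R"
      using PIdl_ops(4) s s' bc lt w(1) w'(1) by blast+
    have "snd (x \<otimes>\<^bsub>LL\<^esub> y) (i, j) = ((s \<otimes> s') \<otimes> (b i \<otimes> b j) \<oplus> w) \<ominus> ((s \<otimes> s') \<otimes> (b i \<otimes> b j) \<oplus> w')"
      unfolding free_nil2_sel(8)[OF ij] w(2) w'(2) m_comm[OF bc[OF lt(2)] bc[OF lt(1)]] ..
    also have "\<dots> = w \<ominus> w'"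
      using reg.minus_telescope(8)[of w w' "(s \<otimes> s') \<otimes> (b i \<otimes> b j)"] c
      by (simp add: regular_sel regular_minus[OF R_cring])
    also have "\<dots> \<in> PIdl (p [^] (r + e))"
      using reg.smD(6)[OF sm_PIdl w(1) w'(1)] c by (simp add: regular_minus[OF R_cring])
    finally show ?thesis .
  qed
  moreover have br: "x \<otimes>\<^bsub>LL\<^esub> y \<in> carrier LL" by (rule free_nil2_closed(4)[OF R_cring xy])
  ultimately have "snd (x \<otimes>\<^bsub>LL\<^esub> y) \<in> diag (index_pairs d) (\<lambda>_. last_two (fst ` H))"
    unfolding lt diag_def by (auto simp: nil_iff)
  then have "snd (x \<otimes>\<^bsub>LL\<^esub> y) \<in> sect H" using sub by blast
  then have "(\<zero>\<^bsub>FF\<^esub>, snd (x \<otimes>\<^bsub>LL\<^esub> y)) \<in> H" by (simp add: sect_def)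
  moreover have "x \<otimes>\<^bsub>LL\<^esub> y = (\<zero>\<^bsub>FF\<^esub>, snd (x \<otimes>\<^bsub>LL\<^esub> y))" by (rule prod_eqI) (simp_all add: nil_sel)
  ultimately show "x \<otimes>\<^bsub>LL\<^esub> y \<in> H" by simp
qed

lemma rcosets_idx: "a_rcosets\<^bsub>LL\<^esub> H = (\<lambda>x. H +>\<^bsub>LL\<^esub> x) ` carrier LL"
  by (auto simp: A_RCOSETS_def')

text \<open>The right-hand side mentions neither brackets nor the index of \<open>H\<close>. The
  inclusion gives closure under the bracket by \<open>bracket_auto\<close>, and it bounds the
  intersection with \<open>[L,L]\<close>, so that \<open>H\<close> has finite index as soon as its
  image does.\<close>

theorem no_overlap_subalgebras_eq:
  assumes d: "d \<ge> 2"
  shows "no_overlap_subalgebras d R = {H. L.sm H \<and> F.idx (carrier FF) (fst ` H) > 0 \<and>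
    diag (index_pairs d) (\<lambda>_. last_two (fst ` H)) \<subseteq> sect H}"
proof -
  have fin: "finite (a_rcosets\<^bsub>LL\<^esub> H) \<longleftrightarrow> L.idx (carrier LL) H > 0" for H
    unfolding rcosets_idx mindex_def card_gt_0_iff using L.M.zero_closed by auto
  have "H \<in> no_overlap_subalgebras d R \<longleftrightarrow> L.sm H \<and> F.idx (carrier FF) (fst ` H) > 0 \<and>
    diag (index_pairs d) (\<lambda>_. last_two (fst ` H)) \<subseteq> sect H" for H
  proof
    assume "H \<in> no_overlap_subalgebras d R"
    then have "L.sm H" "L.idx (carrier LL) H > 0" "no_overlap d R H"
      by (auto simp: no_overlap_subalgebras_def lie_subalgebra_def fin)
    then show "L.sm H \<and> F.idx (carrier FF) (fst ` H) > 0 \<and>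
      diag (index_pairs d) (\<lambda>_. last_two (fst ` H)) \<subseteq> sect H"
      using no_overlap_iff[OF d, of H] idx_split[of H] by auto
  next
    assume *: "L.sm H \<and> F.idx (carrier FF) (fst ` H) > 0 \<and>
      diag (index_pairs d) (\<lambda>_. last_two (fst ` H)) \<subseteq> sect H"
    then have "P.idx (carrier PP) (sect H) > 0"
      using idx_pos_of_pw[OF finite_index_pairs sm_sect] by blast
    then have "L.idx (carrier LL) H > 0" using * idx_split[of H] by simp
    then show "H \<in> no_overlap_subalgebras d R"
      using * no_overlap_iff[OF d, of H] bracket_auto[OF d, of H] by (simp add: no_overlap_subalgebras_def fin)
  qed
  then show ?thesis by blast
qed

lemma no_overlap_term_eq:
  assumes "L.sm H"
  shows "no_overlap_term d R s H =
    of_nat (F.idx (carrier FF) (fst ` H) * P.idx (carrier PP) (sect H)) powr (- s)"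
  unfolding no_overlap_term_def rcosets_idx using idx_split[OF assms] by (simp add: mindex_def)

end

section \<open>Summation\<close>

text \<open>Every finite subset of \<open>A\<close> is eventually contained in \<open>S m\<close>.
  Hence the bound on the sums of norms yields absolute summability, and the sequence
  \<open>S\<close> is cofinal among the finite subsets, so its limit is the unordered sum.\<close>

lemma has_sum_exhaustion:
  fixes f :: "'a \<Rightarrow> complex"
  assumes fin: "\<And>m. finite (S m)" and sub: "\<And>m. S m \<subseteq> A"
    and ev: "\<And>x. x \<in> A \<Longrightarrow> eventually (\<lambda>m. x \<in> S m) sequentially"
    and lim: "(\<lambda>m. sum f (S m)) \<longlonglongrightarrow> c" and bdd: "\<And>m. (\<Sum>x\<in>S m. norm (f x)) \<le> b"
  shows "(f has_sum c) A"
proof -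
  have evF: "eventually (\<lambda>m. F \<subseteq> S m) sequentially" if "finite F" "F \<subseteq> A" for F
    using eventually_ball_finite[OF that(1), of "\<lambda>m x. x \<in> S m" sequentially] ev that(2) by (auto simp: subset_eq)
  have "(\<Sum>x\<in>F. norm (f x)) \<le> b" if F: "finite F" "F \<subseteq> A" for F
  proof -
    obtain m where "F \<subseteq> S m" using evF[OF F] eventually_sequentially by auto
    then have "(\<Sum>x\<in>F. norm (f x)) \<le> (\<Sum>x\<in>S m. norm (f x))" by (intro sum_mono2 fin) auto
    then show ?thesis using bdd[of m] by linarith
  qed
  then have "(\<lambda>x. norm (f x)) summable_on A"
    by (intro nonneg_bdd_above_summable_on bdd_aboveI[of _ b]) auto
  then have "f summable_on A" by (rule abs_summable_summable)
  then have hs: "(f has_sum infsum f A) A" by (rule has_sum_infsum)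
  have "filterlim S (finite_subsets_at_top A) sequentially"
    unfolding filterlim_finite_subsets_at_top using evF fin sub by auto
  then have "(\<lambda>m. sum f (S m)) \<longlonglongrightarrow> infsum f A"
    using hs unfolding has_sum_def by (rule filterlim_compose[rotated])
  then have "infsum f A = c" using lim LIMSEQ_unique by blast
  then show ?thesis using hs by simp
qed

text \<open>The limit solves the triangular system for a fixed vector of the recursion, which for \<open>z = 1\<close>
  is solved by \<^const>\<open>qbase.D\<close> through the Cauchy identity.\<close>

lemma zeta_factor_limit:
  fixes q Q t z :: "'k::real_normed_field" and g :: "nat \<Rightarrow> nat \<Rightarrow> 'k"
  assumes qb: "qbase q Q" and Q: "norm Q \<le> 1" and d: "d \<ge> 2"
    and t: "norm (q ^ d * t) < 1" "norm (q * t) < 1" "norm t < 1" and z: "norm z \<le> 1"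
    and g0: "\<And>r. g 0 r = 1"
    and gS: "\<And>m r. r \<le> d \<Longrightarrow> g (Suc m) r =
      (\<Sum>s\<le>r. qbase.T q Q (q ^ d * t) r s * z ^ (of_bool (d - 1 \<le> s) + of_bool (d \<le> s)) * g m s)"
  shows "(\<lambda>m. g m d) \<longlonglongrightarrow> zeta_factor d q t z"
proof -
  interpret qbase q Q by (rule qb)
  define X where "X = q ^ d * t"
  define \<tau> where "\<tau> = (q * t) ^ (d - 1)"
  have ne1: "1 - w \<noteq> 0" if "norm w < 1" for w :: 'k using that by auto
  have Qp: "norm (Q ^ i) \<le> 1" for i unfolding norm_power using Q by (simp add: power_le_one)
  have small: "norm (Q ^ i * X) < 1" for i
  proof -
    have "norm (Q ^ i) * norm X \<le> 1 * norm X" by (intro mult_right_mono Qp) simp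
    then show ?thesis using t(1) by (simp add: norm_mult X_def)
  qed
  have Dnz: "D X r \<noteq> 0" for r unfolding D_def using ne1[OF small] by (simp del: power_Suc)
  have Trr: "T X r r = (Q ^ r * X) ^ r" for r by (simp add: T_def power_mult power_mult_distrib)
  have QX: "Q ^ i * X = q ^ (d - i) * t" if "i \<le> d" for i
    using that pow_cancel(3)[of i "q ^ (d - i) * t"] by (simp add: X_def power_add[symmetric] flip: mult.assoc)
  have T1: "T X (d - 1) (d - 1) = \<tau>" unfolding Trr using d QX[of "d - 1"] by (simp add: \<tau>_def)
  have Td: "T X d d = t ^ d" unfolding Trr using QX[of d] by simp
  have Td1: "T X d (d - 1) = gbin q d (d - 1) * t ^ (d - 1)"
    using QX[of d] by (simp add: T_def power_mult power_mult_distrib[symmetric] mult.assoc)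
  have DS: "D X d = D X (d - 1) * (1 - t)" using D_Suc[of X "d - 1"] d QX[of d] by simp
  have Dd: "D X d = (\<Prod>i<d. 1 - q ^ i * t)"
  proof -
    have "D X d = (\<Prod>i<d. 1 - q ^ (d - Suc i) * t)"
      unfolding D_def by (intro prod.cong refl) (use QX in \<open>auto simp del: power_Suc\<close>)
    then show ?thesis by (simp add: prod.nat_diff_reindex[of "\<lambda>i. 1 - q ^ i * t"])
  qed
  have zp: "norm (z ^ j) \<le> 1" for j unfolding norm_power using z by (simp add: power_le_one)
  have pw1: "norm (w ^ j * z ^ i) < 1" if "norm w < 1" "j > 0" for w :: 'k and i j
  proof -
    have "norm w ^ j < 1" using that by (simp add: power_less_one_iff)
    moreover have "norm (w ^ j) * norm (z ^ i) \<le> norm (w ^ j) * 1" by (intro mult_left_mono zp) simp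
    ultimately show ?thesis by (simp add: norm_mult norm_power)
  qed
  have nz: "1 - t ^ d * z ^ 2 \<noteq> 0" "1 - \<tau> * z \<noteq> 0" "1 - t \<noteq> 0"
    using ne1[OF pw1[OF t(3), of d 2]] ne1[OF pw1[OF t(2), of "d - 1" 1]] ne1[OF t(3)] d by (auto simp: \<tau>_def)
  have cauchy: "(\<Sum>s<r. T X r s / D X s) = (1 - T X r r) / D X r" for r
  proof -
    have "Q ^ i * X \<noteq> 1" for i using small[of i] by auto
    then have "(\<Sum>s\<le>r. T X r s / D X s) = 1 / D X r" unfolding T_def by (intro cauchy_sum) auto
    then show ?thesis by (simp add: lessThan_Suc_atMost[symmetric] diff_divide_distrib algebra_simps)
  qed
  \<comment> \<open>The fixed vector. Rows below \<open>d - 1\<close> do not involve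
    \<open>z\<close>, and the Cauchy identity gives \<open>1 / D\<close>. In row
    \<open>d - 1\<close> only the diagonal entry carries \<open>z\<close>, which turns the factor
    \<open>1 - \<tau>\<close> on the left into \<open>1 - \<tau> * z\<close>. Row \<open>d\<close>
    is the value sought.\<close>
  define h where "h r = (if r < d - 1 then 1 / D X r else if r = d - 1 then (1 - \<tau>) / (D X (d - 1) * (1 - \<tau> * z))
    else zeta_factor d q t z)" for r
  define K where "K r s = T X r s * z ^ (of_bool (d - 1 \<le> s) + of_bool (d \<le> s))" for r s
  have hd: "h d = zeta_factor d q t z"
  proof -
    have "\<not> d < d - 1" "d \<noteq> d - 1" using d by auto
    then show ?thesis by (simp only: h_def if_False)
  qed
  have "(\<lambda>m. g m d) \<longlonglongrightarrow> h d"
  proof (rule triangular_recursion_tendsto[where K = K])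
    show "g (Suc m) r = (\<Sum>s\<le>r. K r s * g m s)" if "r \<le> d" for m r
      using gS[OF that] by (simp add: K_def X_def)
    have h0: "h 0 = 1" using d by (simp add: h_def D_def)
    show "g m 0 = h 0" for m
      by (induction m) (use d h0 g0 gS[of 0] in \<open>auto simp: T_def\<close>)
    show "norm (K r r) < 1" if "0 < r" "r \<le> d" for r
      unfolding K_def Trr by (rule pw1[OF small that(1)])
    show "h r * (1 - K r r) = (\<Sum>s<r. K r s * h s)" if r: "0 < r" "r \<le> d" for r
    proof -
      consider "r < d - 1" | "r = d - 1" | "r = d" using r by linarith
      then show ?thesis
      proof cases
        case 1
        have "(\<Sum>s<r. K r s * h s) = (\<Sum>s<r. T X r s / D X s)"
          by (intro sum.cong refl) (use 1 in \<open>auto simp: K_def h_def\<close>)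
        then show ?thesis using 1 by (simp add: cauchy K_def h_def)
      next
        case 2
        have "(\<Sum>s<r. K r s * h s) = (\<Sum>s<r. T X r s / D X s)"
          by (intro sum.cong refl) (use 2 in \<open>auto simp: K_def h_def\<close>)
        moreover have "K r r = \<tau> * z" using d 2 T1 by (simp add: K_def)
        moreover have "h r = (1 - \<tau>) / (D X (d - 1) * (1 - \<tau> * z))" using 2 by (simp add: h_def)
        ultimately show ?thesis using 2 T1 nz(2) by (simp add: cauchy)
      next
        case 3
        define G P where "G = T X d (d - 1)" and "P = D X (d - 1)"
        have P: "P \<noteq> 0" using Dnz by (simp add: P_def)
        have d1: "{..<d} = insert (d - 1) {..<d - 1}" using d by auto
        have "(\<Sum>s<d - 1. K d s * h s) = (\<Sum>s<d - 1. T X d s / D X s)"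
          by (intro sum.cong refl) (auto simp: K_def h_def)
        moreover have "(\<Sum>s<d. T X d s / D X s) = G / P + (\<Sum>s<d - 1. T X d s / D X s)"
          unfolding d1 by (simp add: G_def P_def)
        ultimately have 1: "(\<Sum>s<d - 1. K d s * h s) = (1 - t ^ d) / (P * (1 - t)) - G / P"
          using cauchy[of d] by (simp add: Td DS P_def)
        have "K d (d - 1) * h (d - 1) = G * z * ((1 - \<tau>) / (P * (1 - \<tau> * z)))"
          using d by (simp add: K_def h_def G_def P_def)
        then have "(\<Sum>s<d. K d s * h s) = G * z * ((1 - \<tau>) / (P * (1 - \<tau> * z))) + ((1 - t ^ d) / (P * (1 - t)) - G / P)"
          unfolding d1 using 1 by simp
        also have "\<dots> = ((1 - t ^ d) * (1 - \<tau> * z) - G * (1 - t) * (1 - z)) / ((1 - \<tau> * z) * (P * (1 - t)))"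
          using P nz(2,3) by (simp add: divide_simps) (simp add: algebra_simps)
        finally have S: "(\<Sum>s<d. K d s * h s) =
          ((1 - t ^ d) * (1 - \<tau> * z) - G * (1 - t) * (1 - z)) / ((1 - \<tau> * z) * (P * (1 - t)))" .
        have "zeta_factor d q t z = ((1 - t ^ d) * (1 - \<tau> * z) - G * (1 - t) * (1 - z)) *
          inverse ((1 - t ^ d * z ^ 2) * (1 - \<tau> * z) * (P * (1 - t)))"
          unfolding zeta_factor_def Dd[symmetric] DS P_def[symmetric] G_def Td1 \<tau>_def ..
        moreover have "K d d = t ^ d * z ^ 2" by (simp add: K_def Td power2_eq_square)
        ultimately have "zeta_factor d q t z * (1 - K d d) =
          ((1 - t ^ d) * (1 - \<tau> * z) - G * (1 - t) * (1 - z)) / ((1 - \<tau> * z) * (P * (1 - t)))"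
        proof -
          have "w * inverse (a * b * c) * a = w / (b * c)" if "a \<noteq> 0" for w a b c :: 'k
            using that by (simp add: divide_simps)
          then show "zeta_factor d q t z = ((1 - t ^ d) * (1 - \<tau> * z) - G * (1 - t) * (1 - z)) *
              inverse ((1 - t ^ d * z ^ 2) * (1 - \<tau> * z) * (P * (1 - t))) \<Longrightarrow> K d d = t ^ d * z ^ 2 \<Longrightarrow> ?thesis"
            using nz(1) by presburger
        qed
        then show ?thesis using S 3 hd by simp
      qed
    qed
  qed simp
  then show ?thesis using hd by simp
qed

section \<open>Truncated sums over pairs of lattices\<close>

context uniformizer_module
begin

lemma pw_antimono: assumes "sm A" "i \<le> j" shows "pw j A \<subseteq> pw i A"
  by (rule lift_Suc_antimono_le[of "\<lambda>j. pw j A"]) (use assms pw_Suc_le in auto)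

lemma step_index_1:
  assumes "sm L" "sm N" "pw m L \<subseteq> N" "m \<le> j" shows "step_index L N j = 1"
proof -
  have "pw i L <+>\<^sub>M N = N" if "m \<le> i" for i
  proof -
    have s: "sm (pw i L)" by (rule sm_pw[OF assms(1)])
    have "N <+>\<^sub>M pw i L = N" using pw_antimono[OF assms(1) that] assms(3) by (intro sum_absorb[OF assms(2) s]) blast
    then show ?thesis using sum_comm[OF smD(1)[OF s] smD(1)[OF assms(2)]] by simp
  qed
  then show ?thesis unfolding step_index_def using assms(4) idx_self[OF assms(2)] by simp
qed

end

context nil2_dvr
begin

lemma tf_free:
  assumes "x \<in> carrier (free_module R J)" "p \<odot>\<^bsub>free_module R J\<^esub> x = \<zero>\<^bsub>free_module R J\<^esub>"
  shows "x = \<zero>\<^bsub>free_module R J\<^esub>"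
proof (rule extensionalityI[of _ J])
  fix i assume i: "i \<in> J"
  have "p \<otimes> x i = \<zero>" using fun_cong[OF assms(2), of i] i by (simp add: free_sel)
  moreover have "x i \<in> carrier R" using assms(1) i by (auto simp: free_sel)
  ultimately show "x i = \<zero>\<^bsub>free_module R J\<^esub> i" using integral[of p "x i"] p_nz p_closed i by (simp add: free_sel)
qed (use assms(1) in \<open>auto simp: free_sel PiE_iff\<close>)

definition Lat :: "'i set \<Rightarrow> nat \<Rightarrow> ('i \<Rightarrow> 'a) set set" where
  "Lat J m = {N. submodule N R (free_module R J) \<and> diag J (\<lambda>_. m) \<subseteq> N}"

text \<open>The lattice count with the whole module as \<open>E\<close>: the transversality
  condition is void and the recursion starts with \<open>r\<close> equal to the rank. The second
  claim distributes a multiplicative weight of the index over the layers.\<close>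

lemma Lat_sum:
  fixes w :: "nat \<Rightarrow> 'k::comm_semiring_1"
  assumes J: "finite J" and w: "w 1 = 1" "\<And>a b. w (a * b) = w a * w b"
  shows "finite (Lat J m)"
    and "N \<in> Lat J m \<Longrightarrow> w (mindex (free_module R J) (carrier (free_module R J)) N) =
      (\<Prod>j<m. w (uniformizer_module.step_index R (free_module R J) p (carrier (free_module R J)) N j))"
    and "(\<Sum>N\<in>Lat J m. \<Prod>j<m. u (uniformizer_module.step_index R (free_module R J) p (carrier (free_module R J)) N j)) =
      lattice_poly q (card J) (u :: nat \<Rightarrow> 'k) m (card J)"
proof -
  interpret J: uniformizer_module R "free_module R J" p q by (rule um_free)
  let ?C = "carrier (free_module R J)"
  have Lat: "Lat J m = J.lattices m ?C ?C"
  proof (intro Set.set_eqI)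
    fix N
    have "N <+>\<^bsub>free_module R J\<^esub> ?C = ?C" if "J.sm N"
      using J.sum_absorb[OF J.sm_carrier that J.smD(1)[OF that]] J.sum_comm[OF J.smD(1)[OF that] order_refl] by simp
    then show "N \<in> Lat J m \<longleftrightarrow> N \<in> J.lattices m ?C ?C"
      unfolding Lat_def J.lattices_def pw_free using J.smD(1) by blast
  qed
  have i: "J.idx ?C (J.scl p ?C) = q ^ card J"
    using scale_free[of J 1] idx_pw[OF J, of 1] p_closed by simp
  note ls = J.lattice_sum[OF tf_free J.sm_carrier J.sm_carrier J.scale_le[OF J.sm_carrier p_closed] order_refl i i]
  show "finite (Lat J m)" unfolding Lat by (rule ls(1))
  show "(\<Sum>N\<in>Lat J m. \<Prod>j<m. u (J.step_index ?C N j)) = lattice_poly q (card J) u m (card J)"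
    unfolding Lat by (rule ls(2))
  assume "N \<in> Lat J m"
  then have N: "J.sm N" "J.pw m ?C \<subseteq> N" by (auto simp: Lat_def pw_free)
  have "w (\<Prod>j<m. c j) = (\<Prod>j<m. w (c j))" for c and m :: nat by (induction m) (auto simp: w(2) w(1)[simplified])
  then show "w (J.idx ?C N) = (\<Prod>j<m. w (J.step_index ?C N j))"
    unfolding J.idx_prod_step[OF J.sm_carrier N(1) J.smD(1)[OF N(1)] N(2)] .
qed

text \<open>A finite exhaustion. Only the image lattice is truncated explicitly; no overlap then
  confines the intersection with \<open>[L,L]\<close> to lattices containing a power of
  \<open>p\<close> determined by the image.\<close>

definition trunc where
  "trunc m = {H \<in> no_overlap_subalgebras d R. diag {..<d} (\<lambda>_. m) \<subseteq> fst ` H}"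

lemma idx_Lat_pos: "finite J \<Longrightarrow> N \<in> Lat J m \<Longrightarrow> mindex (free_module R J) (carrier (free_module R J)) N > 0"
  unfolding Lat_def using idx_pos_of_pw by blast

text \<open>The function \<open>ch\<close> stands for raising an index to the power
  \<open>-s\<close>; the factor with exponent \<open>d\<close> is the number of submodules over one
  pair of lattices. The general coefficient type also permits the constant weight 1 in
  \<open>nat\<close>, by which finiteness is extracted later.\<close>

lemma trunc_sum:
  fixes ch :: "nat \<Rightarrow> 'k::comm_semiring_1"
  assumes d: "d \<ge> 2" and ch: "ch 1 = 1" "\<And>a b. ch (a * b) = ch a * ch b"
  shows "finite (trunc m)"
    and "(\<Sum>H\<in>trunc m. ch (F.idx (carrier FF) (fst ` H) * P.idx (carrier PP) (sect H))) =
      (\<Sum>\<Lambda>\<in>Lat {..<d} m. \<Sum>N\<in>Lat (index_pairs d) (last_two \<Lambda>).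
        ch (F.idx (carrier FF) \<Lambda>) * (of_nat (P.idx (carrier PP) N ^ d) * ch (P.idx (carrier PP) N)))"
proof -
  define I where "I = (SIGMA \<Lambda>:Lat {..<d} m. Lat (index_pairs d) (last_two \<Lambda>))"
  define Cm where "Cm = (\<lambda>(\<Lambda>, N). L.comps (XX \<Lambda>) ctr (ZZ N))"
  note finL = Lat_sum(1)[of _ "\<lambda>_. 1::nat"]
  have finI: "finite I" unfolding I_def by (intro finite_SigmaI finL finite_index_pairs finite_lessThan) auto
  have mem: "F.sm \<Lambda>" "F.idx (carrier FF) \<Lambda> > 0" "P.sm N" "P.idx (carrier PP) N > 0" if "(\<Lambda>, N) \<in> I" for \<Lambda> N
    using that idx_Lat_pos[OF finite_lessThan, of \<Lambda> d m] idx_Lat_pos[OF finite_index_pairs, of N d "last_two \<Lambda>"]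
    by (auto simp: I_def Lat_def)
  have cardC: "card (Cm (\<Lambda>, N)) = P.idx (carrier PP) N ^ d" if "(\<Lambda>, N) \<in> I" for \<Lambda> N
    unfolding Cm_def using card_sections[OF mem[OF that]] by simp
  have finC: "finite (Cm i)" if "i \<in> I" for i
    using that cardC[of "fst i" "snd i"] mem(4)[of "fst i" "snd i"] by (intro card_ge_0_finite) simp
  have det: "fst ` H = \<Lambda>" "sect H = N" if "(\<Lambda>, N) \<in> I" "H \<in> Cm (\<Lambda>, N)" for \<Lambda> N H
    using comps_determine[OF _ mem(1,3)[OF that(1)]] that(2) by (auto simp: Cm_def)
  have U: "trunc m = (\<Union>i\<in>I. Cm i)"
  proof (intro Set.set_eqI iffI)
    fix H assume "H \<in> trunc m"
    then have H: "L.sm H" "diag (index_pairs d) (\<lambda>_. last_two (fst ` H)) \<subseteq> sect H" "diag {..<d} (\<lambda>_. m) \<subseteq> fst ` H"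
      by (auto simp: trunc_def no_overlap_subalgebras_eq[OF d])
    then have "(fst ` H, sect H) \<in> I" using sm_fst sm_sect by (simp add: I_def Lat_def)
    moreover have "H \<in> Cm (fst ` H, sect H)" using sm_comps[OF H(1)] by (simp add: Cm_def)
    ultimately show "H \<in> (\<Union>i\<in>I. Cm i)" by blast
  next
    fix H assume "H \<in> (\<Union>i\<in>I. Cm i)"
    then obtain \<Lambda> N where i: "(\<Lambda>, N) \<in> I" "H \<in> Cm (\<Lambda>, N)" by auto
    have "L.sm H" using i(2) L.compsD(1) by (auto simp: Cm_def)
    then show "H \<in> trunc m" using det[OF i] mem[OF i(1)] i(1)
      by (auto simp: trunc_def no_overlap_subalgebras_eq[OF d] I_def Lat_def)
  qed
  show "finite (trunc m)" unfolding U using finI finC by blast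
  have "(\<Sum>H\<in>trunc m. ch (F.idx (carrier FF) (fst ` H) * P.idx (carrier PP) (sect H))) =
    (\<Sum>i\<in>I. \<Sum>H\<in>Cm i. ch (F.idx (carrier FF) (fst ` H) * P.idx (carrier PP) (sect H)))"
    unfolding U
  proof (rule sum.UNION_disjoint[OF finI])
    have det': "i = (fst ` H, sect H)" if "i \<in> I" "H \<in> Cm i" for i H
      using det[of "fst i" "snd i" H] that by (cases i) simp
    show "\<forall>i\<in>I. \<forall>j\<in>I. i \<noteq> j \<longrightarrow> Cm i \<inter> Cm j = {}"
      by (intro ballI impI equals0I) (metis IntE det')
  qed (use finC in blast)
  also have "\<dots> = (\<Sum>(\<Lambda>, N)\<in>I. ch (F.idx (carrier FF) \<Lambda>) *
    (of_nat (P.idx (carrier PP) N ^ d) * ch (P.idx (carrier PP) N)))"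
  proof (intro sum.cong refl)
    fix i assume iI: "i \<in> I"
    obtain \<Lambda> N where i: "i = (\<Lambda>, N)" by (cases i)
    have "(\<Sum>H\<in>Cm i. ch (F.idx (carrier FF) (fst ` H) * P.idx (carrier PP) (sect H))) =
      (\<Sum>H\<in>Cm i. ch (F.idx (carrier FF) \<Lambda>) * ch (P.idx (carrier PP) N))"
      by (intro sum.cong refl) (use det iI in \<open>simp add: i ch\<close>)
    then show "(\<Sum>H\<in>Cm i. ch (F.idx (carrier FF) (fst ` H) * P.idx (carrier PP) (sect H))) =
      (case i of (\<Lambda>, N) \<Rightarrow> ch (F.idx (carrier FF) \<Lambda>) * (of_nat (P.idx (carrier PP) N ^ d) * ch (P.idx (carrier PP) N)))"
      using cardC[of \<Lambda> N] iI by (simp add: i mult.left_commute)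
  qed
  also have "\<dots> = (\<Sum>\<Lambda>\<in>Lat {..<d} m. \<Sum>N\<in>Lat (index_pairs d) (last_two \<Lambda>).
        ch (F.idx (carrier FF) \<Lambda>) * (of_nat (P.idx (carrier PP) N ^ d) * ch (P.idx (carrier PP) N)))"
    unfolding I_def by (rule sum.Sigma[symmetric]) (auto intro!: finL finite_index_pairs)
  finally show "(\<Sum>H\<in>trunc m. ch (F.idx (carrier FF) (fst ` H) * P.idx (carrier PP) (sect H))) =
      (\<Sum>\<Lambda>\<in>Lat {..<d} m. \<Sum>N\<in>Lat (index_pairs d) (last_two \<Lambda>).
        ch (F.idx (carrier FF) \<Lambda>) * (of_nat (P.idx (carrier PP) N ^ d) * ch (P.idx (carrier PP) N)))" .
qed

text \<open>Turns a power with exponent \<open>M\<close> into a product over the first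
  \<open>m\<close> layers. Layers from \<open>m\<close> on have index 1, which stays below both
  thresholds because \<open>d \<ge> 2\<close> makes \<open>q^(d-1)\<close> greater than 1.\<close>

lemma last_two_power:
  fixes z :: "'k::comm_semiring_1"
  assumes "d \<ge> 2" "\<Lambda> \<in> Lat {..<d} m"
  shows "z ^ last_two \<Lambda> = (\<Prod>j<m. z ^ (of_bool (q ^ (d - 1) \<le> F.step_index (carrier FF) \<Lambda> j) +
    of_bool (q ^ d \<le> F.step_index (carrier FF) \<Lambda> j)))"
proof -
  have "F.sm \<Lambda>" "F.pw m (carrier FF) \<subseteq> \<Lambda>" using assms(2) by (auto simp: Lat_def pw_free)
  then have s1: "F.step_index (carrier FF) \<Lambda> j = 1" if "m \<le> j" for j
    using F.step_index_1[OF F.sm_carrier] that by blast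
  have c: "card {j. q ^ k \<le> F.step_index (carrier FF) \<Lambda> j} =
    (\<Sum>j<m. of_bool (q ^ k \<le> F.step_index (carrier FF) \<Lambda> j))" if "k > 0" for k
  proof -
    have "q ^ k > 1" using one_less_power[OF q_gt_1 that] .
    then have "j < m" if "q ^ k \<le> F.step_index (carrier FF) \<Lambda> j" for j
      using s1[of j] that by (cases "m \<le> j") auto
    then have "{j. q ^ k \<le> F.step_index (carrier FF) \<Lambda> j} = {j. j < m \<and> q ^ k \<le> F.step_index (carrier FF) \<Lambda> j}"
      by blast
    also have "\<dots> = {..<m} \<inter> {j. q ^ k \<le> F.step_index (carrier FF) \<Lambda> j}" by auto
    finally show ?thesis by (simp add: sum_of_bool_eq)
  qed
  have "0 < d - 1" "0 < d" using assms(1) by auto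
  then have "last_two \<Lambda> = (\<Sum>j<m. of_bool (q ^ (d - 1) \<le> F.step_index (carrier FF) \<Lambda> j)) +
    (\<Sum>j<m. of_bool (q ^ d \<le> F.step_index (carrier FF) \<Lambda> j))"
    unfolding last_two_def by (simp only: c)
  then show ?thesis by (simp only: sum.distrib[symmetric] power_sum)
qed

end

section \<open>Convergence to the closed expression\<close>

context nil2_dvr
begin

lemma qbase_q: "qbase (of_nat q :: complex) (inverse (of_nat q))"
proof
  show "of_nat q * inverse (of_nat q :: complex) = 1" using q_pos by simp
  show "(of_nat q :: complex) ^ i \<noteq> 1" if "i > 0" for i
  proof -
    have "q ^ i \<noteq> 1" using one_less_power[OF q_gt_1 that] by linarith
    then show ?thesis by (metis of_nat_1 of_nat_eq_iff of_nat_power)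
  qed
qed

text \<open>For each \<open>m\<close> the sum over \<open>N\<close> is evaluated exactly, so the
  truncated sum is a combination, with coefficients independent of \<open>m\<close>, of lattice sums
  of rank \<open>d\<close>. Only these tend to a limit: \<open>small\<close> gives \<open>X\<close>
  norm below 1, hence the eigenvalues norm at most 1, as \<open>zeta_factor_limit\<close>
  demands.\<close>

theorem trunc_tendsto:
  fixes ch :: "nat \<Rightarrow> complex"
  assumes d: "d \<ge> 2" and ch: "ch 1 = 1" "\<And>a b. ch (a * b) = ch a * ch b" "ch q \<noteq> 0"
    and small: "norm (of_nat q ^ ((d choose 2) + d) * ch q) < 1"
  shows "(\<lambda>m. \<Sum>H\<in>trunc m. ch (F.idx (carrier FF) (fst ` H) * P.idx (carrier PP) (sect H)))
    \<longlonglongrightarrow> zeta_expr d (of_nat q) (ch q)"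
proof -
  define qq Q :: complex where "qq = of_nat q" and "Q = inverse qq"
  define t n X where "t = ch q" and "n = d choose 2" and "X = qq ^ (n + d) * t"
  interpret qbase qq Q unfolding qq_def Q_def by (rule qbase_q)
  have q1: "norm qq \<ge> 1" using q_pos by (simp add: qq_def)
  have Q1: "norm Q \<le> 1" using q1 by (simp add: Q_def norm_inverse inverse_le_1_iff)
  have Qp: "norm (Q ^ i) \<le> 1" for i unfolding norm_power using Q1 by (simp add: power_le_one)
  have X1: "norm X < 1" using small by (simp add: X_def qq_def n_def t_def)
  have tsmall: "norm (qq ^ e * t) < 1" if "e \<le> n + d" for e
  proof -
    have "norm (qq ^ e) * norm t \<le> norm (qq ^ (n + d)) * norm t"
      unfolding norm_power using q1 that by (intro mult_right_mono power_increasing) auto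
    then show ?thesis using X1 by (simp add: X_def norm_mult)
  qed
  have X0: "X \<noteq> 0" using ch(3) qQ_nz by (simp add: X_def t_def)
  have QX: "Q ^ i * X \<noteq> 1" for i
  proof -
    have "norm (Q ^ i) * norm X \<le> 1 * norm X" by (intro mult_right_mono Qp) simp
    then have "norm (Q ^ i * X) < 1" using X1 by (simp add: norm_mult)
    then show ?thesis by auto
  qed
  have y1: "norm (y X k) \<le> 1" for k
  proof -
    have "norm (X ^ k) \<le> 1" unfolding norm_power using X1 by (intro power_le_one) auto
    then have "norm (Q ^ (k * k)) * norm (X ^ k) \<le> 1 * 1" by (intro mult_mono Qp) auto
    then show ?thesis by (simp add: y_def norm_mult)
  qed
  have chp: "ch (q ^ s) = t ^ s" for s by (induction s) (auto simp: ch(2) ch(1)[simplified] t_def)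
  \<comment> \<open>The number of submodules over a pair is itself multiplicative in the index of
    \<open>N\<close>, so it is absorbed into the weight; this is where \<open>q^d * t\<close> takes
    the place of \<open>t\<close>.\<close>
  define w :: "nat \<Rightarrow> complex" where "w a = of_nat (a ^ d) * ch a" for a
  have w: "w 1 = 1" "\<And>a b. w (a * b) = w a * w b"
    using ch(1,2) by (auto simp: w_def power_mult_distrib)
  \<comment> \<open>The origin of \<open>X = q^(n+d) * t\<close>: splitting
    \<open>(n + d) * s\<close> as \<open>r*s + s*(n - r) + s*d\<close> separates the factor that
    cancels \<open>Q^(r*s)\<close>, the number of complements and the number of sections.\<close>
  have wT: "of_nat (gbin q r s * q ^ (s * (n - r))) * w (q ^ s) = T X r s" if "r \<le> n" for r s
  proof -
    have e: "(n + d) * s = r * s + (s * (n - r) + s * d)"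
      using that by (metis add.assoc add_mult_distrib le_add_diff_inverse mult.commute)
    have "T X r s = gbin qq r s * (Q ^ (r * s) * (qq ^ ((n + d) * s) * t ^ s))"
      by (simp add: T_def X_def power_mult_distrib power_mult mult.assoc)
    also have "\<dots> = gbin qq r s * (Q ^ (r * s) * (qq ^ (r * s) * (qq ^ (s * (n - r)) * qq ^ (s * d) * t ^ s)))"
      unfolding e by (simp only: power_add mult.assoc)
    also have "\<dots> = gbin qq r s * (qq ^ (s * (n - r)) * qq ^ (s * d) * t ^ s)"
      unfolding pow_cancel(3) ..
    finally show ?thesis
      by (simp add: w_def chp of_nat_gbin qq_def power_mult mult.assoc)
  qed
  have inner: "(\<Sum>N\<in>Lat (index_pairs d) M. w (P.idx (carrier PP) N)) = (\<Sum>k\<le>n. coeff X n k * y X k ^ M)" for M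
  proof -
    have "(\<Sum>N\<in>Lat (index_pairs d) M. w (P.idx (carrier PP) N)) =
      (\<Sum>N\<in>Lat (index_pairs d) M. \<Prod>j<M. w (P.step_index (carrier PP) N j))"
      by (intro sum.cong refl Lat_sum(2)[OF finite_index_pairs w])
    also have "\<dots> = lattice_poly q n w M n"
      unfolding Lat_sum(3)[OF finite_index_pairs w] card_index_pairs n_def ..
    also have "\<dots> = (\<Sum>k\<le>n. coeff X n k * y X k ^ M)"
      by (rule closed_form[OF X0 QX, where f = "\<lambda>m r. lattice_poly q n w m r" and n = n]) (simp_all only: lattice_poly.simps wT order_refl)
    finally show ?thesis .
  qed
  \<comment> \<open>Weight of one layer of the image lattice: one factor of the eigenvalue for each
    of the two thresholds that its index reaches, so that the product over all layers yields the
    eigenvalue to the power \<open>M\<close>.\<close>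
  define v where "v k a = ch a * y X k ^ (of_bool (q ^ (d - 1) \<le> a) + of_bool (q ^ d \<le> a))" for k a
  have fin: "(\<Sum>H\<in>trunc m. ch (F.idx (carrier FF) (fst ` H) * P.idx (carrier PP) (sect H))) =
    (\<Sum>k\<le>n. coeff X n k * lattice_poly q d (v k) m d)" for m
  proof -
    have outer: "(\<Sum>\<Lambda>\<in>Lat {..<d} m. ch (F.idx (carrier FF) \<Lambda>) * y X k ^ last_two \<Lambda>) = lattice_poly q d (v k) m d" for k
    proof -
      have "(\<Sum>\<Lambda>\<in>Lat {..<d} m. ch (F.idx (carrier FF) \<Lambda>) * y X k ^ last_two \<Lambda>) =
        (\<Sum>\<Lambda>\<in>Lat {..<d} m. \<Prod>j<m. v k (F.step_index (carrier FF) \<Lambda> j))"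
      proof (intro sum.cong refl)
        fix \<Lambda> assume L: "\<Lambda> \<in> Lat {..<d} m"
        show "ch (F.idx (carrier FF) \<Lambda>) * y X k ^ last_two \<Lambda> = (\<Prod>j<m. v k (F.step_index (carrier FF) \<Lambda> j))"
          unfolding Lat_sum(2)[OF finite_lessThan ch(1,2) L] last_two_power[OF d L] v_def
          by (rule prod.distrib[symmetric])
      qed
      then show ?thesis unfolding Lat_sum(3)[OF finite_lessThan ch(1,2)] card_lessThan .
    qed
    have "(\<Sum>H\<in>trunc m. ch (F.idx (carrier FF) (fst ` H) * P.idx (carrier PP) (sect H))) =
      (\<Sum>\<Lambda>\<in>Lat {..<d} m. ch (F.idx (carrier FF) \<Lambda>) * (\<Sum>N\<in>Lat (index_pairs d) (last_two \<Lambda>). w (P.idx (carrier PP) N)))"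
      unfolding trunc_sum(2)[OF d ch(1,2)] w_def sum_distrib_left ..
    also have "\<dots> = (\<Sum>\<Lambda>\<in>Lat {..<d} m. \<Sum>k\<le>n. coeff X n k * (ch (F.idx (carrier FF) \<Lambda>) * y X k ^ last_two \<Lambda>))"
      unfolding inner sum_distrib_left by (intro sum.cong refl) (rule mult.left_commute)
    also have "\<dots> = (\<Sum>k\<le>n. \<Sum>\<Lambda>\<in>Lat {..<d} m. coeff X n k * (ch (F.idx (carrier FF) \<Lambda>) * y X k ^ last_two \<Lambda>))"
      by (rule sum.swap)
    finally show ?thesis unfolding sum_distrib_left[symmetric] outer .
  qed
  have lim: "(\<lambda>m. lattice_poly q d (v k) m d) \<longlonglongrightarrow> zeta_factor d qq t (y X k)" for k
  proof (rule zeta_factor_limit[where g = "\<lambda>m r. lattice_poly q d (v k) m r", OF qbase_axioms Q1 d _ _ _ y1])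
    show "norm (qq ^ d * t) < 1" "norm (qq * t) < 1" "norm t < 1"
      using tsmall[of d] tsmall[of 1] tsmall[of 0] d by auto
    fix m r assume r: "r \<le> d"
    have "of_nat (gbin q r s * q ^ (s * (d - r))) * v k (q ^ s) =
      T (qq ^ d * t) r s * y X k ^ (of_bool (d - 1 \<le> s) + of_bool (d \<le> s))" for s
    proof -
      have e: "d * s = r * s + s * (d - r)" using r by (metis add_mult_distrib le_add_diff_inverse mult.commute)
      have "T (qq ^ d * t) r s = gbin qq r s * (Q ^ (r * s) * (qq ^ (d * s) * t ^ s))"
        by (simp add: T_def power_mult_distrib power_mult mult.assoc)
      also have "\<dots> = gbin qq r s * (Q ^ (r * s) * (qq ^ (r * s) * (qq ^ (s * (d - r)) * t ^ s)))"
        unfolding e by (simp only: power_add mult.assoc)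
      also have "\<dots> = gbin qq r s * (qq ^ (s * (d - r)) * t ^ s)" unfolding pow_cancel(3) ..
      finally have T: "T (qq ^ d * t) r s = of_nat (gbin q r s * q ^ (s * (d - r))) * t ^ s"
        by (simp add: of_nat_gbin qq_def mult.assoc)
      have le: "q ^ i \<le> q ^ s \<longleftrightarrow> i \<le> s" for i by (rule power_increasing_iff[OF q_gt_1])
      show ?thesis unfolding v_def chp T le by (rule mult.assoc[symmetric])
    qed
    then show "lattice_poly q d (v k) (Suc m) r = (\<Sum>s\<le>r. T (qq ^ d * t) r s *
      y X k ^ (of_bool (d - 1 \<le> s) + of_bool (d \<le> s)) * lattice_poly q d (v k) m s)" by simp
  qed simp
  have "(\<lambda>m. \<Sum>k\<le>n. coeff X n k * lattice_poly q d (v k) m d) \<longlonglongrightarrow>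
    (\<Sum>k\<le>n. coeff X n k * zeta_factor d qq t (y X k))"
    by (intro tendsto_sum tendsto_mult tendsto_const lim)
  moreover have "(\<Sum>k\<le>n. coeff X n k * zeta_factor d qq t (y X k)) = zeta_expr d qq t"
    unfolding zeta_expr_def Let_def n_def[symmetric] Q_def[symmetric] X_def[symmetric]
      coeff_def qbase.v_def[OF qbase_axioms] A_def B_def D_def y_def by (simp only: divide_inverse)
  ultimately show ?thesis unfolding fin by (simp add: qq_def t_def)
qed

lemma trunc_eventually:
  assumes d: "d \<ge> 2" and H: "H \<in> no_overlap_subalgebras d R"
  shows "eventually (\<lambda>m. H \<in> trunc m) sequentially"
proof -
  have sm: "F.sm (fst ` H)" "F.idx (carrier FF) (fst ` H) > 0"
    using H sm_fst by (auto simp: no_overlap_subalgebras_eq[OF d])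
  define k where "k = F.idx (carrier FF) (fst ` H)"
  have k: "F.pw k (carrier FF) \<subseteq> fst ` H"
    unfolding k_def by (rule F.finite_idx_pw[OF sm(1) F.sm_carrier F.smD(1)[OF sm(1)] sm(2)])
  have "H \<in> trunc m" if "k \<le> m" for m
    using k F.pw_antimono[OF F.sm_carrier that] H unfolding trunc_def pw_free by blast
  then show ?thesis unfolding eventually_sequentially by blast
qed

text \<open>The limit along \<open>trunc\<close> becomes an unordered sum once the norms are
  bounded, and the bound comes from the same limit at the real point \<open>Re s\<close>. The
  abscissa \<open>(d choose 2) + d\<close> is the exponent of \<open>q\<close> in
  \<open>X\<close>.\<close>

theorem no_overlap_has_sum:
  assumes d: "d \<ge> 2" and s: "Re s > real ((d choose 2) + d)"
  shows "(no_overlap_term d R s has_sum zeta_expr d (of_nat q) (of_nat q powr (- s))) (no_overlap_subalgebras d R)"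
    and "regular_at ((d choose 2) + d) (of_nat q) (of_nat q powr (- s) :: complex)"
proof -
  define N where "N = (d choose 2) + d"
  define ch where "ch u a = (of_nat a :: complex) powr (- u)" for u a
  define ix where "ix H = F.idx (carrier FF) (fst ` H) * P.idx (carrier PP) (sect H)" for H
  have q1: "real q > 1" using q_gt_1 by simp
  have norm_ch: "norm (ch u a) = real a powr (- Re u)" for u a
    unfolding ch_def by (cases "a = 0") (simp_all add: norm_powr_real_powr)
  have small: "norm (of_nat q ^ N * ch u q) < 1" if "Re u > real N" for u
  proof -
    have "norm (of_nat q ^ N * ch u q) = real q powr (real N - Re u)"
      using q1 by (simp add: norm_mult norm_power norm_ch powr_realpow[symmetric] powr_add[symmetric])
    also have "\<dots> < real q powr 0" using q1 that by (intro powr_less_mono) auto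
    finally show ?thesis using q1 by simp
  qed
  have lim: "(\<lambda>m. \<Sum>H\<in>trunc m. ch u (ix H)) \<longlonglongrightarrow> zeta_expr d (of_nat q) (ch u q)" if u: "Re u > real N" for u
    unfolding ix_def
  proof (rule trunc_tendsto[OF d])
    show "ch u 1 = 1" by (simp add: ch_def)
    show "ch u (a * b) = ch u a * ch u b" for a b by (simp add: ch_def powr_times_real)
    show "ch u q \<noteq> 0" using q_pos by (simp add: ch_def)
    show "norm (of_nat q ^ ((d choose 2) + d) * ch u q) < 1" using small[OF u] by (simp add: N_def)
  qed
  have sN: "Re s > real N" "Re (of_real (Re s)) > real N" using s by (auto simp: N_def)
  have tm: "no_overlap_term d R s H = ch s (ix H)" if "H \<in> no_overlap_subalgebras d R" for H
    using that no_overlap_term_eq[of H s] by (simp add: no_overlap_subalgebras_eq[OF d] ch_def ix_def)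
  have real_ch: "of_real (norm (ch s a)) = ch (of_real (Re s)) a" for a
    unfolding norm_ch using powr_of_real[of "real a" "- Re s"] by (simp add: ch_def)
  \<comment> \<open>At the real point \<open>Re s\<close> the terms are the norms of the given
    terms; a convergent sequence of their partial sums is bounded.\<close>
  obtain b where b: "\<And>m. norm (\<Sum>H\<in>trunc m. ch (of_real (Re s)) (ix H)) \<le> b"
    using convergent_imp_Bseq[OF convergentI[OF lim[OF sN(2)]]] unfolding Bseq_def by blast
  have "((\<lambda>H. ch s (ix H)) has_sum zeta_expr d (of_nat q) (ch s q)) (no_overlap_subalgebras d R)"
  proof (rule has_sum_exhaustion[where S = trunc])
    show "finite (trunc m)" for m using trunc_sum(1)[OF d, of "\<lambda>_. 1::nat"] by simp
    show "trunc m \<subseteq> no_overlap_subalgebras d R" for m by (auto simp: trunc_def)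
    show "eventually (\<lambda>m. H \<in> trunc m) sequentially" if "H \<in> no_overlap_subalgebras d R" for H
      by (rule trunc_eventually[OF d that])
    show "(\<lambda>m. \<Sum>H\<in>trunc m. ch s (ix H)) \<longlonglongrightarrow> zeta_expr d (of_nat q) (ch s q)" by (rule lim[OF sN(1)])
    show "(\<Sum>H\<in>trunc m. norm (ch s (ix H))) \<le> b" for m
    proof -
      have "complex_of_real (\<Sum>H\<in>trunc m. norm (ch s (ix H))) = (\<Sum>H\<in>trunc m. ch (of_real (Re s)) (ix H))"
        unfolding of_real_sum real_ch ..
      then have "norm (complex_of_real (\<Sum>H\<in>trunc m. norm (ch s (ix H)))) \<le> b" using b[of m] by simp
      then show ?thesis unfolding norm_of_real by (rule order_trans[OF abs_ge_self])
    qed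
  qed
  then show "(no_overlap_term d R s has_sum zeta_expr d (of_nat q) (of_nat q powr (- s))) (no_overlap_subalgebras d R)"
    using has_sum_cong[of "no_overlap_subalgebras d R" "no_overlap_term d R s" "\<lambda>H. ch s (ix H)"] tm
    by (simp add: ch_def)
  show "regular_at ((d choose 2) + d) (of_nat q) (of_nat q powr (- s) :: complex)"
    unfolding regular_at_def ch_def[symmetric] N_def[symmetric]
  proof (intro conjI allI impI)
    show "(of_nat q :: complex) \<noteq> 0" "ch s q \<noteq> 0" using q_pos by (auto simp: ch_def)
    fix a b c :: nat assume c: "0 < c" "a \<le> N * c"
    have "norm (of_nat q ^ a * ch s q ^ c) \<le> norm (of_nat q ^ (N * c) * ch s q ^ c)"
      unfolding norm_mult norm_power using q1 c(2) by (intro mult_right_mono power_increasing) auto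
    also have "\<dots> = norm (of_nat q ^ N * ch s q) ^ c"
      unfolding norm_power[symmetric] power_mult power_mult_distrib ..
    also have "\<dots> < 1" using small[OF sN(1)] c(1) by (simp add: power_less_one_iff)
    also have "1 \<le> norm ((of_nat q :: complex) ^ b)" unfolding norm_power using q1 by (simp add: one_le_power)
    finally show "of_nat q ^ a * ch s q ^ c \<noteq> of_nat q ^ b" by auto
  qed
qed

end

section \<open>Interpolation, uniqueness and the functional equation\<close>

lemma zeta_expr_interpolates:
  assumes R: "is_cDVR R" and d: "d \<ge> 2" and s: "Re s > real ((d choose 2) + d)"
  shows "rat_val (of_nat (residue_card R)) (of_nat (residue_card R) powr (- s)) (zeta_expr d q_var t_var)
      (zeta_expr d (of_nat (residue_card R)) (of_nat (residue_card R) powr (- s)))"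
    and "(no_overlap_term d R s has_sum zeta_expr d (of_nat (residue_card R)) (of_nat (residue_card R) powr (- s)))
      (no_overlap_subalgebras d R)"
proof -
  obtain p where p: "uniformizer R p (residue_card R)" "principal_domain R" "p \<noteq> \<zero>\<^bsub>R\<^esub>"
    "\<And>n::nat. max_ideal_pow R n = PIdl\<^bsub>R\<^esub> (p [^]\<^bsub>R\<^esub> n)" using is_cDVR_uniformizer[OF R] by blast
  interpret nil2_dvr R p "residue_card R" d
    by (intro nil2_dvr.intro dvr.intro dvr_axioms.intro p)
  show "rat_val (of_nat (residue_card R)) (of_nat (residue_card R) powr (- s)) (zeta_expr d q_var t_var)
      (zeta_expr d (of_nat (residue_card R)) (of_nat (residue_card R) powr (- s)))"
    by (rule zeta_expr_rat_val[OF no_overlap_has_sum(2)[OF d s] d])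
  show "(no_overlap_term d R s has_sum zeta_expr d (of_nat (residue_card R)) (of_nat (residue_card R) powr (- s)))
      (no_overlap_subalgebras d R)" by (rule no_overlap_has_sum(1)[OF d s])
qed

lemma is_no_overlap_zeta_expr:
  assumes "d \<ge> 2" shows "is_no_overlap_zeta d (zeta_expr d q_var t_var)"
  unfolding is_no_overlap_zeta_def interpolates_no_overlap_def Let_def
proof (intro allI impI)
  fix R :: "(nat \<Rightarrow> nat) ring" assume R: "is_cDVR R"
  show "\<exists>\<sigma>. \<forall>s. \<sigma> < Re s \<longrightarrow>
    ratfun2_defined (of_nat (residue_card R)) (of_nat (residue_card R) powr - s) (zeta_expr d q_var t_var) \<and>
    (no_overlap_term d R s has_sum
      ratfun2_eval (of_nat (residue_card R)) (of_nat (residue_card R) powr - s) (zeta_expr d q_var t_var))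
     (no_overlap_subalgebras d R)"
    using zeta_expr_interpolates[OF R assms] ratfun2_eval_eq[OF zeta_expr_interpolates(1)[OF R assms]]
    by (intro exI[of _ "real ((d choose 2) + d)"] allI impI) simp
qed

lemma is_no_overlap_zeta_unique:
  assumes d: "d \<ge> 2" and W: "is_no_overlap_zeta d W" shows "W = zeta_expr d q_var t_var"
proof (rule ratfun2_eqI[where B = "\<lambda>x. {y. \<exists>z. rat_val x y W z \<and> rat_val x y (zeta_expr d q_var t_var) z}"])
  show "infinite ((of_nat :: nat \<Rightarrow> complex) ` {p. Factorial_Ring.prime p})"
    using primes_infinite by (subst finite_image_iff) (auto intro: inj_onI)
next
  fix x :: complex assume "x \<in> of_nat ` {p. Factorial_Ring.prime p}"
  then obtain p :: nat where p: "Factorial_Ring.prime p" "x = of_nat p" by blast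
  define S where "S = power_series_ring p"
  have S: "is_cDVR S" "residue_card S = p" unfolding S_def using is_cDVR_S residue_card_S p(1) by auto
  obtain \<sigma> where \<sigma>: "\<And>s. Re s > \<sigma> \<Longrightarrow> ratfun2_defined x (x powr - s) W \<and>
      (no_overlap_term d S s has_sum ratfun2_eval x (x powr - s) W) (no_overlap_subalgebras d S)"
    using W S unfolding is_no_overlap_zeta_def interpolates_no_overlap_def Let_def p(2) by metis
  \<comment> \<open>Beyond both half-plane bounds, the one for \<open>W\<close> and the one for the
    closed expression. The integers from \<open>k0\<close> on give pairwise distinct points
    \<open>x powr - s\<close>, hence infinitely many common values for each prime.\<close>
  define k0 where "k0 = Suc (nat \<lceil>max \<sigma> (real ((d choose 2) + d))\<rceil>)"
  have "x powr - of_nat (k0 + k) \<in> {y. \<exists>z. rat_val x y W z \<and> rat_val x y (zeta_expr d q_var t_var) z}" for k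
  proof -
    define s :: complex where "s = of_nat (k0 + k)"
    have s: "Re s > \<sigma>" "Re s > real ((d choose 2) + d)" unfolding s_def k0_def by (simp; linarith)+
    note z = zeta_expr_interpolates[OF S(1) d s(2), unfolded S(2), folded p(2)]
    have "ratfun2_eval x (x powr - s) W = zeta_expr d x (x powr - s)"
      using has_sum_unique[OF conjunct2[OF \<sigma>[OF s(1)]] z(2)] .
    then show ?thesis using rat_val_eval[OF conjunct1[OF \<sigma>[OF s(1)]]] z(1) unfolding s_def by auto
  qed
  then have sub: "range (\<lambda>k. x powr - of_nat (k0 + k)) \<subseteq> {y. \<exists>z. rat_val x y W z \<and> rat_val x y (zeta_expr d q_var t_var) z}"
    by blast
  have "inj (\<lambda>k::nat. x powr - of_nat (k0 + k))"
  proof (rule injI)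
    fix i j :: nat assume "x powr - of_nat (k0 + i) = x powr - of_nat (k0 + j)"
    then have "norm (x powr - of_nat (k0 + i)) = norm (x powr - of_nat (k0 + j))" by simp
    then have "real p powr - real (k0 + i) = real p powr - real (k0 + j)"
      using prime_gt_0_nat[OF p(1)] by (simp add: p(2) norm_powr_real_powr)
    then show "i = j" using prime_gt_1_nat[OF p(1)] by (simp add: powr_inj)
  qed
  then show "infinite {y. \<exists>z. rat_val x y W z \<and> rat_val x y (zeta_expr d q_var t_var) z}"
    using infinite_super[OF sub] range_inj_infinite by blast
qed simp

theorem no_overlap_zeta_eq:
  assumes "d \<ge> 2" shows "no_overlap_zeta d = zeta_expr d q_var t_var"
  unfolding no_overlap_zeta_def
  by (rule the_equality[of "is_no_overlap_zeta d"]) (use is_no_overlap_zeta_expr is_no_overlap_zeta_unique assms in auto)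

theorem theorem5p11:
  fixes d D :: nat
  assumes "d \<ge> 2" and "D = (d + 1) choose 2"
  shows "(\<exists>!W. is_no_overlap_zeta d W) \<and>
    ratfun2_eval (inverse q_var) (inverse t_var) (no_overlap_zeta d) =
      (- 1) ^ D * q_var ^ (D choose 2) * t_var ^ D * no_overlap_zeta d"
proof
  show "\<exists>!W. is_no_overlap_zeta d W"
    using is_no_overlap_zeta_expr[OF assms(1)] is_no_overlap_zeta_unique[OF assms(1)] by blast
  show "ratfun2_eval (inverse q_var) (inverse t_var) (no_overlap_zeta d) =
      (- 1) ^ D * q_var ^ (D choose 2) * t_var ^ D * no_overlap_zeta d"
    unfolding no_overlap_zeta_eq[OF assms(1)] assms(2) by (rule ratfun2_functional_equation[OF assms(1)])
qed

end
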